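(* In $\mathcal{O}(n)$ expected time we can build a data structure taking $n\lceil \log\sigma\rceil + \mathcal{O}(w\log n)$ bits of space and supporting extraction of any length-$m$ text substring and LCE queries w.h.p. in $\mathcal{O}\left(m\log\sigma/w \right)$ and $\mathcal{O}(\log\ell)$ worst-case time, respectively.
   Context: Setting: $T\in\{0,\dots,\sigma-1\}^n$ is a re-writable text stored in $n\lceil\log\sigma\rceil$ bits, on a word RAM with word size $w$ bits where $\log n\le w$ and $\lceil\log\sigma\rceil\le w$. An LCE query $LCE(i,j)$ returns the length of the longest common prefix of the suffixes $T[i,\dots,n-1]$ and $T[j,\dots,n-1]$; $\ell$ denotes the value returned by the query. The structure is based on Karp-Rabin fingerprints $\kappa(S)=S \bmod q$ with a random prime $q$ and a random seed; w.h.p. means with probability at least $1-n^{-c}$ for an arbitrarily large constant $c$. *)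

theory Defs
  imports "HOL-Probability.Probability" "HOL-Library.Sublist"
begin

text \<open>
  A randomised word RAM with \<open>w\<close>-bit words.  A program is a fixed finite object that does not
  depend on \<open>w\<close>; it uses finitely many registers and finitely many word arrays, both selected
  statically.  Having several arrays instead of one address space lets a word address all \<open>2 ^ w\<close>
  cells of each of them, so that the boundary case \<open>log n = w\<close> is meaningful.
\<close>

type_synonym register = nat
type_synonym array = nat

datatype binop = Add | Sub | Mul | Div | Mod | And | Or | Xor | Shl | Shr

datatype test = Eq register register | Less register register

datatype prog =
    Skip
  | Const register nat
  | Op register binop register register
  | Load register array register  \<comment> \<open>target, array, register holding the address\<close>
  | Store array register register \<comment> \<open>array, register holding the address, source\<close>
  | Rand register
  | Seq prog prog
  | If test prog prog
  | While test prog

fun binop_val :: "nat \<Rightarrow> binop \<Rightarrow> nat \<Rightarrow> nat \<Rightarrow> nat" where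
  "binop_val w Add x y = (x + y) mod 2 ^ w"
| "binop_val w Sub x y = (x + (2 ^ w - y)) mod 2 ^ w"
| "binop_val w Mul x y = (x * y) mod 2 ^ w"
| "binop_val w Div x y = x div y"
| "binop_val w Mod x y = x mod y"
| "binop_val w And x y = Bit_Operations.and x y"
| "binop_val w Or x y = Bit_Operations.or x y"
| "binop_val w Xor x y = Bit_Operations.xor x y"
| "binop_val w Shl x y = (x * 2 ^ y) mod 2 ^ w"
| "binop_val w Shr x y = x div 2 ^ y"

record config =
  reg :: "register \<Rightarrow> nat"
  arr :: "array \<Rightarrow> nat list"
  rnd :: "nat stream"

fun test_val :: "test \<Rightarrow> config \<Rightarrow> bool" where
  "test_val (Eq a b) s = (reg s a = reg s b)"
| "test_val (Less a b) s = (reg s a < reg s b)"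

definition set_reg :: "register \<Rightarrow> nat \<Rightarrow> config \<Rightarrow> config" where
  "set_reg r v s = s\<lparr>reg := (reg s)(r := v)\<rparr>"

text \<open>
  \<open>exec w p s t s'\<close>: started in \<open>s\<close>, program \<open>p\<close> halts in \<open>s'\<close> after exactly \<open>t\<close> unit-cost steps.
  An access outside the bounds of an array has no rule, so such a run never halts.  Arrays cannot
  be resized: their lengths in the initial configuration are the memory that is available.
\<close>

inductive exec :: "nat \<Rightarrow> prog \<Rightarrow> config \<Rightarrow> nat \<Rightarrow> config \<Rightarrow> bool" for w :: nat where
  Skip: "exec w Skip s 1 s"
| Const: "exec w (Const r k) s 1 (set_reg r (k mod 2 ^ w) s)"
| Op: "exec w (Op r f a b) s 1 (set_reg r (binop_val w f (reg s a) (reg s b)) s)"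
| Load: "reg s a < length (arr s k) \<Longrightarrow>
    exec w (Load r k a) s 1 (set_reg r (arr s k ! reg s a) s)"
| Store: "reg s a < length (arr s k) \<Longrightarrow>
    exec w (Store k a r) s 1 (s\<lparr>arr := (arr s)(k := (arr s k)[reg s a := reg s r])\<rparr>)"
| Rand: "exec w (Rand r) s 1 (set_reg r (shd (rnd s) mod 2 ^ w) (s\<lparr>rnd := stl (rnd s)\<rparr>))"
| Seq: "exec w p s t s' \<Longrightarrow> exec w q s' u s'' \<Longrightarrow> exec w (Seq p q) s (t + u) s''"
| IfTrue: "test_val b s \<Longrightarrow> exec w p s t s' \<Longrightarrow> exec w (If b p q) s (Suc t) s'"
| IfFalse: "\<not> test_val b s \<Longrightarrow> exec w q s t s' \<Longrightarrow> exec w (If b p q) s (Suc t) s'"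
| WhileTrue: "test_val b s \<Longrightarrow> exec w p s t s' \<Longrightarrow> exec w (While b p) s' u s'' \<Longrightarrow>
    exec w (While b p) s (Suc (t + u)) s''"
| WhileFalse: "\<not> test_val b s \<Longrightarrow> exec w (While b p) s 1 s"

inductive_cases exec_SkipE: "exec w Skip s t s'"
inductive_cases exec_ConstE: "exec w (Const r k) s t s'"
inductive_cases exec_OpE: "exec w (Op r f a b) s t s'"
inductive_cases exec_LoadE: "exec w (Load r k a) s t s'"
inductive_cases exec_StoreE: "exec w (Store k a r) s t s'"
inductive_cases exec_RandE: "exec w (Rand r) s t s'"
inductive_cases exec_SeqE: "exec w (Seq p q) s t s'"
inductive_cases exec_IfE: "exec w (If b p q) s t s'"
inductive_cases exec_WhileE: "exec w (While b p) s t s'"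

lemma exec_deterministic:
  "exec w p s t s' \<Longrightarrow> exec w p s u s'' \<Longrightarrow> t = u \<and> s' = s''"
proof (induction arbitrary: u s'' rule: exec.induct)
  case Skip then show ?case by (auto elim: exec_SkipE)
next
  case Const then show ?case by (auto elim: exec_ConstE)
next
  case Op then show ?case by (auto elim: exec_OpE)
next
  case Load then show ?case by (auto elim: exec_LoadE)
next
  case Store then show ?case by (auto elim: exec_StoreE)
next
  case Rand then show ?case by (auto elim: exec_RandE)
next
  case Seq from Seq.prems Seq.IH show ?case by (elim exec_SeqE) blast
next
  case IfTrue from IfTrue.prems IfTrue.hyps IfTrue.IH show ?case by (elim exec_IfE) blast+
next
  case IfFalse from IfFalse.prems IfFalse.hyps IfFalse.IH show ?case by (elim exec_IfE) blast+
next
  case (WhileTrue b s p t s' v s1)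
  note IH1 = WhileTrue.IH(1) and IH2 = WhileTrue.IH(2)
  from WhileTrue.prems show ?case
  proof (cases rule: exec.cases)
    case (WhileTrue t1 s2 u1)
    from this(3) have "t = t1 \<and> s' = s2" by (rule IH1)
    moreover from this have "v = u1 \<and> s1 = s''" using WhileTrue(4) IH2 by blast
    ultimately show ?thesis using WhileTrue(1) by simp
  qed (use WhileTrue.hyps in auto)
next
  case WhileFalse then show ?case by (auto elim: exec_WhileE)
qed

text \<open>The running time is \<open>\<infinity>\<close> if the run does not halt; the set has at most one element.\<close>

definition run_time :: "nat \<Rightarrow> prog \<Rightarrow> config \<Rightarrow> ennreal" where
  "run_time w p s = Inf {of_nat t | t. \<exists>s'. exec w p s t s'}"

definition tapes :: "nat \<Rightarrow> nat stream measure" where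
  "tapes w = stream_space (measure_pmf (pmf_of_set {..<2 ^ w}))"

text \<open>
  Whether and how a run halts depends on a finite part of the tape only; hence the running time
  and all events that refer to the final contents of the arrays are measurable.
\<close>

lemma set_reg_rnd: "set_reg r v (s\<lparr>rnd := \<omega>\<rparr>) = (set_reg r v s)\<lparr>rnd := \<omega>\<rparr>"
  by (cases s) (simp add: set_reg_def)

lemma rnd_set_reg: "rnd (set_reg r v s) = rnd s"
  by (simp add: set_reg_def)

lemma arr_rnd: "s\<lparr>rnd := \<omega>, arr := f\<rparr> = s\<lparr>arr := f, rnd := \<omega>\<rparr>"
  by (cases s) simp

lemma exec_tape:
  "exec w p s t s' \<Longrightarrow> \<exists>k. rnd s' = sdrop k (rnd s) \<and>
     (\<forall>\<omega>. stake k \<omega> = stake k (rnd s) \<longrightarrow>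
       exec w p (s\<lparr>rnd := \<omega>\<rparr>) t (s'\<lparr>rnd := sdrop k \<omega>\<rparr>))"
  (is "_ \<Longrightarrow> \<exists>k. ?P p s t s' k")
proof (induction rule: exec.induct)
  case (Skip s)
  show ?case using exec.Skip[of w] by (intro exI[of _ 0]) simp
next
  case (Const r k s)
  have "exec w (Const r k) (s\<lparr>rnd := \<omega>\<rparr>) 1 (set_reg r (k mod 2 ^ w) s\<lparr>rnd := \<omega>\<rparr>)" for \<omega>
    using exec.Const[of w r k "s\<lparr>rnd := \<omega>\<rparr>"] by (simp add: set_reg_rnd rnd_set_reg)
  then show ?case by (intro exI[of _ 0]) (simp add: set_reg_rnd rnd_set_reg)
next
  case (Op r f a b s)
  have "exec w (Op r f a b) (s\<lparr>rnd := \<omega>\<rparr>) 1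
      (set_reg r (binop_val w f (reg s a) (reg s b)) s\<lparr>rnd := \<omega>\<rparr>)" for \<omega>
    using exec.Op[of w r f a b "s\<lparr>rnd := \<omega>\<rparr>"] by (simp add: set_reg_rnd rnd_set_reg)
  then show ?case by (intro exI[of _ 0]) (simp add: set_reg_rnd rnd_set_reg)
next
  case (Load s a k r)
  have "exec w (Load r k a) (s\<lparr>rnd := \<omega>\<rparr>) 1 (set_reg r (arr s k ! reg s a) s\<lparr>rnd := \<omega>\<rparr>)" for \<omega>
    using exec.Load[of "s\<lparr>rnd := \<omega>\<rparr>" a k w r] Load by (simp add: set_reg_rnd rnd_set_reg)
  then show ?case by (intro exI[of _ 0]) (simp add: set_reg_rnd rnd_set_reg)
next
  case (Store s a k r)
  have "exec w (Store k a r) (s\<lparr>rnd := \<omega>\<rparr>) 1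
      (s\<lparr>arr := (arr s)(k := (arr s k)[reg s a := reg s r])\<rparr>\<lparr>rnd := \<omega>\<rparr>)" for \<omega>
    using exec.Store[of "s\<lparr>rnd := \<omega>\<rparr>" a k w r] Store by (simp add: arr_rnd)
  then show ?case by (intro exI[of _ 0]) simp
next
  case (Rand r s)
  have "exec w (Rand r) (s\<lparr>rnd := \<omega>\<rparr>) 1
      (set_reg r (shd (rnd s) mod 2 ^ w) (s\<lparr>rnd := stl (rnd s)\<rparr>)\<lparr>rnd := stl \<omega>\<rparr>)"
    if "shd \<omega> = shd (rnd s)" for \<omega>
    using exec.Rand[of w r "s\<lparr>rnd := \<omega>\<rparr>"] that by (simp add: set_reg_rnd rnd_set_reg)
  then show ?case by (intro exI[of _ 1]) (simp add: set_reg_rnd rnd_set_reg)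
next
  case (Seq p s t s' q u s'')
  then obtain k l where "?P p s t s' k" "?P q s' u s'' l" by blast
  then have "?P (Seq p q) s (t + u) s'' (k + l)"
    by (auto simp flip: stake_add sdrop_add intro!: exec.Seq)
  then show ?case ..
next
  case (IfTrue b s p t s' q)
  then obtain k where "?P p s t s' k" by blast
  moreover have "test_val b (s\<lparr>rnd := \<omega>\<rparr>)" for \<omega> using IfTrue.hyps by (cases b) auto
  ultimately have "?P (If b p q) s (Suc t) s' k" by (auto intro!: exec.IfTrue)
  then show ?case ..
next
  case (IfFalse b s q t s' p)
  then obtain k where "?P q s t s' k" by blast
  moreover have "\<not> test_val b (s\<lparr>rnd := \<omega>\<rparr>)" for \<omega> using IfFalse.hyps by (cases b) auto
  ultimately have "?P (If b p q) s (Suc t) s' k" by (auto intro!: exec.IfFalse)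
  then show ?case ..
next
  case (WhileTrue b s p t s' u s'')
  then obtain k l where "?P p s t s' k" "?P (While b p) s' u s'' l" by blast
  moreover have "test_val b (s\<lparr>rnd := \<omega>\<rparr>)" for \<omega> using WhileTrue.hyps by (cases b) auto
  ultimately have "?P (While b p) s (Suc (t + u)) s'' (k + l)"
    by (auto simp flip: stake_add sdrop_add intro!: exec.WhileTrue)
  then show ?case ..
next
  case (WhileFalse b s p)
  then have "\<not> test_val b (s\<lparr>rnd := \<omega>\<rparr>)" for \<omega> by (cases b) auto
  then have "exec w (While b p) (s\<lparr>rnd := \<omega>\<rparr>) 1 (s\<lparr>rnd := \<omega>\<rparr>)" for \<omega>
    by (rule exec.WhileFalse)
  then show ?case by (intro exI[of _ 0]) simp
qed

lemma measurable_exec: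
  "{\<omega>. \<exists>s. exec w p (s0\<lparr>rnd := \<omega>\<rparr>) t s \<and> Q (arr s)} \<in> sets (tapes w)"
proof -
  let ?H = "\<lambda>\<omega>. \<exists>s. exec w p (s0\<lparr>rnd := \<omega>\<rparr>) t s \<and> Q (arr s)"
  let ?X = "{xs. \<forall>\<omega>. stake (length xs) \<omega> = xs \<longrightarrow> ?H \<omega>}"
  have "{\<omega>. ?H \<omega>} = (\<Union>xs\<in>?X. {\<omega>. stake (length xs) \<omega> = xs})"
  proof (intro set_eqI iffI)
    fix \<omega> assume "\<omega> \<in> {\<omega>. ?H \<omega>}"
    then obtain s where s: "exec w p (s0\<lparr>rnd := \<omega>\<rparr>) t s" "Q (arr s)" by blast
    from exec_tape[OF s(1)] obtain k where
      k: "\<And>\<omega>'. stake k \<omega>' = stake k \<omega> \<Longrightarrow>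
            exec w p (s0\<lparr>rnd := \<omega>'\<rparr>) t (s\<lparr>rnd := sdrop k \<omega>'\<rparr>)"
      by auto
    have "stake k \<omega> \<in> ?X"
    proof (intro CollectI allI impI exI conjI)
      fix \<omega>' assume "stake (length (stake k \<omega>)) \<omega>' = stake k \<omega>"
      then show "exec w p (s0\<lparr>rnd := \<omega>'\<rparr>) t (s\<lparr>rnd := sdrop k \<omega>'\<rparr>)" by (intro k) simp
      show "Q (arr (s\<lparr>rnd := sdrop k \<omega>'\<rparr>))" using s(2) by simp
    qed
    then show "\<omega> \<in> (\<Union>xs\<in>?X. {\<omega>. stake (length xs) \<omega> = xs})"
      by (intro UN_I[of "stake k \<omega>"]) auto
  qed auto
  moreover have "{\<omega>. stake (length xs) \<omega> = xs} \<in> sets (tapes w)" for xs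
  proof -
    have "{\<omega>. stake (length xs) \<omega> = xs} = {\<omega> \<in> space (tapes w). \<forall>i<length xs. \<omega> !! i = xs ! i}"
      by (auto simp: tapes_def space_stream_space list_eq_iff_nth_eq)
    also have "\<dots> \<in> sets (tapes w)"
      unfolding tapes_def by measurable
    finally show ?thesis .
  qed
  ultimately show ?thesis by (auto intro!: sets.countable_UN')
qed

lemma measurable_run_time: "(\<lambda>\<omega>. run_time w p (s0\<lparr>rnd := \<omega>\<rparr>)) \<in> borel_measurable (tapes w)"
proof -
  have eq: "run_time w p s = (INF t. if \<exists>s'. exec w p s t s' then of_nat t else \<infinity>)" for s
    unfolding run_time_def
  proof (rule antisym)
    show "Inf {of_nat t |t. \<exists>s'. exec w p s t s'}
        \<le> (INF t. if \<exists>s'. exec w p s t s' then of_nat t else (\<infinity> :: ennreal))"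
      by (intro INF_greatest) (auto intro: Inf_lower)
    show "(INF t. if \<exists>s'. exec w p s t s' then of_nat t else (\<infinity> :: ennreal))
        \<le> Inf {of_nat t |t. \<exists>s'. exec w p s t s'}"
      by (intro Inf_greatest) (auto intro!: Inf_lower)
  qed
  have [measurable]: "Measurable.pred (tapes w) (\<lambda>\<omega>. \<exists>s'. exec w p (s0\<lparr>rnd := \<omega>\<rparr>) t s')" for t
    using measurable_exec[of w p s0 t "\<lambda>_. True"]
    by (simp add: pred_def tapes_def space_stream_space)
  show ?thesis unfolding eq by measurable
qed

definition char_bits :: "nat \<Rightarrow> nat" where
  "char_bits \<sigma> = nat \<lceil>log 2 (real \<sigma>)\<rceil>"

definition num_words :: "nat \<Rightarrow> nat \<Rightarrow> nat" where
  "num_words w k = nat \<lceil>real k / real w\<rceil>"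

text \<open>
  \<open>pack w b xs\<close> stores character \<open>k\<close> of \<open>xs\<close> in the bits \<open>k * b, \<dots>, k * b + b - 1\<close> of a bit vector
  (least significant bit first) that is cut into words of \<open>w\<close> bits.
\<close>

definition pack :: "nat \<Rightarrow> nat \<Rightarrow> nat list \<Rightarrow> nat list" where
  "pack w b xs =
     map (\<lambda>a. (\<Sum>k<length xs. xs ! k * 2 ^ (b * k)) div 2 ^ (w * a) mod 2 ^ w)
       [0..<num_words w (length xs * b)]"

definition lce :: "nat list \<Rightarrow> nat \<Rightarrow> nat \<Rightarrow> nat" where
  "lce T i j = length (longest_common_prefix (drop i T) (drop j T))"

text \<open>
  Numeric arguments and results may be as large as \<open>n = 2 ^ w\<close>, which does not fit into a word;
  each of them is passed as a low and a high word in two consecutive registers.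
\<close>

definition args :: "nat \<Rightarrow> nat list \<Rightarrow> register \<Rightarrow> nat" where
  "args w xs r =
     (if r div 2 < length xs
      then if even r then xs ! (r div 2) mod 2 ^ w else xs ! (r div 2) div 2 ^ w
      else 0)"

definition result :: "nat \<Rightarrow> config \<Rightarrow> nat" where
  "result w s = reg s 0 + 2 ^ w * reg s 1"

definition params :: "nat \<Rightarrow> nat \<Rightarrow> nat \<Rightarrow> nat list" where
  "params w \<sigma> n = [n, \<sigma>, char_bits \<sigma>, w]"

text \<open>
  The construction overwrites the packed text in array 0 and fills array 1, which has \<open>e\<close> words.
  All other arrays are scratch memory that is discarded afterwards.
\<close>

definition build_config :: "nat \<Rightarrow> nat \<Rightarrow> nat list \<Rightarrow> nat \<Rightarrow> nat stream \<Rightarrow> config" where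
  "build_config w \<sigma> T e \<omega> =
     \<lparr>reg = args w (params w \<sigma> (length T)),
      arr = (\<lambda>_. replicate (2 ^ w) 0)(0 := pack w (char_bits \<sigma>) T, 1 := replicate e 0),
      rnd = \<omega>\<rparr>"

text \<open>
  A query sees only the contents \<open>A\<close>, \<open>E\<close> of arrays 0 and 1 and an output array of \<open>k\<close> words.
  Its random tape is constantly zero, so queries are deterministic.
\<close>

definition query_config ::
    "nat \<Rightarrow> nat list \<Rightarrow> nat list \<Rightarrow> nat list \<Rightarrow> nat \<Rightarrow> config" where
  "query_config w xs A E k =
     \<lparr>reg = args w xs,
      arr = (\<lambda>_. [])(0 := A, 1 := E, 2 := replicate k 0),
      rnd = sconst 0\<rparr>"

text \<open>
  Both kinds of query must leave the structure as they found it.  \<open>s\<close> is the configuration in which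
  the construction has halted, \<open>t\<close> the number of steps of the query.
\<close>

definition extract_answer ::
    "nat \<Rightarrow> nat \<Rightarrow> nat \<Rightarrow> prog \<Rightarrow> config \<Rightarrow> nat \<Rightarrow> nat \<Rightarrow> nat \<Rightarrow> nat list \<Rightarrow> bool" where
  "extract_answer w \<sigma> n p s i m t xs \<longleftrightarrow>
     (\<exists>s'. exec w p (query_config w (params w \<sigma> n @ [i, m]) (arr s 0) (arr s 1)
                       (num_words w (m * char_bits \<sigma>))) t s' \<and>
           arr s' 0 = arr s 0 \<and> arr s' 1 = arr s 1 \<and> arr s' 2 = pack w (char_bits \<sigma>) xs)"

definition lce_answer ::
    "nat \<Rightarrow> nat \<Rightarrow> nat \<Rightarrow> prog \<Rightarrow> config \<Rightarrow> nat \<Rightarrow> nat \<Rightarrow> nat \<Rightarrow> nat \<Rightarrow> bool" where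
  "lce_answer w \<sigma> n p s i j t l \<longleftrightarrow>
     (\<exists>s'. exec w p (query_config w (params w \<sigma> n @ [i, j]) (arr s 0) (arr s 1) 0) t s' \<and>
           arr s' 0 = arr s 0 \<and> arr s' 1 = arr s 1 \<and> result w s' = l)"

end

theory Submission
imports Defs "HOL-Real_Asymp.Real_Asymp" "HOL-Computational_Algebra.Primes"
begin

text \<open>
The text, read as a number, is cut into blocks below \<open>R = 2 ^ (3 * K * w)\<close>.  Every block \<open>x\<close> is replaced by a number that has
the same quotient by the modulus \<open>M\<close>, but whose residue is the Karp--Rabin fingerprint of the suffix starting at that block;
the residue of \<open>x\<close> can be recovered from this fingerprint and the next one.  As \<open>M\<close> does not divide \<open>R\<close>, this could
exceed \<open>R\<close>; therefore a random window of length \<open>R mod M\<close> that no block hits is cut out of \<open>{..<R}\<close> first, so that no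
additional bits are needed.  Fingerprints of substrings come from two suffix fingerprints and the powers
\<open>2 ^ (b * 2 ^ k) mod M\<close>, and LCE queries use exponential and binary search.

If \<open>w < (log n) ^ 4\<close>, then \<open>M\<close> is a product of \<open>K\<close> random primes of about \<open>(5 / 4) * log n\<close> bits; there are enough
such primes because \<open>lcm {1..n}\<close> is at least \<open>2 ^ (n - 1)\<close>.  For larger \<open>w\<close> a random number of \<open>w div 3\<close> bits
suffices, since by Rankin's method a difference of two substrings has few divisors of this size.
Large numbers are stored in registers in base \<open>2 ^ (w div 3)\<close>, so that products of digits fit into a word, and for
bounded \<open>w\<close> the queries are answered by finite tables.
\<close>

section \<open>Loop-free machine code\<close>

text \<open>Extraction must be right and both queries fast for every tape; only the value of an LCE
  query may be wrong. So a hit window is detected and answered by the modulus 1, which needs no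
  window, and the time of an LCE query is bounded by the value it returns. A block of
  \<open>3 * K\<close> words leaves \<open>2 * K\<close> for \<open>M\<close> and \<open>K\<close>
  for the random multiple of \<open>M\<close> where the window starts. For a given block at most one
  multiple is harmful, so it is hit with probability at most \<open>2 ^ (- w * K)\<close>. A
  difference of two substrings has at most about \<open>n * w\<close> prime factors. One prime below
  about \<open>n ^ (5 / 4)\<close> divides it with probability about \<open>n ^ (- 1 / 4)\<close> up
  to logarithmic factors, rounded here to \<open>n ^ (- 1 / 8)\<close>; \<open>K\<close> independent
  primes reach \<open>n ^ (- c - 4)\<close>, enough for a union over \<open>n ^ 3\<close>
  differences. Primes this small can be found by trial division in linear time. Both the estimate
  and the \<open>O(w)\<close> rounds of a multi-word reciprocal need \<open>w\<close> polynomial in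
  \<open>log n\<close>, whence the second kind of modulus. Digits have a third of a word rather than
  half of it because a divisor must leave room for one digit in a word, and divisors larger than
  half a word occur.\<close>

primrec no_loop :: "prog \<Rightarrow> bool" where
"no_loop Skip = True"
| "no_loop (Const r k) = True"
| "no_loop (Op r f a b) = True"
| "no_loop (Load r k a) = True"
| "no_loop (Store k a r) = True"
| "no_loop (Rand r) = True"
| "no_loop (Seq p q) = (no_loop p & no_loop q)"
| "no_loop (If b p q) = (no_loop p & no_loop q)"
| "no_loop (While b p) = False"

text \<open>A static bound: a conditional is charged for both branches. The programs depend on
  \<open>K\<close> and on a threshold for \<open>w\<close>, but not on \<open>w\<close>, so
  \<open>steps\<close> of a loop-free part is a constant in every time bound. The value at
  \<open>While\<close> is a dummy.\<close>

primrec steps :: "prog \<Rightarrow> nat" where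
"steps Skip = 1"
| "steps (Const r k) = 1"
| "steps (Op r f a b) = 1"
| "steps (Load r k a) = 1"
| "steps (Store k a r) = 1"
| "steps (Rand r) = 1"
| "steps (Seq p q) = steps p + steps q"
| "steps (If b p q) = Suc (steps p + steps q)"
| "steps (While b p) = 0"

lemma exec_le_steps: "exec w p s t s' ==> no_loop p ==> t <= steps p"
by (induction rule: exec.induct) auto

primrec straight :: "prog \<Rightarrow> bool" where
"straight Skip = True"
| "straight (Const r k) = True"
| "straight (Op r f a b) = True"
| "straight (Load r k a) = False"
| "straight (Store k a r) = False"
| "straight (Rand r) = False"
| "straight (Seq p q) = (straight p & straight q)"
| "straight (If b p q) = False"
| "straight (While b p) = False"

text \<open>The clauses for memory, randomness and control flow are dummies, since
  \<open>exec_sl\<close> asks for \<open>straight\<close>.\<close>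

primrec sl :: "nat \<Rightarrow> prog \<Rightarrow> (nat \<Rightarrow> nat) \<Rightarrow> nat \<Rightarrow> nat" where
"sl w Skip f = f"
| "sl w (Const r k) f = f(r := k mod 2 ^ w)"
| "sl w (Op r g a b) f = f(r := binop_val w g (f a) (f b))"
| "sl w (Load r k a) f = f"
| "sl w (Store k a r) f = f"
| "sl w (Rand r) f = f"
| "sl w (Seq p q) f = sl w q (sl w p f)"
| "sl w (If b p q) f = f"
| "sl w (While b p) f = f"

lemma exec_sl: "straight p ==> \<exists>t. exec w p s t (s\<lparr>reg := sl w p (reg s)\<rparr>)"
proof (induction p arbitrary: s)
case Skip then show ?case using exec.Skip[of w s] by auto
next
case (Const r k) then show ?case using exec.Const[of w r k s] by (simp add: set_reg_def fun_upd_def) blast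
next
case (Op r f a b) then show ?case using exec.Op[of w r f a b s] by (simp add: set_reg_def fun_upd_def) blast
next
case (Seq p q)
from Seq obtain t where t: "exec w p s t (s\<lparr>reg := sl w p (reg s)\<rparr>)" by fastforce
from Seq.IH(2)[of "s\<lparr>reg := sl w p (reg s)\<rparr>"] Seq.prems obtain u where
 "exec w q (s\<lparr>reg := sl w p (reg s)\<rparr>) u (s\<lparr>reg := sl w q (sl w p (reg s))\<rparr>)" by auto
with t show ?case by (auto intro: exec.Seq)
qed auto

primrec unroll :: "nat \<Rightarrow> (nat \<Rightarrow> prog) \<Rightarrow> prog" where
"unroll 0 p = Skip"
| "unroll (Suc n) p = Seq (unroll n p) (p n)"

lemma straight_unroll [simp]: "straight (unroll n p) \<longleftrightarrow> (\<forall>i<n. straight (p i))"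
by (induction n) (auto simp: less_Suc_eq)

lemma no_loop_unroll [simp]: "no_loop (unroll n p) \<longleftrightarrow> (\<forall>i<n. no_loop (p i))"
by (induction n) (auto simp: less_Suc_eq)

text \<open>Time is absent on purpose: for code without loops it is recovered from
  \<open>exec_le_steps\<close>.\<close>

definition runs :: "nat \<Rightarrow> prog \<Rightarrow> config \<Rightarrow> (config \<Rightarrow> bool) \<Rightarrow> bool" where
"runs w p s Q \<longleftrightarrow> (\<exists>t s'. exec w p s t s' & Q s')"

lemma runs_Seq: "runs w p s (%s'. runs w q s' Q) ==> runs w (Seq p q) s Q"
unfolding runs_def by (blast intro: exec.Seq)

lemma runs_sl: "straight p ==> Q (s\<lparr>reg := sl w p (reg s)\<rparr>) ==> runs w p s Q"
unfolding runs_def using exec_sl by blast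

lemma runs_Load: "reg s a < length (arr s k) ==> Q (set_reg r (arr s k ! reg s a) s) ==>
 runs w (Load r k a) s Q"
unfolding runs_def by (blast intro: exec.Load)

lemma runs_Store: "reg s a < length (arr s k) ==>
 Q (s\<lparr>arr := (arr s)(k := (arr s k)[reg s a := reg s r])\<rparr>) ==> runs w (Store k a r) s Q"
unfolding runs_def by (blast intro: exec.Store)

lemma runs_Rand: "Q (set_reg r (shd (rnd s) mod 2 ^ w) (s\<lparr>rnd := stl (rnd s)\<rparr>)) ==>
 runs w (Rand r) s Q"
unfolding runs_def by (blast intro: exec.Rand)

lemma runs_If: "(if test_val b s then runs w p s Q else runs w q s Q) ==> runs w (If b p q) s Q"
unfolding runs_def by (auto split: if_splits intro: exec.IfTrue exec.IfFalse)

lemma runs_mono: "runs w p s Q ==> (!!s'. Q s' ==> R s') ==> runs w p s R"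
unfolding runs_def by blast

section \<open>Multi-word arithmetic\<close>

primrec val :: "nat \<Rightarrow> nat \<Rightarrow> (nat \<Rightarrow> nat) \<Rightarrow> nat" where
"val B 0 g = 0"
| "val B (Suc n) g = val B n g + g n * B ^ n"

text \<open>Horner value of the \<open>i\<close> most significant among \<open>n\<close> digits, the
  order in which division and \<open>to_word\<close> consume them.\<close>

primrec hor :: "nat \<Rightarrow> nat \<Rightarrow> nat \<Rightarrow> (nat \<Rightarrow> nat) \<Rightarrow> nat" where
"hor B n 0 g = 0"
| "hor B n (Suc i) g = hor B n i g * B + g (n - Suc i)"

lemma val_cong: "(!!i. i < n ==> f i = g i) ==> val B n f = val B n g"
by (induction n) auto

lemma hor_cong: "i <= n ==> (!!k. n - i <= k ==> k < n ==> f k = g k) ==> hor B n i f = hor B n i g"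
by (induction i) auto

lemma val_split: "i <= n ==> val B n g = val B (n - i) g + B ^ (n - i) * hor B n i g"
proof (induction i)
case (Suc i)
then have "n - i = Suc (n - Suc i)" by simp
with Suc show ?case by (simp add: algebra_simps)
qed simp

lemma val_hor: "val B n g = hor B n n g"
using val_split[of n n B g] by simp

lemma val_shift: "val B (n + m) g = val B n g + B ^ n * val B m (%i. g (n + i))"
by (induction m) (simp_all add: algebra_simps power_add)

lemma val_less: "(!!i. i < n ==> g i < B) ==> val B n g < B ^ n"
proof (induction n)
case (Suc n)
then have "val B n g < B ^ n" by (auto simp: less_Suc_eq)
moreover have "g n <= B - 1" using Suc.prems[of n] by simp
moreover have "(B - 1) * B ^ n + B ^ n = B ^ Suc n"
 using Suc.prems[of n] by (cases B) auto
moreover have "g n * B ^ n <= (B - 1) * B ^ n"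
 by (intro mult_le_mono1) fact
ultimately show ?case unfolding val.simps by linarith
qed simp

lemma digit_split: "t mod B * B ^ n + t div B * (B * B ^ n) = t * (B :: nat) ^ n"
proof -
have "t * B ^ n = (t div B * B + t mod B) * B ^ n" by (simp only: div_mult_mod_eq)
then show ?thesis by (simp only: distrib_left distrib_right ac_simps)
qed

lemma hor_le_val: "0 < B ==> i <= n ==> hor B n i g <= val B n g"
using val_split[of i n B g] by (simp add: trans_le_add2)

section \<open>Register layout and straight-line code for numbers of \<open>nd\<close>
  digits\<close>

abbreviation "rB \<equiv> 13 :: nat"
abbreviation "rC \<equiv> 14 :: nat"
abbreviation "rT \<equiv> 15 :: nat"
abbreviation "rX \<equiv> 16 :: nat"
abbreviation "rA \<equiv> 17 :: nat"
abbreviation "rM \<equiv> 19 :: nat"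

text \<open>The offset 32 keeps the digits of big numbers apart from the argument registers and from
  the scratch registers \<open>rB\<close> to \<open>rM\<close>.\<close>

definition br :: "nat \<Rightarrow> nat \<Rightarrow> nat \<Rightarrow> nat" where
"br nd x i = 32 + x * nd + i"

lemma br_inj: "i < nd ==> j < nd ==> br nd x i = br nd y j \<longleftrightarrow> x = y & i = j"
proof -
assume "i < nd" "j < nd"
then have "(x * nd + i) div nd = x" "(y * nd + j) div nd = y"
 "(x * nd + i) mod nd = i" "(y * nd + j) mod nd = j" by auto
then show ?thesis unfolding br_def by (metis add.assoc add_left_cancel)
qed

lemma br_ge: "32 <= br nd x i"
by (simp add: br_def)

lemma br_neq [simp]: "k < 32 ==> br nd x i ~= k" "k < 32 ==> k ~= br nd x i"
by (auto simp: br_def)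

lemma br_ge_level: "d <= x ==> 32 + d * nd <= br nd x i"
unfolding br_def by (rule order_trans[OF _ le_add1]) simp

lemma br_less_level: "x < d ==> i < nd ==> br nd x i < 32 + d * nd"
proof -
assume "x < d" "i < nd"
then have "x * nd + i < (x + 1) * nd" by simp
also have "\<dots> <= d * nd" using \<open>x < d\<close> by (intro mult_le_mono1) simp
finally show ?thesis by (simp add: br_def)
qed

definition copy_reg :: "nat \<Rightarrow> nat \<Rightarrow> prog" where
"copy_reg r a = Op r Or a a"

text \<open>Schoolbook multiply-and-add for one digit, with \<open>rC\<close> as carry. Addition is
  the case \<open>rX = 1\<close>; subtraction also complements the second operand and starts with
  carry 1.\<close>

definition mac_step :: "nat \<Rightarrow> nat \<Rightarrow> nat \<Rightarrow> nat \<Rightarrow> nat \<Rightarrow> prog" where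
"mac_step nd k d e i = Seq (Op rT Mul rX (br nd e i)) (Seq (Op rT Add rT (br nd d (k + i)))
 (Seq (Op rT Add rT rC) (Seq (Op (br nd d (k + i)) Mod rT rB) (Op rC Div rT rB))))"

definition compl_step :: "nat \<Rightarrow> nat \<Rightarrow> nat \<Rightarrow> prog" where
"compl_step nd e i = Op (br nd e i) Sub rM (br nd e i)"

definition mov :: "nat \<Rightarrow> nat \<Rightarrow> nat \<Rightarrow> prog" where
"mov nd d e = unroll nd (%i. copy_reg (br nd d i) (br nd e i))"

definition add_big :: "nat \<Rightarrow> nat \<Rightarrow> nat \<Rightarrow> prog" where
"add_big nd d e = Seq (Const rX 1) (Seq (Const rC 0) (unroll nd (mac_step nd 0 d e)))"

text \<open>Adding the complement and 1 leaves the final carry 0 exactly if the first operand is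
  smaller; all comparisons rely on this carry. The second operand is destroyed.\<close>

definition sub_big :: "nat \<Rightarrow> nat \<Rightarrow> nat \<Rightarrow> prog" where
"sub_big nd d e = Seq (unroll nd (compl_step nd e))
 (Seq (Const rX 1) (Seq (Const rC 1) (unroll nd (mac_step nd 0 d e))))"

text \<open>Columns from \<open>nd\<close> on are dropped, so the rows form the product modulo
  \<open>B ^ nd\<close>.\<close>

definition mul_row :: "nat \<Rightarrow> nat \<Rightarrow> nat \<Rightarrow> nat \<Rightarrow> nat \<Rightarrow> prog" where
"mul_row nd d a e i = Seq (copy_reg rX (br nd a i))
 (Seq (Const rC 0) (unroll (nd - i) (mac_step nd i d e)))"

definition mul_big :: "nat \<Rightarrow> nat \<Rightarrow> nat \<Rightarrow> nat \<Rightarrow> prog" where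
"mul_big nd d a e = Seq (unroll nd (%i. Const (br nd d i) 0)) (unroll nd (mul_row nd d a e))"

definition sdiv_step :: "nat \<Rightarrow> nat \<Rightarrow> nat \<Rightarrow> prog" where
"sdiv_step nd d i = Seq (Op rT Mul rC rB) (Seq (Op rT Add rT (br nd d (nd - Suc i)))
 (Seq (Op (br nd d (nd - Suc i)) Div rT rX) (Op rC Mod rT rX)))"

definition sdiv :: "nat \<Rightarrow> nat \<Rightarrow> prog" where
"sdiv nd d = Seq (Const rC 0) (unroll nd (sdiv_step nd d))"

definition of_word :: "nat \<Rightarrow> nat \<Rightarrow> prog" where
"of_word nd d = unroll nd (%i. Seq (Op (br nd d i) Mod rT rB) (Op rT Div rT rB))"

definition to_word :: "nat \<Rightarrow> nat \<Rightarrow> prog" where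
"to_word nd d = Seq (Const rT 0)
 (unroll nd (%i. Seq (Op rT Mul rT rB) (Op rT Add rT (br nd d (nd - Suc i)))))"

lemmas big_defs = mov_def add_big_def sub_big_def mul_big_def mul_row_def sdiv_def of_word_def
to_word_def copy_reg_def mac_step_def compl_step_def sdiv_step_def

lemma straight_big [simp]:
"straight (mov nd d e)" "straight (add_big nd d e)" "straight (sub_big nd d e)"
"straight (mul_big nd d e a)" "straight (sdiv nd d)" "straight (of_word nd d)"
"straight (to_word nd d)" "straight (copy_reg i j)"
by (simp_all add: big_defs)

lemma no_loop_big [simp]:
"no_loop (mov nd d e)" "no_loop (add_big nd d e)" "no_loop (sub_big nd d e)"
"no_loop (mul_big nd d e a)" "no_loop (sdiv nd d)" "no_loop (of_word nd d)"
"no_loop (to_word nd d)" "no_loop (copy_reg i j)"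
by (simp_all add: big_defs)

text \<open>\<open>2 * h <= w\<close> lets a product of two digits together with a carry fit into a
  word; \<open>w <= 4 * h\<close> and \<open>4 <= nd\<close> let every word be split into
  \<open>nd\<close> digits.\<close>

locale machine =
fixes w nd h :: nat
assumes h_pos: "0 < h" and hw: "2 * h <= w" and wh: "w <= 4 * h" and nd4: "4 <= nd"
begin

definition B :: nat where "B = 2 ^ h"

lemma B_pos: "0 < B" and B_gt1: "1 < B"
using h_pos one_less_power[of "2::nat" h] by (auto simp: B_def)

lemma w_pos: "0 < w"
using h_pos hw by simp

lemma BB: "B * B <= 2 ^ w"
unfolding B_def using hw by (simp add: mult_2 flip: power_add)

lemma B_less: "B < 2 ^ w"
proof -
have "B * 1 < B * B" using B_gt1 B_pos by (intro mult_strict_left_mono) auto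
with BB show ?thesis by linarith
qed

lemma wB: "2 ^ w <= B ^ nd"
proof -
have "w <= h * nd" using wh nd4 by (metis dual_order.trans mult.commute mult_le_mono1)
then show ?thesis unfolding B_def by (simp flip: power_mult)
qed

definition bv :: "(nat \<Rightarrow> nat) \<Rightarrow> nat \<Rightarrow> nat" where
"bv f x = val B nd (%i. f (br nd x i))"

definition dg :: "(nat \<Rightarrow> nat) \<Rightarrow> nat \<Rightarrow> bool" where
"dg f x \<longleftrightarrow> (\<forall>i<nd. f (br nd x i) < B)"

lemma bv_less: "dg f x ==> bv f x < B ^ nd"
unfolding dg_def bv_def by (rule val_less) blast

definition ready :: "(nat \<Rightarrow> nat) \<Rightarrow> bool" where
"ready f \<longleftrightarrow> f rB = B & f rM = B - 1"

text \<open>Digits and carry are at most \<open>B - 1\<close>, and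
  \<open>(B - 1) ^ 2 + 2 * (B - 1) < B ^ 2\<close>; so no step overflows a word and the new carry is
  again a digit. The clause on unchanged registers is what lets the rows of a product be
  composed.\<close>

lemma mac:
assumes de: "d ~= e" and r: "ready f" "dg f d" "dg f e" "f rX < B" "f rC < B"
shows "k + n <= nd ==>
 (let f' = sl w (unroll n (mac_step nd k d e)) f in
 (\<forall>r. r \<notin> {rT, rC} \<union> {br nd d (k + i) |i. i < n} --> f' r = f r) &
 f' rC < B & dg f' d &
 val B n (%i. f' (br nd d (k + i))) + f' rC * B ^ n =
 val B n (%i. f (br nd d (k + i))) + f rX * val B n (%i. f (br nd e i)) + f rC)"
proof (induction n)
case 0
then show ?case using r by simp
next
case (Suc n)
define g where "g = sl w (unroll n (mac_step nd k d e)) f"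
from Suc have fr: "!!r. r \<notin> {rT, rC} \<union> {br nd d (k + i) |i. i < n} ==> g r = f r"
 and gC: "g rC < B" and gd: "dg g d"
 and eq: "val B n (%i. g (br nd d (k + i))) + g rC * B ^ n =
 val B n (%i. f (br nd d (k + i))) + f rX * val B n (%i. f (br nd e i)) + f rC"
 by (simp_all add: g_def Let_def)
have lt: "k + n < nd" "n < nd" using Suc.prems by auto
have g1: "g rX = f rX" "g rB = B" by (subst fr; use r in \<open>auto simp: ready_def\<close>)+
have g2: "g (br nd e n) = f (br nd e n)"
 by (rule fr) (use de lt in \<open>auto simp: br_inj\<close>)
have g3: "g (br nd d (k + n)) = f (br nd d (k + n))"
 by (rule fr) (use lt in \<open>auto simp: br_inj\<close>)
define x where "x = f rX" define a where "a = f (br nd e n)"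
define b where "b = f (br nd d (k + n))" define c where "c = g rC"
define t where "t = x * a + b + c"
have "x < B" "a < B" "b < B" "c < B"
 using r gC lt by (auto simp: x_def a_def b_def c_def dg_def)
then have b1: "x <= B - 1" "a <= B - 1" "b <= B - 1" "c <= B - 1" by linarith+
then have "x * a <= (B - 1) * (B - 1)" by (intro mult_le_mono)
moreover have "(B - 1) * (B - 1) + (B - 1) + (B - 1) < B * B"
 using B_pos by (cases B) (auto simp: algebra_simps)
ultimately have tlt: "t < B * B" unfolding t_def using b1 by linarith
have tw: "t < 2 ^ w" using tlt BB by linarith
let ?g' = "g(rT := t, br nd d (k + n) := t mod B, rC := t div B)"
have step: "sl w (mac_step nd k d e n) g = ?g'"
 using tw g1 g2 g3
 by (auto simp: mac_step_def fun_eq_iff x_def[symmetric] a_def[symmetric] b_def[symmetric]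
  c_def[symmetric] t_def mod_add_left_eq)
have tc: "t div B < B" using tlt by (simp add: less_mult_imp_div_less)
have s1: "val B n (%i. ?g' (br nd d (k + i))) = val B n (%i. g (br nd d (k + i)))"
 by (rule val_cong) (use lt in \<open>auto simp: br_inj\<close>)
have tt: "t mod B * B ^ n + t div B * (B * B ^ n) = t * B ^ n"
 by (rule digit_split)
have "val B (Suc n) (%i. ?g' (br nd d (k + i))) + ?g' rC * B ^ Suc n
 = val B n (%i. g (br nd d (k + i))) + t * B ^ n"
 unfolding val.simps s1 using tt lt by simp
also have "\<dots> = val B n (%i. g (br nd d (k + i))) + c * B ^ n + (x * a + b) * B ^ n"
 by (simp add: t_def algebra_simps)
also have "\<dots> = val B (Suc n) (%i. f (br nd d (k + i))) + f rX * val B (Suc n) (%i. f (br nd e i)) + f rC"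
 using eq by (simp add: c_def x_def a_def b_def algebra_simps)
finally have main: "val B (Suc n) (%i. ?g' (br nd d (k + i))) + ?g' rC * B ^ Suc n = \<dots>" .
have "dg ?g' d" using gd B_pos by (auto simp: dg_def br_inj)
moreover have "\<forall>r. r \<notin> {rT, rC} \<union> {br nd d (k + i) |i. i < Suc n} --> ?g' r = f r"
 by (auto intro!: fr)
ultimately show ?case using main tc
 unfolding Let_def unroll.simps sl.simps g_def[symmetric] step by simp
qed

lemma mov:
"let f' = sl w (mov nd d e) f in
 (\<forall>r. r \<notin> {br nd d i |i. i < nd} --> f' r = f r) & (\<forall>i<nd. f' (br nd d i) = f (br nd e i))"
proof -
have "n <= nd ==> (let f' = sl w (unroll n (%i. copy_reg (br nd d i) (br nd e i))) f in
 (\<forall>r. r \<notin> {br nd d i |i. i < n} --> f' r = f r) & (\<forall>i<n. f' (br nd d i) = f (br nd e i)))" for n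
proof (induction n)
 case (Suc n)
 define g where "g = sl w (unroll n (%i. copy_reg (br nd d i) (br nd e i))) f"
 have "g (br nd e n) = f (br nd e n)"
 unfolding g_def by (rule Suc.IH[unfolded Let_def, THEN conjunct1, rule_format])
  (use Suc.prems in \<open>auto simp: br_inj\<close>)
 then show ?case
 using Suc unfolding unroll.simps sl.simps g_def[symmetric]
 by (auto simp: Let_def copy_reg_def br_inj less_Suc_eq)
qed simp
from this[of nd] show ?thesis by (simp add: mov_def)
qed

lemma add_big:
assumes "d ~= e" "ready f" "dg f d" "dg f e" "bv f d + bv f e < B ^ nd"
shows "let f' = sl w (add_big nd d e) f in
 (\<forall>r. r \<notin> {rT, rC, rX} \<union> {br nd d i |i. i < nd} --> f' r = f r) & dg f' d &
 bv f' d = bv f d + bv f e"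
proof -
let ?f = "f(rX := 1, rC := 0)"
have *: "ready ?f" "dg ?f d" "dg ?f e" "?f rX < B" "?f rC < B" "bv ?f d = bv f d" "bv ?f e = bv f e"
 using assms B_gt1 by (auto simp: ready_def dg_def bv_def)
define f' where "f' = sl w (unroll nd (mac_step nd 0 d e)) ?f"
have f': "f' = sl w (add_big nd d e) f"
 using w_pos by (simp add: add_big_def f'_def del: One_nat_def)
from mac[OF assms(1) *(1-5), of 0 nd, unfolded Let_def, folded f'_def] *(6-) have
 fr: "\<forall>r. r \<notin> {rT, rC} \<union> {br nd d i |i. i < nd} --> f' r = ?f r"
 and d: "dg f' d" and eq: "bv f' d + f' rC * B ^ nd = bv f d + bv f e"
 by (simp_all add: bv_def)
have "f' rC = 0"
 using eq assms(5) by (cases "f' rC") auto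
with eq d fr show ?thesis unfolding f'[symmetric] Let_def by auto
qed

lemma compl:
assumes "ready f" "dg f e"
shows "let f' = sl w (unroll nd (compl_step nd e)) f in
 (\<forall>r. r \<notin> {br nd e i |i. i < nd} --> f' r = f r) & dg f' e & bv f' e + bv f e + 1 = B ^ nd"
proof -
have "n <= nd ==> (let f' = sl w (unroll n (compl_step nd e)) f in
 (\<forall>r. r \<notin> {br nd e i |i. i < n} --> f' r = f r) & (\<forall>i<nd. f' (br nd e i) < B) &
 val B n (%i. f' (br nd e i)) + val B n (%i. f (br nd e i)) + 1 = B ^ n)" for n
proof (induction n)
 case 0 then show ?case using assms by (simp add: dg_def)
next
 case (Suc n)
 define g where "g = sl w (unroll n (compl_step nd e)) f"
 from Suc have fr: "!!r. r \<notin> {br nd e i |i. i < n} ==> g r = f r" and gd: "\<forall>i<nd. g (br nd e i) < B"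
 and eq: "val B n (%i. g (br nd e i)) + val B n (%i. f (br nd e i)) + 1 = B ^ n"
 by (simp_all add: Let_def g_def)
 have n: "n < nd" using Suc.prems by simp
 have gM: "g rM = B - 1" using assms(1) fr by (subst fr) (auto simp: ready_def)
 have gn: "g (br nd e n) = f (br nd e n)" by (rule fr) (use n in \<open>auto simp: br_inj\<close>)
 define a where "a = f (br nd e n)"
 have a: "a <= B - 1" using assms n by (simp add: dg_def a_def) (metis Suc_leI Suc_le_mono Suc_pred B_pos)
 have "(B - 1 + (2 ^ w - a)) mod 2 ^ w = B - 1 - a"
 proof -
 have "B - 1 + (2 ^ w - a) = (B - 1 - a) + 2 ^ w" using a B_less by simp
 then show ?thesis using B_less by simp
 qed
 then have step: "sl w (compl_step nd e n) g = g(br nd e n := B - 1 - a)"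
 by (simp add: compl_step_def gM gn a_def[symmetric])
 let ?g' = "g(br nd e n := B - 1 - a)"
 have s1: "val B n (%i. ?g' (br nd e i)) = val B n (%i. g (br nd e i))"
 by (rule val_cong) (use n in \<open>auto simp: br_inj\<close>)
 have "(B - 1 - a) * B ^ n + a * B ^ n + B ^ n = B ^ Suc n"
 using a B_pos by (simp flip: add_mult_distrib) (cases B; simp)
 then have "val B (Suc n) (%i. ?g' (br nd e i)) + val B (Suc n) (%i. f (br nd e i)) + 1 = B ^ Suc n"
 unfolding val.simps s1 using eq by (simp add: a_def[symmetric])
 moreover have "\<forall>i<nd. ?g' (br nd e i) < B" using gd B_pos by auto
 moreover have "\<forall>r. r \<notin> {br nd e i |i. i < Suc n} --> ?g' r = f r" by (auto intro!: fr)
 ultimately show ?case unfolding Let_def unroll.simps sl.simps g_def[symmetric] step by blast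
qed
from this[of nd] show ?thesis by (simp add: Let_def dg_def bv_def)
qed

lemma sub_big:
assumes "d ~= e" "ready f" "dg f d" "dg f e"
shows "let f' = sl w (sub_big nd d e) f in
 (\<forall>r. r \<notin> {rT, rC, rX} \<union> {br nd d i |i. i < nd} \<union> {br nd e i |i. i < nd} --> f' r = f r) &
 dg f' d & (bv f e <= bv f d --> bv f' d = bv f d - bv f e) &
 f' rC = (if bv f d < bv f e then 0 else 1)"
proof -
define g where "g = sl w (unroll nd (compl_step nd e)) f"
from compl[OF assms(2,4)] have frg: "!!r. r \<notin> {br nd e i |i. i < nd} ==> g r = f r"
 and ge: "dg g e" "bv g e + bv f e + 1 = B ^ nd"
 by (simp_all add: Let_def g_def)
have gd: "g (br nd d i) = f (br nd d i)" if "i < nd" for i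
 by (rule frg) (use assms(1) that in \<open>auto simp: br_inj\<close>)
let ?f = "g(rX := 1, rC := 1)"
have rg: "ready g" using assms(2) by (auto simp: ready_def frg)
have bd: "bv ?f d = bv f d"
 unfolding bv_def by (rule val_cong) (simp add: gd)
have *: "ready ?f" "dg ?f d" "dg ?f e" "?f rX < B" "?f rC < B" "bv ?f e = bv g e"
 using assms B_gt1 rg ge(1) by (auto simp: ready_def dg_def bv_def gd)
define f' where "f' = sl w (unroll nd (mac_step nd 0 d e)) ?f"
have f': "f' = sl w (sub_big nd d e) f"
 using w_pos by (simp add: sub_big_def f'_def g_def del: One_nat_def)
from mac[OF assms(1) *(1-5), of 0 nd, unfolded Let_def, folded f'_def] *(6-) have
 fr: "\<forall>r. r \<notin> {rT, rC} \<union> {br nd d i |i. i < nd} --> f' r = ?f r"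
 and d: "dg f' d" and eq: "bv f' d + f' rC * B ^ nd = bv f d + bv g e + 1"
 using bd by (simp_all add: bv_def)
\<comment> \<open>With the complement eliminated, the carry can only be 0 or 1, and comparing both
  sides with \<open>B ^ nd\<close> decides which.\<close>
from eq ge(2) have eq2: "bv f' d + f' rC * B ^ nd + bv f e = bv f d + B ^ nd" by simp
have l: "bv f' d < B ^ nd" "bv f d < B ^ nd" "bv f e < B ^ nd"
 using d assms bv_less by auto
have "f' rC < 2"
proof (rule ccontr)
 assume "\<not> f' rC < 2"
 then have "2 * B ^ nd <= f' rC * B ^ nd" by (intro mult_le_mono1) simp
 with eq2 l show False by linarith
qed
then have "f' rC = 0 \<or> f' rC = 1" by linarith
then have "(bv f e <= bv f d --> bv f' d = bv f d - bv f e) &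
 f' rC = (if bv f d < bv f e then 0 else 1)" using eq2 l by auto
with d fr frg show ?thesis unfolding f'[symmetric] Let_def by auto
qed


text \<open>\<open>q\<close> collects what is lost beyond \<open>B ^ nd\<close>: the last carry of a
  row, the upper digits of \<open>e\<close> that the row skips, and the losses of earlier rows. Its
  existence suffices, because \<open>mul_big\<close> bounds the true product and thereby forces
  \<open>q = 0\<close>.\<close>

lemma mul_rows:
assumes de: "d ~= e" "d ~= a" and r: "ready f" "dg f d" "dg f a" "dg f e" "bv f d = 0"
shows "n <= nd ==>
 (let f' = sl w (unroll n (mul_row nd d a e)) f in
 (\<forall>r. r \<notin> {rT, rC, rX} \<union> {br nd d i |i. i < nd} --> f' r = f r) & dg f' d &
 (\<exists>q. bv f' d + q * B ^ nd = val B n (%i. f (br nd a i)) * bv f e))"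
proof (induction n)
case 0
then show ?case using r by simp
next
case (Suc n)
define g where "g = sl w (unroll n (mul_row nd d a e)) f"
from Suc obtain q where fr: "!!r. r \<notin> {rT, rC, rX} \<union> {br nd d i |i. i < nd} ==> g r = f r"
 and gd: "dg g d" and eq: "bv g d + q * B ^ nd = val B n (%i. f (br nd a i)) * bv f e"
 by (auto simp add: g_def Let_def)
have n: "n < nd" using Suc.prems by simp
have ge: "g (br nd e i) = f (br nd e i)" "g (br nd a i) = f (br nd a i)" if "i < nd" for i
 using that de by (auto intro!: fr simp: br_inj)
define x where "x = f (br nd a n)"
have x: "x < B" using r n by (auto simp: x_def dg_def)
define g1 where "g1 = g(rX := x, rC := 0)"
have g1: "ready g1" "dg g1 d" "dg g1 e" "g1 rX < B" "g1 rC < B"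
 using r fr gd x B_pos ge by (auto simp: ready_def dg_def g1_def)
define f' where "f' = sl w (unroll (nd - n) (mac_step nd n d e)) g1"
have f': "f' = sl w (unroll (Suc n) (mul_row nd d a e)) f"
 using n ge(2)[OF n] by (simp add: f'_def g_def[symmetric] mul_row_def copy_reg_def x_def g1_def)
have m1: "!!r. r \<notin> {rT, rC} \<union> {br nd d (n + i) |i. i < nd - n} ==> f' r = g1 r"
 and m2: "dg f' d"
 and m3: "val B (nd - n) (%i. f' (br nd d (n + i))) + f' rC * B ^ (nd - n) =
 val B (nd - n) (%i. g1 (br nd d (n + i))) + g1 rX * val B (nd - n) (%i. g1 (br nd e i)) + g1 rC"
 using mac[OF de(1) g1, of n "nd - n", unfolded Let_def, folded f'_def] n by auto
have sp: "val B nd u = val B n u + B ^ n * val B (nd - n) (%i. u (n + i))" for u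
 using val_shift[of B n "nd - n" u] n by simp
have low: "val B n (%i. f' (br nd d i)) = val B n (%i. g (br nd d i))"
 by (rule val_cong, subst m1) (use n in \<open>auto simp: br_inj g1_def\<close>)
define E1 where "E1 = val B (nd - n) (%i. f (br nd e i))"
define E2 where "E2 = hor B nd n (%i. f (br nd e i))"
have E: "bv f e = E1 + B ^ (nd - n) * E2"
 unfolding E1_def E2_def bv_def by (rule val_split) (use n in simp)
have E1': "val B (nd - n) (%i. g1 (br nd e i)) = E1"
 unfolding E1_def by (rule val_cong) (use ge in \<open>simp add: g1_def\<close>)
have G1': "val B (nd - n) (%i. g1 (br nd d (n + i))) = val B (nd - n) (%i. g (br nd d (n + i)))"
 by (rule val_cong) (simp add: g1_def)
have m3': "val B (nd - n) (%i. f' (br nd d (n + i))) + f' rC * B ^ (nd - n) =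
 val B (nd - n) (%i. g (br nd d (n + i))) + x * E1"
 using m3 unfolding E1' G1' by (simp add: g1_def)
have pw: "B ^ n * B ^ (nd - n) = B ^ nd" using n by (simp flip: power_add)
have "bv f' d + f' rC * B ^ nd
 = val B n (%i. g (br nd d i)) +
  B ^ n * (val B (nd - n) (%i. f' (br nd d (n + i))) + f' rC * B ^ (nd - n))"
 unfolding bv_def sp[of "%i. f' (br nd d i)"] low pw[symmetric] by (simp add: algebra_simps)
also have "\<dots> = bv g d + B ^ n * (x * E1)"
 unfolding m3' bv_def sp[of "%i. g (br nd d i)"] by (simp add: algebra_simps)
finally have "bv f' d + f' rC * B ^ nd + x * E2 * B ^ nd + q * B ^ nd
 = (bv g d + q * B ^ nd) + B ^ n * x * (E1 + B ^ (nd - n) * E2)"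
 by (simp add: algebra_simps flip: pw)
also have "\<dots> = val B (Suc n) (%i. f (br nd a i)) * bv f e"
 unfolding eq E[symmetric] by (simp add: x_def algebra_simps)
finally have "bv f' d + (f' rC + x * E2 + q) * B ^ nd = \<dots>"
 by (simp add: algebra_simps)
moreover have "\<forall>r. r \<notin> {rT, rC, rX} \<union> {br nd d i |i. i < nd} --> f' r = f r"
proof (intro allI impI)
 fix r assume r: "r \<notin> {rT, rC, rX} \<union> {br nd d i |i. i < nd}"
 then have "f' r = g1 r" by (intro m1) auto
 then show "f' r = f r" using fr[OF r] r by (simp add: g1_def)
qed
ultimately show ?case using m2 unfolding f'[symmetric] Let_def by blast
qed

lemma mul_big:
assumes de: "d ~= e" "d ~= a" and r: "ready f" "dg f a" "dg f e" and l: "bv f a * bv f e < B ^ nd"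
shows "let f' = sl w (mul_big nd d a e) f in
 (\<forall>r. r \<notin> {rT, rC, rX} \<union> {br nd d i |i. i < nd} --> f' r = f r) & dg f' d &
 bv f' d = bv f a * bv f e"
proof -
define g where "g = sl w (unroll nd (%i. Const (br nd d i) 0)) f"
have z: "n <= nd ==> sl w (unroll n (%i. Const (br nd d i) 0)) f =
 (%r. if r \<in> {br nd d i |i. i < n} then 0 else f r)" for n
 by (induction n) (auto simp: fun_eq_iff less_Suc_eq)
have g: "g = (%r. if r \<in> {br nd d i |i. i < nd} then 0 else f r)"
 unfolding g_def by (rule z) simp
have "ready g" "dg g d" "dg g a" "dg g e"
 using r de B_pos by (auto simp: g ready_def dg_def br_inj)
moreover have "bv g d = val B nd (%_. 0)"
 unfolding bv_def by (rule val_cong) (auto simp: g)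
moreover have "val B k (%_. 0) = 0" for k by (induction k) auto
moreover have ba: "bv g a = bv f a" unfolding bv_def
 by (rule val_cong) (use de in \<open>auto simp: g br_inj\<close>)
moreover have be: "bv g e = bv f e" unfolding bv_def
 by (rule val_cong) (use de in \<open>auto simp: g br_inj\<close>)
ultimately obtain q where
 *: "\<forall>r. r \<notin> {rT, rC, rX} \<union> {br nd d i |i. i < nd} --> sl w (mul_big nd d a e) f r = g r"
 "dg (sl w (mul_big nd d a e) f) d"
 "bv (sl w (mul_big nd d a e) f) d + q * B ^ nd = bv f a * bv f e"
 using mul_rows[OF de, of g nd]
 unfolding mul_big_def sl.simps g_def[symmetric] Let_def by (auto simp: bv_def)
have "q = 0" using *(3) l by (cases q) auto
with * show ?thesis unfolding Let_def by (auto simp: g)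
qed

text \<open>Long division from the top digit on. The remainder stays below \<open>f rX\<close>, so
  the next partial dividend is below \<open>f rX * B\<close>; this is why a divisor must leave a
  factor \<open>B\<close> of room in a word.\<close>

lemma sdiv_rows:
assumes r: "ready f" "dg f d" "0 < f rX" "f rX * B <= 2 ^ w" "f rC = 0"
shows "n <= nd ==>
 (let f' = sl w (unroll n (sdiv_step nd d)) f in
 (\<forall>r. r \<notin> {rT, rC} \<union> {br nd d i |i. nd - n <= i & i < nd} --> f' r = f r) & dg f' d &
 f' rC < f rX &
 hor B nd n (%i. f' (br nd d i)) * f rX + f' rC = hor B nd n (%i. f (br nd d i)))"
proof (induction n)
case 0
then show ?case using r by simp
next
case (Suc n)
define g where "g = sl w (unroll n (sdiv_step nd d)) f"
have n: "n < nd" using Suc.prems by simp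
from Suc have fr: "!!r. r \<notin> {rT, rC} \<union> {br nd d i |i. nd - n <= i & i < nd} ==> g r = f r"
 and gd: "dg g d" and c: "g rC < f rX"
 and eq: "hor B nd n (%i. g (br nd d i)) * f rX + g rC = hor B nd n (%i. f (br nd d i))"
 by (simp_all add: g_def Let_def)
define p where "p = nd - Suc n"
have p: "p < nd" "p < nd - n" using n by (auto simp: p_def)
have g1: "g rX = f rX" "g rB = B" by (subst fr; use r in \<open>auto simp: ready_def\<close>)+
have g2: "g (br nd d p) = f (br nd d p)"
 by (rule fr) (use p in \<open>auto simp: br_inj\<close>)
define x where "x = f rX" define a where "a = f (br nd d p)" define c' where "c' = g rC"
define t where "t = c' * B + a"
have a: "a < B" using r p by (auto simp: a_def dg_def)
have "t < (c' + 1) * B" using a by (simp add: t_def)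
also have "\<dots> <= x * B" using c by (intro mult_le_mono1) (simp add: x_def c'_def)
finally have t: "t < x * B" .
then have tw: "t < 2 ^ w" using r by (simp add: x_def)
let ?g' = "g(rT := t, br nd d p := t div x, rC := t mod x)"
have step: "sl w (sdiv_step nd d n) g = ?g'"
 using tw g1 g2
 by (auto simp: sdiv_step_def fun_eq_iff x_def[symmetric] a_def[symmetric] p_def[symmetric]
  c'_def[symmetric] t_def mod_add_left_eq)
have x0: "0 < x" using r by (simp add: x_def)
have tx: "t div x < B" using t x0 by (simp add: less_mult_imp_div_less mult.commute)
have s1: "hor B nd n (%i. ?g' (br nd d i)) = hor B nd n (%i. g (br nd d i))"
 by (rule hor_cong) (use p in \<open>auto simp: br_inj\<close>)
have "hor B nd (Suc n) (%i. ?g' (br nd d i)) * f rX + ?g' rC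
 = (hor B nd n (%i. g (br nd d i)) * B + t div x) * x + t mod x"
 unfolding hor.simps s1 p_def[symmetric] by (simp add: x_def)
also have "\<dots> = (hor B nd n (%i. g (br nd d i)) * x + c') * B + a"
 by (simp add: algebra_simps t_def)
also have "\<dots> = hor B nd (Suc n) (%i. f (br nd d i))"
 using eq by (simp add: x_def c'_def p_def[symmetric] a_def)
finally have main: "hor B nd (Suc n) (%i. ?g' (br nd d i)) * f rX + ?g' rC = \<dots>" .
have "dg ?g' d" using gd tx by (auto simp: dg_def br_inj)
moreover have "\<forall>r. r \<notin> {rT, rC} \<union> {br nd d i |i. nd - Suc n <= i & i < nd} --> ?g' r = f r"
 using p by (auto simp: p_def intro!: fr)
moreover have "?g' rC < f rX" using x0 by (simp add: x_def)
ultimately show ?case using main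
 unfolding Let_def unroll.simps sl.simps g_def[symmetric] step by blast
qed

lemma sdiv:
assumes r: "ready f" "dg f d" "0 < f rX" "f rX * B <= 2 ^ w"
shows "let f' = sl w (sdiv nd d) f in
 (\<forall>r. r \<notin> {rT, rC} \<union> {br nd d i |i. i < nd} --> f' r = f r) & dg f' d &
 bv f' d = bv f d div f rX & f' rC = bv f d mod f rX"
proof -
let ?f = "f(rC := 0)"
have *: "ready ?f" "dg ?f d" "0 < ?f rX" "?f rX * B <= 2 ^ w" "?f rC = 0" "bv ?f d = bv f d"
 using r by (auto simp: ready_def dg_def bv_def)
define f' where "f' = sl w (sdiv nd d) f"
have f': "sl w (unroll nd (sdiv_step nd d)) ?f = f'" by (simp add: f'_def sdiv_def)
from sdiv_rows[OF *(1-5), of nd, unfolded Let_def f'] have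
 1: "\<forall>r. r \<notin> {rT, rC} \<union> {br nd d i |i. i < nd} --> f' r = ?f r" "dg f' d" "f' rC < f rX"
 "bv f' d * f rX + f' rC = bv f d"
 by (simp_all add: bv_def val_hor)
then have "bv f d div f rX = bv f' d & bv f d mod f rX = f' rC"
 by (auto simp flip: 1(4))
with 1 show ?thesis unfolding f'_def[symmetric] Let_def by auto
qed

lemma of_word:
assumes r: "ready f" "f rT < 2 ^ w"
shows "let f' = sl w (of_word nd d) f in
 (\<forall>r. r \<notin> {rT} \<union> {br nd d i |i. i < nd} --> f' r = f r) & dg f' d & bv f' d = f rT"
proof -
let ?p = "%i. Seq (Op (br nd d i) Mod rT rB) (Op rT Div rT rB)"
have *: "n <= nd ==> (let f' = sl w (unroll n ?p) f in
 (\<forall>r. r \<notin> {rT} \<union> {br nd d i |i. i < n} --> f' r = f r) &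
 (\<forall>i<n. f' (br nd d i) < B) & val B n (%i. f' (br nd d i)) + f' rT * B ^ n = f rT)" for n
proof (induction n)
 case (Suc n)
 define g where "g = sl w (unroll n ?p) f"
 from Suc have fr: "!!r. r \<notin> {rT} \<union> {br nd d i |i. i < n} ==> g r = f r"
 and gd: "\<forall>i<n. g (br nd d i) < B" and eq: "val B n (%i. g (br nd d i)) + g rT * B ^ n = f rT"
 by (simp_all add: g_def Let_def)
 have n: "n < nd" using Suc.prems by simp
 have gB: "g rB = B" by (subst fr) (use r in \<open>auto simp: ready_def\<close>)
 define t where "t = g rT"
 let ?g' = "g(br nd d n := t mod B, rT := t div B)"
 have s: "sl w (?p n) g = ?g'" by (simp add: gB t_def)
 have s1: "val B n (%i. ?g' (br nd d i)) = val B n (%i. g (br nd d i))"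
 by (rule val_cong) (use n in \<open>auto simp: br_inj\<close>)
 have "t mod B * B ^ n + t div B * (B * B ^ n) = t * B ^ n"
 by (rule digit_split)
 then have "val B (Suc n) (%i. ?g' (br nd d i)) + ?g' rT * B ^ Suc n = f rT"
 unfolding val.simps s1 using eq by (simp add: t_def)
 moreover have "\<forall>i<Suc n. ?g' (br nd d i) < B"
 using gd B_pos by (auto simp: less_Suc_eq)
 moreover have "\<forall>r. r \<notin> {rT} \<union> {br nd d i |i. i < Suc n} --> ?g' r = f r"
 by (auto intro!: fr)
 ultimately show ?case unfolding Let_def unroll.simps sl.simps(7)[of w "unroll n ?p"] g_def[symmetric] s by blast
qed simp
define f' where "f' = sl w (of_word nd d) f"
from *[of nd, unfolded Let_def, folded of_word_def, folded f'_def]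
have 1: "\<forall>r. r \<notin> {rT} \<union> {br nd d i |i. i < nd} --> f' r = f r" "dg f' d"
 "bv f' d + f' rT * B ^ nd = f rT"
 by (simp_all add: dg_def bv_def)
have "f' rT = 0" using 1(3) r(2) wB by (cases "f' rT") auto
with 1 show ?thesis unfolding f'_def[symmetric] Let_def by auto
qed

lemma to_word:
assumes r: "ready f" "dg f d" "bv f d < 2 ^ w"
shows "sl w (to_word nd d) f = f(rT := bv f d)"
proof -
let ?p = "%i. Seq (Op rT Mul rT rB) (Op rT Add rT (br nd d (nd - Suc i)))"
have *: "n <= nd ==> sl w (unroll n ?p) (f(rT := 0)) = f(rT := hor B nd n (%i. f (br nd d i)))" for n
proof (induction n)
 case (Suc n)
 have "hor B nd (Suc n) (%i. f (br nd d i)) < 2 ^ w"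
 using hor_le_val[OF B_pos Suc.prems, of "%i. f (br nd d i)"] r(3) by (simp add: bv_def)
 then show ?case using Suc r(1) by (simp add: fun_eq_iff ready_def mod_add_left_eq)
qed simp
from *[of nd] show ?thesis by (simp add: to_word_def bv_def val_hor)
qed

end

section \<open>A compiler for programs with big numbers\<close>

datatype ex = Var nat | Num nat | Plus ex ex | Minus ex ex | Times ex ex | Quo ex ex | Rem ex ex
| Cell array ex | Pow ex

datatype hl = Asg nat ex | Sto array ex ex | Rnd nat | Sq hl hl | Iff ex ex hl hl | Nop | Whl ex ex hl

abbreviation "nv \<equiv> 100 :: nat"

text \<open>Evaluation on a stack of big numbers: the result goes to level \<open>d\<close>, higher
  levels are free, and the levels below \<open>nv\<close> are the variables. A product takes a third
  level because its target must differ from both factors. Divisors and addresses pass through a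
  single word.\<close>

primrec cmp_ex :: "nat \<Rightarrow> nat \<Rightarrow> ex \<Rightarrow> prog" where
"cmp_ex nd d (Var x) = mov nd d x"
| "cmp_ex nd d (Num k) = Seq (Const rT k) (of_word nd d)"
| "cmp_ex nd d (Plus a b) = Seq (cmp_ex nd d a) (Seq (cmp_ex nd (Suc d) b) (add_big nd d (Suc d)))"
| "cmp_ex nd d (Minus a b) = Seq (cmp_ex nd d a) (Seq (cmp_ex nd (Suc d) b) (sub_big nd d (Suc d)))"
| "cmp_ex nd d (Times a b) = Seq (cmp_ex nd (Suc d) a) (Seq (cmp_ex nd (Suc (Suc d)) b)
 (mul_big nd d (Suc d) (Suc (Suc d))))"
| "cmp_ex nd d (Quo a b) = Seq (cmp_ex nd d a) (Seq (cmp_ex nd (Suc d) b)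
 (Seq (to_word nd (Suc d)) (Seq (copy_reg rX rT) (sdiv nd d))))"
| "cmp_ex nd d (Rem a b) = Seq (cmp_ex nd d a) (Seq (cmp_ex nd (Suc d) b)
 (Seq (to_word nd (Suc d)) (Seq (copy_reg rX rT) (Seq (sdiv nd d) (Seq (copy_reg rT rC) (of_word nd d))))))"
| "cmp_ex nd d (Cell k a) = Seq (cmp_ex nd d a) (Seq (to_word nd d) (Seq (Load rT k rT) (of_word nd d)))"
| "cmp_ex nd d (Pow a) = Seq (cmp_ex nd d a) (Seq (to_word nd d)
 (Seq (Const rX 1) (Seq (Op rT Shl rX rT) (of_word nd d))))"

text \<open>The carry of the subtraction carries the outcome; \<open>rX\<close> is cleared because
  the machine can compare registers only with each other.\<close>

definition cmp_test :: "nat \<Rightarrow> ex \<Rightarrow> ex \<Rightarrow> prog" where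
"cmp_test nd a b = Seq (cmp_ex nd nv a) (Seq (cmp_ex nd (Suc nv) b) (Seq (sub_big nd nv (Suc nv)) (Const rX 0)))"

primrec cmp :: "nat \<Rightarrow> hl \<Rightarrow> prog" where
"cmp nd (Asg x e) = Seq (cmp_ex nd nv e) (mov nd x nv)"
| "cmp nd (Sto k a e) = Seq (cmp_ex nd nv a) (Seq (to_word nd nv) (Seq (copy_reg rA rT)
 (Seq (cmp_ex nd nv e) (Seq (to_word nd nv) (Store k rA rT)))))"
| "cmp nd (Rnd x) = Seq (Rand rT) (of_word nd x)"
| "cmp nd (Sq p q) = Seq (cmp nd p) (cmp nd q)"
| "cmp nd (Iff a b p q) = Seq (cmp_test nd a b) (If (Eq rC rX) (cmp nd p) (cmp nd q))"
| "cmp nd Nop = Skip"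
| "cmp nd (Whl a b p) = Seq (cmp_test nd a b) (While (Eq rC rX) (Seq (cmp nd p) (cmp_test nd a b)))"

primrec hfree :: "hl \<Rightarrow> bool" where
"hfree (Asg x e) = True"
| "hfree (Sto k a e) = True"
| "hfree (Rnd x) = True"
| "hfree (Sq p q) = (hfree p & hfree q)"
| "hfree (Iff a b p q) = (hfree p & hfree q)"
| "hfree Nop = True"
| "hfree (Whl a b p) = False"

lemma no_loop_cmp_ex [simp]: "no_loop (cmp_ex nd d e)"
by (induction e arbitrary: d) auto

lemma no_loop_cmp: "hfree c ==> no_loop (cmp nd c)"
by (induction c) (auto simp: cmp_test_def)

section \<open>Semantics of the language over unbounded numbers, and its agreement with the
  machine\<close>

primrec eval :: "config \<Rightarrow> ex \<Rightarrow> nat" where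
"eval s (Var x) = reg s x"
| "eval s (Num k) = k"
| "eval s (Plus a b) = eval s a + eval s b"
| "eval s (Minus a b) = eval s a - eval s b"
| "eval s (Times a b) = eval s a * eval s b"
| "eval s (Quo a b) = eval s a div eval s b"
| "eval s (Rem a b) = eval s a mod eval s b"
| "eval s (Cell k a) = arr s k ! eval s a"
| "eval s (Pow a) = 2 ^ eval s a"

text \<open>What a variable is changed to, and what a loop does, is given by \<open>ht_Whl\<close> only.\<close>

primrec hval :: "nat \<Rightarrow> hl \<Rightarrow> config \<Rightarrow> config" where
"hval w (Asg x e) s = set_reg x (eval s e) s"
| "hval w (Sto k a e) s = s\<lparr>arr := (arr s)(k := (arr s k)[eval s a := eval s e])\<rparr>"
| "hval w (Rnd x) s = set_reg x (shd (rnd s) mod 2 ^ w) (s\<lparr>rnd := stl (rnd s)\<rparr>)"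
| "hval w (Sq p q) s = hval w q (hval w p s)"
| "hval w (Iff a b p q) s = (if eval s a < eval s b then hval w p s else hval w q s)"
| "hval w Nop s = s"
| "hval w (Whl a b p) s = s"

context machine
begin

text \<open>\<open>B ^ nd\<close> is the capacity of a big number. Truncated subtraction would
  disagree with the machine, so a borrow is excluded; the condition on divisors is the one of
  \<open>sdiv\<close>.\<close>

primrec safe :: "config \<Rightarrow> ex \<Rightarrow> bool" where
"safe s (Var x) = (x < nv)"
| "safe s (Num k) = (k < 2 ^ w)"
| "safe s (Plus a b) = (safe s a & safe s b & eval s a + eval s b < B ^ nd)"
| "safe s (Minus a b) = (safe s a & safe s b & eval s b <= eval s a)"
| "safe s (Times a b) = (safe s a & safe s b & eval s a * eval s b < B ^ nd)"
| "safe s (Quo a b) = (safe s a & safe s b & 0 < eval s b & eval s b * B <= 2 ^ w)"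
| "safe s (Rem a b) = (safe s a & safe s b & 0 < eval s b & eval s b * B <= 2 ^ w)"
| "safe s (Cell k a) = (safe s a & eval s a < length (arr s k) & eval s a < 2 ^ w &
 arr s k ! eval s a < 2 ^ w)"
| "safe s (Pow a) = (safe s a & eval s a < w)"

primrec hok :: "hl \<Rightarrow> config \<Rightarrow> bool" where
"hok (Asg x e) s = (x < nv & safe s e)"
| "hok (Sto k a e) s = (safe s a & safe s e & eval s a < length (arr s k) & eval s a < 2 ^ w &
 eval s e < 2 ^ w)"
| "hok (Rnd x) s = (x < nv)"
| "hok (Sq p q) s = (hok p s & hok q (hval w p s))"
| "hok (Iff a b p q) s = (safe s a & safe s b &
 (if eval s a < eval s b then hok p s else hok q s))"
| "hok Nop s = True"
| "hok (Whl a b p) s = False"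

lemma frame_level:
assumes "\<forall>k<32 + d * nd. k \<notin> {rT, rC, rX} --> f' k = f k" "x < d"
shows "bv f' x = bv f x" "dg f' x = dg f x"
proof -
have "f' (br nd x i) = f (br nd x i)" if "i < nd" for i
 using assms(1) br_less_level[OF assms(2) that] by simp
then show "bv f' x = bv f x" "dg f' x = dg f x"
 by (auto simp: bv_def dg_def intro: val_cong)
qed

lemma frame_ready:
assumes "\<forall>k<32 + d * nd. k \<notin> {rT, rC, rX} --> f' k = f k"
shows "ready f' = ready f"
using assms unfolding ready_def by simp

lemma not_big_low:
"k < 32 + d * nd ==> d <= x ==> k \<notin> {br nd x i |i. i < nd}"
by (auto simp: br_def) (metis add.assoc add_le_mono le_add1 linorder_not_less mult_le_mono1 nat_add_left_cancel_less le_trans)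

text \<open>Everything below level \<open>d\<close> survives except scratch registers, so results of
  earlier subexpressions and all variables are kept.\<close>

definition out :: "nat \<Rightarrow> config \<Rightarrow> nat \<Rightarrow> config \<Rightarrow> bool" where
"out d r v r' \<longleftrightarrow> arr r' = arr r & rnd r' = rnd r &
 (\<forall>k<32 + d * nd. k \<notin> {rT, rC, rX} --> reg r' k = reg r k) & dg (reg r') d & bv (reg r') d = v"

lemma out_arr: "out d r v r' ==> arr r' = arr r"
and out_rnd: "out d r v r' ==> rnd r' = rnd r"
and out_dg: "out d r v r' ==> dg (reg r') d"
and out_bv: "out d r v r' ==> bv (reg r') d = v"
and out_frame: "out d r v r' ==> \<forall>k<32 + d * nd. k \<notin> {rT, rC, rX} --> reg r' k = reg r k"
by (simp_all add: out_def)

lemmas out_ready = frame_ready[OF out_frame]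

lemma le_level: "d <= d' ==> 32 + d * nd <= 32 + d' * nd"
by simp

lemma runs_of_word:
assumes "ready (reg r)" "reg r rT < 2 ^ w"
 and frame: "\<forall>k<32 + d * nd. k \<notin> {rT, rC, rX} --> reg r k = reg r0 k"
 and "arr r = arr r0" "rnd r = rnd r0" "reg r rT = v"
shows "runs w (of_word nd d) r (out d r0 v)"
proof (rule runs_sl, simp)
from of_word[OF assms(1,2), of d] assms(3-) not_big_low[of _ d d]
show "out d r0 v (r\<lparr>reg := sl w (of_word nd d) (reg r)\<rparr>)"
 unfolding out_def Let_def by simp
qed

definition vars_ok :: "config \<Rightarrow> config \<Rightarrow> bool" where
"vars_ok s r \<longleftrightarrow> ready (reg r) & (\<forall>x<nv. dg (reg r) x & bv (reg r) x = reg s x)"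

lemma vars_ok_out: "vars_ok s r ==> out d r v r' ==> nv <= d ==> vars_ok s r'"
unfolding vars_ok_def
by (auto simp: out_ready frame_level[OF out_frame])

lemma vars_ok_cong: "vars_ok s r ==>
 \<forall>k<32 + d * nd. k \<notin> {rT, rC, rX} --> reg r' k = reg r k ==> nv <= d ==> vars_ok s r'"
unfolding vars_ok_def by (auto simp: frame_ready frame_level)

text \<open>The level is arbitrary in the induction: operands occupy successive levels, so
  \<open>frame_level\<close> protects the first while the second is evaluated, and
  \<open>vars_ok\<close> survives because every level in use is at least \<open>nv\<close>.\<close>

lemma runs_cmp_ex:
assumes "safe s e" "vars_ok s r" "arr r = arr s" "nv <= d"
shows "runs w (cmp_ex nd d e) r (out d r (eval s e))"
using assms
proof (induction e arbitrary: d r)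
case (Var x)
have "bv (sl w (mov nd d x) (reg r)) d = bv (reg r) x"
 unfolding bv_def by (rule val_cong) (use mov[of d x "reg r"] in \<open>auto simp: Let_def\<close>)
with Var show ?case
 using mov[of d x "reg r"] not_big_low[of _ d d]
 by (auto intro!: runs_sl simp: out_def Let_def vars_ok_def dg_def)
next
case (Num k)
show ?case unfolding cmp_ex.simps
 by (rule runs_Seq, rule runs_sl, simp, rule runs_of_word)
 (use Num in \<open>auto simp: vars_ok_def ready_def\<close>)
next
case (Plus a b)
show ?case unfolding cmp_ex.simps
proof (rule runs_Seq, rule runs_mono[OF Plus.IH(1)], goal_cases)
 case (5 r1)
 note o1 = this
 have v1: "vars_ok s r1" using vars_ok_out[OF _ o1] Plus.prems by simp
 show ?case
 proof (rule runs_Seq, rule runs_mono[OF Plus.IH(2)], goal_cases)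
 case (5 r2)
 note o2 = this
 from o2 have rd: "ready (reg r2)" using v1 by (simp add: out_ready vars_ok_def)
 have d: "dg (reg r2) d" "bv (reg r2) d = eval s a"
  using frame_level[OF out_frame[OF o2], of d] o1 by (auto simp: out_def)
 have e: "dg (reg r2) (Suc d)" "bv (reg r2) (Suc d) = eval s b"
  using o2 by (auto simp: out_def)
 from add_big[OF _ rd d(1) e(1)] d e Plus.prems have
  "(\<forall>r. r \<notin> {rT, rC, rX} \<union> {br nd d i |i. i < nd} --> sl w (add_big nd d (Suc d)) (reg r2) r = reg r2 r)"
  "dg (sl w (add_big nd d (Suc d)) (reg r2)) d"
  "bv (sl w (add_big nd d (Suc d)) (reg r2)) d = eval s a + eval s b"
  by (simp_all add: Let_def)
 then show ?case
  using o1 o2 not_big_low[of _ d d] by (auto intro!: runs_sl simp: out_def)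
 qed (use Plus.prems v1 o1 in \<open>auto simp: out_def\<close>)
qed (use Plus.prems in auto)
next
case (Minus a b)
show ?case unfolding cmp_ex.simps
proof (rule runs_Seq, rule runs_mono[OF Minus.IH(1)], goal_cases)
 case (5 r1)
 note o1 = this
 have v1: "vars_ok s r1" using vars_ok_out[OF _ o1] Minus.prems by simp
 show ?case
 proof (rule runs_Seq, rule runs_mono[OF Minus.IH(2)], goal_cases)
 case (5 r2)
 note o2 = this
 from o2 have rd: "ready (reg r2)" using v1 by (simp add: out_ready vars_ok_def)
 have d: "dg (reg r2) d" "bv (reg r2) d = eval s a"
  using frame_level[OF out_frame[OF o2], of d] o1 by (auto simp: out_def)
 have e: "dg (reg r2) (Suc d)" "bv (reg r2) (Suc d) = eval s b"
  using o2 by (auto simp: out_def)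
 from sub_big[OF _ rd d(1) e(1)] d e Minus.prems have
  "(\<forall>r. r \<notin> {rT, rC, rX} \<union> {br nd d i |i. i < nd} \<union> {br nd (Suc d) i |i. i < nd} --> sl w (sub_big nd d (Suc d)) (reg r2) r = reg r2 r)"
  "dg (sl w (sub_big nd d (Suc d)) (reg r2)) d"
  "bv (sl w (sub_big nd d (Suc d)) (reg r2)) d = eval s a - eval s b"
  by (simp_all add: Let_def)
 then show ?case
  using o1 o2 not_big_low[of _ d d] not_big_low[of _ d "Suc d"] by (auto intro!: runs_sl simp: out_def)
 qed (use Minus.prems v1 o1 in \<open>auto simp: out_def\<close>)
qed (use Minus.prems in auto)
next
case (Times a b)
show ?case unfolding cmp_ex.simps
proof (rule runs_Seq, rule runs_mono[OF Times.IH(1)], goal_cases)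
 case (5 r1)
 note o1 = this
 have v1: "vars_ok s r1" using vars_ok_out[OF _ o1] Times.prems by simp
 show ?case
 proof (rule runs_Seq, rule runs_mono[OF Times.IH(2)], goal_cases)
 case (5 r2)
 note o2 = this
 from o2 have rd: "ready (reg r2)" using v1 by (simp add: out_ready vars_ok_def)
 have d: "dg (reg r2) (Suc d)" "bv (reg r2) (Suc d) = eval s a"
  using frame_level[OF out_frame[OF o2], of "Suc d"] o1 by (auto simp: out_def)
 have e: "dg (reg r2) (Suc (Suc d))" "bv (reg r2) (Suc (Suc d)) = eval s b"
  using o2 by (auto simp: out_def)
 from mul_big[of d "Suc (Suc d)" "Suc d", OF _ _ rd d(1) e(1)] d e Times.prems have
  "(\<forall>r. r \<notin> {rT, rC, rX} \<union> {br nd d i |i. i < nd} --> sl w (mul_big nd d (Suc d) (Suc (Suc d))) (reg r2) r = reg r2 r)"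
  "dg (sl w (mul_big nd d (Suc d) (Suc (Suc d))) (reg r2)) d"
  "bv (sl w (mul_big nd d (Suc d) (Suc (Suc d))) (reg r2)) d = eval s a * eval s b"
  by (simp_all add: Let_def)
 then show ?case
  using o1 o2 not_big_low[of _ d d] by (auto intro!: runs_sl simp: out_def)
 qed (use Times.prems v1 o1 in \<open>auto simp: out_def\<close>)
qed (use Times.prems in auto)
next
case (Quo a b)
show ?case unfolding cmp_ex.simps
proof (rule runs_Seq, rule runs_mono[OF Quo.IH(1)], goal_cases)
 case (5 r1)
 note o1 = this
 have v1: "vars_ok s r1" using vars_ok_out[OF _ o1] Quo.prems by simp
 show ?case
 proof (rule runs_Seq, rule runs_mono[OF Quo.IH(2)], goal_cases)
 case (5 r2)
 note o2 = this
 from o2 have rd: "ready (reg r2)" using v1 by (simp add: out_ready vars_ok_def)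
 have d: "dg (reg r2) d" "bv (reg r2) d = eval s a"
  using frame_level[OF out_frame[OF o2], of d] o1 by (auto simp: out_def)
 have e: "dg (reg r2) (Suc d)" "bv (reg r2) (Suc d) = eval s b"
  using o2 by (auto simp: out_def)
 have "0 < eval s b" "eval s b * B <= 2 ^ w" using Quo.prems by auto
 moreover have "eval s b * 2 <= eval s b * B" using B_gt1 by (intro mult_le_mono2) simp
 ultimately have bw: "eval s b < 2 ^ w" by linarith
 let ?g = "(reg r2)(rT := eval s b, rX := eval s b)"
 have tw: "sl w (copy_reg rX rT) (sl w (to_word nd (Suc d)) (reg r2)) = ?g"
  using to_word[OF rd e(1)] e(2) bw by (simp add: copy_reg_def)
 have "ready ?g" "dg ?g d" "0 < ?g rX" "?g rX * B <= 2 ^ w" "bv ?g d = eval s a"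
  using rd d Quo.prems by (auto simp: ready_def dg_def bv_def)
 note sd = sdiv[OF this(1-4), unfolded Let_def this(5)]
 define g' where "g' = sl w (sdiv nd d) ?g"
 have g': "\<forall>r. r \<notin> {rT, rC} \<union> {br nd d i |i. i < nd} --> g' r = ?g r"
  "dg g' d" "bv g' d = eval s a div eval s b"
  using sd by (simp_all add: g'_def)
 have fin: "out d r (eval s (Quo a b)) (r2\<lparr>reg := g'\<rparr>)"
  using o1 o2 not_big_low[of _ d d] g' by (simp add: out_def)
 show ?case
  by (rule runs_Seq runs_sl straight_big | simp only: tw)+
  (use fin in \<open>simp add: tw g'_def[symmetric]\<close>)
 qed (use Quo.prems v1 o1 in \<open>auto simp: out_def\<close>)
qed (use Quo.prems in auto)
next
case (Rem a b)
show ?case unfolding cmp_ex.simps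
proof (rule runs_Seq, rule runs_mono[OF Rem.IH(1)], goal_cases)
 case (5 r1)
 note o1 = this
 have v1: "vars_ok s r1" using vars_ok_out[OF _ o1] Rem.prems by simp
 show ?case
 proof (rule runs_Seq, rule runs_mono[OF Rem.IH(2)], goal_cases)
 case (5 r2)
 note o2 = this
 from o2 have rd: "ready (reg r2)" using v1 by (simp add: out_ready vars_ok_def)
 have d: "dg (reg r2) d" "bv (reg r2) d = eval s a"
  using frame_level[OF out_frame[OF o2], of d] o1 by (auto simp: out_def)
 have e: "dg (reg r2) (Suc d)" "bv (reg r2) (Suc d) = eval s b"
  using o2 by (auto simp: out_def)
 have "0 < eval s b" "eval s b * B <= 2 ^ w" using Rem.prems by auto
 moreover have "eval s b * 2 <= eval s b * B" using B_gt1 by (intro mult_le_mono2) simp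
 ultimately have bw: "eval s b < 2 ^ w" by linarith
 let ?g = "(reg r2)(rT := eval s b, rX := eval s b)"
 have tw: "sl w (copy_reg rX rT) (sl w (to_word nd (Suc d)) (reg r2)) = ?g"
  using to_word[OF rd e(1)] e(2) bw by (simp add: copy_reg_def)
 have "ready ?g" "dg ?g d" "0 < ?g rX" "?g rX * B <= 2 ^ w" "bv ?g d = eval s a"
  using rd d Rem.prems by (auto simp: ready_def dg_def bv_def)
 note sd = sdiv[OF this(1-4), unfolded Let_def this(5)]
 define g' where "g' = sl w (sdiv nd d) ?g"
 have g': "\<forall>r. r \<notin> {rT, rC} \<union> {br nd d i |i. i < nd} --> g' r = ?g r"
  "g' rC = eval s a mod eval s b"
  using sd by (simp_all add: g'_def)
 have "eval s a mod eval s b < 2 ^ w" using bw Rem.prems by (auto intro: less_trans[OF mod_less_divisor])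
 moreover have "ready g'" using rd g'(1) by (auto simp: ready_def)
 ultimately have fin: "runs w (of_word nd d) (r2\<lparr>reg := g'(rT := eval s a mod eval s b)\<rparr>) (out d r (eval s (Rem a b)))"
  using o1 o2 not_big_low[of _ d d] g'(1)
  by (intro runs_of_word) (auto simp: out_def ready_def)
 have tw0: "sl w (to_word nd (Suc d)) (reg r2) = (reg r2)(rT := eval s b)"
  using to_word[OF rd e(1)] e(2) bw by simp
 have cp: "sl w (copy_reg i j) f = f(i := f j)" for i j f by (simp add: copy_reg_def)
 show ?case
  by (rule runs_Seq, rule runs_sl, simp, rule runs_Seq, rule runs_sl, simp,
   rule runs_Seq, rule runs_sl, simp, rule runs_Seq, rule runs_sl, simp)
  (use fin in \<open>simp add: tw0 cp g'_def[symmetric] g'(2)\<close>)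
 qed (use Rem.prems v1 o1 in \<open>auto simp: out_def\<close>)
qed (use Rem.prems in auto)
next
case (Cell k a)
show ?case unfolding cmp_ex.simps
proof (rule runs_Seq, rule runs_mono[OF Cell.IH], goal_cases)
 case (5 r1)
 note o1 = this
 have v1: "vars_ok s r1" using vars_ok_out[OF _ o1] Cell.prems by simp
 have tw: "sl w (to_word nd d) (reg r1) = (reg r1)(rT := eval s a)"
 using to_word[of "reg r1" d] o1 v1 Cell.prems by (simp add: out_def vars_ok_def)
 have ready: "ready (reg r1)" using v1 by (simp add: vars_ok_def)
 show ?case
 using o1 Cell.prems
 by - (rule runs_Seq, rule runs_sl, simp, rule runs_Seq, rule runs_Load,
  simp add: tw out_def, rule runs_of_word,
  use o1 Cell.prems ready in \<open>auto simp: tw out_def set_reg_def ready_def\<close>)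
qed (use Cell.prems in auto)
next
case (Pow a)
show ?case unfolding cmp_ex.simps
proof (rule runs_Seq, rule runs_mono[OF Pow.IH], goal_cases)
 case (5 r1)
 note o1 = this
 have v1: "vars_ok s r1" using vars_ok_out[OF _ o1] Pow.prems by simp
 have aw: "eval s a < 2 ^ w" using Pow.prems by (auto intro: less_trans[OF _ less_exp])
 have tw: "sl w (to_word nd d) (reg r1) = (reg r1)(rT := eval s a)"
 using to_word[of "reg r1" d] o1 v1 aw by (simp add: out_def vars_ok_def)
 have p: "(2::nat) ^ eval s a < 2 ^ w" using Pow.prems by simp
 have ready: "ready (reg r1)" using v1 by (simp add: vars_ok_def)
 show ?case
 by (rule runs_Seq, rule runs_sl, simp, rule runs_Seq, rule runs_sl, simp,
  rule runs_Seq, rule runs_sl, simp, rule runs_of_word)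
  (use o1 Pow.prems ready p w_pos in \<open>auto simp: tw out_def ready_def\<close>)
qed (use Pow.prems in auto)
qed

text \<open>\<open>s\<close> is an abstract configuration whose registers hold unbounded numbers,
  \<open>r\<close> the machine configuration that holds their digits.\<close>

definition rep :: "config \<Rightarrow> config \<Rightarrow> bool" where
"rep s r \<longleftrightarrow> vars_ok s r & arr r = arr s & rnd r = rnd s"

lemma rep_frame: "rep s r ==> out d r v r' ==> nv <= d ==> rep s r'"
unfolding rep_def by (auto simp: vars_ok_out out_arr out_rnd)

lemma rep_update:
assumes "rep s r" "x < nv" "arr r' = arr r" "rnd r' = rnd r"
 "dg (reg r') x" "bv (reg r') x = v" "ready (reg r')"
 "!!y i. y < nv ==> y ~= x ==> i < nd ==> reg r' (br nd y i) = reg r (br nd y i)"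
shows "rep (set_reg x v s) r'"
proof -
have "dg (reg r') y & bv (reg r') y = bv (reg r) y" if y: "y < nv" "y ~= x" for y
proof
 show "bv (reg r') y = bv (reg r) y" unfolding bv_def by (rule val_cong) (rule assms(8)[OF y])
 show "dg (reg r') y" using assms(1,8) y unfolding rep_def vars_ok_def dg_def by auto
qed
then show ?thesis using assms unfolding rep_def vars_ok_def set_reg_def by auto
qed

lemma runs_test:
assumes "rep s r" "safe s a" "safe s b"
shows "runs w (cmp_test nd a b) r (%r'. rep s r' & (reg r' rC = reg r' rX \<longleftrightarrow> eval s a < eval s b))"
unfolding cmp_test_def
proof (rule runs_Seq, rule runs_mono[OF runs_cmp_ex[where s = s]], goal_cases)
case (5 r1)
note o1 = this
have v1: "rep s r1" using rep_frame[OF _ o1] assms by simp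
show ?case
proof (rule runs_Seq, rule runs_mono[OF runs_cmp_ex[where s = s]], goal_cases)
 case (5 r2)
 note o2 = this
 have v2: "rep s r2" using rep_frame[OF _ o2] v1 by simp
 from v2 have rd: "ready (reg r2)" by (simp add: rep_def vars_ok_def)
 have d: "dg (reg r2) nv" "bv (reg r2) nv = eval s a"
 using frame_level[OF out_frame[OF o2], of nv] o1 by (auto simp: out_def)
 have e: "dg (reg r2) (Suc nv)" "bv (reg r2) (Suc nv) = eval s b"
 using o2 by (auto simp: out_def)
 define g where "g = sl w (sub_big nd nv 101) (reg r2)"
 from sub_big[OF _ rd d(1) e(1)] d e have
 g1: "(\<forall>r. r \<notin> {rT, rC, rX} \<union> {br nd nv i |i. i < nd} \<union> {br nd (Suc nv) i |i. i < nd} --> g r = reg r2 r)"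
 and g2: "g rC = (if eval s a < eval s b then 0 else 1)"
 by (simp_all add: Let_def g_def)
 have "\<forall>k<32 + nv * nd. k \<notin> {rT, rC, rX} --> (g(rX := 0)) k = reg r2 k"
 using g1 not_big_low[of _ nv nv] not_big_low[of _ nv "Suc nv"] by auto
 then have "rep s (r2\<lparr>reg := g(rX := 0)\<rparr>)"
 using v2 vars_ok_cong[of s r2 nv "r2\<lparr>reg := g(rX := 0)\<rparr>"] by (auto simp: rep_def)
 then show ?case using g2
 by (auto intro!: runs_Seq runs_sl simp: g_def[symmetric] split: if_splits)
qed (use assms v1 in \<open>auto simp: rep_def\<close>)
qed (use assms in \<open>auto simp: rep_def\<close>)

lemma runs_hval:
assumes "hfree c" "hok c s" "rep s r"
shows "runs w (cmp nd c) r (rep (hval w c s))"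
using assms
proof (induction c arbitrary: s r)
case (Asg x e)
show ?case unfolding cmp.simps
proof (rule runs_Seq, rule runs_mono[OF runs_cmp_ex[where s = s]], goal_cases)
 case (5 r1)
 have v1: "rep s r1" using rep_frame[OF _ 5] Asg by simp
 have x: "x < nv" using Asg by simp
 define g where "g = sl w (mov nd x nv) (reg r1)"
 have g: "\<forall>r. r \<notin> {br nd x i |i. i < nd} --> g r = reg r1 r" "\<forall>i<nd. g (br nd x i) = reg r1 (br nd nv i)"
 using mov[of x nv "reg r1"] by (simp_all add: Let_def g_def)
 have "rep (set_reg x (eval s e) s) (r1\<lparr>reg := g\<rparr>)"
 proof (rule rep_update[OF v1 x])
 have "bv g x = bv (reg r1) nv" unfolding bv_def by (rule val_cong) (use g(2) in auto)
 then show "dg (reg (r1\<lparr>reg := g\<rparr>)) x" "bv (reg (r1\<lparr>reg := g\<rparr>)) x = eval s e"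
  using 5 g(2) by (auto simp: out_def dg_def)
 show "ready (reg (r1\<lparr>reg := g\<rparr>))" using v1 g(1) by (auto simp: rep_def vars_ok_def ready_def)
 next
 fix y i assume "y ~= x" "i < nd"
 then have "br nd y i \<notin> {br nd x i |i. i < nd}" by (auto simp: br_inj)
 then show "reg (r1\<lparr>reg := g\<rparr>) (br nd y i) = reg r1 (br nd y i)" using g(1) by simp
 qed auto
 then show ?case by (auto intro!: runs_sl simp: g_def)
qed (use Asg in \<open>auto simp: rep_def\<close>)
next
case (Sto k a e)
show ?case unfolding cmp.simps
proof (rule runs_Seq, rule runs_mono[OF runs_cmp_ex[where s = s]], goal_cases)
 case (5 r1)
 note o1 = this
 have v1: "rep s r1" using rep_frame[OF _ 5] Sto by simp
 have rd: "ready (reg r1)" using v1 by (simp add: rep_def vars_ok_def)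
 have tw: "sl w (to_word nd nv) (reg r1) = (reg r1)(rT := eval s a)"
 using to_word[OF rd, of nv] 5 Sto.prems by (simp add: out_def)
 let ?r = "r1\<lparr>reg := (reg r1)(rT := eval s a, rA := eval s a)\<rparr>"
 have v2: "rep s ?r"
 using v1 by (auto simp: rep_def vars_ok_def ready_def dg_def bv_def)
 have "runs w (cmp_ex nd nv e) ?r
 (%s'. runs w (Seq (to_word nd nv) (Store k rA rT)) s' (rep (hval w (Sto k a e) s)))"
 proof (rule runs_mono[OF runs_cmp_ex[where s = s]], goal_cases)
 case (5 r3)
 have v3: "rep s r3" using rep_frame[OF v2 5] by simp
 have rd3: "ready (reg r3)" using v3 by (simp add: rep_def vars_ok_def)
 have tw3: "sl w (to_word nd nv) (reg r3) = (reg r3)(rT := eval s e)"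
  using to_word[OF rd3, of nv] 5 Sto.prems by (simp add: out_def)
 have A: "reg r3 rA = eval s a" using out_frame[OF 5] by simp
 show ?case
  apply (rule runs_Seq, rule runs_sl, simp, rule runs_Store)
  using v3 A Sto.prems by (auto simp: tw3 rep_def vars_ok_def ready_def dg_def bv_def)
 qed (use Sto v2 in \<open>auto simp: rep_def\<close>)
 then show ?case
 by - (rule runs_Seq, rule runs_sl, simp, rule runs_Seq, rule runs_sl, simp, rule runs_Seq,
  simp add: tw copy_reg_def)
qed (use Sto in \<open>auto simp: rep_def\<close>)
next
case (Rnd x)
let ?v = "shd (rnd r) mod 2 ^ w"
let ?f = "(reg r)(rT := ?v)"
let ?g = "sl w (of_word nd x) ?f"
have x: "x < nv" using Rnd by simp
have rd: "ready ?f" "?f rT < 2 ^ w" using Rnd by (auto simp: rep_def vars_ok_def ready_def)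
from of_word[OF rd, of x, unfolded Let_def] have g: "\<forall>r. r \<notin> {rT} \<union> {br nd x i |i. i < nd} --> ?g r = ?f r"
 "dg ?g x" "bv ?g x = ?v" by simp_all
have 1: "rep (s\<lparr>rnd := stl (rnd s)\<rparr>) (r\<lparr>rnd := stl (rnd r)\<rparr>)"
 using Rnd by (auto simp: rep_def vars_ok_def)
have "rep (hval w (Rnd x) s) (r\<lparr>rnd := stl (rnd r), reg := ?g\<rparr>)"
 unfolding hval.simps
proof (rule rep_update[OF 1 x])
 show "ready (reg (r\<lparr>rnd := stl (rnd r), reg := ?g\<rparr>))"
 using g(1) rd(1) by (auto simp: ready_def)
next
 fix y i assume "y ~= x" "i < nd"
 then have "br nd y i \<notin> {br nd x i |i. i < nd}" by (auto simp: br_inj)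
 then show "reg (r\<lparr>rnd := stl (rnd r), reg := ?g\<rparr>) (br nd y i) =
  reg (r\<lparr>rnd := stl (rnd r)\<rparr>) (br nd y i)" using g(1) by simp
qed (use g Rnd.prems in \<open>auto simp: rep_def\<close>)
then show ?case
 by (auto intro!: runs_Seq runs_Rand runs_sl simp: set_reg_def)
next
case (Sq c1 c2)
then show ?case by (auto intro!: runs_Seq runs_mono[OF Sq.IH(1)])
next
case (Iff a b c1 c2)
show ?case unfolding cmp.simps
 by (rule runs_Seq, rule runs_mono[OF runs_test], use Iff in \<open>auto intro!: runs_If\<close>)
next
case Nop
then show ?case by (auto intro!: runs_sl)
qed simp

text \<open>Quantifying over all \<open>r\<close> keeps the triple independent of scratch registers,
  about which \<open>rep\<close> says nothing. Time is an argument of \<open>Q\<close> because the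
  abstract state does not determine it.\<close>

definition ht :: "hl \<Rightarrow> (nat \<Rightarrow> config \<Rightarrow> bool) \<Rightarrow> config \<Rightarrow> bool" where
"ht c Q s \<longleftrightarrow> (\<forall>r. rep s r --> (\<exists>t r' s'. exec w (cmp nd c) r t r' & rep s' r' & Q t s'))"

lemma ht_hval:
assumes "hfree c" "hok c s" "!!t. t <= steps (cmp nd c) ==> Q t (hval w c s)"
shows "ht c Q s"
unfolding ht_def
proof (intro allI impI)
fix r assume "rep s r"
from runs_hval[OF assms(1,2) this] obtain t r' where
 "exec w (cmp nd c) r t r'" "rep (hval w c s) r'" unfolding runs_def by auto
moreover from exec_le_steps[OF this(1) no_loop_cmp[OF assms(1)]] have "t <= steps (cmp nd c)" .
ultimately show "\<exists>t r' s'. exec w (cmp nd c) r t r' & rep s' r' & Q t s'"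
 using assms(3) by blast
qed

lemma ht_Sq: "ht p (%t s'. ht q (%u. Q (t + u)) s') s ==> ht (Sq p q) Q s"
unfolding ht_def cmp.simps by (meson exec.Seq)

lemma ht_mono: "ht p Q s ==> (!!t s'. Q t s' ==> R t s') ==> ht p R s"
unfolding ht_def by blast

text \<open>The added 2 covers the machine step that branches on the outcome of the test.\<close>

definition cost_test :: "ex \<Rightarrow> ex \<Rightarrow> nat" where
"cost_test a b = steps (cmp_test nd a b) + 2"

lemma ht_Iff:
assumes "safe s a" "safe s b"
 "!!v. v <= cost_test a b ==> ht (if eval s a < eval s b then p else q) (%u. Q (v + u)) s"
shows "ht (Iff a b p q) Q s"
unfolding ht_def
proof (intro allI impI)
fix r assume r: "rep s r"
from runs_test[OF r assms(1,2)] obtain t1 r1 where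
 t1: "exec w (cmp_test nd a b) r t1 r1" "rep s r1" "reg r1 rC = reg r1 rX \<longleftrightarrow> eval s a < eval s b"
 unfolding runs_def by auto
have "t1 <= steps (cmp_test nd a b)"
 by (rule exec_le_steps[OF t1(1)]) (simp add: cmp_test_def)
with assms(3)[of "t1 + 1"] t1(2) obtain u r' s' where
 "exec w (cmp nd (if eval s a < eval s b then p else q)) r1 u r'" "rep s' r'" "Q (t1 + 1 + u) s'"
 unfolding ht_def cost_test_def by fastforce
moreover from this(1) t1(3) have "exec w (If (Eq rC rX) (cmp nd p) (cmp nd q)) r1 (Suc u) r'"
 by (auto intro: exec.IfTrue exec.IfFalse split: if_splits)
from exec.Seq[OF t1(1) this] have "exec w (cmp nd (Iff a b p q)) r (t1 + 1 + u) r'" by simp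
ultimately show "\<exists>t r' s'. exec w (cmp nd (Iff a b p q)) r t r' & rep s' r' & Q t s'"
 by blast
qed

text \<open>\<open>I k t s\<close> combines a measure \<open>k\<close>, the time \<open>t\<close>
  spent so far and the invariant. The duration of a test is known only up to
  \<open>cost_test a b\<close>, so the invariant is demanded for every \<open>v\<close> up to this
  bound. The compiled loop evaluates its test at the end of a round; hence the induction starts with
  the outcome already in \<open>rC\<close>.\<close>

lemma while_loop:
assumes step: "!!k t s. I k t s ==> safe s a & safe s b &
 (eval s a < eval s b --> ht p (%u s'. \<forall>v\<le>cost_test a b. \<exists>k'<k. I k' (t + u + v) s') s) &
 (\<not> eval s a < eval s b --> Q (t + 1) s)"
 and I: "I (k :: nat) t s" "rep s r" "reg r rC = reg r rX \<longleftrightarrow> eval s a < eval s b"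
shows "\<exists>u r' s'. exec w (While (Eq rC rX) (Seq (cmp nd p) (cmp_test nd a b))) r u r' &
 rep s' r' & Q (t + u) s'"
using I
proof (induction k arbitrary: t s r rule: less_induct)
case (less k)
note st = step[OF less.prems(1)]
show ?case
proof (cases "eval s a < eval s b")
 case True
 with st less.prems(2) obtain u1 r1 s1 where
 1: "exec w (cmp nd p) r u1 r1" "rep s1 r1" "\<forall>v\<le>cost_test a b. \<exists>k'<k. I k' (t + u1 + v) s1"
 unfolding ht_def by blast
 \<comment> \<open>Any \<open>v\<close> will do here: only the safety of the test in
   \<open>s1\<close> is extracted, before its true duration is known.\<close>
 from 1(3) obtain k0 t0 where "I k0 t0 s1" by blast
 from step[OF this] have "safe s1 a" "safe s1 b" by auto
 from runs_test[OF 1(2) this] obtain u2 r2 where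
 2: "exec w (cmp_test nd a b) r1 u2 r2" "rep s1 r2" "reg r2 rC = reg r2 rX \<longleftrightarrow> eval s1 a < eval s1 b"
 unfolding runs_def by auto
 have "u2 <= steps (cmp_test nd a b)"
 by (rule exec_le_steps[OF 2(1)]) (simp add: cmp_test_def)
 then have "u2 + 1 <= cost_test a b" by (simp add: cost_test_def)
 with 1(3) obtain k' where "k' < k" "I k' (t + u1 + (u2 + 1)) s1" by blast
 from less.IH[OF this 2(2,3)] obtain u3 r' s' where
 3: "exec w (While (Eq rC rX) (Seq (cmp nd p) (cmp_test nd a b))) r2 u3 r'" "rep s' r'"
 "Q (t + u1 + (u2 + 1) + u3) s'" by blast
 have "exec w (While (Eq rC rX) (Seq (cmp nd p) (cmp_test nd a b))) r (Suc (u1 + u2 + u3)) r'"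
 by (rule exec.WhileTrue[OF _ exec.Seq[OF 1(1) 2(1)] 3(1)]) (use True less.prems(3) in simp)
 with 3(2,3) show ?thesis
 by (intro exI[of _ "Suc (u1 + u2 + u3)"] exI[of _ r'] exI[of _ s']) (simp add: ac_simps)
next
 case False
 with less.prems(3) have "exec w (While (Eq rC rX) (Seq (cmp nd p) (cmp_test nd a b))) r 1 r"
 by (intro exec.WhileFalse) simp
 with False st less.prems(2) show ?thesis by blast
qed
qed

lemma ht_Whl:
assumes step: "!!k t s. I k t s ==> safe s a & safe s b &
 (eval s a < eval s b --> ht p (%u s'. \<forall>v\<le>cost_test a b. \<exists>k'<k. I k' (t + u + v) s') s) &
 (\<not> eval s a < eval s b --> Q (t + 1) s)"
 and I: "!!t. t <= cost_test a b ==> I (k :: nat) t s"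
shows "ht (Whl a b p) Q s"
unfolding ht_def
proof (intro allI impI)
fix r assume r: "rep s r"
from step[OF I[of 0]] have "safe s a" "safe s b" by auto
from runs_test[OF r this] obtain u2 r2 where
 2: "exec w (cmp_test nd a b) r u2 r2" "rep s r2" "reg r2 rC = reg r2 rX \<longleftrightarrow> eval s a < eval s b"
 unfolding runs_def by auto
have "u2 <= steps (cmp_test nd a b)"
 by (rule exec_le_steps[OF 2(1)]) (simp add: cmp_test_def)
then have "I k u2 s" by (intro I) (simp add: cost_test_def)
from while_loop[of I a b p Q, OF step this 2(2,3)] obtain u r' s' where
 "exec w (While (Eq rC rX) (Seq (cmp nd p) (cmp_test nd a b))) r2 u r'" "rep s' r'" "Q (u2 + u) s'"
 by blast
with 2(1) show "\<exists>t r' s'. exec w (cmp nd (Whl a b p)) r t r' & rep s' r' & Q t s'"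
 by (auto intro: exec.Seq)
qed

text \<open>A loop with a fixed time bound \<open>c\<close> per round and at most \<open>k\<close> rounds.\<close>

lemma ht_loop:
assumes step: "!!k s. J k s ==> safe s a & safe s b &
 (eval s a < eval s b --> 0 < k & ht p (%u s'. u <= c & J (k - 1) s') s) &
 (\<not> eval s a < eval s b --> P s)"
 and J: "J k s" and T: "(k + 1) * (c + cost_test a b) + 1 <= T"
shows "ht (Whl a b p) (%t s'. t <= T & P s') s"
proof (rule ht_Whl[where I = "%j t s. J j s & j <= k & t + j * (c + cost_test a b) <= T - 1" and k = k])
fix j t s assume I: "J j s & j <= k & t + j * (c + cost_test a b) <= T - 1"
note st = step[OF conjunct1[OF I]]
have "ht p (%u s'. \<forall>v\<le>cost_test a b. \<exists>k'<j. J k' s' & k' <= k &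
 t + u + v + k' * (c + cost_test a b) <= T - 1) s" if lt: "eval s a < eval s b"
proof -
 from st lt have j: "0 < j" and h: "ht p (%u s'. u <= c & J (j - 1) s') s" by auto
 have "j * (c + cost_test a b) = (c + cost_test a b) + (j - 1) * (c + cost_test a b)"
 using j by (cases j) auto
 with I j show ?thesis
 by (intro ht_mono[OF h] allI impI exI[of _ "j - 1"]) auto
qed
then show "safe s a & safe s b &
 (eval s a < eval s b --> ht p (%u s'. \<forall>v\<le>cost_test a b. \<exists>k'<j. J k' s' & k' <= k &
  t + u + v + k' * (c + cost_test a b) <= T - 1) s) &
 (\<not> eval s a < eval s b --> t + 1 <= T & P s)"
 using st I T by auto
qed (use J T in \<open>auto simp: algebra_simps\<close>)

end

section \<open>Numbers written in a base\<close>

lemma val_eq_sum: "val D n g = (\<Sum>i<n. g i * D ^ i)"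
by (induction n) simp_all

lemma val_div_mod:
assumes "!!i. i < n ==> g i < D" "p <= n"
shows "val D n g div D ^ p = val D (n - p) (%i. g (p + i))" "val D n g mod D ^ p = val D p g"
proof -
have s: "val D n g = val D p g + D ^ p * val D (n - p) (%i. g (p + i))"
 using val_shift[of D p "n - p" g] assms(2) by simp
have l: "val D p g < D ^ p" using assms by (intro val_less) simp
then have "D ^ p ~= 0" by (metis not_less_zero)
show "val D n g div D ^ p = val D (n - p) (%i. g (p + i))" "val D n g mod D ^ p = val D p g"
 unfolding s using l div_mult_self2[OF \<open>D ^ p ~= 0\<close>] by simp_all
qed

lemma val_0: "val D n (%i. 0) = 0"
by (induction n) auto

lemma val_digit:
assumes "!!i. i < n ==> g i < D" "k < n"
shows "val D n g div D ^ k mod D = g k"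
proof -
have "val D n g div D ^ k mod D ^ 1 = val D 1 (%i. g (k + i))"
 by (subst val_div_mod(1), use assms in simp, use assms in simp,
  rule val_div_mod(2)) (use assms in auto)
then show ?thesis by simp
qed

lemma val_digits: "val D n (%i. v div D ^ i mod D) = v mod (D :: nat) ^ n"
proof (induction n)
case (Suc n)
have "v mod (D ^ n * D) = D ^ n * (v div D ^ n mod D) + v mod D ^ n"
 by (rule mod_mult2_eq)
with Suc show ?case by (simp add: ac_simps)
qed simp

lemma val_inj:
assumes "!!i. i < n ==> f i < D" "!!i. i < n ==> g i < D" "val D n f = val D n g" "k < n"
shows "f k = g k"
using val_digit[of n f D k] val_digit[of n g D k] assms by auto

lemma val_pad: "n <= m ==> (!!i. n <= i ==> i < m ==> g i = 0) ==> val D m g = val D n g"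
by (induction m) (auto simp: le_Suc_eq)

section \<open>A text as one number, and its packing into words\<close>

definition tnum :: "nat \<Rightarrow> nat list \<Rightarrow> nat" where
"tnum b xs = val (2 ^ b) (length xs) (%i. xs ! i)"

lemma tnum_less: "(!!x. x \<in> set xs ==> x < 2 ^ b) ==> tnum b xs < 2 ^ (b * length xs)"
unfolding tnum_def power_mult by (rule val_less) simp

lemma tnum_eq_sum: "tnum b xs = (\<Sum>k<length xs. xs ! k * 2 ^ (b * k))"
by (simp add: tnum_def val_eq_sum power_mult)

lemma pack_eq: "pack w b xs =
 map (%a. tnum b xs div (2 ^ w) ^ a mod 2 ^ w) [0..<num_words w (length xs * b)]"
by (simp add: pack_def tnum_eq_sum power_mult)

lemma length_pack [simp]: "length (pack w b xs) = num_words w (length xs * b)"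
by (simp add: pack_def)

lemma nth_pack: "a < num_words w (length xs * b) ==> pack w b xs ! a = tnum b xs div (2 ^ w) ^ a mod 2 ^ w"
by (simp add: pack_eq)

lemma num_words_eq: "1 <= w ==> num_words w k = (k + (w - 1)) div w"
proof -
assume w: "1 <= w"
have "\<lceil>real k / real w\<rceil> = int ((k + (w - 1)) div w)"
proof (rule ceiling_unique)
 define q where "q = (k + (w - 1)) div w"
 have "q * w <= k + (w - 1)" unfolding q_def by simp
 then have "real (q * w) <= real (k + (w - 1))" by (rule of_nat_mono)
 then have "real q * real w - real w < real k" using w by (simp add: of_nat_diff)
 then show "real_of_int (int q) - 1 < real k / real w"
 using w by (simp add: field_simps)
 have "k + (w - 1) < (q + 1) * w" unfolding q_def
 using w by (simp add: dividend_less_div_times)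
 then have "k <= q * w" using w by (simp add: algebra_simps)
 then have "real k <= real (q * w)" by (rule of_nat_mono)
 then show "real k / real w <= real_of_int (int q)"
 using w by (simp add: field_simps)
qed
then show ?thesis by (simp add: num_words_def)
qed

lemma num_words_bounds:
assumes "1 <= w"
shows "k <= num_words w k * w" "num_words w k * w < k + w"
proof -
let ?q = "(k + (w - 1)) div w"
have "?q * w <= k + (w - 1)" by simp
then show "num_words w k * w < k + w" unfolding num_words_eq[OF assms] using assms by linarith
have "k + (w - 1) < (?q + 1) * w" using assms by (simp add: dividend_less_div_times)
then show "k <= num_words w k * w" using assms by (simp add: num_words_eq algebra_simps)
qed

lemma pack_less: "x \<in> set (pack w b xs) ==> x < 2 ^ w"
by (auto simp: pack_eq)

text \<open>The words of the packing are the digits of \<open>tnum b xs\<close> in base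
  \<open>2 ^ w\<close>. So the packed array, read with word-sized characters, is the same number,
  and all later arithmetic refers to this number.\<close>

lemma tnum_pack:
assumes "1 <= w" "!!x. x \<in> set xs ==> x < 2 ^ b"
shows "tnum w (pack w b xs) = tnum b xs"
proof -
let ?N = "num_words w (length xs * b)"
have "tnum w (pack w b xs) = val (2 ^ w) ?N (%i. tnum b xs div (2 ^ w) ^ i mod 2 ^ w)"
 unfolding tnum_def[of w] by (auto intro!: val_cong simp: nth_pack)
also have "\<dots> = tnum b xs mod (2 ^ w) ^ ?N" by (rule val_digits)
also have "\<dots> = tnum b xs"
proof (rule mod_less)
 have "tnum b xs < 2 ^ (b * length xs)" using assms(2) by (rule tnum_less)
 also have "(2::nat) ^ (b * length xs) <= 2 ^ (w * ?N)"
 using num_words_bounds(1)[OF assms(1), of "length xs * b"] by (intro power_increasing) (auto simp: ac_simps)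
 finally show "tnum b xs < (2 ^ w) ^ ?N" by (simp add: power_mult)
qed
finally show ?thesis .
qed

text \<open>The first character is least significant, so a suffix is a quotient by a power of two
  and a substring a remainder of such a quotient.\<close>

lemma tnum_take_drop:
assumes "!!x. x \<in> set T ==> x < 2 ^ b" "i + m <= length T"
shows "tnum b T div 2 ^ (b * i) mod 2 ^ (b * m) = tnum b (take m (drop i T))"
proof -
have "tnum b T div (2 ^ b) ^ i mod (2 ^ b) ^ m = val (2 ^ b) m (%k. T ! (i + k))"
 unfolding tnum_def
 by (subst val_div_mod(1), use assms in \<open>auto intro!: val_div_mod(2)\<close>)
also have "\<dots> = tnum b (take m (drop i T))"
 using assms(2) unfolding tnum_def by (auto intro!: val_cong)
finally show ?thesis by (simp add: power_mult)
qed

lemma tnum_inj: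
assumes "length xs = length ys" "!!x. x \<in> set xs ==> x < 2 ^ b" "!!x. x \<in> set ys ==> x < 2 ^ b"
 "tnum b xs = tnum b ys"
shows "xs = ys"
proof (rule nth_equalityI)
fix i assume "i < length xs"
then show "xs ! i = ys ! i"
 using assms unfolding tnum_def by (intro val_inj[of "length xs" "(!) xs" "2 ^ b" "(!) ys"]) auto
qed fact

section \<open>Longest common extensions\<close>

lemma take_lce:
"take (lce T i j) (drop i T) = take (lce T i j) (drop j T)"
"lce T i j <= length T - i" "lce T i j <= length T - j"
proof -
let ?p = "longest_common_prefix (drop i T) (drop j T)"
have p: "prefix ?p (drop i T)" "prefix ?p (drop j T)"
 by (rule longest_common_prefix_prefix1 longest_common_prefix_prefix2)+
from p show "take (lce T i j) (drop i T) = take (lce T i j) (drop j T)"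
 unfolding lce_def by (metis append_eq_conv_conj prefix_def)
from p show "lce T i j <= length T - i" "lce T i j <= length T - j"
 unfolding lce_def by (metis prefix_length_le length_drop)+
qed

lemma lce_ge:
assumes "take k (drop i T) = take k (drop j T)" "k <= length T - i" "k <= length T - j"
shows "k <= lce T i j"
proof -
have "prefix (take k (drop i T)) (longest_common_prefix (drop i T) (drop j T))"
 by (rule longest_common_prefix_max_prefix) (simp add: take_is_prefix, simp add: assms(1) take_is_prefix)
then have "length (take k (drop i T)) <= lce T i j" unfolding lce_def by (rule prefix_length_le)
with assms(2) show ?thesis by simp
qed

lemma lce_iff:
assumes "i + k <= length T" "j + k <= length T"
shows "k <= lce T i j \<longleftrightarrow> take k (drop i T) = take k (drop j T)"
proof
assume k: "k <= lce T i j"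
have "take k (take (lce T i j) (drop i T)) = take k (take (lce T i j) (drop j T))"
 using take_lce(1)[of T i j] by simp
with k show "take k (drop i T) = take k (drop j T)" by (simp add: min_absorb1)
qed (use assms lce_ge in auto)

text \<open>The reason why both search phases may compare only the next \<open>d\<close>
  characters.\<close>

lemma lce_extend:
assumes "i + (l + d) <= length T" "j + (l + d) <= length T" "l <= lce T i j"
shows "l + d <= lce T i j \<longleftrightarrow> take d (drop (i + l) T) = take d (drop (j + l) T)"
proof -
have "take l (drop i T) = take l (drop j T)" using assms by (subst lce_iff[symmetric]) auto
moreover have "take (l + d) (drop k T) = take l (drop k T) @ take d (drop (k + l) T)" for k
 by (subst take_add) (simp add: add.commute)
ultimately show ?thesis using assms(1,2) by (subst lce_iff) auto
qed

lemma lce_bound: "i <= length T ==> j <= length T ==> lce T i j <= length T - max i j"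
using take_lce(2,3)[of T i j] by auto

lemma lce_refl: "lce T i i = length T - i"
using take_lce(2)[of T i i] lce_ge[of "length T - i" i T i] by simp

section \<open>Arithmetic of the encoding\<close>

text \<open>Barrett reduction, with \<open>S div M\<close> in the role of the reciprocal. Rounding
  it costs less than \<open>V / S < 1\<close> in the quotient, and rounding the product again less
  than 1; so the estimate is at most 1 too small and one conditional subtraction finishes the
  reduction.\<close>

lemma barrett:
assumes "0 < M" "V < (S :: nat)"
shows "V * (S div M) div S * M <= V" "V < V * (S div M) div S * M + 2 * M"
proof -
define u q where "u = S div M" and "q = V * u div S"
have S: "0 < S" using assms by simp
have uM: "u * M <= S" "S < (u + 1) * M" unfolding u_def
 using assms(1) by (simp_all add: dividend_less_div_times)
have q: "q * S <= V * u" "V * u < (q + 1) * S" unfolding q_def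
 using S by (simp_all add: dividend_less_div_times)
have "q * M * S <= V * (u * M)" using mult_le_mono1[OF q(1), of M] by (simp add: ac_simps)
also have "\<dots> <= V * S" using uM(1) by simp
finally show "V * (S div M) div S * M <= V" using S unfolding q_def u_def by simp
have "V * S <= V * ((u + 1) * M)" using uM(2) by (intro mult_le_mono2) simp
also have "\<dots> = V * u * M + V * M" by (simp add: algebra_simps)
also have "\<dots> < (q + 1) * S * M + S * M"
proof (rule add_le_less_mono)
 show "V * u * M <= (q + 1) * S * M" using q(2) by (intro mult_le_mono1) simp
 show "V * M < S * M" using assms by simp
qed
also have "\<dots> = (q * M + 2 * M) * S" by (simp add: algebra_simps)
finally show "V < V * (S div M) div S * M + 2 * M" using S unfolding q_def u_def by simp
qed

text \<open>
Blocks outside the window \<open>{J..<J + e}\<close> are shifted to a range whose length is a multiple of the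
modulus; there the remainder of a block can be exchanged for a fingerprint.
\<close>

definition enc :: "nat \<Rightarrow> nat \<Rightarrow> nat \<Rightarrow> nat \<Rightarrow> nat \<Rightarrow> nat" where
"enc M J e x y = (let x' = (if x < J then x else x - e) in x' - x' mod M + y)"

locale window =
fixes M R J e j :: nat
assumes M: "0 < M" and e: "e = R mod M" and J: "J = j * M" and JR: "J + e <= R"
begin

lemma JR': "J <= R div M * M"
proof -
have "R = R div M * M + e" by (simp add: e)
then have "j * M <= R div M * M" using JR J by linarith
then show ?thesis by (simp add: J)
qed

text \<open>After the cut, \<open>x'\<close> ranges below a multiple of \<open>M\<close>, so
  exchanging its residue cannot leave the range. As \<open>J\<close> is a multiple of
  \<open>M\<close> too, the exchange cannot cross \<open>J\<close>, and a decoder still sees on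
  which side of the window \<open>x\<close> was. Beyond the window the residue in question is that
  of \<open>x - e\<close>, hence the summand \<open>M - e\<close>.\<close>

lemma enc:
assumes "x < R" "\<not> (J <= x & x < J + e)" "y < M"
shows "enc M J e x y < R" "enc M J e x y mod M = y" "enc M J e x y < J \<longleftrightarrow> x < J"
 "y <= enc M J e x y"
 "x = enc M J e x y - y + (x + (if x < J then 0 else M - e)) mod M + (if x < J then 0 else e)"
proof -
define x' where "x' = (if x < J then x else x - e)"
define d where "d = x' div M"
have R: "R = R div M * M + e" by (simp add: e)
have eM: "e < M" using M by (simp add: e)
have x': "x' < R div M * M"
proof (cases "x < J")
 case True
 then show ?thesis using JR' by (simp add: x'_def)
next
 case False
 then show ?thesis using assms(1,2) R by (simp add: x'_def)
qed
have dk: "d < R div M" using x' unfolding d_def by (simp add: less_mult_imp_div_less)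
have xd: "x' - x' mod M = d * M" by (simp add: d_def minus_mod_eq_div_mult)
have z: "enc M J e x y = d * M + y" by (simp only: enc_def Let_def x'_def[symmetric] xd)
have "d * M + y < (d + 1) * M" using assms(3) by simp
also have "\<dots> <= R div M * M" using dk by (intro mult_le_mono1) simp
also have "\<dots> <= R" by simp
finally show "enc M J e x y < R" by (simp add: z)
show "enc M J e x y mod M = y" using assms(3) by (simp add: z)
have "d * M + y < j * M \<longleftrightarrow> d < j"
proof
 assume "d < j"
 then have "(d + 1) * M <= j * M" by (intro mult_le_mono1) simp
 with assms(3) show "d * M + y < j * M" by simp
qed (metis add_lessD1 mult_less_cancel2)
moreover have "d < j \<longleftrightarrow> x' < J" unfolding d_def J using M by (simp add: div_less_iff_less_mult)
moreover have "x' < J \<longleftrightarrow> x < J" using assms(2) by (auto simp: x'_def)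
ultimately show zJ: "enc M J e x y < J \<longleftrightarrow> x < J" unfolding z by (simp add: J)
show "y <= enc M J e x y" by (simp add: z)
have x'M: "x' = d * M + x' mod M" by (simp add: d_def)
show "x = enc M J e x y - y + (x + (if x < J then 0 else M - e)) mod M + (if x < J then 0 else e)"
proof (cases "x < J")
 case True
 then have "x = d * M + x mod M" using x'M unfolding x'_def by simp
 then show ?thesis unfolding z by (simp only: True if_True add_diff_cancel_right' add_0_right)
next
 case False
 then have "e <= x" using assms(2) by linarith
 then have "x + (M - e) = x - e + M" using eM by linarith
 then have eq: "(x + (M - e)) mod M = (x - e) mod M" by (simp only: mod_add_self2)
 have "x - e = d * M + (x - e) mod M" using x'M False unfolding x'_def by (simp only: if_False)
 with \<open>e <= x\<close> have "x = d * M + (x - e) mod M + e" by linarith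
 then show ?thesis unfolding z by (simp only: False if_False eq add_diff_cancel_right')
qed
qed

end

text \<open>\<open>M - r mod M\<close> plays the role of minus \<open>r\<close>, which avoids
  subtraction below zero. The summand \<open>a\<close> will be the shift of blocks beyond the
  window.\<close>

lemma mod_from_sum:
assumes "0 < M" "y = (x + r) mod (M :: nat)"
shows "(y + (M - r mod M) + a) mod M = (x + a) mod M"
proof -
define k m where "k = r div M" and "m = r mod M"
have r: "r = k * M + m" by (simp add: k_def m_def)
have m: "m < M" using assms(1) by (simp add: m_def)
have "(y + c) mod M = (x + r + c) mod M" for c
 unfolding assms(2) by (rule mod_add_left_eq)
from this[of "M - m + a"] have "(y + (M - m) + a) mod M = (x + r + (M - m + a)) mod M"
 by (simp only: add.assoc)
also have "x + r + (M - m + a) = (x + a) + (k + 1) * M"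
 using m by (simp add: r)
also have "\<dots> mod M = (x + a) mod M" by (rule mod_mult_self1)
finally show ?thesis unfolding m_def .
qed

text \<open>The fingerprint at an unaligned position from that of the next block boundary.\<close>

lemma suffix_fingerprint:
fixes X R M :: nat
assumes "R = 2 ^ L" "off <= L"
shows "(X mod R + R * (X div R mod M)) div 2 ^ off mod M = X div 2 ^ off mod M"
proof -
define q y B C where "q = X div R div M" and "y = X div R mod M" and "B = X mod R"
 and "C = (2::nat) ^ (L - off)"
have R: "R = 2 ^ off * C" using assms by (simp add: C_def flip: power_add)
have XR: "X div R = M * q + y" by (simp add: q_def y_def)
have "X = X mod R + R * (X div R)" by (rule mod_mult_div_eq[symmetric])
then have "X = B + 2 ^ off * C * (M * q + y)" by (simp only: XR B_def[symmetric] R[symmetric])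
also have "B + 2 ^ off * C * (M * q + y) = (B + R * y) + 2 ^ off * (M * (C * q))"
 unfolding R by (simp add: algebra_simps)
finally have "X = (B + R * y) + 2 ^ off * (M * (C * q))" .
then have "X div 2 ^ off = ((B + R * y) + 2 ^ off * (M * (C * q))) div 2 ^ off"
 by (rule arg_cong)
also have "\<dots> = (B + R * y) div 2 ^ off + M * (C * q)"
 by (subst div_mult_self2) auto
finally show ?thesis by (simp add: B_def y_def)
qed

lemma nat_mod_eq_dvd_diff:
fixes u v M :: nat
shows "u mod M = v mod M \<longleftrightarrow> M dvd (if u <= v then v - u else u - v)"
proof (cases "u <= v")
case True
then have "v mod M = u mod M \<longleftrightarrow> M dvd v - u" by (rule mod_eq_dvd_iff_nat)
with True show ?thesis by (simp only: if_True eq_commute[of "u mod M"])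
next
case False
then have "u mod M = v mod M \<longleftrightarrow> M dvd u - v" by (intro mod_eq_dvd_iff_nat) simp
with False show ?thesis by (simp only: if_False)
qed

text \<open>\<open>X1\<close> and \<open>X2\<close> are suffixes, \<open>Y1\<close> and
  \<open>Y2\<close> their lowest \<open>d\<close> bits. Adding to each suffix the shifted rest of
  the other one turns the sides into \<open>Y1 + P * (a + b)\<close> and
  \<open>Y2 + P * (a + b)\<close>, so substrings are compared without computing the fingerprint of
  either.\<close>

lemma fingerprint_test:
fixes X M d :: nat
assumes "Y1 = X1 mod 2 ^ d" "Y2 = X2 mod 2 ^ d"
shows "(X1 mod M + (2 ^ d mod M) * (X2 div 2 ^ d mod M)) mod M =
 (X2 mod M + (2 ^ d mod M) * (X1 div 2 ^ d mod M)) mod M \<longleftrightarrow> Y1 mod M = Y2 mod M"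
proof -
define P where "P = (2::nat) ^ d"
define a b where "a = X1 div P" and "b = X2 div P"
have X: "X1 = Y1 + P * a" "X2 = Y2 + P * b" using assms by (simp_all add: P_def a_def b_def)
have 1: "(X1 mod M + (P mod M) * (b mod M)) mod M = (Y1 + (P * a + P * b)) mod M"
proof -
 have "(X1 mod M + (P mod M) * (b mod M)) mod M = (X1 + P * b) mod M"
 by (rule mod_add_cong[OF mod_mod_trivial mod_mult_eq])
 then show ?thesis by (simp only: X(1) add.assoc)
qed
have 2: "(X2 mod M + (P mod M) * (a mod M)) mod M = (Y2 + (P * a + P * b)) mod M"
proof -
 have "(X2 mod M + (P mod M) * (a mod M)) mod M = (X2 + P * a) mod M"
 by (rule mod_add_cong[OF mod_mod_trivial mod_mult_eq])
 then show ?thesis by (simp only: X(2) ac_simps)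
qed
have "(Y1 + c) mod M = (Y2 + c) mod M \<longleftrightarrow> Y1 mod M = Y2 mod M" for c
 unfolding nat_mod_eq_dvd_diff by simp
then show ?thesis unfolding P_def[symmetric] a_def[symmetric] b_def[symmetric] 1 2 .
qed

section \<open>Verification conditions for loop-free code\<close>

text \<open>Footprints are read off the syntax; \<open>hs_call\<close> turns them into a frame rule,
  so that specifications mention results only. Loops are kept out by \<open>hfree\<close>.\<close>

primrec writes :: "hl \<Rightarrow> nat set" where
"writes (Asg x e) = {x}"
| "writes (Sto k a e) = {}"
| "writes (Rnd x) = {x}"
| "writes (Sq p q) = writes p \<union> writes q"
| "writes (Iff a b p q) = writes p \<union> writes q"
| "writes Nop = {}"
| "writes (Whl a b p) = {}"

primrec stores :: "hl \<Rightarrow> array set" where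
"stores (Asg x e) = {}"
| "stores (Sto k a e) = {k}"
| "stores (Rnd x) = {}"
| "stores (Sq p q) = stores p \<union> stores q"
| "stores (Iff a b p q) = stores p \<union> stores q"
| "stores Nop = {}"
| "stores (Whl a b p) = {}"

primrec random :: "hl \<Rightarrow> bool" where
"random (Asg x e) = False"
| "random (Sto k a e) = False"
| "random (Rnd x) = True"
| "random (Sq p q) = (random p \<or> random q)"
| "random (Iff a b p q) = (random p \<or> random q)"
| "random Nop = False"
| "random (Whl a b p) = False"

lemma reg_set_reg [simp]: "reg (set_reg r v s) = (reg s)(r := v)"
and arr_set_reg [simp]: "arr (set_reg r v s) = arr s"
and rnd_set_reg' [simp]: "rnd (set_reg r v s) = rnd s"
by (simp_all add: set_reg_def)

lemma writes: "x \<notin> writes c ==> reg (hval w c s) x = reg s x"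
by (induction c arbitrary: s) auto

lemma stores: "k \<notin> stores c ==> arr (hval w c s) k = arr s k"
by (induction c arbitrary: s) auto

lemma random: "\<not> random c ==> rnd (hval w c s) = rnd s"
by (induction c arbitrary: s) auto

lemma length_arr: "length (arr (hval w c s) k) = length (arr s k)"
by (induction c arbitrary: s) auto

primrec hrep :: "nat \<Rightarrow> hl \<Rightarrow> hl" where
"hrep 0 c = Nop"
| "hrep (Suc n) c = Sq (hrep n c) c"

lemma writes_hrep: "writes (hrep n c) \<subseteq> writes c"
and stores_hrep: "stores (hrep n c) \<subseteq> stores c"
and random_hrep: "random (hrep n c) ==> random c"
and hfree_hrep: "hfree c ==> hfree (hrep n c)"
by (induction n) auto

context machine
begin

text \<open>Since \<open>hval\<close> is a function, a triple for loop-free code is a statement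
  about one final state; the time is added later by \<open>ht_hs\<close>.\<close>

definition hs :: "hl \<Rightarrow> config \<Rightarrow> (config \<Rightarrow> bool) \<Rightarrow> bool" where
"hs c s Q \<longleftrightarrow> hfree c & hok c s & Q (hval w c s)"

lemma hs_Sq: "hs p s (%s'. hs q s' Q) ==> hs (Sq p q) s Q"
by (simp add: hs_def)

lemma hs_Asg: "x < nv ==> safe s e ==> Q (set_reg x (eval s e) s) ==> hs (Asg x e) s Q"
by (simp add: hs_def)

lemma hs_Asg_Sq: "x < nv ==> safe s e ==> hs q (set_reg x (eval s e) s) Q ==> hs (Sq (Asg x e) q) s Q"
by (simp add: hs_def)

lemma hs_Rnd: "x < nv ==> Q (set_reg x (shd (rnd s) mod 2 ^ w) (s\<lparr>rnd := stl (rnd s)\<rparr>)) ==> hs (Rnd x) s Q"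
by (simp add: hs_def)

lemma hs_Sto: "safe s a ==> safe s e ==> eval s a < length (arr s k) ==> eval s a < 2 ^ w ==>
 eval s e < 2 ^ w ==> Q (s\<lparr>arr := (arr s)(k := (arr s k)[eval s a := eval s e])\<rparr>) ==>
 hs (Sto k a e) s Q"
by (simp add: hs_def)

lemma hs_Nop: "Q s ==> hs Nop s Q"
by (simp add: hs_def)

lemma hs_Iff: "safe s a ==> safe s b ==> hfree p ==> hfree q ==>
 (eval s a < eval s b ==> hs p s Q) ==> (\<not> eval s a < eval s b ==> hs q s Q) ==> hs (Iff a b p q) s Q"
by (auto simp: hs_def)

lemma hs_call:
assumes "hs c s P"
 "!!s'. P s' ==> (!!x. x \<notin> writes c ==> reg s' x = reg s x) ==>
 (!!k. k \<notin> stores c ==> arr s' k = arr s k) ==> (\<not> random c ==> rnd s' = rnd s) ==>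
 (!!k. length (arr s' k) = length (arr s k)) ==> Q s'"
shows "hs c s Q"
using assms unfolding hs_def by (auto simp: writes stores random length_arr)

lemma hs_mono: "hs c s P ==> (!!s'. P s' ==> Q s') ==> hs c s Q"
by (auto simp: hs_def)

lemma hs_hrep:
assumes "hfree c" "!!k s. k < n ==> I k s ==> hs c s (I (Suc k))" "I 0 s"
shows "hs (hrep n c) s (I n)"
proof -
have "m <= n ==> hs (hrep m c) s (I m)" for m
proof (induction m)
 case 0 then show ?case using assms by (simp add: hs_Nop)
next
 case (Suc m)
 then show ?case using assms(2) by (auto intro!: hs_Sq hs_mono[OF Suc.IH])
qed
then show ?thesis by simp
qed

lemma ht_hs: "hs c s P ==> (!!t s'. t <= steps (cmp nd c) ==> P s' ==> Q t s') ==> ht c Q s"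
unfolding hs_def by (blast intro: ht_hval)

end

section \<open>Building blocks of the data structure\<close>

text \<open>Arguments arrive as pairs of a low and a high word in variables 0 to 11:
  \<open>n\<close>, \<open>\<sigma>\<close>, character width, word size, then the two arguments of a
  query. Width and word size fit into the low word.\<close>

abbreviation "vb \<equiv> 4 :: nat"
abbreviation "vw \<equiv> 6 :: nat"
abbreviation "vW \<equiv> 20 :: nat"
abbreviation "vW1 \<equiv> 21 :: nat"
abbreviation "vW2 \<equiv> 22 :: nat"
abbreviation "vh \<equiv> 23 :: nat"
abbreviation "vH \<equiv> 24 :: nat"
abbreviation "vn \<equiv> 25 :: nat"
abbreviation "vL \<equiv> 26 :: nat"
abbreviation "vR \<equiv> 27 :: nat"
abbreviation "vM \<equiv> 28 :: nat"
abbreviation "vU \<equiv> 29 :: nat"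
abbreviation "vJ \<equiv> 30 :: nat"
abbreviation "vE \<equiv> 31 :: nat"
abbreviation "vRem \<equiv> 32 :: nat"
abbreviation "vY \<equiv> 33 :: nat"
abbreviation "vN \<equiv> 34 :: nat"
abbreviation "vF \<equiv> 35 :: nat"

text \<open>\<open>2 ^ w\<close> leaves no room for a digit and is not an admissible divisor; its
  two halves are.\<close>

definition div_W :: "ex \<Rightarrow> ex" where
"div_W e = Quo (Quo e (Var vW1)) (Var vW2)"

primrec wpow :: "nat \<Rightarrow> ex" where
"wpow 0 = Num 1"
| "wpow (Suc u) = Times (wpow u) (Var vW)"

primrec cells :: "array \<Rightarrow> ex \<Rightarrow> nat \<Rightarrow> ex" where
"cells k a 0 = Num 0"
| "cells k a (Suc u) = Plus (cells k a u) (Times (Cell k (Plus a (Num u))) (wpow u))"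

text \<open>The range \<open>W ^ (5 * K)\<close> is dictated by numbers of the form
  \<open>a + R * y\<close>: a block takes \<open>3 * K\<close> words and a residue
  \<open>2 * K\<close>.\<close>

definition reduce :: "nat \<Rightarrow> nat \<Rightarrow> hl" where
"reduce K x = Sq (Asg 40 ((div_W ^^ (5 * K)) (Times (Var x) (Var vU))))
 (Sq (Asg x (Minus (Var x) (Times (Var 40) (Var vM))))
 (Iff (Var x) (Var vM) Nop (Asg x (Minus (Var x) (Var vM)))))"

text \<open>A long shift cannot be one division, so whole digits are removed first. The fixed number
  \<open>12 * K\<close> of attempts keeps the code loop-free; attempts beyond the last whole digit
  do nothing.\<close>

definition shr :: "nat \<Rightarrow> nat \<Rightarrow> nat \<Rightarrow> hl" where
"shr K x y = Sq (hrep (12 * K) (Iff (Var y) (Var vh) Nop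
 (Sq (Asg x (Quo (Var x) (Var vH))) (Asg y (Minus (Var y) (Var vh))))))
 (Asg x (Quo (Var x) (Pow (Var y))))"

definition block_ex :: "nat \<Rightarrow> ex \<Rightarrow> ex" where
"block_ex K t = cells 0 (Times t (Num (3 * K))) (3 * K)"

text \<open>For the block number in variable 41, the original block goes to 43 and the fingerprint
  of the suffix behind it to 44. The latter is the remainder of the next encoded block, or
  \<open>vY\<close> if the incomplete last block follows.\<close>

definition get_block :: "nat \<Rightarrow> hl" where
"get_block K = Iff (Var 41) (Var vF)
 (Sq (Asg 43 (block_ex K (Var 41)))
 (Sq (Iff (Plus (Var 41) (Num 1)) (Var vF)
  (Sq (Asg 44 (block_ex K (Plus (Var 41) (Num 1)))) (reduce K 44)) (Asg 44 (Var vY)))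
 (Sq (Asg 45 (Var 43)) (Sq (reduce K 45)
 (Sq (Asg 46 (Times (Var vR) (Var 44))) (Sq (reduce K 46)
 (Sq (Iff (Var 43) (Var vJ) (Sq (Asg 47 (Num 0)) (Asg 48 (Num 0)))
  (Sq (Asg 47 (Minus (Var vM) (Var vE))) (Asg 48 (Var vE))))
 (Sq (Asg 47 (Plus (Plus (Var 45) (Minus (Var vM) (Var 46))) (Var 47)))
 (Sq (reduce K 47)
 (Asg 43 (Plus (Plus (Minus (Var 43) (Var 45)) (Var 47)) (Var 48))))))))))))
 (Sq (Iff (Var vF) (Var 41) (Asg 43 (Num 0)) (Asg 43 (Var vRem))) (Asg 44 (Num 0)))"

definition locate :: hl where
"locate = Sq (Asg 41 (Quo (Var 49) (Var vL))) (Asg 51 (Minus (Var 49) (Times (Var 41) (Var vL))))"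

definition fingerprint :: "nat \<Rightarrow> hl" where
"fingerprint K = Sq locate (Sq (get_block K)
 (Sq (Asg 50 (Plus (Var 43) (Times (Var vR) (Var 44)))) (Sq (shr K 50 51) (reduce K 50))))"

text \<open>A word that starts inside a block may run into the next one, so two blocks are
  decoded.\<close>

definition text_word :: "nat \<Rightarrow> hl" where
"text_word K = Sq locate (Sq (get_block K) (Sq (Asg 52 (Var 43))
 (Sq (Asg 41 (Plus (Var 41) (Num 1))) (Sq (get_block K)
 (Sq (Asg 50 (Plus (Var 52) (Times (Var vR) (Var 43)))) (Sq (shr K 50 51)
 (Asg 50 (Minus (Var 50) (Times (div_W (Var 50)) (Var vW))))))))))"

lemma writes_shr: "writes (shr K x y) \<subseteq> {x, y}"
using writes_hrep[of "12 * K" "Iff (Var y) (Var vh) Nop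
 (Sq (Asg x (Quo (Var x) (Var vH))) (Asg y (Minus (Var y) (Var vh))))"]
by (auto simp: shr_def)

lemma writes_reduce [simp]: "writes (reduce K x) = {40, x}"
by (auto simp: reduce_def)

lemma writes_get_block [simp]: "writes (get_block K) = {40, 43, 44, 45, 46, 47, 48}"
by (auto simp: get_block_def)

lemma writes_locate [simp]: "writes locate = {41, 51}"
by (auto simp: locate_def)

lemma writes_fingerprint: "writes (fingerprint K) \<subseteq> {40, 41, 43, 44, 45, 46, 47, 48, 50, 51}"
using writes_shr[of K 50 51] by (auto simp: fingerprint_def)

lemma writes_text_word: "writes (text_word K) \<subseteq> {40, 41, 43, 44, 45, 46, 47, 48, 50, 51, 52}"
using writes_shr[of K 50 51] by (auto simp: text_word_def)

lemma stores_shr [simp]: "stores (shr K x y) = {}"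
using stores_hrep[of "12 * K" "Iff (Var y) (Var vh) Nop
 (Sq (Asg x (Quo (Var x) (Var vH))) (Asg y (Minus (Var y) (Var vh))))"]
by (auto simp: shr_def)

lemma stores_blocks [simp]:
"stores (reduce K x) = {}" "stores (get_block K) = {}" "stores locate = {}"
"stores (fingerprint K) = {}" "stores (text_word K) = {}"
by (auto simp: reduce_def get_block_def locate_def fingerprint_def text_word_def)

lemma random_shr [simp]: "\<not> random (shr K x y)"
using random_hrep[of "12 * K" "Iff (Var y) (Var vh) Nop
 (Sq (Asg x (Quo (Var x) (Var vH))) (Asg y (Minus (Var y) (Var vh))))"]
by (auto simp: shr_def)

lemma random_blocks [simp]:
"\<not> random (reduce K x)" "\<not> random (get_block K)" "\<not> random locate"
"\<not> random (fingerprint K)" "\<not> random (text_word K)"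
by (auto simp: reduce_def get_block_def locate_def fingerprint_def text_word_def)

lemma hfree_shr [simp]: "hfree (shr K x y)"
by (simp add: shr_def hfree_hrep)

lemma hfree_blocks [simp]:
"hfree (reduce K x)" "hfree (get_block K)" "hfree locate"
"hfree (fingerprint K)" "hfree (text_word K)"
by (auto simp: reduce_def get_block_def locate_def fingerprint_def text_word_def)

text \<open>\<open>48 * K\<close> digits hold \<open>12 * K\<close> words of at most four digits
  each, enough for the Barrett product of \<open>10 * K + 1\<close> words. The condition
  \<open>big\<close> holds for all large \<open>w\<close>; it makes numbers such as
  \<open>3 * K * w\<close> admissible as divisors.\<close>

locale word_sizes =
fixes w K nd h :: nat
assumes K1: "1 <= K" and w6: "6 <= w" and nd: "nd = 48 * K" and h: "h = w div 3"
 and big: "1000 * K * w * 2 ^ h <= 2 ^ w"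

sublocale word_sizes \<subseteq> machine w nd h
by unfold_locales (use w6 K1 nd h in auto)

context word_sizes
begin

definition W :: nat where "W = 2 ^ w"

lemma W_pos: "0 < W" and W_gt1: "1 < W"
using w6 one_less_power[of "2::nat" w] by (auto simp: W_def)

lemma W_ge2: "2 <= W"
using W_gt1 by simp

lemma big': "1000 * K * w * B <= W"
using big by (simp add: B_def W_def)

lemma K_less: "c * K < W" if "c <= 1000" for c
proof -
have "c * K <= 1000 * K" using that by (rule mult_le_mono1)
moreover have "1000 * K * 1 < 1000 * K * w"
 by (rule mult_strict_left_mono) (use w6 K1 in auto)
moreover have "1000 * K * w * 1 <= 1000 * K * w * B"
 by (rule mult_le_mono2) (use B_pos in simp)
ultimately show ?thesis using big' by linarith
qed

lemma num_less: "c < W" if "c <= 1000" for c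
proof -
have "c * 1 <= c * K" by (rule mult_le_mono2[OF K1])
with K_less[OF that] show ?thesis by linarith
qed

lemma w_less: "w < W"
unfolding W_def by (rule less_exp)

lemma lim: "x < W ^ a ==> a <= 12 * K ==> x < B ^ nd"
proof -
assume x: "x < W ^ a" "a <= 12 * K"
have "w * (12 * K) <= h * nd" using wh by (simp add: nd)
then have "W ^ (12 * K) <= B ^ nd"
 unfolding W_def B_def by (simp flip: power_mult)
moreover have "W ^ a <= W ^ (12 * K)" using x W_pos by (intro power_increasing) auto
ultimately show ?thesis using x by linarith
qed

lemma lim_mult: "x < W ^ a ==> y < W ^ c ==> a + c <= 12 * K ==> x * y < B ^ nd"
by (rule lim[of _ "a + c"]) (auto simp: power_add intro: mult_strict_mono')

lemma lim_plus: "x < W ^ a ==> y < W ^ a ==> a < 12 * K ==> x + y < B ^ nd"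
proof (rule lim[of _ "Suc a"])
assume "x < W ^ a" "y < W ^ a"
moreover have "2 * W ^ a <= W * W ^ a" using W_ge2 by (rule mult_le_mono1)
ultimately show "x + y < W ^ Suc a" unfolding power_Suc by linarith
qed simp

lemma less_W_pow: "x < W ==> 1 <= a ==> x < W ^ a"
using power_increasing[of 1 a W] W_pos by simp

lemma lim_W: "x < W ==> x < B ^ nd"
using lim[of x 1] K1 by simp

definition env :: "config \<Rightarrow> bool" where
"env s \<longleftrightarrow> reg s vW = W & reg s vW1 = 2 ^ (w div 2) & reg s vW2 = 2 ^ (w - w div 2) &
 reg s vh = h & reg s vH = B & reg s vw = w"

lemma env_set_reg [simp]: "36 <= x ==> env (set_reg x v s) = env s"
by (simp add: env_def)

lemma env_arr [simp]: "env (s\<lparr>arr := a\<rparr>) = env s"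
by (simp add: env_def)

lemma W12: "(2::nat) ^ (w div 2) * 2 ^ (w - w div 2) = W"
unfolding W_def by (simp flip: power_add)

lemma half_B: "2 ^ (w div 2) * B <= 2 ^ w" "2 ^ (w - w div 2) * B <= 2 ^ w"
unfolding B_def using hw wh by (simp_all add: h flip: power_add)

lemma div_W: "env s ==> safe s (div_W e) = safe s e" "env s ==> eval s (div_W e) = eval s e div W"
using half_B by (auto simp: div_W_def env_def simp flip: W12 div_mult2_eq)

lemma div_W_pow: "env s ==> safe s ((div_W ^^ n) e) = safe s e"
"env s ==> eval s ((div_W ^^ n) e) = eval s e div W ^ n"
by (induction n) (simp_all add: div_W div_mult2_eq[symmetric] mult.commute)

lemma wpow: "env s ==> eval s (wpow u) = W ^ u"
by (induction u) (simp_all add: env_def)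

lemma wpow_less: "u < a ==> W ^ u < W ^ a"
using W_gt1 by (intro power_strict_increasing)

lemma safe_wpow: "env s ==> u < 12 * K ==> safe s (wpow u)"
proof (induction u)
case 0
then show ?case using W_gt1 by (simp add: W_def)
next
case (Suc u)
then have "W ^ u * W < B ^ nd"
 using lim[of "W ^ Suc u" "12 * K"] wpow_less[of "Suc u" "12 * K"] by (simp add: ac_simps)
with Suc show ?case by (simp add: wpow) (simp add: env_def)
qed

lemma cells:
assumes "env s"
shows "eval s (cells k a u) = val W u (%i. arr s k ! (eval s a + i))"
using assms by (induction u) (simp_all add: wpow)

lemma safe_cells:
assumes "env s" "safe s a" "u < 12 * K" "eval s a + u <= length (arr s k)" "eval s a + u <= W"
 "!!i. i < u ==> arr s k ! (eval s a + i) < W"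
shows "safe s (cells k a u)"
using assms(3-)
proof (induction u)
case 0
then show ?case by (simp flip: W_def add: W_pos)
next
case (Suc u)
have "val W (Suc u) (%i. arr s k ! (eval s a + i)) < W ^ Suc u"
 by (rule val_less) (use Suc.prems in auto)
then have 1: "val W (Suc u) (%i. arr s k ! (eval s a + i)) < B ^ nd"
 by (rule lim) (use Suc.prems in auto)
then have 2: "arr s k ! (eval s a + u) * W ^ u < B ^ nd" by simp
have 3: "eval s a + u < W" using Suc.prems by simp
have 4: "eval s a + u < B ^ nd" using 3 by (rule lim_W)
have 5: "u < 2 ^ w" using 3 by (simp add: W_def)
have 6: "safe s (cells k a u)" by (rule Suc.IH) (use Suc.prems in auto)
show ?case using 1 2 3 4 5 6 assms Suc.prems safe_wpow[OF assms(1), of u]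
 by (simp add: cells wpow W_def)
qed

definition modulus :: "config \<Rightarrow> nat \<Rightarrow> bool" where
"modulus s M \<longleftrightarrow> 0 < M & M <= W ^ (2 * K) & reg s vM = M & reg s vU = W ^ (5 * K) div M"

lemma modulus_set_reg [simp]: "36 <= x ==> modulus (set_reg x v s) M = modulus s M"
by (simp add: modulus_def)

lemma hs_reduce:
assumes "env s" "modulus s M" "reg s x < W ^ (5 * K)" "x ~= 40" "36 <= x" "x < nv"
 "!!q. Q (set_reg x (reg s x mod M) (set_reg 40 q s))"
shows "hs (reduce K x) s Q"
proof -
define V q where "V = reg s x" and "q = V * (W ^ (5 * K) div M) div W ^ (5 * K)"
from assms(2) have M: "0 < M" "reg s vM = M" "reg s vU = W ^ (5 * K) div M" "M <= W ^ (2 * K)"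
 by (auto simp: modulus_def)
have V: "V < W ^ (5 * K)" using assms by (simp add: V_def)
have U: "W ^ (5 * K) div M < W ^ (5 * K + 1)"
 using wpow_less[of "5 * K" "5 * K + 1"] div_le_dividend[of "W ^ (5 * K)" M] by linarith
have l1: "V * (W ^ (5 * K) div M) < B ^ nd"
 by (rule lim_mult[OF V U]) (use K1 in simp)
note b = barrett[OF M(1) V, folded q_def]
have l2: "q * M < B ^ nd" using b(1) V by (intro lim[of _ "5 * K"]) auto
have lV: "V < B ^ nd" using V by (rule lim) simp
have x: "q * M <= V" by (rule b(1))
have VM: "V - q * M < 2 * M" using b by linarith
have mm: "V mod M = (V - q * M) mod M" using x by (metis mod_mult_self1 le_add_diff_inverse2)
have fin: "V mod M = (if V - q * M < M then V - q * M else V - q * M - M)"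
proof (cases "V - q * M < M")
 case False
 then have "(V - q * M) mod M = (V - q * M - M) mod M" by (intro le_mod_geq) simp
 also have "\<dots> = V - q * M - M" using VM False by (intro mod_less) linarith
 finally show ?thesis using False mm by simp
qed (simp add: mm)
have set2: "set_reg x a (set_reg x c s') = set_reg x a s'" for a c s'
 by (simp add: set_reg_def)
have e1: "eval s ((div_W ^^ (5 * K)) (Times (Var x) (Var vU))) = q"
 using assms(1) by (simp add: div_W_pow M V_def[symmetric] q_def)
have s1: "safe s ((div_W ^^ (5 * K)) (Times (Var x) (Var vU)))"
 using assms l1 by (simp add: div_W_pow M V_def[symmetric])
let ?s1 = "set_reg 40 q s" and ?s2 = "set_reg x (V - q * M) (set_reg 40 q s)"
have Q: "Q (set_reg x (V mod M) ?s1)" unfolding V_def using assms(7) .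
show ?thesis unfolding reduce_def
proof (rule hs_Asg_Sq)
 show "hs (Sq (Asg x (Minus (Var x) (Times (Var 40) (Var vM))))
 (Iff (Var x) (Var vM) Nop (Asg x (Minus (Var x) (Var vM)))))
 (set_reg 40 (eval s ((div_W ^^ (5 * K)) (Times (Var x) (Var vU)))) s) Q"
 unfolding e1
 proof (rule hs_Asg_Sq)
 show "safe ?s1 (Minus (Var x) (Times (Var 40) (Var vM)))"
  using assms x l2 by (simp add: M V_def[symmetric])
 have e2: "eval ?s1 (Minus (Var x) (Times (Var 40) (Var vM))) = V - q * M"
  using assms by (simp add: M V_def)
 show "hs (Iff (Var x) (Var vM) Nop (Asg x (Minus (Var x) (Var vM))))
  (set_reg x (eval ?s1 (Minus (Var x) (Times (Var 40) (Var vM)))) ?s1) Q"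
  unfolding e2
  by (rule hs_Iff; (rule hs_Nop | rule hs_Asg)?) (use assms fin Q in \<open>auto simp: M set2\<close>)
 qed (use assms in auto)
qed (use s1 in auto)
qed

lemma hs_shr:
assumes "env s" "x ~= y" "36 <= x" "36 <= y" "x < nv" "y < nv" "reg s y <= 12 * K * (h)"
shows "hs (shr K x y) s (%s'. reg s' x = reg s x div 2 ^ reg s y)"
proof -
have h0: "0 < h" by (rule h_pos)
have hw: "h < w" using w6 by (simp add: h)
have BB': "B * B <= 2 ^ w" by (rule BB)
have Bh: "B = 2 ^ h" by (simp add: B_def)
define V D where "V = reg s x" and "D = reg s y"
let ?c = "Iff (Var y) (Var vh) Nop
 (Sq (Asg x (Quo (Var x) (Var vH))) (Asg y (Minus (Var y) (Var vh))))"
\<comment> \<open>Either the shift amount is already below \<open>h\<close>, or each of the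
  \<open>k\<close> rounds has removed \<open>h\<close> from it; as \<open>D <= 12 * K * h\<close>,
  the second alternative ends at 0.\<close>
define I where "I k s' \<longleftrightarrow> env s' & reg s' x div 2 ^ reg s' y = V div 2 ^ D &
 (reg s' y < h \<or> reg s' y + k * h <= D)" for k s'
have "hs (hrep (12 * K) ?c) s (I (12 * K))"
proof (rule hs_hrep)
 fix k s' assume I: "I k s'"
 then have e: "env s'" and vh: "reg s' vh = h" "reg s' vH = B" by (auto simp: I_def env_def)
 show "hs ?c s' (I (Suc k))"
 proof (rule hs_Iff)
 assume "\<not> eval s' (Var y) < eval s' (Var vh)"
 then have ge: "h <= reg s' y" by (simp add: vh)
 then have "(2::nat) ^ reg s' y = B * 2 ^ (reg s' y - h)" by (simp add: Bh flip: power_add)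
 then have "reg s' x div 2 ^ reg s' y = reg s' x div B div 2 ^ (reg s' y - h)"
  by (simp add: div_mult2_eq)
 then show "hs (Sq (Asg x (Quo (Var x) (Var vH))) (Asg y (Minus (Var y) (Var vh)))) s' (I (Suc k))"
  using assms I ge BB' B_pos
  by (intro hs_Sq hs_Asg) (auto simp: vh I_def)
 next
 assume "eval s' (Var y) < eval s' (Var vh)"
 then show "hs Nop s' (I (Suc k))" by (intro hs_Nop) (use I vh in \<open>simp add: I_def\<close>)
 qed (use assms in auto)
qed (use assms in \<open>auto simp: I_def V_def D_def\<close>)
then show ?thesis unfolding shr_def
proof (intro hs_Sq, elim hs_mono)
 fix s' assume I: "I (12 * K) s'"
 have y: "reg s' y < h \<or> reg s' y = 0" using I assms(7) by (auto simp: I_def D_def)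
 then have y: "reg s' y < h" using h0 by auto
 then have "(2::nat) ^ reg s' y <= B" unfolding Bh by (intro power_increasing) auto
 then have "2 ^ reg s' y * B <= 2 ^ w" using BB' by (meson le_trans mult_le_mono1)
 then show "hs (Asg x (Quo (Var x) (Pow (Var y)))) s' (%s'. reg s' x = reg s x div 2 ^ reg s y)"
 using I y hw assms by (intro hs_Asg) (auto simp: I_def V_def D_def)
qed
qed

end

section \<open>Access to the encoded text\<close>

lemma mod_div_mod_pow2: "b + c <= a ==> (Y mod 2 ^ a) div 2 ^ b mod 2 ^ c = Y div 2 ^ b mod (2::nat) ^ c"
proof -
assume "b + c <= a"
have "(Y mod 2 ^ a) div 2 ^ b = Y div 2 ^ b mod 2 ^ (a - b)"
 using drop_bit_take_bit[of b a Y] by (simp add: drop_bit_eq_div take_bit_eq_mod)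
moreover have "(2::nat) ^ c dvd 2 ^ (a - b)" using \<open>b + c <= a\<close> by (intro le_imp_power_dvd) simp
ultimately show ?thesis by (simp add: mod_mod_cancel)
qed

lemma writes_shr_low: "x < 36 ==> x \<notin> writes (shr K 50 51)"
proof
assume "x < 36" "x \<in> writes (shr K 50 51)"
then have "x \<in> {50, 51}" using writes_shr by blast
with \<open>x < 36\<close> show False by auto
qed

text \<open>The \<open>N\<close> words of the text form \<open>F\<close> full blocks; the words left
  over are block \<open>F\<close>, which is kept outside the encoded array.\<close>

locale encoding = word_sizes +
fixes M J e jw X N F R :: nat
assumes M: "0 < M" and MW: "M <= W ^ (2 * K)" and R: "R = W ^ (3 * K)"
 and e: "e = R mod M" and J: "J = jw * M" and JR: "J + e <= R"
 and NW: "N <= W" and XN: "X < W ^ N" and F: "F = N div (3 * K)"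

sublocale encoding \<subseteq> window M R J e jw
by unfold_locales (rule M e J JR)+

context encoding
begin

definition bl :: "nat \<Rightarrow> nat" where "bl t = X div R ^ t mod R"
definition ys :: "nat \<Rightarrow> nat" where "ys t = X div R ^ t mod M"

lemma R_pos: "0 < R" using W_pos by (simp add: R)

lemma bl_less: "bl t < R" using R_pos by (simp add: bl_def)
lemma ys_less: "ys t < M" using M by (simp add: ys_def)

lemma X_small: "X < R ^ Suc F"
proof -
have "N < 3 * K + N div (3 * K) * (3 * K)" by (rule dividend_less_div_times) (use K1 in simp)
then have "N < (F + 1) * (3 * K)" by (simp add: F)
then have "W ^ N <= W ^ (3 * K * Suc F)" using W_pos by (intro power_increasing) (auto simp: algebra_simps)
with XN show ?thesis by (simp only: R power_mult less_le_trans)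
qed

lemma X_div: "F < t ==> X div R ^ t = 0"
proof -
assume "F < t"
then have "R ^ Suc F <= R ^ t" using R_pos by (intro power_increasing) auto
with X_small show ?thesis by (intro div_less) linarith
qed

lemma bl_zero: "F < t ==> bl t = 0" and ys_zero: "F < t ==> ys t = 0"
by (simp_all add: bl_def ys_def X_div)

lemma X_step: "X div R ^ t = bl t + R * (X div R ^ Suc t)"
proof -
have "X div R ^ Suc t = X div R ^ t div R" by (metis div_mult2_eq power_Suc2)
then show ?thesis by (simp add: bl_def)
qed

lemma ys_step: "ys t = (bl t + R * ys (Suc t)) mod M"
unfolding ys_def by (subst X_step[of t]) (metis mod_add_right_eq mod_mult_right_eq)

text \<open>Only full blocks are constrained: the remaining cells of the array belong to block
  \<open>F\<close>, whose contents are taken from \<open>vRem\<close>.\<close>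

definition stru :: "nat list \<Rightarrow> bool" where
"stru A \<longleftrightarrow> length A = N & (\<forall>a<N. A ! a < W) &
 (\<forall>t<F. val W (3 * K) (%i. A ! (t * (3 * K) + i)) = enc M J e (bl t) (ys t) &
  \<not> (J <= bl t & bl t < J + e))"

definition st :: "config \<Rightarrow> bool" where
"st s \<longleftrightarrow> env s & modulus s M & reg s vJ = J & reg s vE = e & reg s vRem = bl F &
 reg s vY = ys F & reg s vF = F & reg s vR = R & reg s vL = 3 * K * w & stru (arr s 0)"

lemma st_frame:
assumes "st s" "!!x. x < 36 ==> reg s' x = reg s x" "arr s' 0 = arr s 0"
shows "st s'"
using assms unfolding st_def env_def modulus_def by simp

lemma st_set_reg [simp]: "36 <= x ==> st (set_reg x v s) = st s"
by (simp add: st_def)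

lemma F_le: "t < F ==> t * (3 * K) + 3 * K <= N"
proof -
assume "t < F"
then have "(t + 1) * (3 * K) <= F * (3 * K)" by (intro mult_le_mono1) simp
also have "\<dots> <= N" by (simp add: F)
finally show ?thesis by simp
qed

lemma FW: "F <= W"
unfolding F by (rule order_trans[OF div_le_dividend NW])

lemma block_ex:
assumes "st s" "safe s a" "eval s a < F"
shows "safe s (block_ex K a)" "eval s (block_ex K a) = enc M J e (bl (eval s a)) (ys (eval s a))"
proof -
have A: "length (arr s 0) = N" "\<forall>a<N. arr s 0 ! a < W"
 "val W (3 * K) (%i. arr s 0 ! (eval s a * (3 * K) + i)) = enc M J e (bl (eval s a)) (ys (eval s a))"
 and en: "env s"
 using assms by (auto simp: st_def stru_def)
show "eval s (block_ex K a) = enc M J e (bl (eval s a)) (ys (eval s a))"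
 using A(3) by (simp add: block_ex_def cells[OF en])
have l: "eval s a * (3 * K) + 3 * K <= N" by (rule F_le[OF assms(3)])
show "safe s (block_ex K a)" unfolding block_ex_def
proof (rule safe_cells[OF en])
 have "eval s a * (3 * K) < W" using l NW K1 by linarith
 then have "eval s a * (3 * K) < B ^ nd" by (rule lim_W)
 then show "safe s (Times a (Num (3 * K)))" using assms K_less[of 3] by (simp add: W_def)
qed (use l NW A K1 in auto)
qed

lemma MW': "x < M ==> x < W ^ (2 * K)"
using MW by simp

lemma RM_less: "a < R ==> y < M ==> a + R * y < W ^ (5 * K)"
proof -
assume "a < R" "y < M"
then have "a + R * y < R * (y + 1)" by simp
also have "\<dots> <= R * W ^ (2 * K)" using MW \<open>y < M\<close> by (intro mult_le_mono2) simp
also have "\<dots> = W ^ (5 * K)" by (simp add: R flip: power_add)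
finally show ?thesis .
qed

text \<open>Decoding adds three residues before it reduces, so a small multiple of
  \<open>W ^ (2 * K)\<close> must be in the range of \<open>reduce\<close>.\<close>

lemma M3_less: "x < 4 * W ^ (2 * K) ==> x < W ^ (5 * K)"
proof -
assume "x < 4 * W ^ (2 * K)"
also have "(4::nat) <= W * W" using mult_le_mono[OF W_ge2 W_ge2] by simp
then have "4 * W ^ (2 * K) <= W * W * W ^ (2 * K)" by (rule mult_le_mono1)
also have "\<dots> = W ^ (2 * K + 2)" by (simp add: power_add power2_eq_square)
also have "\<dots> <= W ^ (5 * K)" using W_pos K1 by (intro power_increasing) auto
finally show ?thesis .
qed

text \<open>By \<open>ys_step\<close> the fingerprint \<open>y\<close> stored with block
  \<open>t\<close> is the residue of the block plus \<open>R * ys (Suc t)\<close>. The second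
  summand is available from the following block, \<open>mod_from_sum\<close> cancels it, and
  \<open>z - y\<close> supplies the quotient part, which the encoding preserves.\<close>

lemma hs_get_block:
assumes st: "st s" and t: "reg s 41 < W ^ 2"
shows "hs (get_block K) s (%s'. reg s' 43 = bl (reg s 41) & reg s' 44 = ys (Suc (reg s 41)))"
proof -
define t where "t = reg s 41"
have lt1: "t + 1 < B ^ nd"
 using t less_W_pow[OF W_gt1, of 2] K1 unfolding t_def[symmetric] by (intro lim_plus[of _ 2]) auto
have regs: "env s" "modulus s M" "reg s vJ = J" "reg s vE = e" "reg s vRem = bl F" "reg s vM = M"
 "reg s vY = ys F" "reg s vF = F" "reg s vR = R"
 using st by (auto simp: st_def modulus_def)
have W1: "(1::nat) < 2 ^ w" "(0::nat) < 2 ^ w" using W_gt1 by (auto simp: W_def)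
show ?thesis unfolding get_block_def
proof (rule hs_Iff)
 assume "eval s (Var 41) < eval s (Var vF)"
 then have tF: "t < F" by (simp add: regs t_def)
 define z y where "z = enc M J e (bl t) (ys t)" and "y = ys t"
 have win: "\<not> (J <= bl t & bl t < J + e)" using st tF by (auto simp: st_def stru_def)
 note z = enc[OF bl_less win ys_less, of t, folded z_def y_def]
 have e1: "eval s (block_ex K (Var 41)) = z" "safe s (block_ex K (Var 41))"
 using block_ex[OF st, of "Var 41"] tF by (simp_all add: t_def z_def)
 define s1 where "s1 = set_reg 43 z s"
 have s1: "st s1" "reg s1 41 = t" "reg s1 43 = z" "reg s1 vF = F" "reg s1 vY = ys F"
 using st regs by (auto simp: s1_def t_def)
 have en1: "env s1" "modulus s1 M" using s1(1) by (auto simp: st_def)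
 let ?c = "Iff (Plus (Var 41) (Num 1)) (Var vF)
  (Sq (Asg 44 (block_ex K (Plus (Var 41) (Num 1)))) (reduce K 44)) (Asg 44 (Var vY))"
 have 1: "hs ?c s1 (%s2. reg s2 44 = ys (Suc t))"
 proof (rule hs_Iff)
 assume "eval s1 (Plus (Var 41) (Num 1)) < eval s1 (Var vF)"
 then have tF': "Suc t < F" by (simp add: s1)
 define z' where "z' = enc M J e (bl (Suc t)) (ys (Suc t))"
 have win': "\<not> (J <= bl (Suc t) & bl (Suc t) < J + e)" using st tF' by (auto simp: st_def stru_def)
 note zz = enc[OF bl_less win' ys_less, of "Suc t", folded z'_def]
 have e2: "eval s1 (block_ex K (Plus (Var 41) (Num 1))) = z'" "safe s1 (block_ex K (Plus (Var 41) (Num 1)))"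
  using block_ex[OF s1(1), of "Plus (Var 41) (Num 1)"] tF' lt1 W1 s1 by (simp_all add: z'_def)
 have zl: "z' < W ^ (5 * K)" using zz(1) wpow_less[of "3 * K" "5 * K"] K1 by (simp add: R)
 show "hs (Sq (Asg 44 (block_ex K (Plus (Var 41) (Num 1)))) (reduce K 44)) s1 (%s2. reg s2 44 = ys (Suc t))"
  by (rule hs_Asg_Sq, simp, rule e2, unfold e2, rule hs_reduce[of _ M])
  (use en1 zl zz(2) in auto)
 next
 assume "\<not> eval s1 (Plus (Var 41) (Num 1)) < eval s1 (Var vF)"
 then have "F = Suc t" using tF by (simp add: s1)
 then show "hs (Asg 44 (Var vY)) s1 (%s2. reg s2 44 = ys (Suc t))"
  by (intro hs_Asg) (simp_all add: s1)
 qed (use lt1 W1 s1 in auto)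
 have r44: "R * ys (Suc t) < W ^ (5 * K)" using RM_less[OF R_pos ys_less] by simp
 have zl: "z < W ^ (5 * K)" using z(1) wpow_less[of "3 * K" "5 * K"] K1 by (simp add: R)
 show "hs (Sq (Asg 43 (block_ex K (Var 41))) (Sq ?c
 (Sq (Asg 45 (Var 43)) (Sq (reduce K 45)
 (Sq (Asg 46 (Times (Var vR) (Var 44))) (Sq (reduce K 46)
 (Sq (Iff (Var 43) (Var vJ) (Sq (Asg 47 (Num 0)) (Asg 48 (Num 0)))
  (Sq (Asg 47 (Minus (Var vM) (Var vE))) (Asg 48 (Var vE))))
 (Sq (Asg 47 (Plus (Plus (Var 45) (Minus (Var vM) (Var 46))) (Var 47)))
 (Sq (reduce K 47)
 (Asg 43 (Plus (Plus (Minus (Var 43) (Var 45)) (Var 47)) (Var 48)))))))))))) s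
 (%s'. reg s' 43 = bl (reg s 41) & reg s' 44 = ys (Suc (reg s 41)))"
 proof (rule hs_Asg_Sq, simp, rule e1, unfold e1 s1_def[symmetric], rule hs_Sq, rule hs_call[OF 1])
 fix s2 :: config assume y2: "reg s2 44 = ys (Suc t)" and
  fr: "!!x. x \<notin> writes ?c ==> reg s2 x = reg s1 x" "!!k. k \<notin> stores ?c ==> arr s2 k = arr s1 k"
 have st2: "st s2" by (rule st_frame[OF s1(1)]) (auto intro: fr)
 have r2: "reg s2 41 = t" "reg s2 43 = z" using fr s1 by simp_all
 have regs2: "env s2" "modulus s2 M" "reg s2 vJ = J" "reg s2 vE = e" "reg s2 vM = M"
  "reg s2 vF = F" "reg s2 vR = R"
  using st2 by (auto simp: st_def modulus_def)
 define r1 where "r1 = (R * ys (Suc t)) mod M"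
 have r1M: "r1 < M" using M by (simp add: r1_def)
 have eM: "e < M" using M by (simp add: e)
 \<comment> \<open>For a block beyond the window the residue refers to the block shifted down by
   \<open>e\<close>; \<open>a\<close> applies this shift, and \<open>ee\<close> takes it back at the
   end.\<close>
 define a where "a = (if bl t < J then 0 else M - e)"
 define ee where "ee = (if bl t < J then 0 else e)"
 have aM: "a <= M" by (simp add: a_def)
 define \<rho> where "\<rho> = (bl t + a) mod M"
 have rho: "(y + (M - r1) + a) mod M = \<rho>"
  unfolding r1_def \<rho>_def by (rule mod_from_sum[OF M]) (simp add: y_def ys_step[symmetric])
 have fin: "z - y + \<rho> + ee = bl t"
  using z(5) unfolding \<rho>_def a_def ee_def by simp
 have yM: "y < M" by (simp add: y_def ys_less)
 have big: "y + (M - r1) + a < W ^ (5 * K)" "y + (M - r1) < W ^ (5 * K)"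
  by (rule M3_less, use yM aM MW in linarith)+
 have l5: "v < W ^ (5 * K) ==> v < B ^ nd" for v by (rule lim) auto
 have bll: "bl t < W ^ (5 * K)" using bl_less[of t] wpow_less[of "3 * K" "5 * K"] K1 by (simp add: R)
 have l6: "z - y + \<rho> < B ^ nd" "z - y + \<rho> + ee < B ^ nd"
  using fin bll by (auto intro!: l5)
 let ?d = "Iff (Var 43) (Var vJ) (Sq (Asg 47 (Num 0)) (Asg 48 (Num 0)))
  (Sq (Asg 47 (Minus (Var vM) (Var vE))) (Asg 48 (Var vE)))"
 show "hs (Sq (Asg 45 (Var 43)) (Sq (reduce K 45)
  (Sq (Asg 46 (Times (Var vR) (Var 44))) (Sq (reduce K 46) (Sq ?d
  (Sq (Asg 47 (Plus (Plus (Var 45) (Minus (Var vM) (Var 46))) (Var 47)))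
  (Sq (reduce K 47)
  (Asg 43 (Plus (Plus (Minus (Var 43) (Var 45)) (Var 47)) (Var 48)))))))))) s2
  (%s'. reg s' 43 = bl (reg s 41) & reg s' 44 = ys (Suc (reg s 41)))"
 proof (rule hs_Asg_Sq, simp, simp, rule hs_Sq, rule hs_reduce[of _ M], goal_cases)
  case (7 q1)
  define s3 where "s3 = set_reg 45 y (set_reg 40 q1 (set_reg 45 z s2))"
  have s3': "set_reg 45 (reg (set_reg 45 (eval s2 (Var 43)) s2) 45 mod M)
   (set_reg 40 q1 (set_reg 45 (eval s2 (Var 43)) s2)) = s3"
  using z(2) by (simp add: s3_def r2)
  show ?case unfolding s3'
  proof (rule hs_Asg_Sq, simp, goal_cases)
  case 1
  show ?case using r44 by (auto simp: s3_def regs2 y2 intro: l5)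
  next
  case 2
  have ev: "eval s3 (Times (Var vR) (Var 44)) = R * ys (Suc t)"
   by (simp add: s3_def regs2 y2)
  show ?case unfolding ev
  proof (rule hs_Sq, rule hs_reduce[of _ M], goal_cases)
   case (7 q2)
   define s4 where "s4 = set_reg 46 r1 (set_reg 40 q2 (set_reg 46 (R * ys (Suc t)) s3))"
   have s4': "set_reg 46 (reg (set_reg 46 (R * ys (Suc t)) s3) 46 mod M)
   (set_reg 40 q2 (set_reg 46 (R * ys (Suc t)) s3)) = s4"
   by (simp add: s4_def r1_def)
   have r4: "reg s4 43 = z" "reg s4 45 = y" "reg s4 46 = r1" "reg s4 44 = ys (Suc t)"
   "reg s4 vJ = J" "reg s4 vM = M" "reg s4 vE = e" "env s4" "modulus s4 M"
   by (auto simp: s4_def s3_def r2 regs2 y2)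
   have 5: "hs ?d s4 (%s5. reg s5 47 = a & reg s5 48 = ee)"
   by (rule hs_Iff; (rule hs_Asg_Sq)?; (rule hs_Asg)?)
    (use W1 eM z(3) in \<open>auto simp: r4 a_def ee_def\<close>)
   show ?case unfolding s4'
   proof (rule hs_Sq, rule hs_call[OF 5])
   fix s5 :: config assume a5: "reg s5 47 = a & reg s5 48 = ee" and
    fr: "!!x. x \<notin> writes ?d ==> reg s5 x = reg s4 x"
   have r5: "reg s5 43 = z" "reg s5 45 = y" "reg s5 46 = r1" "reg s5 44 = ys (Suc t)" "reg s5 vM = M"
    "env s5" "modulus s5 M"
    using fr r4 by (auto simp: env_def modulus_def)
   show "hs (Sq (Asg 47 (Plus (Plus (Var 45) (Minus (Var vM) (Var 46))) (Var 47)))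
    (Sq (reduce K 47)
    (Asg 43 (Plus (Plus (Minus (Var 43) (Var 45)) (Var 47)) (Var 48))))) s5
    (%s'. reg s' 43 = bl (reg s 41) & reg s' 44 = ys (Suc (reg s 41)))"
    by (rule hs_Asg_Sq, simp, (use a5 r5 big r1M l5 in simp), rule hs_Sq, rule hs_reduce[of _ M])
    (use a5 r5 big rho l6 fin z(4) in \<open>auto simp: t_def[symmetric] intro!: hs_Asg\<close>)
   qed
  qed (use r44 in \<open>auto simp: s3_def regs2\<close>)
  qed
 qed (use zl in \<open>auto simp: r2 regs2\<close>)
 qed
next
 assume "\<not> eval s (Var 41) < eval s (Var vF)"
 then have tF: "F <= t" by (simp add: regs t_def)
 show "hs (Sq (Iff (Var vF) (Var 41) (Asg 43 (Num 0)) (Asg 43 (Var vRem))) (Asg 44 (Num 0))) s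
 (%s'. reg s' 43 = bl (reg s 41) & reg s' 44 = ys (Suc (reg s 41)))"
 proof (rule hs_Sq, rule hs_Iff)
 assume "eval s (Var vF) < eval s (Var 41)"
 then have "F < t" by (simp add: regs t_def)
 then show "hs (Asg 43 (Num 0)) s (%s'. hs (Asg 44 (Num 0)) s'
  (%s'. reg s' 43 = bl (reg s 41) & reg s' 44 = ys (Suc (reg s 41))))"
  using W1 by (intro hs_Asg) (auto simp: bl_zero ys_zero t_def[symmetric])
 next
 assume "\<not> eval s (Var vF) < eval s (Var 41)"
 then have "F = t" using tF by (simp add: regs t_def)
 then show "hs (Asg 43 (Var vRem)) s (%s'. hs (Asg 44 (Num 0)) s'
  (%s'. reg s' 43 = bl (reg s 41) & reg s' 44 = ys (Suc (reg s 41))))"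
  using W1 by (intro hs_Asg) (auto simp: ys_zero regs t_def[symmetric])
 qed auto
qed auto
qed

lemma L_facts: "0 < 3 * K * w" "3 * K * w * B <= 2 ^ w" "3 * K * w < W"
and off_ok: "y < 3 * K * w ==> y <= 12 * K * h"
proof -
show "0 < 3 * K * w" using K1 w6 by simp
have "3 * K * w * B <= 1000 * K * w * B" by (intro mult_le_mono1) simp
then show 1: "3 * K * w * B <= 2 ^ w" using big' by (simp add: W_def)
have "3 * K * w * 1 < 3 * K * w * B" using K1 w6 B_gt1 by (intro mult_strict_left_mono) auto
with 1 show "3 * K * w < W" unfolding W_def by linarith
assume "y < 3 * K * w"
also have "3 * K * w <= 3 * K * (4 * h)" using wh by (intro mult_le_mono2)
finally show "y <= 12 * K * h" by simp
qed

lemma R_pow: "R ^ t * 2 ^ y = 2 ^ (t * (3 * K * w) + y)"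
by (simp add: R W_def power_add ac_simps flip: power_mult)

lemma X_div_pow: "X div R ^ (p div (3 * K * w)) div 2 ^ (p mod (3 * K * w)) = X div 2 ^ p"
unfolding div_mult2_eq[symmetric] R_pow div_mult_mod_eq ..

lemma hs_locate:
assumes "st s" "reg s 49 < W ^ 2"
shows "hs locate s (%s'. reg s' 41 = reg s 49 div (3 * K * w) & reg s' 51 = reg s 49 mod (3 * K * w))"
proof -
have L: "reg s vL = 3 * K * w" using assms by (simp add: st_def)
have "reg s 49 div (3 * K * w) * (3 * K * w) <= reg s 49" by simp
also have "reg s 49 < B ^ nd" using assms(2) K1 by (intro lim[of _ 2]) auto
finally have l: "reg s 49 div (3 * K * w) * (3 * K * w) < B ^ nd" .
have m: "p - p div q * q = p mod q" for p q :: nat by (rule minus_div_mult_eq_mod)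
show ?thesis unfolding locate_def
 by (rule hs_Asg_Sq, simp, (use L_facts in \<open>simp add: L\<close>), rule hs_Asg)
 (use l in \<open>auto simp: L m\<close>)
qed

text \<open>\<open>V\<close> agrees with the suffix at block \<open>t\<close> up to a multiple of
  \<open>R * M\<close>, and the shift divides by a divisor of \<open>R\<close>; hence nothing is
  lost modulo \<open>M\<close>.\<close>

lemma hs_fingerprint:
assumes st: "st s" and p: "reg s 49 < W ^ 2"
shows "hs (fingerprint K) s (%s'. reg s' 50 = X div 2 ^ reg s 49 mod M)"
unfolding fingerprint_def
proof (rule hs_Sq, rule hs_call[OF hs_locate[OF st p]], goal_cases)
case (1 s1)
define t y where "t = reg s 49 div (3 * K * w)" and "y = reg s 49 mod (3 * K * w)"
have st1: "st s1" by (rule st_frame[OF st]) (auto intro: 1)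
have r1: "reg s1 41 = t" "reg s1 51 = y" using 1 by (simp_all add: t_def y_def)
have t1W: "reg s1 41 < W ^ 2" unfolding r1 t_def using p div_le_dividend le_less_trans by blast
show ?case
proof (rule hs_Sq, rule hs_call[OF hs_get_block[OF st1 t1W]], goal_cases)
 case (1 s2)
 have st2: "st s2" by (rule st_frame[OF st1]) (auto intro: 1)
 have r2: "reg s2 43 = bl t" "reg s2 44 = ys (Suc t)" "reg s2 51 = y" "reg s2 vR = R"
 using 1 r1 st2 by (auto simp: st_def)
 define V where "V = bl t + R * ys (Suc t)"
 have V: "V < W ^ (5 * K)" unfolding V_def by (rule RM_less[OF bl_less ys_less])
 then have V': "V < B ^ nd" by (rule lim) simp
 define s3 where "s3 = set_reg 50 V s2"
 have s3: "st s3" "env s3" "reg s3 50 = V" "reg s3 51 = y" using st2 r2 by (auto simp: s3_def st_def)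
 have yl: "y < 3 * K * w" using L_facts by (simp add: y_def)
 have y12: "reg s3 51 <= 12 * K * h" using off_ok[OF yl] s3 by simp
 have fin: "V div 2 ^ y mod M = X div 2 ^ reg s 49 mod M"
 proof -
 have "X div R ^ t div R = X div R ^ Suc t" by (metis div_mult2_eq power_Suc2)
 then have "V = X div R ^ t mod R + R * (X div R ^ t div R mod M)"
  by (simp add: V_def bl_def ys_def)
 moreover have "R = 2 ^ (3 * K * w)" by (simp add: R W_def mult.commute flip: power_mult)
 ultimately have "V div 2 ^ y mod M = X div R ^ t div 2 ^ y mod M"
  using suffix_fingerprint[of R "3 * K * w" y "X div R ^ t" M] yl by simp
 then show ?thesis by (simp add: t_def y_def X_div_pow)
 qed
 show ?case
 proof (rule hs_Asg_Sq, simp, goal_cases)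
 case 1
 have "R * ys (Suc t) <= V" by (simp add: V_def)
 then show ?case using V' by (simp add: r2 V_def)
 next
 case 2
 have ev: "eval s2 (Plus (Var 43) (Times (Var vR) (Var 44))) = V" by (simp add: r2 V_def)
 show ?case unfolding ev s3_def[symmetric]
 proof (rule hs_Sq, rule hs_call[OF hs_shr], goal_cases)
  case (8 s4)
  have st4: "st s4" by (rule st_frame[OF s3(1)]) (use 8 in \<open>simp_all add: writes_shr_low\<close>)
  have "V div 2 ^ y < W ^ (5 * K)" using V div_le_dividend le_less_trans by blast
  then show ?case
  by (intro hs_reduce[of _ M]) (use st4 8 s3 fin in \<open>auto simp: st_def\<close>)
 qed (use s3 y12 in auto)
 qed
qed
qed

lemma hs_text_word:
assumes st: "st s" and p: "reg s 49 < W ^ 2"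
shows "hs (text_word K) s (%s'. reg s' 50 = X div 2 ^ reg s 49 mod W)"
unfolding text_word_def
proof (rule hs_Sq, rule hs_call[OF hs_locate[OF st p]], goal_cases)
case (1 s1)
define t y where "t = reg s 49 div (3 * K * w)" and "y = reg s 49 mod (3 * K * w)"
have st1: "st s1" by (rule st_frame[OF st]) (auto intro: 1)
have r1: "reg s1 41 = t" "reg s1 51 = y" using 1 by (simp_all add: t_def y_def)
have tW: "t < W ^ 2" unfolding t_def using p div_le_dividend le_less_trans by blast
\<comment> \<open>The following block is decoded as well, and \<open>hs_get_block\<close> limits
  block numbers by \<open>W ^ 2\<close>.\<close>
have tW1: "Suc t < W ^ 2"
proof -
 have "1 * 2 <= 3 * K * w" by (rule mult_le_mono) (use K1 w6 in auto)
 then have "t * 2 <= t * (3 * K * w)" by (intro mult_le_mono2) simp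
 also have "\<dots> <= reg s 49" by (simp add: t_def)
 finally have "2 * t < W ^ 2" using p by simp
 moreover have "2 * 2 <= W ^ 2" using mult_le_mono[OF W_ge2 W_ge2] by (simp add: power2_eq_square)
 ultimately show ?thesis by linarith
qed
have t1W: "reg s1 41 < W ^ 2" using r1 tW by simp
show ?case
proof (rule hs_Sq, rule hs_call[OF hs_get_block[OF st1 t1W]], goal_cases)
 case (1 s2)
 have st2: "st s2" by (rule st_frame[OF st1]) (auto intro: 1)
 have r2: "reg s2 43 = bl t" "reg s2 41 = t" "reg s2 51 = y" using 1 r1 by auto
 define s3 where "s3 = set_reg 41 (Suc t) (set_reg 52 (bl t) s2)"
 have s3: "st s3" "reg s3 41 = Suc t" "reg s3 52 = bl t" "reg s3 51 = y"
 using st2 r2 by (auto simp: s3_def)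
 have "reg s3 41 < W ^ 2" using s3 tW1 by simp
 note gb = hs_get_block[OF s3(1) this]
 have tl: "t + 1 < B ^ nd" using tW1 K1 by (intro lim[of _ 2]) auto
 have W1: "(1::nat) < 2 ^ w" using W_gt1 by (auto simp: W_def)
 show ?case
 proof (rule hs_Asg_Sq, simp, simp, rule hs_Asg_Sq, simp, goal_cases)
 case 1
 then show ?case using tl W1 by (simp add: r2)
 next
 case 2
 have ev: "set_reg 41 (eval (set_reg 52 (eval s2 (Var 43)) s2) (Plus (Var 41) (Num 1)))
  (set_reg 52 (eval s2 (Var 43)) s2) = s3" by (simp add: s3_def r2)
 show ?case unfolding ev
 proof (rule hs_Sq, rule hs_call[OF gb], goal_cases)
  case (1 s4)
  have st4: "st s4" by (rule st_frame[OF s3(1)]) (auto intro: 1)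
  have r4: "reg s4 43 = bl (Suc t)" "reg s4 52 = bl t" "reg s4 51 = y" "reg s4 vR = R"
  using 1 s3 st4 by (auto simp: st_def)
  define V where "V = bl t + R * bl (Suc t)"
  have "V < R * (bl (Suc t) + 1)" using bl_less[of t] by (simp add: V_def)
  also have "\<dots> <= R * R" using bl_less[of "Suc t"] by (intro mult_le_mono2) simp
  finally have VR: "V < R * R" .
  then have V: "V < W ^ (6 * K)" by (simp add: R flip: power_add)
  then have V': "V < B ^ nd" by (rule lim) simp
  define s5 where "s5 = set_reg 50 V s4"
  have s5: "st s5" "env s5" "reg s5 50 = V" "reg s5 51 = y" using st4 r4 by (auto simp: s5_def st_def)
  have yl: "y < 3 * K * w" using L_facts by (simp add: y_def)
  have y12: "reg s5 51 <= 12 * K * h" using off_ok[OF yl] s5 by simp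
  have fin: "V div 2 ^ y mod W = X div 2 ^ reg s 49 mod W"
  proof -
  have RL: "R * R = 2 ^ (6 * K * w)" by (simp add: R W_def ac_simps flip: power_mult power_add)
  have "X div R ^ t = V + (R * R) * (X div R ^ Suc (Suc t))"
   unfolding V_def by (subst X_step, subst X_step) (simp only: algebra_simps)
  then have "V = X div R ^ t mod (R * R)" using VR by simp
  then have "V div 2 ^ y mod W = (X div R ^ t mod 2 ^ (6 * K * w)) div 2 ^ y mod 2 ^ w"
   by (simp add: RL W_def)
  also have "\<dots> = X div R ^ t div 2 ^ y mod 2 ^ w"
  proof (rule mod_div_mod_pow2)
   have "1 * w <= 3 * K * w" using K1 by (intro mult_le_mono1) simp
   with yl show "y + w <= 6 * K * w" by linarith
  qed
  finally show ?thesis by (simp add: t_def y_def X_div_pow W_def)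
  qed
  show ?case
  proof (rule hs_Asg_Sq, simp, goal_cases)
  case 1
  have "R * bl (Suc t) <= V" by (simp add: V_def)
  then show ?case using V' by (simp add: r4 V_def)
  next
  case 2
  have ev: "eval s4 (Plus (Var 52) (Times (Var vR) (Var 43))) = V" by (simp add: r4 V_def)
  show ?case unfolding ev s5_def[symmetric]
  proof (rule hs_Sq, rule hs_call[OF hs_shr], goal_cases)
   case (8 s6)
   have st6: "st s6" by (rule st_frame[OF s5(1)]) (use 8 in \<open>simp_all add: writes_shr_low\<close>)
   then have e6: "env s6" "reg s6 vW = W" by (auto simp: st_def env_def)
   have v6: "reg s6 50 = V div 2 ^ y" using 8 s5 by simp
   have "V div 2 ^ y div W * W <= V" by (meson div_le_dividend div_times_less_eq_dividend le_trans)
   then have "V div 2 ^ y div W * W < B ^ nd" using V' by linarith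
   then show ?case using fin
   by (intro hs_Asg) (auto simp: div_W[OF e6(1)] e6 v6 minus_div_mult_eq_mod)
  qed (use s5 y12 in auto)
  qed
 qed
 qed
qed
qed

end

section \<open>Preparation of a query and extraction\<close>

primrec seqs :: "hl list \<Rightarrow> hl" where
"seqs [] = Nop"
| "seqs (c # cs) = Sq c (seqs cs)"

text \<open>The word size in register 6 yields \<open>h\<close>, \<open>B\<close> and
  \<open>B - 1\<close> before the twelve argument registers are split into digits. Other variables
  need no code, because their registers start at 0.\<close>

definition prologue :: "nat \<Rightarrow> prog" where
"prologue nd = Seq (Const rC 3) (Seq (Op rT Div 6 rC) (Seq (Const rC 1) (Seq (Op rB Shl rC rT)
 (Seq (Op rM Sub rB rC) (unroll 12 (%x. Seq (copy_reg rT x) (of_word nd x)))))))"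

lemma no_loop_prologue: "no_loop (prologue nd)"
by (simp add: prologue_def)

definition start_vars :: "config \<Rightarrow> config" where
"start_vars s = s\<lparr>reg := %x. if x < 12 then reg s x else 0\<rparr>"

lemma start_vars_sel [simp]: "arr (start_vars s) = arr s" "rnd (start_vars s) = rnd s"
"reg (start_vars s) = (%x. if x < 12 then reg s x else 0)"
by (simp_all add: start_vars_def)

context machine
begin

lemma prologue:
assumes "!!x. x < 12 ==> reg s x < 2 ^ w" "reg s 6 = w" "!!x. 32 <= x ==> reg s x = 0"
 "h = w div 3" "3 <= w"
shows "\<exists>t r. exec w (prologue nd) s t r & t <= steps (prologue nd) & rep (start_vars s) r"
proof -
let ?p = "%x. Seq (copy_reg rT x) (of_word nd x)"
define f where "f = (reg s)(rC := 1, rT := h, rB := B, rM := B - 1)"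
have w8: "3 < (2::nat) ^ w"
 using power_increasing[of 3 w "2::nat"] assms(5) by simp
have hw': "h < w" using assms(4,5) by simp
have "(B + (2 ^ w - 1)) mod 2 ^ w = B - 1"
proof -
 have eq: "B + (2 ^ w - 1) = (B - 1) + 2 ^ w" using B_gt1 B_less by simp
 show ?thesis unfolding eq mod_add_self2 using B_less by (intro mod_less) linarith
qed
then have f: "sl w (prologue nd) (reg s) = sl w (unroll 12 ?p) f"
 using w8 hw' by (simp add: prologue_def f_def assms(2) assms(4)[symmetric] B_def fun_upd_twist)
have cp: "sl w (copy_reg i j) f = f(i := f j)" for i j f by (simp add: copy_reg_def)
have *: "n <= 12 ==> (let g = sl w (unroll n ?p) f in
 (\<forall>r<32. r ~= rT --> g r = f r) & (\<forall>x<n. dg g x & bv g x = reg s x) &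
 (\<forall>x i. n <= x --> i < nd --> g (br nd x i) = 0))" for n
proof (induction n)
 case 0
 show ?case using assms(3) by (simp add: f_def br_ge)
next
 case (Suc n)
 define g where "g = sl w (unroll n ?p) f"
 from Suc have g: "\<forall>r<32. r ~= rT --> g r = f r" "\<forall>x<n. dg g x & bv g x = reg s x"
 "\<forall>x i. n <= x --> i < nd --> g (br nd x i) = 0"
 by (simp_all add: Let_def g_def)
 have n: "n < 12" using Suc.prems by simp
 have gn: "g n = reg s n" using g(1) n by (simp add: f_def)
 let ?g = "g(rT := reg s n)"
 have rd: "ready ?g" "?g rT < 2 ^ w" using g(1) assms(1)[OF n] by (auto simp: ready_def f_def)
 define g' where "g' = sl w (of_word nd n) ?g"
 from of_word[OF rd, of n, unfolded Let_def, folded g'_def]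
 have g': "\<forall>r. r \<notin> {rT} \<union> {br nd n i |i. i < nd} --> g' r = ?g r" "dg g' n" "bv g' n = reg s n"
 by auto
 have eq: "sl w (unroll (Suc n) ?p) f = g'"
 by (simp add: g_def[symmetric] cp gn g'_def)
 have sm: "g' (br nd x i) = g (br nd x i)" if "x ~= n" "i < nd" for x i
 proof -
 have "br nd x i \<notin> {rT} \<union> {br nd n i |i. i < nd}" using that by (auto simp: br_inj)
 then show ?thesis using g'(1) by auto
 qed
 have "dg g' x & bv g' x = reg s x" if "x < Suc n" for x
 proof (cases "x = n")
 case False
 have "bv g' x = bv g x" unfolding bv_def by (rule val_cong) (use sm False in auto)
 moreover have "dg g' x = dg g x" using sm[OF False] by (simp add: dg_def)
 ultimately show ?thesis using g(2) False that by auto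
 qed (use g' in simp)
 moreover have "\<forall>x i. Suc n <= x --> i < nd --> g' (br nd x i) = 0"
 using sm g(3) by auto
 moreover have "g' r = f r" if "r < 32" "r ~= rT" for r
 proof -
 have "r \<notin> {rT} \<union> {br nd n i |i. i < nd}" using that by (auto simp: br_def)
 then show ?thesis using g'(1) g(1) that by auto
 qed
 ultimately show ?case unfolding eq Let_def by blast
qed
define g where "g = sl w (prologue nd) (reg s)"
from *[of 12] have g: "\<forall>r<32. r ~= rT --> g r = f r" "\<forall>x<12. dg g x & bv g x = reg s x"
 "\<forall>x i. 12 <= x --> i < nd --> g (br nd x i) = 0"
 by (simp_all add: Let_def g_def f)
have z: "dg g x & bv g x = 0" if "12 <= x" for x
proof -
 have "bv g x = val B nd (%_. 0)" unfolding bv_def by (rule val_cong) (use g(3) that in simp)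
 then show ?thesis using g(3) that B_pos by (simp add: val_0 dg_def)
qed
have "rep (start_vars s) (s\<lparr>reg := g\<rparr>)"
 using g z by (auto simp: rep_def vars_ok_def ready_def f_def not_less)
moreover have "straight (prologue nd)" by (simp add: prologue_def)
from exec_sl[OF this, of w s] obtain t where "exec w (prologue nd) s t (s\<lparr>reg := g\<rparr>)"
 by (auto simp: g_def)
ultimately show ?thesis using exec_le_steps no_loop_prologue by blast
qed

end

definition prepare :: "nat \<Rightarrow> hl" where
"prepare K = seqs [Asg vW1 (Pow (Quo (Var vw) (Num 2))),
 Asg vW2 (Pow (Minus (Var vw) (Quo (Var vw) (Num 2)))),
 Asg vW (Times (Var vW1) (Var vW2)), Asg vh (Quo (Var vw) (Num 3)), Asg vH (Pow (Var vh)),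
 Asg vn (Plus (Var 0) (Times (Var 1) (Var vW))), Asg vL (Times (Num (3 * K)) (Var vw)),
 Asg vR (wpow (3 * K)), Asg vN (Quo (Plus (Times (Var vn) (Var vb)) (Minus (Var vw) (Num 1))) (Var vw)),
 Asg vF (Quo (Var vN) (Num (3 * K)))]"

text \<open>The widest stored number is \<open>W ^ (5 * K) div M\<close>; for \<open>M = 1\<close>
  it equals \<open>W ^ (5 * K)\<close> and needs one word more than \<open>5 * K\<close>.\<close>

definition sw :: "nat \<Rightarrow> nat" where
"sw K = 5 * K + 1"

definition slot_ex :: "nat \<Rightarrow> ex \<Rightarrow> ex" where
"slot_ex K k = cells 1 (Times k (Num (sw K))) (sw K)"

definition load :: "nat \<Rightarrow> hl" where
"load K = seqs [Asg vM (slot_ex K (Num 0)), Asg vU (slot_ex K (Num 1)), Asg vJ (slot_ex K (Num 2)),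
 Asg vE (slot_ex K (Num 3)), Asg vRem (slot_ex K (Num 4)), Asg vY (slot_ex K (Num 5))]"

text \<open>Variable 49 is the bit position in the text, 53 the number of bits still due and 55 the
  output index. The last word is cut to the bits due, because the output has to be the packing of
  the substring and nothing else.\<close>

definition extract_step :: "nat \<Rightarrow> hl" where
"extract_step K = seqs [text_word K,
 Iff (Var 53) (Var vw)
 (seqs [Asg 56 (Var 50), Asg 57 (Var 53), shr K 56 57,
  Asg 50 (Minus (Var 50) (Times (Var 56) (Pow (Var 53)))), Asg 53 (Num 0)])
 (Asg 53 (Minus (Var 53) (Var vw))),
 Sto 2 (Var 55) (Var 50), Asg 49 (Plus (Var 49) (Var vw)), Asg 55 (Plus (Var 55) (Num 1))]"

definition extract_init :: "nat \<Rightarrow> hl" where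
"extract_init K = seqs [prepare K, load K,
 Asg 53 (Times (Plus (Var 10) (Times (Var 11) (Var vW))) (Var vb)),
 Asg 49 (Times (Plus (Var 8) (Times (Var 9) (Var vW))) (Var vb)), Asg 55 (Num 0)]"

definition extract_hl :: "nat \<Rightarrow> hl" where
"extract_hl K = Sq (extract_init K) (Whl (Num 0) (Var 53) (extract_step K))"

lemma writes_prepare [simp]: "writes (prepare K) = {vW1, vW2, vW, vh, vH, vn, vL, vR, vN, vF}"
and stores_prepare [simp]: "stores (prepare K) = {}"
and hfree_prepare [simp]: "hfree (prepare K)"
and random_prepare [simp]: "\<not> random (prepare K)"
by (auto simp: prepare_def)

lemma writes_load [simp]: "writes (load K) = {vM, vU, vJ, vE, vRem, vY}"
and stores_load [simp]: "stores (load K) = {}"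
and hfree_load [simp]: "hfree (load K)"
and random_load [simp]: "\<not> random (load K)"
by (auto simp: load_def)

lemma writes_text_word_iff: "x \<notin> {40, 41, 43, 44, 45, 46, 47, 48, 50, 51, 52} ==> x \<notin> writes (text_word K)"
using writes_text_word[of K] by blast

context word_sizes
begin

lemma small_div: "c <= 1000 * K ==> c * B <= 2 ^ w"
proof -
assume "c <= 1000 * K"
moreover have "1000 * K * 1 <= 1000 * K * w" using w6 by (intro mult_le_mono2) simp
ultimately have "c <= 1000 * K * w" by linarith
from mult_le_mono1[OF this, of B] show ?thesis using big' unfolding W_def by linarith
qed

lemma w_div: "w * B <= 2 ^ w"
proof -
have "w * B <= 1000 * K * w * B" using K1 by (intro mult_le_mono1) simp
then show ?thesis using big' unfolding W_def by linarith
qed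

lemma Ww_less: "x <= W * w ==> x < W ^ 2"
proof -
assume "x <= W * w"
also have "W * w < W * W" using w_less W_pos by simp
finally show ?thesis by (simp add: power2_eq_square)
qed

lemma W2_lim: "x < W ^ 2 ==> x < B ^ nd"
using K1 by (auto intro: lim[of _ 2])

lemma hs_prepare:
assumes "reg s 0 = n mod W" "reg s 1 = n div W" "reg s vb = b" "reg s vw = w" "b <= w" "n <= W"
shows "hs (prepare K) s (%s'. env s' & reg s' vn = n & reg s' vL = 3 * K * w & reg s' vR = W ^ (3 * K) &
 reg s' vN = num_words w (n * b) & reg s' vF = num_words w (n * b) div (3 * K))"
proof -
have c: "k <= 1000 ==> k < 2 ^ w" for k :: nat using num_less[of k] by (simp add: W_def)
have wB: "w < B ^ nd" using w_less by (rule lim_W)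
have K3: "3 * K < 2 ^ w" using K_less[of 3] by (simp add: W_def)
have WB: "W < B ^ nd"
 using wpow_less[of 1 "12 * K"] K1 by (intro lim[of _ "12 * K"]) auto
have nn: "n mod W + n div W * W = n" by simp
have nW: "n div W * W <= n" by simp
have nB: "n < B ^ nd" using assms(6) WB by simp
have nW': "n div W * W < B ^ nd" using nB nW by linarith
have nb: "n * b <= W * w" using assms by (intro mult_le_mono)
have "n * b < W ^ 2" by (rule Ww_less[OF nb])
moreover have "w - 1 < W ^ 2" using less_W_pow[OF w_less, of 2] by simp
ultimately have nbw: "n * b + (w - 1) < B ^ nd" using K1 by (intro lim_plus[of _ 2]) auto
have L: "3 * K * w < B ^ nd"
proof -
 have "3 * K * w * 1 <= 1000 * K * w * B" using B_pos by (intro mult_le_mono) auto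
 then have "3 * K * w <= W" using big' by linarith
 then show ?thesis using WB by simp
qed
have wpos: "0 < w" "1 <= w" using w6 by auto
have h3: "w div 3 = h" by (simp add: h)
have hw': "h < w" using w6 by (simp add: h)
have div3: "0 < 3 * K" "3 * K * B <= 2 ^ w" using K1 small_div[of "3 * K"] by auto
define s8 where "s8 = set_reg vL (3 * K * w) (set_reg vn n (set_reg vH B (set_reg vh h (set_reg vW W
 (set_reg vW2 (2 ^ (w - w div 2)) (set_reg vW1 (2 ^ (w div 2)) s))))))"
have s8: "env s8" "reg s8 vn = n" "reg s8 vb = b" "reg s8 vw = w" "reg s8 vL = 3 * K * w"
 using assms by (auto simp: s8_def env_def)
have rest: "hs (seqs [Asg vR (wpow (3 * K)), Asg vN (Quo (Plus (Times (Var vn) (Var vb)) (Minus (Var vw) (Num 1))) (Var vw)),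
 Asg vF (Quo (Var vN) (Num (3 * K)))]) s8 (%s'. env s' & reg s' vn = n & reg s' vL = 3 * K * w & reg s' vR = W ^ (3 * K) &
 reg s' vN = num_words w (n * b) & reg s' vF = num_words w (n * b) div (3 * K))"
 unfolding seqs.simps num_words_eq[OF wpos(2)]
 apply (rule hs_Asg_Sq, simp, rule safe_wpow[OF s8(1)], use K1 in simp)
 apply (rule hs_Asg_Sq, simp)
 using s8 c[of 1] nbw w_div wpos apply (simp)
 apply (rule hs_Asg_Sq, simp)
 using s8 K3 div3 apply (simp)
 by (rule hs_Nop) (use s8 in \<open>auto simp: env_def wpow[OF s8(1)]\<close>)
show ?thesis unfolding prepare_def seqs.simps
 apply (rule hs_Asg_Sq, simp)
 using assms small_div[of 2] K1 c[of 2] w6 apply simp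
 apply (rule hs_Asg_Sq, simp)
 using assms small_div[of 2] K1 c[of 2] w6 apply simp
 apply (rule hs_Asg_Sq, simp)
 using assms WB W12 apply simp
 apply (rule hs_Asg_Sq, simp)
 using assms small_div[of 3] K1 c[of 3] w6 apply simp
 apply (rule hs_Asg_Sq, simp)
 using assms hw' h3 apply simp
 apply (rule hs_Asg_Sq, simp)
 using assms nn nB nW' W12 apply simp
 apply (rule hs_Asg_Sq, simp)
 using assms K3 L apply simp
 using rest unfolding seqs.simps s8_def
 by (simp add: assms assms(2)[unfolded One_nat_def] h3 W12 B_def)
qed

end

definition (in word_sizes) slot :: "nat list \<Rightarrow> nat \<Rightarrow> nat" where
"slot E k = val W (sw K) (%i. E ! (k * sw K + i))"

text \<open>The interface between construction and queries. Slots from 6 on hold the shift factors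
  for substrings of \<open>2 ^ k\<close> characters, the only lengths that the search
  compares.\<close>

locale query = encoding +
fixes b n :: nat and A E :: "nat list"
assumes b: "b <= w" and n1: "1 <= n" and nW: "n <= W" and N: "N = num_words w (n * b)"
 and X: "X < 2 ^ (b * n)" and A: "stru A"
 and E_len: "length E <= W" "6 * sw K <= length E"
 "!!k. 2 ^ k <= n ==> (7 + k) * sw K <= length E"
 and E_less: "!!a. a < length E ==> E ! a < W"
 and E_val: "slot E 0 = M"
 "slot E 1 = W ^ (5 * K) div M"
 "slot E 2 = J"
 "slot E 3 = e"
 "slot E 4 = bl F"
 "slot E 5 = ys F"
 "!!k. 2 ^ k <= n ==> slot E (6 + k) = 2 ^ (b * 2 ^ k) mod M"
begin

lemma slot_ex:
assumes "env s" "arr s 1 = E" "safe s k" "(eval s k + 1) * sw K <= length E"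
shows "safe s (slot_ex K k)"
 "eval s (slot_ex K k) = slot E (eval s k)"
proof -
show "eval s (slot_ex K k) = slot E (eval s k)"
 unfolding slot_ex_def cells[OF assms(1)] by (simp add: assms(2)[unfolded One_nat_def] slot_def)
have le: "eval s k * sw K + sw K <= length E" using assms(4) by (simp add: algebra_simps)
have sw: "sw K < 12 * K" using K1 by (simp add: sw_def)
have "sw K < 2 ^ w" unfolding sw_def using K_less[of 6] K1 by (simp add: W_def)
moreover have "eval s k * sw K < B ^ nd"
 using le E_len(1) by (intro lim_W) (simp add: sw_def)
ultimately show "safe s (slot_ex K k)" unfolding slot_ex_def
 using assms le E_len(1) E_less sw by (intro safe_cells) auto
qed

lemma slot_num:
assumes "env s" "arr s 1 = E" "k < 6"
shows "safe s (slot_ex K (Num k))"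
 "eval s (slot_ex K (Num k)) = slot E k"
proof -
have "(k + 1) * sw K <= 6 * sw K" using assms by (intro mult_le_mono1) simp
then have "(k + 1) * sw K <= length E" using E_len(2) by linarith
moreover have "k < 2 ^ w" using num_less[of k] assms(3) by (simp add: W_def)
ultimately show "safe s (slot_ex K (Num k))"
 "eval s (slot_ex K (Num k)) = slot E k"
 using slot_ex[OF assms(1,2), of "Num k"] by auto
qed

lemma hs_load:
assumes "env s" "arr s 1 = E" "arr s 0 = A" "reg s vL = 3 * K * w" "reg s vR = R" "reg s vF = F"
shows "hs (load K) s st"
proof -
have "hs (load K) s (%s'. reg s' vM = M & reg s' vU = W ^ (5 * K) div M & reg s' vJ = J &
 reg s' vE = e & reg s' vRem = bl F & reg s' vY = ys F)"
 unfolding load_def seqs.simps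
 by (rule hs_Asg_Sq, simp, rule slot_num, (use assms in \<open>simp_all add: env_def\<close>)[3])+
 (use assms in \<open>auto intro!: hs_Nop simp: slot_num env_def E_val E_val(2)[unfolded One_nat_def]\<close>)
then show ?thesis
proof (rule hs_call, goal_cases)
 case (1 s')
 then show ?case using assms M MW A by (auto simp: st_def env_def modulus_def)
qed
qed

lemma nbw: "n * b <= W * w" using b nW by (intro mult_le_mono) auto

definition start :: "config \<Rightarrow> bool" where
"start s \<longleftrightarrow> reg s 0 = n mod W & reg s 1 = n div W & reg s vb = b & reg s vw = w & arr s 0 = A & arr s 1 = E"

lemma hs_prepare_load:
assumes "start s"
 "!!s'. st s' ==> reg s' vn = n ==> (!!x. x \<notin> {20..35} ==> reg s' x = reg s x) ==> arr s' = arr s ==> hs c s' Q"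
shows "hs (Sq (prepare K) (Sq (load K) c)) s Q"
proof (rule hs_Sq, rule hs_call[OF hs_prepare[of s n b]], goal_cases)
case (7 s1)
have e1: "env s1" "arr s1 1 = E" "arr s1 0 = A" "reg s1 vL = 3 * K * w" "reg s1 vR = R" "reg s1 vF = F"
 using 7 assms(1) by (auto simp: start_def R F N)
show ?case
 by (rule hs_Sq, rule hs_call[OF hs_load[OF e1]], rule assms(2)) (use 7 in auto)
qed (use assms(1) b nW in \<open>auto simp: start_def\<close>)

end

section \<open>Correctness and cost of extraction\<close>

locale extraction = query +
fixes i m :: nat
assumes im: "i + m <= n"
begin

definition D :: nat where "D = X div 2 ^ (b * i) mod 2 ^ (b * m)"

abbreviation "k_out \<equiv> num_words w (m * b)"

lemma D_word:
assumes "a * w < m * b"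
shows "D div W ^ a mod W = (let v = X div 2 ^ (i * b + a * w) mod W in
 if m * b - a * w < w then v mod 2 ^ (m * b - a * w) else v)"
proof -
have Wa: "W ^ a = 2 ^ (a * w)" by (simp add: W_def mult.commute flip: power_mult)
have Xe: "X div 2 ^ (b * i) div 2 ^ (a * w) = X div 2 ^ (i * b + a * w)"
 by (simp add: power_add mult.commute flip: div_mult2_eq)
show ?thesis
proof (cases "m * b - a * w < w")
 case False
 then have "a * w + w <= b * m" using assms by (simp add: mult.commute)
 then show ?thesis using False unfolding D_def Wa
 by (simp add: W_def mod_div_mod_pow2 Xe)
next
 case True
 define c where "c = m * b - a * w"
 have le: "b * m = a * w + c" using assms by (simp add: c_def mult.commute)
 have "D div W ^ a = X div 2 ^ (i * b + a * w) mod 2 ^ c"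
 unfolding D_def Wa Xe[symmetric] le using drop_bit_take_bit[of "a * w" "a * w + c" "X div 2 ^ (b * i)"]
 by (simp add: drop_bit_eq_div take_bit_eq_mod)
 moreover have "(2::nat) ^ c <= 2 ^ w" using True by (intro power_increasing) (auto simp: c_def)
 then have "X div 2 ^ (i * b + a * w) mod 2 ^ c < W"
 unfolding W_def by (intro less_le_trans[OF mod_less_divisor]) auto
 moreover have "(2::nat) ^ c dvd W" unfolding W_def using True by (intro le_imp_power_dvd) (simp add: c_def)
 ultimately show ?thesis using True by (simp add: c_def[symmetric] mod_mod_cancel)
qed
qed

definition inv :: "nat \<Rightarrow> config \<Rightarrow> bool" where
"inv k s \<longleftrightarrow> st s & arr s 0 = A & arr s 1 = E & reg s 55 + k = k_out & reg s 49 = i * b + reg s 55 * w &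
 reg s 53 = m * b - reg s 55 * w & length (arr s 2) = k_out &
 (\<forall>a<reg s 55. arr s 2 ! a = D div W ^ a mod W)"

lemma k_outW: "k_out <= W"
proof -
have "m * b <= W * w" using im nW b by (intro mult_le_mono) auto
then have "k_out * w < W * w + w" using num_words_bounds(2)[of w "m * b"] w6 by simp
then have "k_out * w < (W + 1) * w" by simp
then have "k_out < W + 1" by (rule mult_less_cancel2[THEN iffD1, THEN conjunct2])
then show ?thesis by simp
qed

text \<open>\<open>k_out\<close> is \<open>m * b / w\<close> rounded up, so bits are still due
  exactly while words are.\<close>

lemma inv_iff: "inv k s ==> 0 < reg s 53 \<longleftrightarrow> 0 < k"
proof -
assume I: "inv k s"
have o: "m * b <= k_out * w" "k_out * w < m * b + w"
 using num_words_bounds[of w "m * b"] w6 by auto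
show ?thesis
proof
 assume "0 < reg s 53"
 then have "reg s 55 * w < m * b" using I by (simp add: inv_def)
 also note o(1)
 finally have "reg s 55 < k_out" by (simp only: mult_less_cancel2)
 then show "0 < k" using I by (auto simp: inv_def)
next
 assume "0 < k"
 then have "(reg s 55 + 1) * w <= k_out * w" using I by (intro mult_le_mono1) (simp add: inv_def)
 then have "reg s 55 * w < m * b" using o by simp
 then show "0 < reg s 53" using I by (simp add: inv_def)
qed
qed

lemma step:
assumes I: "inv k s" and pos: "0 < reg s 53"
shows "hs (extract_step K) s (inv (k - 1))"
proof -
define a where "a = reg s 55"
have r: "st s" "arr s 0 = A" "arr s 1 = E" "a + k = k_out" "reg s 49 = i * b + a * w"
 "reg s 53 = m * b - a * w" "length (arr s 2) = k_out"
 "\<forall>a'<a. arr s 2 ! a' = D div W ^ a' mod W"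
 using I by (auto simp: inv_def a_def)
have k: "0 < k" using inv_iff[OF I] pos by simp
have aw: "a * w < m * b" using pos r by simp
have "i * b + m * b <= n * b" using im by (simp flip: add_mult_distrib)
then have "i * b + a * w < W * w" using aw nbw by linarith
then have p2: "reg s 49 < W ^ 2" using r by (intro Ww_less) simp
have c: "(1::nat) < 2 ^ w" "(0::nat) < 2 ^ w" using W_gt1 by (auto simp: W_def)
define v where "v = X div 2 ^ (i * b + a * w) mod W"
define c0 where "c0 = m * b - a * w"
define v' where "v' = (if c0 < w then v mod 2 ^ c0 else v)"
define c' where "c' = (if c0 < w then 0 else c0 - w)"
have vW: "v < W" using W_pos by (simp add: v_def)
have v'W: "v' < W" using vW by (auto simp: v'_def intro: le_less_trans[OF mod_less_eq_dividend])
have Dv: "D div W ^ a mod W = v'" using D_word[OF aw] by (simp add: v'_def v_def c0_def Let_def)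
have c': "c' = m * b - (a + 1) * w" by (auto simp: c'_def c0_def)
show ?thesis unfolding extract_step_def seqs.simps
proof (rule hs_Sq, rule hs_call[OF hs_text_word[OF r(1) p2]], goal_cases)
 case (1 s1)
 have st1: "st s1" by (rule st_frame[OF r(1)]) (use 1 writes_text_word_iff in auto)
 have r1: "reg s1 50 = v" "reg s1 53 = c0" "reg s1 55 = a" "reg s1 49 = i * b + a * w" "reg s1 vw = w"
 "arr s1 0 = A" "arr s1 1 = E" "arr s1 2 = arr s 2"
 using 1 r st1 by (simp_all add: writes_text_word_iff v_def c0_def a_def st_def env_def)
 let ?c = "Iff (Var 53) (Var vw)
 (Sq (Asg 56 (Var 50)) (Sq (Asg 57 (Var 53)) (Sq (shr K 56 57)
  (Sq (Asg 50 (Minus (Var 50) (Times (Var 56) (Pow (Var 53))))) (Sq (Asg 53 (Num 0)) Nop)))))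
 (Asg 53 (Minus (Var 53) (Var vw)))"
 have w_shr: "x \<notin> writes (shr K 56 57)" if "x ~= 56" "x ~= 57" for x
 using writes_shr[of K 56 57] that by blast
 have 2: "hs ?c s1 (%s2. reg s2 50 = v' & reg s2 53 = c')"
 proof (rule hs_Iff)
 assume "eval s1 (Var 53) < eval s1 (Var vw)"
 then have lt: "c0 < w" by (simp add: r1)
 define s2 where "s2 = set_reg 57 c0 (set_reg 56 v s1)"
 have s2: "env s2" "reg s2 56 = v" "reg s2 57 = c0" "reg s2 50 = v" "reg s2 53 = c0"
  using st1 r1 by (auto simp: s2_def st_def)
 have y: "reg s2 57 <= 12 * K * h"
 proof -
  have "c0 <= 4 * h" using lt wh by simp
  also have "\<dots> <= 12 * K * h" using K1 by (intro mult_le_mono1) simp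
  finally show ?thesis by (simp add: s2)
 qed
 show "hs (Sq (Asg 56 (Var 50)) (Sq (Asg 57 (Var 53)) (Sq (shr K 56 57)
  (Sq (Asg 50 (Minus (Var 50) (Times (Var 56) (Pow (Var 53))))) (Sq (Asg 53 (Num 0)) Nop))))) s1
  (%s2. reg s2 50 = v' & reg s2 53 = c')"
 proof (rule hs_Asg_Sq, simp, simp, rule hs_Asg_Sq, simp, simp, goal_cases)
  case 1
  have e: "set_reg 57 (eval (set_reg 56 (eval s1 (Var 50)) s1) (Var 53)) (set_reg 56 (eval s1 (Var 50)) s1) = s2"
  by (simp add: s2_def r1)
  show ?case unfolding e
  proof (rule hs_Sq, rule hs_call[OF hs_shr], goal_cases)
  case (8 s3)
  have r3: "reg s3 56 = v div 2 ^ c0" "reg s3 50 = v" "reg s3 53 = c0"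
   using 8 s2 w_shr by auto
  have le: "v div 2 ^ c0 * 2 ^ c0 <= v" by simp
  have "v div 2 ^ c0 * 2 ^ c0 < B ^ nd" by (rule lim_W) (use le vW in linarith)
  moreover have "v - v div 2 ^ c0 * 2 ^ c0 = v mod 2 ^ c0" by (rule minus_div_mult_eq_mod)
  ultimately show ?case
   by - ((rule hs_Asg_Sq, simp), (use r3 lt le in simp),
   (rule hs_Asg_Sq, simp), (use c in simp), (rule hs_Nop), (use r3 lt in \<open>simp add: v'_def c'_def\<close>))
  qed (use s2 y in auto)
 qed
 next
 assume "\<not> eval s1 (Var 53) < eval s1 (Var vw)"
 then show "hs (Asg 53 (Minus (Var 53) (Var vw))) s1 (%s2. reg s2 50 = v' & reg s2 53 = c')"
  by (intro hs_Asg) (auto simp: r1 v'_def c'_def)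
 qed auto
 show ?case
 proof (rule hs_Sq, rule hs_call[OF 2], goal_cases)
 case (1 s2)
 have wc: "x \<notin> writes ?c" if "x \<notin> {50, 53, 56, 57}" for x using w_shr that by auto
 have st2: "st s2" by (rule st_frame[OF st1]) (use 1 wc in auto)
 have r2: "reg s2 50 = v'" "reg s2 53 = c'" "reg s2 55 = a" "reg s2 49 = i * b + a * w" "reg s2 vw = w"
  "arr s2 0 = A" "arr s2 1 = E" "arr s2 2 = arr s 2"
  using 1 wc r1 by simp_all
 have ak: "a < k_out" using r k by simp
 then have aW: "a < W" using k_outW by simp
 have l2: "a + 1 < B ^ nd" using less_W_pow[OF aW, of 1] less_W_pow[OF W_gt1, of 1] K1
  by (intro lim_plus[of _ 1]) auto
 have l1: "i * b + a * w + w < B ^ nd" using p2 r less_W_pow[OF w_less, of 2] K1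
  by (intro lim_plus[of _ 2]) auto
 define s3 where "s3 = s2\<lparr>arr := (arr s2)(2 := (arr s2 2)[a := v'])\<rparr>"
 have st3: "st s3" by (rule st_frame[OF st2]) (auto simp: s3_def)
 show ?case
 proof (rule hs_Sq, rule hs_Sto, goal_cases)
  case 6
  have e: "s2\<lparr>arr := (arr s2)(2 := (arr s2 2)[eval s2 (Var 55) := eval s2 (Var 50)])\<rparr> = s3"
  by (simp add: s3_def r2)
  have r3: "reg s3 = reg s2" by (simp add: s3_def)
  have a3: "arr s3 0 = A" "arr s3 (Suc 0) = E" "arr s3 2 = (arr s 2)[a := v']"
  using r2 by (simp_all add: s3_def)
  have A2: "\<forall>a'<Suc a. (arr s 2)[a := v'] ! a' = D div W ^ a' mod W"
  using r Dv ak by (auto simp: less_Suc_eq nth_list_update)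
  show ?case unfolding e
  proof (rule hs_Asg_Sq, simp, goal_cases)
  case 2
  show ?case
  proof (rule hs_Asg_Sq, simp, goal_cases)
   case 2
   show ?case
   by (rule hs_Nop) (use st3 r k c' A2 a3 in \<open>simp add: inv_def r3 r2\<close>)
  qed (use l2 c in \<open>simp add: r2 r3\<close>)
  qed (use l1 in \<open>simp add: r2 r3\<close>)
 qed (use ak aW v'W r in \<open>simp_all add: r2 W_def[symmetric]\<close>)
 qed
qed
qed

lemma ht_extract:
assumes s: "start s" "reg s 8 = i mod W" "reg s 9 = i div W" "reg s 10 = m mod W" "reg s 11 = m div W"
 "arr s 2 = replicate k_out 0"
shows "\<exists>c. c = steps (cmp nd (extract_init K)) + (k_out + 1) * (steps (cmp nd (extract_step K)) + cost_test (Num 0) (Var 53)) + 1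
 & ht (extract_hl K) (%t s'. t <= c & arr s' 0 = A & arr s' 1 = E &
  arr s' 2 = map (%a. D div W ^ a mod W) [0..<k_out]) s"
proof (intro exI conjI, rule refl)
have 1: "hs (extract_init K) s (inv k_out)"
 unfolding extract_init_def seqs.simps
proof (rule hs_prepare_load[OF s(1)], goal_cases)
 case (1 s1)
 have r1: "reg s1 8 = i mod W" "reg s1 9 = i div W" "reg s1 10 = m mod W" "reg s1 11 = m div W"
 "reg s1 vb = b" "reg s1 vW = W"
 using 1 s by (auto simp: start_def st_def env_def)
 have le: "x mod W + x div W * W = x" "x div W * W <= x" for x by simp_all
 have mW: "m <= W" "i <= W" using im nW by auto
 have mb: "m * b <= W * w" "i * b <= W * w" using mW b by (auto intro: mult_le_mono)
 note l2 = W2_lim[OF Ww_less]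
 have W1: "W <= W * w" using w6 by simp
 have l: "m < B ^ nd" "i < B ^ nd" "m div W * W < B ^ nd" "i div W * W < B ^ nd" "m * b < B ^ nd" "i * b < B ^ nd"
 by (rule l2, use mW W1 le(2)[of m] le(2)[of i] mb in linarith)+
 have z: "(0::nat) < 2 ^ w" by simp
 show ?case
 apply (rule hs_Asg_Sq, simp)
 using r1 le l apply simp
 apply (rule hs_Asg_Sq, simp)
 using r1 le l apply simp
 apply (rule hs_Asg_Sq, simp, simp)
 by (rule hs_Nop) (use 1 s in \<open>auto simp: inv_def r1 start_def\<close>)
qed
show "ht (extract_hl K) (%t s'. t <= steps (cmp nd (extract_init K)) + (k_out + 1) * (steps (cmp nd (extract_step K)) + cost_test (Num 0) (Var 53)) + 1
 & arr s' 0 = A & arr s' 1 = E &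
  arr s' 2 = map (%a. D div W ^ a mod W) [0..<k_out]) s"
 unfolding extract_hl_def
proof (rule ht_Sq, rule ht_hs[OF 1])
 fix t s' assume t: "t <= steps (cmp nd (extract_init K))" and I: "inv k_out s'"
 have "ht (Whl (Num 0) (Var 53) (extract_step K))
 (%u s'. u <= (k_out + 1) * (steps (cmp nd (extract_step K)) + cost_test (Num 0) (Var 53)) + 1 & inv 0 s') s'"
 proof (rule ht_loop[where J = inv and k = k_out and c = "steps (cmp nd (extract_step K))"])
 fix k s assume I: "inv k s"
 have "0 < reg s 53 ==> ht (extract_step K) (%u s'. u <= steps (cmp nd (extract_step K)) & inv (k - 1) s') s"
  by (rule ht_hs[OF step[OF I]]) auto
 then show "safe s (Num 0) & safe s (Var 53) &
  (eval s (Num 0) < eval s (Var 53) -->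
  0 < k & ht (extract_step K) (%u s'. u <= steps (cmp nd (extract_step K)) & inv (k - 1) s') s) &
  (\<not> eval s (Num 0) < eval s (Var 53) --> inv 0 s)"
  using inv_iff[OF I] I by auto
 qed (use I in auto)
 then show "ht (Whl (Num 0) (Var 53) (extract_step K))
 (%u s'. t + u <= steps (cmp nd (extract_init K)) + (k_out + 1) * (steps (cmp nd (extract_step K)) + cost_test (Num 0) (Var 53)) + 1
 & arr s' 0 = A & arr s' 1 = E &
  arr s' 2 = map (%a. D div W ^ a mod W) [0..<k_out]) s'"
 by (rule ht_mono) (use t in \<open>auto simp: inv_def intro: nth_equalityI\<close>)
qed
qed

end

section \<open>Longest common extension queries\<close>

definition fp_at :: "nat \<Rightarrow> nat \<Rightarrow> ex \<Rightarrow> hl" where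
"fp_at K x p = seqs [Asg 49 (Times p (Var vb)), fingerprint K, Asg x (Var 50)]"

text \<open>Variable 64 receives the shift factor, 65 to 68 the fingerprints of the suffixes at both
  current positions and \<open>2 ^ k\<close> characters further on; 69 and 70 are the two sides of
  \<open>fingerprint_test\<close>, whose equality is tested by two strict comparisons. Query
  positions are below \<open>n <= W\<close>, so their low words 8 and 10 suffice.\<close>

definition compare :: "nat \<Rightarrow> hl" where
"compare K = seqs [Asg 64 (slot_ex K (Plus (Num 6) (Var 61))),
 fp_at K 65 (Plus (Var 8) (Var 60)), fp_at K 66 (Plus (Var 10) (Var 60)),
 fp_at K 67 (Plus (Plus (Var 8) (Var 60)) (Var 62)), fp_at K 68 (Plus (Plus (Var 10) (Var 60)) (Var 62)),
 Asg 69 (Plus (Var 65) (Times (Var 64) (Var 68))), reduce K 69,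
 Asg 70 (Plus (Var 66) (Times (Var 64) (Var 67))), reduce K 70,
 Asg 71 (Num 1), Iff (Var 69) (Var 70) (Asg 71 (Num 0)) Nop, Iff (Var 70) (Var 69) (Asg 71 (Num 0)) Nop]"

definition advance :: hl where
"advance = Sq (Asg 60 (Plus (Var 60) (Var 62))) (Asg 63 (Minus (Var 63) (Var 62)))"

text \<open>Variable 60 is the length matched so far, 61 and 62 are \<open>k\<close> and
  \<open>2 ^ k\<close>, 63 counts the characters left, and 72 is cleared to end the phase.\<close>

definition up_step :: "nat \<Rightarrow> hl" where
"up_step K = Iff (Var 63) (Var 62) (Asg 72 (Num 0))
 (Sq (compare K) (Iff (Num 0) (Var 71)
  (seqs [advance, Asg 61 (Plus (Var 61) (Num 1)), Asg 62 (Times (Num 2) (Var 62))])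
  (Asg 72 (Num 0))))"

definition down_step :: "nat \<Rightarrow> hl" where
"down_step K = seqs [Asg 61 (Minus (Var 61) (Num 1)), Asg 62 (Quo (Var 62) (Num 2)),
 Iff (Var 63) (Var 62) Nop (Sq (compare K) (Iff (Num 0) (Var 71) advance Nop))]"

definition lce_init :: "nat \<Rightarrow> hl" where
"lce_init K = seqs [prepare K, load K, Asg 60 (Num 0), Asg 61 (Num 0), Asg 62 (Num 1), Asg 72 (Num 1),
 Iff (Var 8) (Var 10) (Asg 63 (Minus (Var vn) (Var 10)))
 (Iff (Var 10) (Var 8) (Asg 63 (Minus (Var vn) (Var 8)))
  (seqs [Asg 60 (Minus (Var vn) (Var 8)), Asg 63 (Num 0), Asg 72 (Num 0)]))]"

text \<open>For \<open>i = j = 0\<close> and \<open>n = W\<close> the result is \<open>W\<close>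
  itself, the one value that needs a high word.\<close>

definition lce_final :: hl where
"lce_final = Iff (Var 60) (Var vW) (Sq (Asg 80 (Var 60)) (Asg 81 (Num 0)))
 (Sq (Asg 80 (Minus (Var 60) (Var vW))) (Asg 81 (Num 1)))"

definition lce_hl :: "nat \<Rightarrow> hl" where
"lce_hl K = Sq (lce_init K) (Sq (Whl (Num 0) (Var 72) (up_step K))
 (Sq (Whl (Num 0) (Var 61) (down_step K)) lce_final))"

lemma writes_fingerprint_iff: "x \<notin> {40, 41, 43, 44, 45, 46, 47, 48, 50, 51} ==> x \<notin> writes (fingerprint K)"
using writes_fingerprint[of K] by blast

lemma stores_compare [simp]: "stores (compare K) = {}"
and random_compare [simp]: "\<not> random (compare K)"
and hfree_compare [simp]: "hfree (compare K)"
by (simp_all add: compare_def fp_at_def)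

lemma writes_compare:
"x \<notin> {40, 41, 43, 44, 45, 46, 47, 48, 49, 50, 51, 64, 65, 66, 67, 68, 69, 70, 71} ==> x \<notin> writes (compare K)"
using writes_fingerprint_iff[of x K] by (auto simp: compare_def fp_at_def)

section \<open>Correctness and cost of exponential and binary search\<close>

locale lce_query = query +
fixes i j :: nat and T :: "nat list"
assumes i: "i < n" and j: "j < n" and T: "length T = n" and chars: "!!x. x \<in> set T ==> x < 2 ^ b"
 and XT: "X = tnum b T"
begin

definition part :: "nat \<Rightarrow> nat \<Rightarrow> nat" where
"part a d = X div 2 ^ (b * a) mod 2 ^ (b * d)"

lemma part_tnum: "a + d <= n ==> part a d = tnum b (take d (drop a T))"
using tnum_take_drop[of T b a d] chars T by (simp add: part_def flip: XT)

lemma part_eq_iff: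
assumes "a + d <= n" "c + d <= n"
shows "part a d = part c d \<longleftrightarrow> take d (drop a T) = take d (drop c T)"
proof
assume "part a d = part c d"
then have "tnum b (take d (drop a T)) = tnum b (take d (drop c T))"
 using assms by (simp only: part_tnum)
then show "take d (drop a T) = take d (drop c T)"
 by (rule tnum_inj[rotated 3]) (use assms T chars in \<open>auto dest!: in_set_takeD in_set_dropD\<close>)
qed (use assms in \<open>simp only: part_tnum\<close>)

text \<open>The only place where luck enters a query. It occurs as a premise inside the invariants
  and affects the answer alone; safety and running time are proved for every modulus.\<close>

definition good :: bool where
"good \<longleftrightarrow> (\<forall>l k. i + l + 2 ^ k <= n --> j + l + 2 ^ k <= n -->
 part (i + l) (2 ^ k) mod M = part (j + l) (2 ^ k) mod M --> part (i + l) (2 ^ k) = part (j + l) (2 ^ k))"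

abbreviation "\<Lambda> \<equiv> lce T i j"

lemma good_test:
assumes good "l + 2 ^ k <= n - max i j" "l <= \<Lambda>"
shows "part (i + l) (2 ^ k) mod M = part (j + l) (2 ^ k) mod M \<longleftrightarrow> l + 2 ^ k <= \<Lambda>"
proof -
have le: "i + l + 2 ^ k <= n" "j + l + 2 ^ k <= n" using assms(2) i j by auto
then have "part (i + l) (2 ^ k) mod M = part (j + l) (2 ^ k) mod M \<longleftrightarrow>
 part (i + l) (2 ^ k) = part (j + l) (2 ^ k)" using assms(1) unfolding good_def by metis
also have "\<dots> \<longleftrightarrow> take (2 ^ k) (drop (i + l) T) = take (2 ^ k) (drop (j + l) T)"
 using le by (intro part_eq_iff) auto
also have "\<dots> \<longleftrightarrow> l + 2 ^ k <= \<Lambda>"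
 using le assms(3) T by (intro lce_extend[symmetric]) auto
finally show ?thesis .
qed

lemma lce_le: "\<Lambda> <= n - max i j"
using lce_bound[of i T j] i j T by simp

definition cm :: "config \<Rightarrow> bool" where
"cm s \<longleftrightarrow> st s & arr s 0 = A & arr s 1 = E & reg s 8 = i & reg s 10 = j & reg s vb = b &
 reg s 60 + reg s 63 = n - max i j & (good --> reg s 60 <= \<Lambda>)"

lemma cm_frame:
assumes "cm s" "!!x. x < 36 \<or> x = 60 \<or> x = 63 ==> reg s' x = reg s x" "arr s' = arr s"
shows "cm s'"
proof -
have "st s'" by (rule st_frame[of s]) (use assms in \<open>auto simp: cm_def\<close>)
with assms show ?thesis unfolding cm_def by simp
qed

lemma nB: "n < B ^ nd"
proof -
have "n <= W * w" using nW w6 by (metis le_trans mult.right_neutral mult_le_mono one_le_numeral order_refl)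
then show ?thesis by (intro W2_lim Ww_less)
qed

lemma hs_fp_at:
assumes s: "st s" "reg s vb = b" "safe s p" "eval s p <= n" and x: "60 <= x" "x < nv"
 and Q: "!!s'. st s' ==> reg s' x = X div 2 ^ (b * eval s p) mod M ==>
 (!!y. (y < 36 \<or> 60 <= y) ==> y ~= x ==> reg s' y = reg s y) ==> arr s' = arr s ==> hs c s' Q"
shows "hs (Sq (fp_at K x p) c) s Q"
proof -
have "eval s p * b <= W * w" using s(4) nW b by (intro mult_le_mono) auto
then have p2: "eval s p * b < W ^ 2" by (rule Ww_less)
then have pl: "eval s p * b < B ^ nd" by (rule W2_lim)
define s1 where "s1 = set_reg 49 (eval s p * b) s"
have s1: "st s1" "reg s1 49 < W ^ 2" "reg s1 49 = b * eval s p" using s p2 by (simp_all add: s1_def)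
have "hs (fp_at K x p) s (%s'. st s' & reg s' x = X div 2 ^ (b * eval s p) mod M &
 (\<forall>y. (y < 36 \<or> 60 <= y) & y ~= x --> reg s' y = reg s y) & arr s' = arr s)"
 unfolding fp_at_def seqs.simps
proof (rule hs_Asg_Sq, simp, goal_cases)
 case 1
 show ?case using s pl by simp
next
 case 2
 have ev: "set_reg 49 (eval s (Times p (Var vb))) s = s1" by (simp add: s1_def s)
 show ?case unfolding ev
 proof (rule hs_Sq, rule hs_call[OF hs_fingerprint[OF s1(1,2)]], goal_cases)
 case (1 s2)
 have "st s2" by (rule st_frame[OF s1(1)]) (use 1 writes_fingerprint_iff in auto)
 then show ?case using 1 x writes_fingerprint_iff s1
  by (intro hs_Asg_Sq hs_Nop) (auto simp: s1_def mult.commute)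
 qed
qed
then show ?thesis by (intro hs_Sq, elim hs_mono) (auto intro!: Q)
qed

lemma hs_compare:
assumes c: "cm s" and k: "reg s 61 = k" "reg s 62 = 2 ^ k" "2 ^ k <= reg s 63"
shows "hs (compare K) s (%s'. reg s' 71 =
 (if part (i + reg s 60) (2 ^ k) mod M = part (j + reg s 60) (2 ^ k) mod M then 1 else 0))"
proof -
define l where "l = reg s 60"
from c have r: "st s" "arr s 1 = E" "reg s 8 = i" "reg s 10 = j" "reg s vb = b" "l + reg s 63 = n - max i j"
 by (auto simp: cm_def l_def)
then have le: "i + l + 2 ^ k <= n" "j + l + 2 ^ k <= n" using k(3) i j by auto
have kn: "2 ^ k <= n" using le by simp
have kk: "k < 2 ^ k" by (rule less_exp)
have k6: "6 + k < B ^ nd"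
proof -
 have "6 + k <= W * w" using kk kn nW w6 W_ge2 mult_le_mono[of 2 W 6 w] mult_le_mono[of W W 6 w] by linarith
 then show ?thesis by (intro W2_lim Ww_less)
qed
have W61: "6 < (2::nat) ^ w" "(1::nat) < 2 ^ w" "(0::nat) < 2 ^ w" using num_less[of 6] W_gt1 by (auto simp: W_def)
define P where "P = 2 ^ (b * 2 ^ k) mod M"
define s1 where "s1 = set_reg 64 P s"
have e: "env s" using r by (simp add: st_def)
have sl: "safe s (slot_ex K (Plus (Num 6) (Var 61)))" "eval s (slot_ex K (Plus (Num 6) (Var 61))) = P"
 using slot_ex[OF e r(2), of "Plus (Num 6) (Var 61)"] k k6 W61 E_len(3)[OF kn] E_val(7)[OF kn]
 by (auto simp: P_def)
have s1: "st s1" "reg s1 vb = b" using r by (auto simp: s1_def)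
have lB: "x <= n ==> x < B ^ nd" for x using nB by simp
have PM: "P < M" using M by (simp add: P_def)
define S where "S p = X div 2 ^ (b * p) mod M" for p
have SM: "S p < M" for p using M by (simp add: S_def)
have Pl: "P * S p < W ^ (4 * K)" for p
proof -
 have "P * S p < W ^ (2 * K) * W ^ (2 * K)" using PM SM MW' by (intro mult_strict_mono') auto
 then show ?thesis by (simp flip: power_add)
qed
have Sl: "S q + P * S p < W ^ (5 * K)" "P * S p < B ^ nd" "S q + P * S p < B ^ nd" for p q
proof -
 have "S q < W ^ (4 * K)" using MW'[OF SM] wpow_less[of "2 * K" "4 * K"] K1 by (meson less_trans mult_less_cancel2 less_le_trans zero_less_one numeral_less_iff rel_simps(76) semiring_norm(78) semiring_norm(80) semiring_norm(76))
 then have "S q + P * S p < 2 * W ^ (4 * K)" using Pl[of p] by linarith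
 also have "\<dots> <= W * W ^ (4 * K)" using W_ge2 by (rule mult_le_mono1)
 also have "\<dots> <= W ^ (5 * K)" using K1 W_pos power_increasing[of "Suc (4 * K)" "5 * K" W] by simp
 finally show 1: "S q + P * S p < W ^ (5 * K)" .
 then show "S q + P * S p < B ^ nd" by (rule lim) simp
 then show "P * S p < B ^ nd" by simp
qed
have fin: "(S (i + l) + P * S (j + l + 2 ^ k)) mod M = (S (j + l) + P * S (i + l + 2 ^ k)) mod M \<longleftrightarrow>
 part (i + l) (2 ^ k) mod M = part (j + l) (2 ^ k) mod M"
proof -
 have sp: "X div 2 ^ (b * (a + l + 2 ^ k)) = X div 2 ^ (b * (a + l)) div 2 ^ (b * 2 ^ k)" for a
 by (simp add: div_mult2_eq[symmetric] flip: power_add) (simp add: algebra_simps)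
 show ?thesis unfolding S_def sp P_def
 by (rule fingerprint_test) (simp_all add: part_def)
qed
show ?thesis unfolding compare_def seqs.simps l_def[symmetric]
proof (rule hs_Asg_Sq, simp, rule sl, unfold sl s1_def[symmetric],
 rule hs_fp_at[OF s1], goal_cases)
 case (5 s2)
 have r2: "reg s2 8 = i" "reg s2 10 = j" "reg s2 vb = b" "reg s2 60 = l" "reg s2 62 = 2 ^ k" "reg s2 64 = P"
 "reg s2 65 = S (i + l)"
 using 5 r k by (auto simp: s1_def S_def l_def)
 show ?case
 proof (rule hs_fp_at[OF 5(1) r2(3)], goal_cases)
 case (5 s3)
 have r3: "reg s3 8 = i" "reg s3 10 = j" "reg s3 vb = b" "reg s3 60 = l" "reg s3 62 = 2 ^ k" "reg s3 64 = P"
  "reg s3 65 = S (i + l)" "reg s3 66 = S (j + l)"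
  using 5 r2 by (auto simp: S_def)
 show ?case
 proof (rule hs_fp_at[OF 5(1) r3(3)], goal_cases)
  case (5 s4)
  have r4: "reg s4 8 = i" "reg s4 10 = j" "reg s4 vb = b" "reg s4 60 = l" "reg s4 62 = 2 ^ k" "reg s4 64 = P"
  "reg s4 65 = S (i + l)" "reg s4 66 = S (j + l)" "reg s4 67 = S (i + l + 2 ^ k)"
  using 5 r3 by (auto simp: S_def)
  show ?case
  proof (rule hs_fp_at[OF 5(1) r4(3)], goal_cases)
  case (5 s5)
  have r5: "reg s5 64 = P" "reg s5 65 = S (i + l)" "reg s5 66 = S (j + l)"
   "reg s5 67 = S (i + l + 2 ^ k)" "reg s5 68 = S (j + l + 2 ^ k)" "env s5" "modulus s5 M"
   using 5 r4 by (auto simp: S_def st_def)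
  define a c where "a = S (i + l) + P * S (j + l + 2 ^ k)" and "c = S (j + l) + P * S (i + l + 2 ^ k)"
  have e5: "eval s5 (Plus (Var 65) (Times (Var 64) (Var 68))) = a" by (simp add: r5 a_def)
  show ?case
  proof (rule hs_Asg_Sq, simp, (use r5 Sl in simp), unfold e5, rule hs_Sq, rule hs_reduce[of _ M], goal_cases)
   case (7 q)
   define s6 where "s6 = set_reg 69 (a mod M) (set_reg 40 q (set_reg 69 a s5))"
   have s6: "set_reg 69 (reg (set_reg 69 a s5) 69 mod M) (set_reg 40 q (set_reg 69 a s5)) = s6"
   by (simp add: s6_def)
   have r6: "reg s6 69 = a mod M" "env s6" "modulus s6 M" using r5 by (auto simp: s6_def)
   have e6: "eval s6 (Plus (Var 66) (Times (Var 64) (Var 67))) = c" by (simp add: s6_def r5 c_def)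
   have sf6: "safe s6 (Plus (Var 66) (Times (Var 64) (Var 67)))" using r5 Sl by (simp add: s6_def)
   show ?case unfolding s6
   proof (rule hs_Asg_Sq, simp, rule sf6, unfold e6, rule hs_Sq, rule hs_reduce[of _ M], goal_cases)
   case (7 q')
   have r7: "reg (set_reg 70 (reg (set_reg 70 c s6) 70 mod M) (set_reg 40 q' (set_reg 70 c s6))) 69 = a mod M"
    "reg (set_reg 70 (reg (set_reg 70 c s6) 70 mod M) (set_reg 40 q' (set_reg 70 c s6))) 70 = c mod M"
    using r6 by auto
   then obtain s7 where s7: "set_reg 70 (reg (set_reg 70 c s6) 70 mod M) (set_reg 40 q' (set_reg 70 c s6)) = s7"
    "reg s7 69 = a mod M" "reg s7 70 = c mod M" by blast
   show ?case unfolding s7(1)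
   proof (rule hs_Asg_Sq, simp, (use W61 in simp), rule hs_Sq, rule hs_Iff, goal_cases)
    case 5
    then have "a mod M < c mod M" using s7 by simp
    then show ?case using W61 fin s7
    by (intro hs_Asg hs_Sq hs_Iff hs_Nop) (auto simp: a_def c_def)
   next
    case 6
    then have "\<not> a mod M < c mod M" using s7 by simp
    then show ?case using W61 fin s7
    by (intro hs_Nop hs_Sq, intro hs_Iff hs_Asg hs_Nop) (auto simp: a_def c_def intro!: hs_Nop)
   qed auto
   qed (use r6 Sl in \<open>auto simp: c_def\<close>)
  qed (use r5 Sl in \<open>auto simp: a_def\<close>)
  qed (use r4 le lB in auto)
 qed (use r3 le lB in auto)
 qed (use r2 le lB in auto)
qed (use s1_def r le lB l_def in auto)
qed

lemma hs_compare_Sq: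
assumes c: "cm s" and k: "reg s 61 = k" "reg s 62 = 2 ^ k" "2 ^ k <= reg s 63"
 and Q: "!!s'. cm s' ==> (!!x. x \<in> {60, 61, 62, 63, 72} ==> reg s' x = reg s x) ==>
 reg s' 71 <= 1 ==>
 (good ==> reg s' 71 = 1 \<longleftrightarrow> reg s 60 + 2 ^ k <= \<Lambda>) ==> hs d s' Q"
shows "hs (Sq (compare K) d) s Q"
proof (rule hs_Sq, rule hs_call[OF hs_compare[OF c k]], goal_cases)
case (1 s')
have "cm s'" by (rule cm_frame[OF c]) (use 1 writes_compare in auto)
then show ?case
proof (rule Q)
 assume g: good
 have "reg s 60 + 2 ^ k <= n - max i j" "reg s 60 <= \<Lambda>" using c k g by (auto simp: cm_def)
 from good_test[OF g this] 1(1) show "reg s' 71 = 1 \<longleftrightarrow> reg s 60 + 2 ^ k <= \<Lambda>" by simp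
qed (use 1 writes_compare in auto)
qed

text \<open>After \<open>k\<close> successful rounds at least
  \<open>1 + 2 + ... + 2 ^ (k - 1) = 2 ^ k - 1\<close> characters count as matched. The matched
  length never shrinks later, so the number of rounds is logarithmic in the value returned, even if
  comparisons err.\<close>

definition up :: "nat \<Rightarrow> config \<Rightarrow> bool" where
"up k s \<longleftrightarrow> cm s & reg s 61 = k & reg s 62 = 2 ^ k & 2 ^ k <= reg s 60 + 1 & reg s 72 <= 1 &
 (reg s 72 = 0 --> good --> \<Lambda> < reg s 60 + 2 ^ k)"

text \<open>The answer lies in an interval of length \<open>2 ^ k\<close> that begins at the matched
  length; at \<open>k = 0\<close> this determines it.\<close>

definition down :: "nat \<Rightarrow> config \<Rightarrow> bool" where
"down k s \<longleftrightarrow> cm s & reg s 61 = k & reg s 62 = 2 ^ k & (good --> \<Lambda> < reg s 60 + 2 ^ k)"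

lemma cm_n: "cm s ==> reg s 60 <= n" "cm s ==> reg s 63 <= n" "cm s ==> reg s 60 + reg s 63 <= n"
by (auto simp: cm_def)

lemma n2B: "x <= 2 * n ==> x < B ^ nd"
proof -
assume "x <= 2 * n"
also have "\<dots> <= w * W" using w6 nW by (intro mult_le_mono) auto
finally show ?thesis by (intro W2_lim Ww_less) (simp add: mult.commute)
qed

lemma cm_set_reg: "36 <= x ==> x ~= 60 ==> x ~= 63 ==> cm (set_reg x v s) = cm s"
by (simp add: cm_def)

lemma hs_advance:
assumes c: "cm s" and k: "reg s 62 = 2 ^ k" "2 ^ k <= reg s 63" "good ==> reg s 60 + 2 ^ k <= \<Lambda>"
 and Q: "cm (set_reg 63 (reg s 63 - 2 ^ k) (set_reg 60 (reg s 60 + 2 ^ k) s)) ==>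
 Q (set_reg 63 (reg s 63 - 2 ^ k) (set_reg 60 (reg s 60 + 2 ^ k) s))"
shows "hs advance s Q"
proof -
have "cm (set_reg 63 (reg s 63 - 2 ^ k) (set_reg 60 (reg s 60 + 2 ^ k) s))"
 using c k by (auto simp: cm_def)
moreover have "reg s 60 + 2 ^ k < B ^ nd" by (rule n2B) (use cm_n[OF c] k in linarith)
ultimately show ?thesis using k Q unfolding advance_def
 by (intro hs_Asg_Sq hs_Asg) auto
qed

lemma up_step:
assumes u: "up k s" "reg s 72 = 1"
shows "hs (up_step K) s (%s'. up k s' & reg s' 72 = 0 \<or> up (Suc k) s' & reg s' 72 = 1 & reg s' 63 < reg s 63)"
proof -
from u have c: "cm s" and k: "reg s 61 = k" "reg s 62 = 2 ^ k" "2 ^ k <= reg s 60 + 1" by (auto simp: up_def)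
have W1: "(1::nat) < 2 ^ w" "(0::nat) < 2 ^ w" "(2::nat) < 2 ^ w" using num_less[of 2] W_gt1 by (auto simp: W_def)
show ?thesis unfolding up_step_def
proof (rule hs_Iff, goal_cases)
 case 5
 then have "\<Lambda> < reg s 60 + 2 ^ k" using lce_le c k by (auto simp: cm_def)
 then show ?case using c k u W1 by (intro hs_Asg) (auto simp: up_def cm_set_reg)
next
 case 6
 then have rem: "2 ^ k <= reg s 63" using k by simp
 show ?case
 proof (rule hs_compare_Sq[OF c k(1,2) rem], goal_cases)
 case (1 s1)
 note s1 = this
 have r1: "reg s1 61 = k" "reg s1 62 = 2 ^ k" "reg s1 60 = reg s 60" "reg s1 63 = reg s 63" "reg s1 72 = 1"
  using s1 k u by auto
 show ?case
 proof (rule hs_Iff, goal_cases)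
  case 5
  then have "reg s1 71 = 1" using s1 by simp
  then have g: "good ==> reg s1 60 + 2 ^ k <= \<Lambda>" using s1 r1 by simp
  show ?case unfolding seqs.simps
  proof (rule hs_Sq, rule hs_advance[OF s1(1) r1(2) _ g], goal_cases)
  case 3
  have le: "2 ^ k <= n" using cm_n[OF c] rem by simp
  have rp: "0 < reg s 63" by (rule less_le_trans[OF _ rem]) simp
  have kk: "k < 2 ^ k" by (rule less_exp)
  have l: "k + 1 < B ^ nd" "2 * 2 ^ k < B ^ nd"
   by (rule n2B, use kk le in linarith)+
  show ?case
   by (rule hs_Asg_Sq, simp, (use r1 l W1 in simp), rule hs_Asg_Sq, simp, (use r1 l W1 in simp), rule hs_Nop)
   (use 3 r1 k rp in \<open>auto simp: up_def cm_set_reg\<close>)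
  qed (use rem r1 in auto)
 next
  case 6
  then have "good ==> \<Lambda> < reg s1 60 + 2 ^ k" using s1 r1 by fastforce
  then show ?case using s1 r1 k W1 by (intro hs_Asg) (auto simp: up_def cm_set_reg)
 qed (use W1 in \<open>auto simp: advance_def\<close>)
 qed
qed (auto simp: advance_def)
qed

lemma down_step:
assumes d: "down (Suc k) s"
shows "hs (down_step K) s (%s'. down k s' & reg s 60 <= reg s' 60)"
proof -
from d have c: "cm s" and k: "reg s 61 = Suc k" "reg s 62 = 2 * 2 ^ k" "good ==> \<Lambda> < reg s 60 + 2 * 2 ^ k"
 by (auto simp: down_def)
have W1: "(1::nat) < 2 ^ w" "(0::nat) < 2 ^ w" "(2::nat) < 2 ^ w" using num_less[of 2] W_gt1 by (auto simp: W_def)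
define s1 where "s1 = set_reg 62 (2 ^ k) (set_reg 61 k s)"
have c1: "cm s1" using c by (simp add: s1_def cm_set_reg)
have r1: "reg s1 61 = k" "reg s1 62 = 2 ^ k" "reg s1 60 = reg s 60" "reg s1 63 = reg s 63"
 by (auto simp: s1_def)
have st1: "set_reg 62 (eval (set_reg 61 (eval s (Minus (Var 61) (Num 1))) s) (Quo (Var 62) (Num 2)))
 (set_reg 61 (eval s (Minus (Var 61) (Num 1))) s) = s1"
 using k by (simp add: s1_def)
have d2: "2 * B <= 2 ^ w" by (rule small_div) (use K1 in simp)
show ?thesis unfolding down_step_def seqs.simps
proof (rule hs_Asg_Sq, simp, (use k W1 in simp), rule hs_Asg_Sq, simp, (use k W1 d2 in simp), unfold st1,
 rule hs_Sq, rule hs_Iff, goal_cases)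
 case 5
 then have "reg s 63 < 2 ^ k" using r1 by simp
 then have "\<Lambda> < reg s 60 + 2 ^ k" using lce_le c by (auto simp: cm_def)
 then show ?case using c1 r1 by (intro hs_Nop) (auto simp: down_def)
next
 case 6
 then have rem: "2 ^ k <= reg s1 63" using r1 by simp
 show ?case
 proof (rule hs_compare_Sq[OF c1 r1(1,2) rem], goal_cases)
 case (1 s2)
 note s2 = this
 have r2: "reg s2 61 = k" "reg s2 62 = 2 ^ k" "reg s2 60 = reg s 60" "reg s2 63 = reg s 63"
  using s2 r1 by auto
 show ?case
 proof (rule hs_Iff, goal_cases)
  case 5
  then have "reg s2 71 = 1" using s2 by simp
  then have g: "good ==> reg s2 60 + 2 ^ k <= \<Lambda>" using s2 r1 r2 by simp
  show ?case
  by (rule hs_advance[OF s2(1) r2(2) _ g])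
   (use rem r1 r2 k in \<open>auto simp: down_def intro!: hs_Nop\<close>)
 next
  case 6
  then have "good ==> \<Lambda> < reg s2 60 + 2 ^ k" using s2 r1 r2 by fastforce
  then show ?case using s2 r2 by (intro hs_Nop) (auto simp: down_def)
 qed (use W1 in \<open>auto simp: advance_def\<close>)
 qed
qed (auto simp: advance_def)
qed

lemma hs_lce_init:
assumes s: "start s" "reg s 8 = i" "reg s 10 = j"
shows "hs (lce_init K) s (up 0)"
unfolding lce_init_def seqs.simps
proof (rule hs_prepare_load[OF s(1)], goal_cases)
case (1 s1)
have W1: "(1::nat) < 2 ^ w" "(0::nat) < 2 ^ w" using W_gt1 by (auto simp: W_def)
have r1: "reg s1 8 = i" "reg s1 10 = j" "reg s1 vn = n" "reg s1 vb = b" "arr s1 0 = A" "arr s1 1 = E"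
 using 1 s by (auto simp: start_def)
define s2 where "s2 = set_reg 72 1 (set_reg 62 1 (set_reg 61 0 (set_reg 60 0 s1)))"
have st2: "st s2" using 1 by (simp add: s2_def)
have r2: "reg s2 8 = i" "reg s2 10 = j" "reg s2 vn = n" "reg s2 vb = b" "arr s2 0 = A" "arr s2 1 = E"
 "reg s2 60 = 0" "reg s2 61 = 0" "reg s2 62 = 1" "reg s2 72 = 1"
 using r1 by (auto simp: s2_def)
have *: "hs (Iff (Var 8) (Var 10) (Asg 63 (Minus (Var vn) (Var 10)))
 (Iff (Var 10) (Var 8) (Asg 63 (Minus (Var vn) (Var 8)))
  (seqs [Asg 60 (Minus (Var vn) (Var 8)), Asg 63 (Num 0), Asg 72 (Num 0)]))) s2 (up 0)"
proof (rule hs_Iff, goal_cases)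
 case 5
 then show ?case using st2 r2 i j
 by (intro hs_Asg) (auto simp: up_def cm_def max_def)
next
 case 6
 note ij = this
 show ?case
 proof (rule hs_Iff, goal_cases)
 case 5
 then show ?case using st2 r2 i j
  by (intro hs_Asg) (auto simp: up_def cm_def max_def)
 next
 case 6
 then have "i = j" using ij r2 by simp
 then have mx: "max i j = i" "\<Lambda> = n - i" using lce_refl[of T i] T by simp_all
 then have "up 0 (set_reg 72 0 (set_reg 63 0 (set_reg 60 (n - i) s2)))"
  using st2 mx by (simp add: up_def cm_def r2 r2(6)[unfolded One_nat_def])
 then show ?case unfolding seqs.simps
  by (intro hs_Asg_Sq hs_Nop) (simp_all add: r2 less_imp_le[OF i])
 qed auto
qed auto
show ?case
 apply (rule hs_Asg_Sq, simp, simp add: W1)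
 apply (rule hs_Asg_Sq, simp, simp add: W1)
 apply (rule hs_Asg_Sq, simp, simp add: W1[unfolded One_nat_def])
 apply (rule hs_Asg_Sq, simp, simp add: W1[unfolded One_nat_def])
 apply (rule hs_Sq, rule hs_mono[of _ _ "up 0"])
 using * unfolding s2_def seqs.simps by (auto intro: hs_Nop)
qed

lemma hs_lce_final:
assumes c: "cm s"
shows "hs lce_final s (%s'. arr s' = arr s & reg s' 80 + W * reg s' 81 = reg s 60 & reg s' 80 < W & reg s' 81 < W)"
proof -
have e: "reg s vW = W" using c by (simp add: cm_def st_def env_def)
have W1: "(1::nat) < 2 ^ w" "(0::nat) < 2 ^ w" using W_gt1 by (auto simp: W_def)
have le: "reg s 60 <= W" using cm_n(1)[OF c] nW by simp
show ?thesis unfolding lce_final_def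
 by (rule hs_Iff; (rule hs_Asg_Sq)?; (rule hs_Asg)?)
 (use e W1 le W_gt1 in \<open>auto simp: W_def[symmetric]\<close>)
qed

definition c_up :: nat where "c_up = steps (cmp nd (up_step K)) + cost_test (Num 0) (Var 72)"
definition c_down :: nat where "c_down = steps (cmp nd (down_step K)) + cost_test (Num 0) (Var 61)"

text \<open>Termination and time of the upward phase are separated: the measure is the number of
  characters left, which may be linear in \<open>n\<close>, while time is charged to the exponent
  \<open>k\<close>, which every successful round increases.\<close>

lemma ht_lce:
assumes s: "start s" "reg s 8 = i" "reg s 10 = j"
shows "ht (lce_hl K) (%t s'. \<exists>k l. t <= steps (cmp nd (lce_init K)) + ((k + 2) * c_up + 1) +
 ((k + 1) * c_down + 1) + steps (cmp nd lce_final) & 2 ^ k <= l + 1 & (good --> l = \<Lambda>) &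
 arr s' 0 = A & arr s' 1 = E & reg s' 80 + W * reg s' 81 = l & reg s' 80 < W & reg s' 81 < W) s"
(is "ht _ ?Q s")
unfolding lce_hl_def
proof (rule ht_Sq, rule ht_hs[OF hs_lce_init[OF s]])
fix t1 s1 assume t1: "t1 <= steps (cmp nd (lce_init K))" and u1: "up 0 s1"
\<comment> \<open>The term \<open>1 - reg s 72\<close> becomes 1 when the flag is cleared and pays
  for the round that failed; the final 1 pays for the test before the first round.\<close>
let ?I = "%m t s. \<exists>k. up k s & t <= (k + (1 - reg s 72) + 1) * c_up & m = (if reg s 72 = 0 then 0 else reg s 63 + 1)"
let ?R = "%t s. \<exists>k. up k s & t <= (k + 2) * c_up + 1 & reg s 72 = 0"
have "ht (Whl (Num 0) (Var 72) (up_step K)) ?R s1"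
proof (rule ht_Whl[where I = ?I and k = "if reg s1 72 = 0 then 0 else reg s1 63 + 1"])
 fix m t s assume "?I m t s"
 then obtain k where k: "up k s" "t <= (k + (1 - reg s 72) + 1) * c_up" "m = (if reg s 72 = 0 then 0 else reg s 63 + 1)"
 by blast
 have 1: "ht (up_step K) (%u s'. \<forall>v\<le>cost_test (Num 0) (Var 72). \<exists>k'<m. ?I k' (t + u + v) s') s"
 if "reg s 72 = 1"
 proof (rule ht_hs[OF up_step[OF k(1) that]], intro allI impI)
 fix u v s' assume u: "u <= steps (cmp nd (up_step K))" "v <= cost_test (Num 0) (Var 72)"
  and s': "up k s' & reg s' 72 = 0 \<or> up (Suc k) s' & reg s' 72 = 1 & reg s' 63 < reg s 63"
 have uv: "u + v <= c_up" using u by (simp add: c_up_def)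
 have t: "t <= (k + 1) * c_up" using k(2) that by simp
 show "\<exists>k'<m. ?I k' (t + u + v) s'"
 proof (rule exI[of _ "if reg s' 72 = 0 then 0 else reg s' 63 + 1"], intro conjI)
  show "(if reg s' 72 = 0 then 0 else reg s' 63 + 1) < m" using k(3) that s' by auto
  show "?I (if reg s' 72 = 0 then 0 else reg s' 63 + 1) (t + u + v) s'"
  using s' uv t by (auto intro!: exI[of _ "reg s' 61"] simp: up_def)
 qed
 qed
 have le1: "reg s 72 <= 1" using k by (simp add: up_def)
 show "safe s (Num 0) & safe s (Var 72) &
 (eval s (Num 0) < eval s (Var 72) --> ht (up_step K) (%u s'. \<forall>v\<le>cost_test (Num 0) (Var 72). \<exists>k'<m. ?I k' (t + u + v) s') s) &
 (\<not> eval s (Num 0) < eval s (Var 72) --> ?R (t + 1) s)"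
 proof (intro conjI impI)
 assume "eval s (Num 0) < eval s (Var 72)"
 then have "reg s 72 = 1" using le1 by simp
 then show "ht (up_step K) (%u s'. \<forall>v\<le>cost_test (Num 0) (Var 72). \<exists>k'<m. ?I k' (t + u + v) s') s" by (rule 1)
 next
 assume "\<not> eval s (Num 0) < eval s (Var 72)"
 then show "?R (t + 1) s" using k by (intro exI[of _ k]) auto
 qed auto
next
 fix t assume "t <= cost_test (Num 0) (Var 72)"
 then have "t <= c_up" by (simp add: c_up_def)
 also have "c_up <= (0 + (1 - reg s1 72) + 1) * c_up" by simp
 finally show "?I (if reg s1 72 = 0 then 0 else reg s1 63 + 1) t s1" using u1 by blast
qed
then show "ht (Sq (Whl (Num 0) (Var 72) (up_step K)) (Sq (Whl (Num 0) (Var 61) (down_step K)) lce_final))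
 (%u. ?Q (t1 + u)) s1"
proof (intro ht_Sq, elim ht_mono, elim exE conjE)
 fix t2 s2 k assume u2: "up k s2" "t2 <= (k + 2) * c_up + 1" "reg s2 72 = 0"
 then have d2: "down k s2" "2 ^ k <= reg s2 60 + 1" by (auto simp: up_def down_def)
 have "ht (Whl (Num 0) (Var 61) (down_step K))
 (%u s'. u <= (k + 1) * c_down + 1 & (down 0 s' & reg s2 60 <= reg s' 60)) s2"
 proof (rule ht_loop[where J = "%k s. down k s & reg s2 60 <= reg s 60" and k = k and c = "steps (cmp nd (down_step K))"])
 fix k s assume d: "down k s & reg s2 60 <= reg s 60"
 have "ht (down_step K) (%u s'. u <= steps (cmp nd (down_step K)) & down (k - 1) s' & reg s2 60 <= reg s' 60) s"
  if k: "0 < k"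
 proof -
  have "down (Suc (k - 1)) s" using d k by simp
  from ht_hs[OF down_step[OF this]] d show ?thesis by fastforce
 qed
 then show "safe s (Num 0) & safe s (Var 61) &
  (eval s (Num 0) < eval s (Var 61) --> 0 < k &
  ht (down_step K) (%u s'. u <= steps (cmp nd (down_step K)) & down (k - 1) s' & reg s2 60 <= reg s' 60) s) &
  (\<not> eval s (Num 0) < eval s (Var 61) --> down 0 s & reg s2 60 <= reg s 60)"
  using d by (auto simp: down_def)
 qed (use d2 in \<open>auto simp: c_down_def\<close>)
 then show "ht (Sq (Whl (Num 0) (Var 61) (down_step K)) lce_final) (%u. ?Q (t1 + (t2 + u))) s2"
 proof (intro ht_Sq, elim ht_mono, elim conjE)
 fix t3 s3 assume d3: "t3 <= (k + 1) * c_down + 1" "down 0 s3" "reg s2 60 <= reg s3 60"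
 then have c3: "cm s3" "good ==> reg s3 60 = \<Lambda>" by (auto simp: down_def cm_def)
 show "ht lce_final (%u. ?Q (t1 + (t2 + (t3 + u)))) s3"
 proof (rule ht_hs[OF hs_lce_final[OF c3(1)]])
  fix t4 and s4 :: config assume t4: "t4 <= steps (cmp nd lce_final)"
  and "arr s4 = arr s3 & reg s4 80 + W * reg s4 81 = reg s3 60 & reg s4 80 < W & reg s4 81 < W"
  then show "?Q (t1 + (t2 + (t3 + t4))) s4"
  using t1 u2(2) d3 d2(2) c3 by (intro exI[of _ k] exI[of _ "reg s3 60"]) (auto simp: cm_def)
 qed
 qed
qed
qed

end

section \<open>Choice of the modulus\<close>

context machine
begin

text \<open>For the construction a fixed bound per command is enough, unlike for LCE queries, whose
  time depends on their result.\<close>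

definition hb :: "nat \<Rightarrow> hl \<Rightarrow> config \<Rightarrow> (config \<Rightarrow> bool) \<Rightarrow> bool" where
"hb T c s P \<longleftrightarrow> ht c (%t s'. t <= T & P s') s"

lemma hb_Sq:
assumes "hb T1 p s P" "!!s'. P s' ==> hb T2 q s' Q"
shows "hb (T1 + T2) (Sq p q) s Q"
unfolding hb_def
proof (rule ht_Sq, rule ht_mono[OF assms(1)[unfolded hb_def]])
fix t s' assume "t <= T1 & P s'"
then have "ht q (%u s'. u <= T2 & Q s') s'" using assms(2)[unfolded hb_def] by simp
then show "ht q (%u s'. t + u <= T1 + T2 & Q s') s'"
 by (rule ht_mono) (use \<open>t <= T1 & P s'\<close> in auto)
qed

lemma hb_hs: "hs c s P ==> hb (steps (cmp nd c)) c s P"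
unfolding hb_def by (erule ht_hs) auto

lemma hb_mono: "hb T c s P ==> T <= T' ==> (!!s'. P s' ==> Q s') ==> hb T' c s Q"
unfolding hb_def by (erule ht_mono) auto

lemma hb_Iff:
assumes "safe s a" "safe s b" "eval s a < eval s b ==> hb T p s Q" "\<not> eval s a < eval s b ==> hb T q s Q"
shows "hb (cost_test a b + T) (Iff a b p q) s Q"
unfolding hb_def
proof (rule ht_Iff[OF assms(1,2)])
fix v assume "v <= cost_test a b"
then show "ht (if eval s a < eval s b then p else q) (%u s'. v + u <= cost_test a b + T & Q s') s"
 using assms(3,4) unfolding hb_def by (auto elim!: ht_mono)
qed

lemma hb_loop:
assumes "!!k s. J k s ==> safe s a & safe s b &
 (eval s a < eval s b --> 0 < k & hb c p s (J (k - 1))) & (\<not> eval s a < eval s b --> P s)"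
 and "J k s"
shows "hb ((k + 1) * (c + cost_test a b) + 1) (Whl a b p) s P"
unfolding hb_def by (rule ht_loop[where J = J and k = k and c = c]) (use assms in \<open>auto simp: hb_def\<close>)

lemma hb_hrep:
assumes "!!k s. k < n ==> I k s ==> hb c p s (I (Suc k))" "I 0 s"
shows "hb (1 + n * c) (hrep n p) s (I n)"
proof -
have "m <= n ==> hb (1 + m * c) (hrep m p) s (I m)" for m
proof (induction m)
 case 0
 have "hs Nop s (I 0)" using assms(2) by (rule hs_Nop)
 from hb_hs[OF this] show ?case by simp
next
 case (Suc m)
 then have "hb (1 + m * c) (hrep m p) s (I m)" by simp
 from hb_Sq[OF this assms(1)] Suc.prems have "hb (1 + m * c + c) (Sq (hrep m p) p) s (I (Suc m))" by simp
 then show ?case by (simp add: ac_simps)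
qed
then show ?thesis by simp
qed

end

definition lg_step :: hl where
"lg_step = Sq (Asg 61 (Times (Num 2) (Var 61))) (Asg 60 (Plus (Var 60) (Num 1)))"

definition lg_hl :: hl where
"lg_hl = Sq (Sq (Asg 60 (Num 0)) (Asg 61 (Num 1)))
 (Whl (Times (Num 2) (Var 61)) (Plus (Var vn) (Num 1)) lg_step)"

text \<open>A modulus of at most one digit is an admissible divisor, so its reciprocal is a single
  expression.\<close>

definition word_modulus :: "nat \<Rightarrow> hl" where
"word_modulus K = seqs [Rnd vM, Asg vM (Rem (Var vM) (Var vH)), Iff (Num 0) (Var vM) Nop (Asg vM (Num 1)),
 Asg vU (Quo (wpow (5 * K)) (Var vM))]"

definition trial_step :: hl where
"trial_step = Sq (Iff (Var 69) (Var 66) (Iff (Num 0) (Rem (Var 66) (Var 69)) Nop (Asg 68 (Num 0))) Nop)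
 (Asg 69 (Plus (Var 69) (Num 1)))"

text \<open>A candidate of about \<open>5 * l / 4\<close> bits may exceed one word, so two random
  words contribute half of the bits each.\<close>

definition candidate :: hl where
"candidate = seqs [Rnd 66, Rnd 67,
 Asg 66 (Plus (Rem (Var 66) (Var 63)) (Times (Var 63) (Rem (Var 67) (Var 63)))), Asg 68 (Num 1), Asg 69 (Num 2)]"

definition accept :: hl where
"accept = seqs [Iff (Var 66) (Num 2) (Asg 68 (Num 0)) Nop, Iff (Num 0) (Var 68) (Asg 64 (Var 66)) Nop,
 Asg 65 (Minus (Var 65) (Num 1))]"

definition try_prime :: hl where
"try_prime = Sq candidate (Sq (Whl (Var 69) (Plus (Var 63) (Num 1)) trial_step) accept)"

text \<open>\<open>l ^ 3\<close> candidates make it unlikely that none is prime, while trial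
  division up to \<open>2 ^ (5 * l div 8)\<close> for each of them still costs
  \<open>O(2 ^ l)\<close>.\<close>

definition slot_hl :: hl where
"slot_hl = Sq (Sq (Asg 64 (Num 1)) (Asg 65 (Times (Times (Var 60) (Var 60)) (Var 60))))
 (Sq (Whl (Num 0) (Var 65) try_prime) (Asg vM (Times (Var vM) (Var 64))))"

definition recip_init :: "nat \<Rightarrow> hl" where
"recip_init K = Sq (Iff (Num 1) (Var vM) (Sq (Asg 70 (Num 1)) (Asg vU (Num 0))) (Sq (Asg 70 (Num 0)) (Asg vU (Num 1))))
 (Asg 71 (Times (Num (5 * K)) (Var vw)))"

text \<open>One digit of the binary long division of \<open>W ^ (5 * K)\<close> by \<open>M\<close>,
  which has several words and hence is no divisor for \<open>Quo\<close>. Quotient \<open>vU\<close>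
  and remainder 70 of a power of two are doubled together. The \<open>5 * K * w\<close> rounds are
  affordable since \<open>w < l ^ 4\<close> in this case.\<close>

definition recip_step :: hl where
"recip_step = seqs [Asg 70 (Times (Num 2) (Var 70)), Asg vU (Times (Num 2) (Var vU)),
 Iff (Var 70) (Var vM) Nop (Sq (Asg 70 (Minus (Var 70) (Var vM))) (Asg vU (Plus (Var vU) (Num 1)))),
 Asg 71 (Minus (Var 71) (Num 1))]"

definition prime_modulus :: "nat \<Rightarrow> hl" where
"prime_modulus K = Sq (seqs [Asg 62 (Quo (Times (Num 5) (Var 60)) (Num 8)), Asg 63 (Pow (Var 62)), Asg vM (Num 1)])
 (Sq (hrep K slot_hl) (Sq (recip_init K) (Whl (Num 0) (Var 71) recip_step)))"

definition choose_modulus :: "nat \<Rightarrow> hl" where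
"choose_modulus K = Sq lg_hl (Iff (Var vw) (Times (Times (Var 60) (Var 60)) (Times (Var 60) (Var 60)))
 (prime_modulus K) (word_modulus K))"

section \<open>The modulus as a function of the random tape\<close>

definition sample :: "nat \<Rightarrow> nat \<Rightarrow> nat stream \<Rightarrow> nat" where
"sample w A \<omega> = shd \<omega> mod 2 ^ w mod A + A * (shd (stl \<omega>) mod 2 ^ w mod A)"

text \<open>Later primes overwrite earlier ones. Slots start with 1, which divides everything and
  thus counts as a failure in the analysis.\<close>

primrec slot_prime :: "nat \<Rightarrow> nat \<Rightarrow> nat \<Rightarrow> nat \<Rightarrow> nat stream \<Rightarrow> nat" where
"slot_prime w A 0 q \<omega> = q"
| "slot_prime w A (Suc r) q \<omega> =
 slot_prime w A r (if prime (sample w A \<omega>) then sample w A \<omega> else q) (sdrop 2 \<omega>)"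

primrec prime_product :: "nat \<Rightarrow> nat \<Rightarrow> nat \<Rightarrow> nat \<Rightarrow> nat \<Rightarrow> nat stream \<Rightarrow> nat" where
"prime_product w A r 0 M \<omega> = M"
| "prime_product w A r (Suc k) M \<omega> =
 prime_product w A r k (M * slot_prime w A r 1 \<omega>) (sdrop (2 * r) \<omega>)"

definition modulus_of :: "nat \<Rightarrow> nat \<Rightarrow> nat \<Rightarrow> nat stream \<Rightarrow> nat" where
"modulus_of w K l \<omega> = (if w < l ^ 4 then prime_product w (2 ^ (5 * l div 8)) (l ^ 3) K 1 \<omega>
 else max 1 (shd \<omega> mod 2 ^ w mod 2 ^ (w div 3)))"

text \<open>The number of tape words that the modulus consumes; the window is drawn from the words
  behind them and is therefore independent of it.\<close>

definition modulus_words :: "nat \<Rightarrow> nat \<Rightarrow> nat \<Rightarrow> nat" where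
"modulus_words w K l = (if w < l ^ 4 then 2 * l ^ 3 * K else 1)"

text \<open>The smaller of two complementary divisors is below \<open>A\<close>. The condition
  \<open>d < x\<close> matters for \<open>x <= A\<close>, where \<open>x\<close> is itself among the
  trial divisors.\<close>

lemma prime_iff_no_small_divisor:
fixes x A :: nat
assumes "x < A * A"
shows "prime x \<longleftrightarrow> 2 <= x & \<not> (\<exists>d. 2 <= d & d <= A & d < x & d dvd x)"
proof (intro iffI conjI; (elim conjE)?)
assume p: "prime x"
then show "2 <= x" by (rule prime_ge_2_nat)
show "\<not> (\<exists>d. 2 <= d & d <= A & d < x & d dvd x)"
 using p by (auto simp: prime_nat_iff)
next
assume x: "2 <= x" and nd: "\<not> (\<exists>d. 2 <= d & d <= A & d < x & d dvd x)"
show "prime x"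
proof (rule ccontr)
 assume np: "\<not> prime x"
 from x obtain p where p: "prime p" "p dvd x" using prime_factor_nat[of x] by auto
 then obtain m where m: "x = p * m" by (elim dvdE)
 have "m ~= 0" "m ~= 1" using m x p np by auto
 then have m2: "2 <= m" by simp
 have p2: "2 <= p" using p by (simp add: prime_ge_2_nat)
 define d where "d = min p m"
 have d: "2 <= d" "d dvd x" using m m2 p2 by (auto simp: d_def min_def)
 have "d * d <= p * m" by (intro mult_le_mono) (auto simp: d_def)
 then have dd: "d * d < A * A" using assms m by simp
 then have "d < A" by (metis linorder_not_less mult_le_mono)
 moreover have "d * 2 <= d * d" using d by simp
 then have "d < x" using \<open>d * d <= p * m\<close> d m by linarith
 ultimately show False using nd d by auto
qed
qed

lemma slot_prime_bound: "1 <= A ==> 1 <= q ==> q <= A * A ==>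
 1 <= slot_prime w A r q \<omega> & slot_prime w A r q \<omega> <= A * A"
proof (induction r arbitrary: q \<omega>)
case (Suc r)
have "shd \<omega> mod 2 ^ w mod A < A" "shd (stl \<omega>) mod 2 ^ w mod A < A" using Suc.prems by auto
then have "A * (shd (stl \<omega>) mod 2 ^ w mod A + 1) <= A * A" by (intro mult_le_mono2) simp
then have "sample w A \<omega> <= A * A"
 using \<open>shd \<omega> mod 2 ^ w mod A < A\<close> unfolding sample_def by simp
then show ?case using Suc by (auto simp: prime_gt_0_nat Suc_leI)
qed simp

lemma sample_less: "1 <= A ==> sample w A \<omega> < A * A"
proof -
assume A: "1 <= A"
have "shd \<omega> mod 2 ^ w mod A < A" "shd (stl \<omega>) mod 2 ^ w mod A < A" using A by auto
then have "A * (shd (stl \<omega>) mod 2 ^ w mod A + 1) <= A * A" by (intro mult_le_mono2) simp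
then show ?thesis
 using \<open>shd \<omega> mod 2 ^ w mod A < A\<close> unfolding sample_def by simp
qed

lemma lg_exists: "1 <= (n::nat) ==> \<exists>l. 2 ^ l <= n & n < 2 ^ Suc l"
proof (induction n rule: nat_induct_at_least)
case base show ?case by (intro exI[of _ 0]) auto
next
case (Suc n)
then obtain l where l: "2 ^ l <= n" "n < 2 ^ Suc l" by auto
show ?case
proof (cases "Suc n < 2 ^ Suc l")
 case True with l show ?thesis by (intro exI[of _ l]) auto
next
 case False with l show ?thesis by (intro exI[of _ "Suc l"]) auto
qed
qed

section \<open>Correctness of the code that draws the modulus\<close>

locale building = word_sizes +
fixes b n l N F R X :: nat and A0 E0 :: "nat list"
assumes b: "b <= w" and n1: "1 <= n" and nW: "n <= W" and l: "2 ^ l <= n" "n < 2 ^ Suc l"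
 and R: "R = W ^ (3 * K)" and N: "N = num_words w (n * b)" and F: "F = N div (3 * K)"
 and A0: "length A0 = N" "!!a. a < N ==> A0 ! a < W" and X: "X = val W N (%a. A0 ! a)" and Xn: "X < 2 ^ (b * n)"
 and E0: "length E0 = sw K * (7 + l)" and E0_less: "!!a. a < length E0 ==> E0 ! a < W"
begin

definition base :: "config \<Rightarrow> bool" where
"base s \<longleftrightarrow> env s & reg s vn = n & reg s vL = 3 * K * w & reg s vR = R & reg s vN = N & reg s vF = F &
 reg s vb = b & arr s 0 = A0 & arr s 1 = E0"

lemma base_frame:
assumes "base s" "!!x. x < 28 \<or> x = 34 \<or> x = 35 ==> reg s' x = reg s x" "arr s' 0 = arr s 0" "arr s' 1 = arr s 1"
shows "base s'"
using assms unfolding base_def env_def by simp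

lemma base_set_reg [simp]: "28 <= x ==> x ~= 34 ==> x ~= 35 ==> base (set_reg x v s) = base s"
by (simp add: base_def env_def)

lemma base_rnd [simp]: "base (s\<lparr>rnd := \<omega>\<rparr>) = base s"
by (simp add: base_def env_def)

lemma base_env: "base s ==> env s"
by (simp add: base_def)

lemma W01: "(0::nat) < 2 ^ w" "Suc 0 < 2 ^ w" "(2::nat) < 2 ^ w" "(5::nat) < 2 ^ w" "(8::nat) < 2 ^ w" "5 * K < 2 ^ w"
using num_less[of 2] num_less[of 5] num_less[of 8] num_less[of 1] K_less[of 5] by (auto simp: W_def)

lemma lw: "l <= w"
proof -
have "(2::nat) ^ l <= 2 ^ w" using order_trans[OF l(1) nW] by (simp only: W_def)
then show ?thesis by (rule power_le_imp_le_exp[rotated]) simp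
qed

lemma W2I: "x <= W * c ==> c < W ==> x < W ^ 2"
unfolding power2_eq_square by (rule le_less_trans, assumption) (use W_pos in simp)

lemma small_lim: "x <= W * 8 ==> x < B ^ nd"
by (rule W2_lim, rule W2I, assumption) (use num_less[of 8] in simp)

definition T_lg :: nat where
"T_lg = steps (cmp nd (Sq (Asg 60 (Num 0)) (Asg 61 (Num 1)))) +
 ((l + 1) * (steps (cmp nd lg_step) + cost_test (Times (Num 2) (Var 61)) (Plus (Var vn) (Num 1))) + 1)"

lemma hb_lg:
assumes s: "base s"
shows "hb T_lg lg_hl s (%s'. base s' & reg s' 60 = l & rnd s' = rnd s)"
unfolding lg_hl_def T_lg_def
proof (rule hb_Sq[OF hb_hs])
let ?J = "%k s'. base s' & rnd s' = rnd s & reg s' 60 + k = l & reg s' 61 = 2 ^ reg s' 60"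
show "hs (Sq (Asg 60 (Num 0)) (Asg 61 (Num 1))) s (?J l)"
 using s W01 by (intro hs_Asg_Sq hs_Asg) auto
fix s1 assume s1: "?J l s1"
show "hb ((l + 1) * (steps (cmp nd lg_step) + cost_test (Times (Num 2) (Var 61)) (Plus (Var vn) (Num 1))) + 1)
 (Whl (Times (Num 2) (Var 61)) (Plus (Var vn) (Num 1)) lg_step) s1 (%s'. base s' & reg s' 60 = l & rnd s' = rnd s)"
proof (rule hb_loop[where J = ?J])
 fix k s' assume J: "?J k s'"
 define m where "m = reg s' 60"
 have ml: "m <= l" and r: "reg s' 61 = 2 ^ m" "reg s' vn = n" "m + k = l" using J by (auto simp: m_def base_def)
 have "(2::nat) ^ m <= 2 ^ l" using ml by simp
 then have pm: "2 ^ m <= n" using l by linarith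
 have mm: "m < 2 ^ m" by (rule less_exp)
 have lims: "2 * 2 ^ m < B ^ nd" "n + 1 < B ^ nd" "m + 1 < B ^ nd"
 by (rule small_lim, use pm nW W_ge2 mm in linarith)+
 have test: "2 * 2 ^ m < n + 1 \<longleftrightarrow> m < l"
 proof
 assume "2 * 2 ^ m < n + 1"
 moreover have "n < 2 * 2 ^ l" using l(2) by simp
 ultimately have "(2::nat) ^ m < 2 ^ l" by linarith
 then show "m < l" by (rule power_less_imp_less_exp[rotated]) simp
 next
 assume "m < l"
 then have "(2::nat) ^ Suc m <= 2 ^ l" by (intro power_increasing) auto
 then show "2 * 2 ^ m < n + 1" using l by simp
 qed
 have "hs lg_step s' (?J (k - 1))" if "m < l"
 unfolding lg_step_def using J lims r W01 that
 by (intro hs_Asg_Sq hs_Asg) (auto simp: m_def[symmetric])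
 then show "safe s' (Times (Num 2) (Var 61)) & safe s' (Plus (Var vn) (Num 1)) &
 (eval s' (Times (Num 2) (Var 61)) < eval s' (Plus (Var vn) (Num 1)) --> 0 < k & hb (steps (cmp nd lg_step)) lg_step s' (?J (k - 1))) &
 (\<not> eval s' (Times (Num 2) (Var 61)) < eval s' (Plus (Var vn) (Num 1)) --> base s' & reg s' 60 = l & rnd s' = rnd s)"
 using J lims r W01 test by (auto simp: m_def[symmetric] intro!: hb_hs)
qed (rule s1)
qed

definition chosen :: "nat \<Rightarrow> nat stream \<Rightarrow> config \<Rightarrow> bool" where
"chosen M \<omega> s \<longleftrightarrow> base s & modulus s M & rnd s = \<omega>"

lemma hs_word_modulus:
assumes s: "base s"
shows "hs (word_modulus K) s (chosen (max 1 (shd (rnd s) mod W mod B)) (stl (rnd s)))"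
proof -
define m where "m = shd (rnd s) mod W mod B"
define s1 where "s1 = set_reg vM (shd (rnd s) mod W) (s\<lparr>rnd := stl (rnd s)\<rparr>)"
define s2 where "s2 = set_reg vM m s1"
define s3 where "s3 = set_reg vM (max 1 m) s2"
have b2: "base s2" "rnd s2 = stl (rnd s)" "reg s2 vM = m" "base s3" "rnd s3 = stl (rnd s)" "reg s3 vM = max 1 m"
 using s by (auto simp: s3_def s2_def s1_def)
have e: "env s1" "env s3" "reg s1 vM = shd (rnd s) mod W" "reg s1 vH = B"
 using s b2 by (auto simp: s1_def base_def env_def)
have mB: "max 1 m <= B" using B_pos by (auto simp: m_def less_imp_le)
have BB': "max 1 m * B <= 2 ^ w" using mB BB by (meson le_trans mult_le_mono1)
have "B <= W" using B_less by (simp add: W_def)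
then have "max 1 m <= W" using mB by simp
also have "W <= W ^ (2 * K)" using power_increasing[of 1 "2 * K" W] W_pos K1 by simp
finally have mW: "max 1 m <= W ^ (2 * K)" .
have idem: "set_reg vM (Suc 0) s2 = s3" if "m = 0" using that by (simp add: s3_def)
have idem': "s2 = s3" if "0 < m" using that by (auto simp: s3_def s2_def set_reg_def max_def)
have 1: "hs (Iff (Num 0) (Var vM) Nop (Asg vM (Num 1))) s2 (%s. s = s3)"
 by (rule hs_Iff; (rule hs_Nop | rule hs_Asg)?) (use b2 W01 idem idem' in auto)
have e4: "eval s3 (Quo (wpow (5 * K)) (Var vM)) = W ^ (5 * K) div max 1 m"
 by (simp add: wpow[OF e(2)] b2)
show ?thesis unfolding word_modulus_def seqs.simps m_def[symmetric]
proof (rule hs_Sq, rule hs_Rnd, simp, unfold W_def[symmetric] s1_def[symmetric], rule hs_Asg_Sq, simp, goal_cases)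
 case 1
 show ?case using e BB B_pos by (simp add: B_def)
next
 case 2
 have "set_reg vM (eval s1 (Rem (Var vM) (Var vH))) s1 = s2"
 by (simp add: s2_def e m_def)
 then show ?case
 apply (simp only:)
 apply (rule hs_Sq, rule hs_mono[OF 1], hypsubst, rule hs_Asg_Sq, simp)
 using e b2 BB' safe_wpow[OF e(2), of "5 * K"] K1 apply simp
 unfolding e4 using b2 mW by (intro hs_Nop) (auto simp: chosen_def modulus_def)
qed
qed

definition A :: nat where "A = 2 ^ (5 * l div 8)"

lemma A1: "1 <= A" by (simp add: A_def)

lemma a_less: "5 * l div 8 < w" using lw w6 by simp

text \<open>Trial divisors reach \<open>5 / 8\<close> of a word and digits take a third of it;
  \<open>5 / 8 + 1 / 3 < 1\<close> makes these divisors admissible.\<close>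

lemma AB: "d <= A ==> d * B <= 2 ^ w"
proof -
assume "d <= A"
then have "d * B <= A * B" by (rule mult_le_mono1)
also have "A * B = 2 ^ (5 * l div 8 + h)" by (simp add: A_def B_def power_add)
also have "\<dots> <= 2 ^ w" using lw w6 h by (intro power_increasing) auto
finally show ?thesis .
qed

lemma AW: "A < W" using a_less by (simp add: A_def W_def)

lemma AA: "A * A < W ^ 2" using AW by (simp add: power2_eq_square mult_strict_mono')

definition pb :: "config \<Rightarrow> bool" where
"pb s \<longleftrightarrow> base s & reg s 60 = l & reg s 63 = A"

lemma pb_set_reg [simp]: "28 <= x ==> x \<notin> {34, 35, 60, 63} ==> pb (set_reg x v s) = pb s"
by (simp add: pb_def)

definition T_try :: nat where
"T_try = steps (cmp nd candidate) + ((A + 1) * (steps (cmp nd trial_step) + cost_test (Var 69) (Plus (Var 63) (Num 1))) + 1 + steps (cmp nd accept))"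

lemma hb_try_prime:
assumes s: "pb s" "reg s 65 = Suc r"
shows "hb T_try try_prime s (%s'. pb s' & reg s' 65 = r & reg s' vM = reg s vM & rnd s' = sdrop 2 (rnd s) &
 reg s' 64 = (if prime (sample w A (rnd s)) then sample w A (rnd s) else reg s 64))"
unfolding try_prime_def T_try_def
proof (rule hb_Sq[OF hb_hs])
define x where "x = sample w A (rnd s)"
define K0 where "K0 s' \<longleftrightarrow> pb s' & reg s' 65 = Suc r & reg s' vM = reg s vM & rnd s' = sdrop 2 (rnd s) &
 reg s' 64 = reg s 64 & reg s' 66 = x" for s'
have K0_set: "K0 (set_reg y v s') = K0 s'" if "y = 68 \<or> y = 69" for y v s'
 using that by (auto simp: K0_def)
have xAA: "x < A * A" unfolding x_def by (rule sample_less[OF A1])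
have xW: "x < W ^ 2" using xAA AA by simp
\<comment> \<open>A proper divisor of \<open>x\<close> exists among the trial divisors before
  \<open>d\<close>; \<open>fl d\<close> is then the value of the flag in variable 68.\<close>
define bad where "bad d \<longleftrightarrow> (\<exists>d'. 2 <= d' & d' < d & d' <= A & d' < x & d' dvd x)" for d
define fl where "fl d = (if bad d then 0 else 1 :: nat)" for d
have fl2: "fl 2 = 1" "fl (Suc (Suc 0)) = 1" by (auto simp: fl_def bad_def)
have fl_end: "fl d = fl (Suc A)" if "Suc A <= d" for d
 using that by (auto simp: fl_def bad_def)
let ?J = "%k s'. K0 s' & 2 <= reg s' 69 & k = A + 1 - reg s' 69 & reg s' 68 = fl (reg s' 69)"
show "hs candidate s (?J (A - 1))"
proof -
 have "x < B ^ nd" using xW by (rule W2_lim)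
 moreover have "A * (shd (stl (rnd s)) mod W mod A) <= x" by (simp add: x_def sample_def W_def)
 ultimately show ?thesis
 unfolding candidate_def seqs.simps using s AB[of A] A1 W01
 by (intro hs_Sq[of "Rnd 66"] hs_Rnd hs_Sq[of "Rnd 67"] hs_Asg_Sq hs_Nop)
  (auto simp: pb_def x_def sample_def W_def[symmetric] K0_def numeral_2_eq_2 fl2)
qed
fix s1 assume s1: "?J (A - 1) s1"
show "hb ((A + 1) * (steps (cmp nd trial_step) + cost_test (Var 69) (Plus (Var 63) (Num 1))) + 1 + steps (cmp nd accept))
 (Sq (Whl (Var 69) (Plus (Var 63) (Num 1)) trial_step) accept) s1
 (%s'. pb s' & reg s' 65 = r & reg s' vM = reg s vM & rnd s' = sdrop 2 (rnd s) &
 reg s' 64 = (if prime (sample w A (rnd s)) then sample w A (rnd s) else reg s 64))"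
proof (rule hb_Sq)
 have "hb ((A - 1 + 1) * (steps (cmp nd trial_step) + cost_test (Var 69) (Plus (Var 63) (Num 1))) + 1)
 (Whl (Var 69) (Plus (Var 63) (Num 1)) trial_step) s1 (%s'. K0 s' & reg s' 68 = fl (A + 1))"
 proof (rule hb_loop[where J = ?J])
 fix k s' assume J: "?J k s'"
 define d where "d = reg s' 69"
 have r: "reg s' 63 = A" "reg s' 66 = x" "K0 s'" using J by (auto simp: K0_def pb_def)
 have Al: "A + 1 < B ^ nd" using AW by (intro small_lim) simp
 have "hs trial_step s' (?J (k - 1))" if dA: "d <= A"
 proof -
  have d: "2 <= d" "d * B <= 2 ^ w" "d + 1 < B ^ nd" using J dA AB[OF dA] Al by (auto simp: d_def)
  let ?c = "Iff (Var 69) (Var 66) (Iff (Num 0) (Rem (Var 66) (Var 69)) Nop (Asg 68 (Num 0))) Nop"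
  have "hs ?c s' (%s''. K0 s'' & reg s'' 69 = d & reg s'' 68 = fl (Suc d))"
  proof (rule hs_Iff, goal_cases)
  case 5
  then have dx: "d < x" by (simp add: d_def r)
  have sb: "fl (Suc d) = (if d dvd x then 0 else fl d)"
   using d dA dx unfolding fl_def bad_def by (auto simp: less_Suc_eq)
  show ?case
  proof (rule hs_Iff, goal_cases)
   case 5
   then have "\<not> d dvd x" by (simp add: d_def r dvd_eq_mod_eq_0)
   then show ?case using J sb by (intro hs_Nop) (auto simp: d_def)
  next
   case 6
   then have "d dvd x" by (simp add: d_def r dvd_eq_mod_eq_0)
   then show ?case using J sb W01 by (intro hs_Asg) (auto simp: d_def K0_set)
  qed (use W01 d in \<open>auto simp: d_def\<close>)
  next
  case 6
  then have "x <= d" by (simp add: d_def r)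
  then have "fl (Suc d) = fl d" unfolding fl_def bad_def by (auto simp: less_Suc_eq)
  then show ?case using J by (intro hs_Nop) (auto simp: d_def)
  qed auto
  then show ?thesis unfolding trial_step_def
  proof (intro hs_Sq, elim hs_mono, elim conjE)
  fix s3 :: config assume s3: "K0 s3" "reg s3 69 = d" "reg s3 68 = fl (Suc d)"
  have "k = A + 1 - d" using J by (simp add: d_def)
  then have k1: "k - Suc 0 = A - d" by linarith
  show "hs (Asg 69 (Plus (Var 69) (Num 1))) s3 (?J (k - 1))"
   by (rule hs_Asg) (use s3 d W01 in \<open>simp_all add: K0_set k1\<close>)
  qed
 qed
 note st = this
 show "safe s' (Var 69) & safe s' (Plus (Var 63) (Num 1)) &
  (eval s' (Var 69) < eval s' (Plus (Var 63) (Num 1)) --> 0 < k & hb (steps (cmp nd trial_step)) trial_step s' (?J (k - 1))) &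
  (\<not> eval s' (Var 69) < eval s' (Plus (Var 63) (Num 1)) --> K0 s' & reg s' 68 = fl (A + 1))"
 proof (intro conjI impI)
  show "safe s' (Var 69)" "safe s' (Plus (Var 63) (Num 1))" using r Al W01 by simp_all
 next
  assume "eval s' (Var 69) < eval s' (Plus (Var 63) (Num 1))"
  then have "d <= A" by (simp add: d_def r)
  then show "0 < k" "hb (steps (cmp nd trial_step)) trial_step s' (?J (k - 1))"
  using J st by (auto simp: d_def intro: hb_hs)
 next
  assume "\<not> eval s' (Var 69) < eval s' (Plus (Var 63) (Num 1))"
  then have "Suc A <= reg s' 69" by (simp add: r)
  from fl_end[OF this] show "reg s' 68 = fl (A + 1)" using J by simp
 qed (use J in simp)
 qed (rule s1)
 then show "hb ((A + 1) * (steps (cmp nd trial_step) + cost_test (Var 69) (Plus (Var 63) (Num 1))) + 1)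
 (Whl (Var 69) (Plus (Var 63) (Num 1)) trial_step) s1 (%s'. K0 s' & reg s' 68 = fl (A + 1))"
 by (rule hb_mono) auto
next
 fix s2 assume s2: "K0 s2 & reg s2 68 = fl (A + 1)"
 have p: "prime x \<longleftrightarrow> 2 <= x & fl (A + 1) = 1" "fl (A + 1) <= 1"
 unfolding fl_def prime_iff_no_small_divisor[OF xAA] bad_def by (auto simp: less_Suc_eq_le)
 have "hs (Iff (Var 66) (Num 2) (Asg 68 (Num 0)) Nop) s2 (%s3. K0 s3 & reg s3 68 = (if prime x then 1 else 0))"
 by (rule hs_Iff; (rule hs_Nop | rule hs_Asg)?) (use s2 p W01 in \<open>auto simp: K0_set K0_def le_Suc_eq\<close>)
 then have "hs accept s2 (%s'. pb s' & reg s' 65 = r & reg s' vM = reg s vM & rnd s' = sdrop 2 (rnd s) &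
 reg s' 64 = (if prime x then x else reg s 64))"
 unfolding accept_def seqs.simps
 proof (intro hs_Sq, elim hs_mono, goal_cases)
 case (1 s3)
 then have r3: "pb s3" "reg s3 65 = Suc r" "reg s3 vM = reg s vM" "rnd s3 = sdrop 2 (rnd s)" "reg s3 64 = reg s 64" "reg s3 66 = x"
  "reg s3 68 = (if prime x then 1 else 0)" by (auto simp: K0_def)
 have "hs (Iff (Num 0) (Var 68) (Asg 64 (Var 66)) Nop) s3 (%s'. pb s' & reg s' 65 = Suc r & reg s' vM = reg s vM & rnd s' = sdrop 2 (rnd s) &
  reg s' 64 = (if prime x then x else reg s 64))"
  by (rule hs_Iff; (rule hs_Nop | rule hs_Asg)?) (use r3 W01 in \<open>auto split: if_splits\<close>)
 then show ?case
  by (intro hs_Sq[of "Iff (Num 0) (Var 68) (Asg 64 (Var 66)) Nop"], elim hs_mono)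
  (use W01 in \<open>auto intro!: hs_Asg_Sq hs_Nop\<close>)
 qed
 from hb_hs[OF this] show "hb (steps (cmp nd accept)) accept s2
 (%s'. pb s' & reg s' 65 = r & reg s' vM = reg s vM & rnd s' = sdrop 2 (rnd s) &
 reg s' 64 = (if prime (sample w A (rnd s)) then sample w A (rnd s) else reg s 64))"
 unfolding x_def .
qed
qed

definition T_slot :: nat where
"T_slot = steps (cmp nd (Sq (Asg 64 (Num 1)) (Asg 65 (Times (Times (Var 60) (Var 60)) (Var 60))))) +
 ((l ^ 3 + 1) * (T_try + cost_test (Num 0) (Var 65)) + 1 + steps (cmp nd (Asg vM (Times (Var vM) (Var 64)))))"

lemma lW: "l < W" using lw w_less by simp

lemma l4: "l * l < B ^ nd" "l * l * l < B ^ nd" "(l * l) * (l * l) < B ^ nd"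
proof -
have "1 <= W" using W_pos by simp
then have 1: "l * l < W ^ 2" "l * l * l < W ^ 3" "(l * l) * (l * l) < W ^ 4"
 using lW by (auto simp: power2_eq_square power3_eq_cube power4_eq_xxxx mult.assoc intro!: mult_strict_mono')
show "l * l < B ^ nd" by (rule lim[OF 1(1)]) (use K1 in simp)
show "l * l * l < B ^ nd" by (rule lim[OF 1(2)]) (use K1 in simp)
show "(l * l) * (l * l) < B ^ nd" by (rule lim[OF 1(3)]) (use K1 in simp)
qed

text \<open>A slot contributes a factor of at most \<open>A * A < W ^ 2\<close>, so \<open>K\<close>
  slots keep the modulus within the limit \<open>W ^ (2 * K)\<close> of the encoding.\<close>

lemma hb_slot:
assumes s: "pb s" "reg s vM = M" "M <= W ^ (2 * k)" "k < K"
shows "hb T_slot slot_hl s (%s'. pb s' & reg s' vM = M * slot_prime w A (l ^ 3) 1 (rnd s) &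
 rnd s' = sdrop (2 * l ^ 3) (rnd s))"
unfolding slot_hl_def T_slot_def
proof (rule hb_Sq[OF hb_hs])
define q where "q = slot_prime w A (l ^ 3) 1 (rnd s)"
let ?J = "%k s'. pb s' & reg s' vM = M & reg s' 65 = k & slot_prime w A k (reg s' 64) (rnd s') = q &
 sdrop (2 * k) (rnd s') = sdrop (2 * l ^ 3) (rnd s)"
show "hs (Sq (Asg 64 (Num 1)) (Asg 65 (Times (Times (Var 60) (Var 60)) (Var 60)))) s (?J (l ^ 3))"
 using s l4 W01 by (intro hs_Asg_Sq hs_Asg) (auto simp: pb_def q_def power3_eq_cube)
fix s1 assume s1: "?J (l ^ 3) s1"
show "hb ((l ^ 3 + 1) * (T_try + cost_test (Num 0) (Var 65)) + 1 + steps (cmp nd (Asg vM (Times (Var vM) (Var 64)))))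
 (Sq (Whl (Num 0) (Var 65) try_prime) (Asg vM (Times (Var vM) (Var 64)))) s1
 (%s'. pb s' & reg s' vM = M * slot_prime w A (l ^ 3) 1 (rnd s) & rnd s' = sdrop (2 * l ^ 3) (rnd s))"
proof (rule hb_Sq)
 show "hb ((l ^ 3 + 1) * (T_try + cost_test (Num 0) (Var 65)) + 1) (Whl (Num 0) (Var 65) try_prime) s1 (?J 0)"
 proof (rule hb_loop[where J = ?J])
 fix k s' assume J: "?J k s'"
 have "hb T_try try_prime s' (?J (k - 1))" if k: "0 < k"
 proof -
  obtain r where r: "k = Suc r" using k by (cases k) auto
  have "pb s'" "reg s' 65 = Suc r" using J r by auto
  from hb_try_prime[OF this] show ?thesis
  by (rule hb_mono) (use J r in \<open>auto simp: sdrop_add[symmetric] add.commute\<close>)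
 qed
 then show "safe s' (Num 0) & safe s' (Var 65) &
  (eval s' (Num 0) < eval s' (Var 65) --> 0 < k & hb T_try try_prime s' (?J (k - 1))) &
  (\<not> eval s' (Num 0) < eval s' (Var 65) --> ?J 0 s')"
  using J W01 by auto
 qed (rule s1)
next
 fix s2 assume s2: "?J 0 s2"
 have "1 * 1 <= A * A" using A1 by (intro mult_le_mono)
 then have "q <= A * A" using slot_prime_bound[OF A1, of 1 w "l ^ 3" "rnd s"] by (simp add: q_def)
 then have "M * q <= W ^ (2 * k) * W ^ 2" using AA s(3) by (intro mult_le_mono) auto
 also have "\<dots> = W ^ (2 * k + 2)" by (simp only: power_add)
 also have "\<dots> < W ^ (12 * K)" by (rule wpow_less) (use s(4) in simp)
 finally have "M * q < B ^ nd" by (rule lim) simp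
 then have "hs (Asg vM (Times (Var vM) (Var 64))) s2 (%s'. pb s' & reg s' vM = M * q & rnd s' = sdrop (2 * l ^ 3) (rnd s))"
 using s2 by (intro hs_Asg) auto
 from hb_hs[OF this] show "hb (steps (cmp nd (Asg vM (Times (Var vM) (Var 64))))) (Asg vM (Times (Var vM) (Var 64))) s2
 (%s'. pb s' & reg s' vM = M * slot_prime w A (l ^ 3) 1 (rnd s) & rnd s' = sdrop (2 * l ^ 3) (rnd s))"
 by (simp add: q_def)
qed
qed

definition T_recip :: nat where
"T_recip = steps (cmp nd (recip_init K)) + ((5 * K * w + 1) * (steps (cmp nd recip_step) + cost_test (Num 0) (Var 71)) + 1)"

lemma hb_recip:
assumes s: "base s" "reg s vM = M" "0 < M" "M <= W ^ (2 * K)"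
shows "hb T_recip (Sq (recip_init K) (Whl (Num 0) (Var 71) recip_step)) s (chosen M (rnd s))"
unfolding T_recip_def
proof (rule hb_Sq[OF hb_hs])
let ?S = "5 * K * w"
let ?J = "%k s'. base s' & rnd s' = rnd s & reg s' vM = M & reg s' 71 = k & k <= ?S & reg s' 70 < M &
 2 ^ (?S - k) = reg s' vU * M + reg s' 70"
have Sl: "?S < B ^ nd"
proof -
 have "5 * K * w * 1 <= 1000 * K * w * B" using B_pos by (intro mult_le_mono) auto
 then have "5 * K * w <= W" using big' by linarith
 then show ?thesis by (intro small_lim) simp
qed
have W5: "W ^ (5 * K) = 2 ^ ?S" by (simp add: W_def mult.commute flip: power_mult)
have "hs (Iff (Num 1) (Var vM) (Sq (Asg 70 (Num 1)) (Asg vU (Num 0))) (Sq (Asg 70 (Num 0)) (Asg vU (Num 1)))) s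
 (%s'. base s' & rnd s' = rnd s & reg s' vM = M & reg s' 70 < M & 1 = reg s' vU * M + reg s' 70)"
 by (rule hs_Iff; (rule hs_Asg_Sq)?; (rule hs_Asg)?) (use s W01 in auto)
then show "hs (recip_init K) s (?J ?S)"
 unfolding recip_init_def
 by (intro hs_Sq) (erule hs_mono, rule hs_Asg, use Sl W01 in \<open>auto simp: base_def env_def\<close>)
fix s1 assume s1: "?J ?S s1"
show "hb ((?S + 1) * (steps (cmp nd recip_step) + cost_test (Num 0) (Var 71)) + 1) (Whl (Num 0) (Var 71) recip_step) s1 (chosen M (rnd s))"
proof (rule hb_loop[where J = ?J])
 fix k s' assume J: "?J k s'"
 define r u where "r = reg s' 70" and "u = reg s' vU"
 have step: "hs recip_step s' (?J (k - 1))" if k: "0 < k"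
 proof -
 have eq: "2 * 2 ^ (?S - k) = 2 * u * M + 2 * r" using J by (simp add: r_def u_def)
 have sk: "2 ^ (?S - (k - 1)) = 2 * (2::nat) ^ (?S - k)"
 proof -
  have "?S - (k - 1) = Suc (?S - k)" using J k by linarith
  then show ?thesis by (simp only: power_Suc)
 qed
 have "(2::nat) ^ (?S - (k - 1)) <= 2 ^ ?S" by (intro power_increasing) auto
 then have le: "2 * u * M + 2 * r <= W ^ (5 * K)" using eq sk W5 by linarith
 have rM: "r < M" using J by (simp add: r_def)
 have u1: "2 * u * 1 <= 2 * u * M" using s(3) by (intro mult_le_mono2) simp
 have l5: "x <= W ^ (5 * K) + 1 ==> x < B ^ nd" for x
 proof -
  assume "x <= W ^ (5 * K) + 1"
  also have "\<dots> <= W * W ^ (5 * K)"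
  using mult_le_mono1[OF W_ge2, of "W ^ (5 * K)"] W_pos by (simp add: Suc_leI le_trans[rotated])
  also have "\<dots> < W ^ (12 * K)" using wpow_less[of "Suc (5 * K)" "12 * K"] K1 by simp
  finally show ?thesis by (rule lim) simp
 qed
 have lims: "2 * r < B ^ nd" "2 * u < B ^ nd" "2 * u + 1 < B ^ nd"
  by (rule l5, use le u1 in linarith)+
 define s2 where "s2 = set_reg vU (2 * u) (set_reg 70 (2 * r) s')"
 have r2: "base s2" "rnd s2 = rnd s" "reg s2 vM = M" "reg s2 71 = k" "reg s2 70 = 2 * r" "reg s2 vU = 2 * u"
  using J by (auto simp: s2_def)
 have "hs (Iff (Var 70) (Var vM) Nop (Sq (Asg 70 (Minus (Var 70) (Var vM))) (Asg vU (Plus (Var vU) (Num 1))))) s2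
  (%s'. base s' & rnd s' = rnd s & reg s' vM = M & reg s' 71 = k & reg s' 70 < M & 2 * 2 ^ (?S - k) = reg s' vU * M + reg s' 70)"
  by (rule hs_Iff; (rule hs_Nop)?; (rule hs_Asg_Sq)?; (rule hs_Asg)?)
  (use r2 lims W01 eq rM in \<open>auto simp: algebra_simps\<close>)
 note i = this
 show ?thesis unfolding recip_step_def seqs.simps
 proof (rule hs_Asg_Sq, simp, (use lims W01 in \<open>simp add: r_def[symmetric]\<close>), rule hs_Asg_Sq, simp,
  (use lims W01 in \<open>simp add: u_def[symmetric]\<close>), goal_cases)
  case 1
  have "set_reg vU (eval (set_reg 70 (eval s' (Times (Num 2) (Var 70))) s') (Times (Num 2) (Var vU)))
   (set_reg 70 (eval s' (Times (Num 2) (Var 70))) s') = s2"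
  by (simp add: s2_def r_def u_def)
  then show ?case using J k W01 sk
  by (simp only:) (rule hs_Sq, rule hs_mono[OF i], rule hs_Asg_Sq, simp, simp, rule hs_Nop, auto)
 qed
 qed
 have fin: "chosen M (rnd s) s'" if "k = 0"
 proof -
 have "W ^ (5 * K) = u * M + r" "r < M" using J that W5 by (auto simp: u_def r_def)
 then have "W ^ (5 * K) div M = u" by simp
 then show ?thesis using J s by (simp add: chosen_def modulus_def u_def)
 qed
 show "safe s' (Num 0) & safe s' (Var 71) &
 (eval s' (Num 0) < eval s' (Var 71) --> 0 < k & hb (steps (cmp nd recip_step)) recip_step s' (?J (k - 1))) &
 (\<not> eval s' (Num 0) < eval s' (Var 71) --> chosen M (rnd s) s')"
 using J W01 step fin by (auto intro!: hb_hs)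
qed (rule s1)
qed

definition T_prime :: nat where
"T_prime = steps (cmp nd (seqs [Asg 62 (Quo (Times (Num 5) (Var 60)) (Num 8)), Asg 63 (Pow (Var 62)), Asg vM (Num 1)])) +
 (1 + K * T_slot + T_recip)"

lemma hb_prime_modulus:
assumes s: "base s" "reg s 60 = l"
shows "hb T_prime (prime_modulus K) s (chosen (prime_product w A (l ^ 3) K 1 (rnd s)) (sdrop (2 * l ^ 3 * K) (rnd s)))"
unfolding prime_modulus_def T_prime_def
proof (rule hb_Sq[OF hb_hs])
define P where "P = prime_product w A (l ^ 3) K 1 (rnd s)"
let ?J = "%k s'. pb s' & 0 < reg s' vM & reg s' vM <= W ^ (2 * k) &
 prime_product w A (l ^ 3) (K - k) (reg s' vM) (rnd s') = P &
 sdrop (2 * l ^ 3 * (K - k)) (rnd s') = sdrop (2 * l ^ 3 * K) (rnd s)"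
have l5: "5 * l < B ^ nd" using lW by (intro small_lim) simp
have "8 * B <= 2 ^ w" by (rule small_div) (use K1 in simp)
then show "hs (seqs [Asg 62 (Quo (Times (Num 5) (Var 60)) (Num 8)), Asg 63 (Pow (Var 62)), Asg vM (Num 1)]) s (?J 0)"
 unfolding seqs.simps using s W01 l5 a_less
 by (intro hs_Asg_Sq hs_Nop) (auto simp: pb_def P_def A_def)
fix s1 assume s1: "?J 0 s1"
show "hb (1 + K * T_slot + T_recip) (Sq (hrep K slot_hl) (Sq (recip_init K) (Whl (Num 0) (Var 71) recip_step))) s1
 (chosen (prime_product w A (l ^ 3) K 1 (rnd s)) (sdrop (2 * l ^ 3 * K) (rnd s)))"
proof (rule hb_Sq)
 show "hb (1 + K * T_slot) (hrep K slot_hl) s1 (?J K)"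
 proof (rule hb_hrep[where I = ?J])
 fix k s' assume k: "k < K" and J: "?J k s'"
 obtain m where m: "K - k = Suc m" "K - Suc k = m" using k by (cases "K - k") auto
 have "1 * 1 <= A * A" using A1 by (intro mult_le_mono)
 then have q: "1 <= slot_prime w A (l ^ 3) 1 (rnd s')" "slot_prime w A (l ^ 3) 1 (rnd s') <= A * A"
  using slot_prime_bound[OF A1, of 1 w "l ^ 3" "rnd s'"] by auto
 have "reg s' vM * slot_prime w A (l ^ 3) 1 (rnd s') <= W ^ (2 * k) * W ^ 2"
  using J q AA by (intro mult_le_mono) auto
 also have "\<dots> = W ^ (2 * Suc k)" by (simp flip: power_add)
 finally have le: "reg s' vM * slot_prime w A (l ^ 3) 1 (rnd s') <= W ^ (2 * Suc k)" .
 have pbs: "pb s'" using J by simp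
 show "hb T_slot slot_hl s' (?J (Suc k))"
  by (rule hb_mono[OF hb_slot[OF pbs refl _ k]]) (use J q le in \<open>auto simp: m\<close>)
 qed (rule s1)
next
 fix s2 assume s2: "?J K s2"
 then have "base s2" "reg s2 vM = P" "0 < P" "P <= W ^ (2 * K)" by (auto simp: pb_def)
 from hb_recip[OF this] s2 show "hb T_recip (Sq (recip_init K) (Whl (Num 0) (Var 71) recip_step)) s2
 (chosen (prime_product w A (l ^ 3) K 1 (rnd s)) (sdrop (2 * l ^ 3 * K) (rnd s)))"
 by (simp add: P_def)
qed
qed

definition T_choose :: nat where
"T_choose = T_lg + (cost_test (Var vw) (Times (Times (Var 60) (Var 60)) (Times (Var 60) (Var 60))) +
 (steps (cmp nd (word_modulus K)) + (if w < l ^ 4 then T_prime else 0)))"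

lemma hb_choose_modulus:
assumes s: "base s"
shows "hb T_choose (choose_modulus K) s (chosen (modulus_of w K l (rnd s)) (sdrop (modulus_words w K l) (rnd s)))"
unfolding choose_modulus_def T_choose_def
proof (rule hb_Sq[OF hb_lg[OF s]], elim conjE)
fix s1 assume s1: "base s1" "reg s1 60 = l" "rnd s1 = rnd s"
have ww: "reg s1 vw = w" using s1 by (simp add: base_def env_def)
have ll: "(l * l) * (l * l) = l ^ 4" by (simp add: power4_eq_xxxx)
show "hb (cost_test (Var vw) (Times (Times (Var 60) (Var 60)) (Times (Var 60) (Var 60))) +
 (steps (cmp nd (word_modulus K)) + (if w < l ^ 4 then T_prime else 0)))
 (Iff (Var vw) (Times (Times (Var 60) (Var 60)) (Times (Var 60) (Var 60))) (prime_modulus K) (word_modulus K)) s1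
 (chosen (modulus_of w K l (rnd s)) (sdrop (modulus_words w K l) (rnd s)))"
proof (rule hb_Iff, goal_cases)
 case 3
 then have lt: "w < l ^ 4" using s1 ww ll by simp
 show ?case
 by (rule hb_mono[OF hb_prime_modulus[OF s1(1,2)]])
  (use lt s1 in \<open>auto simp: modulus_of_def modulus_words_def A_def\<close>)
next
 case 4
 then have lt: "\<not> w < l ^ 4" using s1 ww ll by simp
 show ?case
 by (rule hb_mono[OF hb_hs[OF hs_word_modulus[OF s1(1)]]])
  (use lt s1 in \<open>auto simp: modulus_of_def modulus_words_def W_def B_def h[symmetric]\<close>)
qed (use l4 s1 in auto)
qed

end

section \<open>Construction of the encoding\<close>

lemma val_Suc_left: "val D (Suc m) g = g 0 + D * val D m (%i. g (Suc i))"
by (induction m) (simp_all add: algebra_simps)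

primrec save :: "array \<Rightarrow> nat \<Rightarrow> nat \<Rightarrow> nat \<Rightarrow> hl" where
"save k a x 0 = Nop"
| "save k a x (Suc u) = Sq (save k a x u) (Sq (Asg 42 (div_W (Var x)))
 (Sq (Sto k (Plus (Var a) (Num u)) (Minus (Var x) (Times (Var 42) (Var vW)))) (Asg x (Var 42))))"

lemma writes_save: "writes (save k a x u) \<subseteq> {42, x}"
and stores_save: "stores (save k a x u) \<subseteq> {k}"
and hfree_save [simp]: "hfree (save k a x u)"
and random_save [simp]: "\<not> random (save k a x u)"
by (induction u) auto

lemma save_frame: "y ~= 42 ==> y ~= x ==> y \<notin> writes (save k a x u)" "k' ~= k ==> k' \<notin> stores (save k a x u)"
using writes_save[of k a x u] stores_save[of k a x u] by auto

primrec word_num :: "nat \<Rightarrow> nat \<Rightarrow> nat \<Rightarrow> nat stream \<Rightarrow> nat" where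
"word_num w 0 v \<omega> = v"
| "word_num w (Suc k) v \<omega> = word_num w k (v * 2 ^ w + shd \<omega> mod 2 ^ w) (stl \<omega>)"

definition random_step :: hl where
"random_step = Sq (Rnd 73) (Asg 72 (Plus (Times (Var 72) (Var vW)) (Var 73)))"

text \<open>A random factor of \<open>K\<close> words and a modulus of at most
  \<open>W ^ (2 * K)\<close> keep the window inside \<open>{..<R}\<close>. The window length
  \<open>R mod M\<close> is obtained by reducing \<open>R\<close>.\<close>

definition window_hl :: "nat \<Rightarrow> hl" where
"window_hl K = Sq (Asg 72 (Num 0)) (Sq (hrep K random_step)
 (seqs [Asg vJ (Times (Var 72) (Var vM)), Asg 74 (Var vR), reduce K 74, Asg vE (Var 74),
  Asg 75 (Num 0), Asg 41 (Num 0)]))"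

definition check_step :: "nat \<Rightarrow> hl" where
"check_step K = Sq (Asg 43 (block_ex K (Var 41)))
 (Sq (Iff (Var 43) (Var vJ) Nop (Iff (Var 43) (Plus (Var vJ) (Var vE)) (Asg 75 (Num 1)) Nop))
 (Asg 41 (Plus (Var 41) (Num 1))))"

text \<open>For \<open>M = 1\<close> the remainder \<open>R mod M\<close> is 0, so the window is
  empty and the encoding is the identity: extraction stays exact, only comparisons become
  worthless.\<close>

definition fallback :: "nat \<Rightarrow> hl" where
"fallback K = Sq (Iff (Num 0) (Var 75) (seqs [Asg vM (Num 1), Asg vU (wpow (5 * K)), Asg vJ (Num 0), Asg vE (Num 0)]) Nop)
 (Sq (Asg vRem (Num 0)) (Asg 76 (Var vN)))"

definition tail_step :: hl where
"tail_step = Sq (Asg 76 (Minus (Var 76) (Num 1)))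
 (Asg vRem (Plus (Times (Var vRem) (Var vW)) (Cell 0 (Var 76))))"

definition tail_final :: "nat \<Rightarrow> hl" where
"tail_final K = seqs [Asg 77 (Var vRem), reduce K 77, Asg vY (Var 77), Asg 41 (Var vF), Asg 44 (Var vY)]"

text \<open>Blocks are encoded from the last to the first: the fingerprint of a suffix is computed
  from the next one, kept in variable 44, and from the block itself, which must still be
  raw.\<close>

definition encode_step :: "nat \<Rightarrow> hl" where
"encode_step K = seqs [Asg 41 (Minus (Var 41) (Num 1)), Asg 43 (block_ex K (Var 41)),
 Asg 45 (Plus (Var 43) (Times (Var vR) (Var 44))), reduce K 45,
 Iff (Var 43) (Var vJ) (Asg 46 (Var 43)) (Asg 46 (Minus (Var 43) (Var vE))),
 Asg 47 (Var 46), reduce K 47, Asg 43 (Plus (Minus (Var 46) (Var 47)) (Var 45)), Asg 44 (Var 45),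
 Asg 56 (Times (Var 41) (Num (3 * K))), save 0 56 43 (3 * K)]"

definition put_slot :: "nat \<Rightarrow> nat \<Rightarrow> nat \<Rightarrow> hl" where
"put_slot K k x = Sq (Asg 43 (Var x)) (Sq (Asg 56 (Times (Num k) (Num (sw K)))) (save 1 56 43 (sw K)))"

text \<open>\<open>2 ^ b\<close> is multiplied together from two powers because \<open>Pow\<close>
  admits only exponents below \<open>w\<close>, whereas \<open>b = w\<close> is possible.\<close>

definition table_init :: "nat \<Rightarrow> hl" where
"table_init K = seqs [put_slot K 0 vM, put_slot K 1 vU, put_slot K 2 vJ, put_slot K 3 vE, put_slot K 4 vRem,
 put_slot K 5 vY, Asg 48 (Times (Pow (Quo (Var vb) (Num 2))) (Pow (Minus (Var vb) (Quo (Var vb) (Num 2))))),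
 reduce K 48, Asg 61 (Num 1), Asg 60 (Num 0)]"

definition table_step :: "nat \<Rightarrow> hl" where
"table_step K = seqs [Asg 43 (Var 48), Asg 56 (Times (Plus (Num 6) (Var 60)) (Num (sw K))),
 save 1 56 43 (sw K), Asg 48 (Times (Var 48) (Var 48)), reduce K 48,
 Asg 61 (Times (Num 2) (Var 61)), Asg 60 (Plus (Var 60) (Num 1))]"

definition build_hl :: "nat \<Rightarrow> hl" where
"build_hl K = Sq (prepare K) (Sq (choose_modulus K) (Sq (window_hl K) (Sq (Whl (Var 41) (Var vF) (check_step K))
 (Sq (fallback K) (Sq (Whl (Times (Var vF) (Num (3 * K))) (Var 76) tail_step)
 (Sq (tail_final K) (Sq (Whl (Num 0) (Var 41) (encode_step K))
 (Sq (table_init K) (Whl (Var 61) (Plus (Var vn) (Num 1)) (table_step K))))))))))"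

context word_sizes
begin

lemma hs_save:
assumes s: "env s" "36 <= x" "36 <= a" "x < nv" "a < nv" "x ~= a" "x ~= 42" "a ~= 42"
 and v: "reg s x < W ^ (12 * K)" and l: "reg s a + u <= length (arr s k)" "reg s a + u <= W"
shows "hs (save k a x u) s (%s'. (\<forall>i<length (arr s k). arr s' k ! i =
 (if reg s a <= i & i < reg s a + u then reg s x div W ^ (i - reg s a) mod W else arr s k ! i)))"
proof -
define V p L where "V = reg s x" and "p = reg s a" and "L = length (arr s k)"
have VB: "V < B ^ nd" unfolding V_def by (rule lim[OF v]) simp
have "m <= u ==> hs (save k a x m) s (%s'. env s' & reg s' a = p & reg s' x = V div W ^ m & length (arr s' k) = L &
 (\<forall>i<L. arr s' k ! i = (if p <= i & i < p + m then V div W ^ (i - p) mod W else arr s k ! i)))" for m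
proof (induction m)
 case 0
 then show ?case using s by (auto intro!: hs_Nop simp: V_def p_def L_def)
next
 case (Suc m)
 show ?case unfolding save.simps
 proof (rule hs_Sq, rule hs_mono[OF Suc.IH], use Suc.prems in simp, elim conjE)
 fix s' :: config
 assume e: "env s'" and r: "reg s' a = p" "reg s' x = V div W ^ m" "length (arr s' k) = L"
  and c: "\<forall>i<L. arr s' k ! i = (if p <= i & i < p + m then V div W ^ (i - p) mod W else arr s k ! i)"
 define V' where "V' = V div W ^ m"
 have V'W: "V' div W * W <= V'" "V' <= V" by (simp_all add: V'_def)
 have l1: "V' div W * W < B ^ nd" using V'W VB by linarith
 have pm: "p + m < L" "p + m < W" "m < W" using Suc.prems l by (auto simp: p_def L_def)
 have pB: "p + m < B ^ nd" using pm by (intro lim_W) simp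
 have md: "V' - V' div W * W = V' mod W" by (rule minus_div_mult_eq_mod)
 have mW: "V' mod W < W" using W_pos by simp
 define s1 where "s1 = set_reg 42 (V' div W) s'"
 have e1: "env s1" "reg s1 vW = W" "reg s1 42 = V' div W" "reg s1 x = V'" "reg s1 a = p" "arr s1 = arr s'"
  using e r s by (auto simp: s1_def V'_def env_def)
 have V'd: "V div W ^ Suc m = V' div W" by (simp add: V'_def div_mult2_eq[symmetric] mult.commute)
 show "hs (Sq (Asg 42 (div_W (Var x)))
  (Sq (Sto k (Plus (Var a) (Num m)) (Minus (Var x) (Times (Var 42) (Var vW)))) (Asg x (Var 42)))) s'
  (%s'. env s' & reg s' a = p & reg s' x = V div W ^ Suc m & length (arr s' k) = L &
  (\<forall>i<L. arr s' k ! i = (if p <= i & i < p + Suc m then V div W ^ (i - p) mod W else arr s k ! i)))"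
 proof (rule hs_Asg_Sq, simp, goal_cases)
  case 1 show ?case using s by (simp add: div_W[OF e])
 next
  case 2
  have "set_reg 42 (eval s' (div_W (Var x))) s' = s1" by (simp add: s1_def div_W[OF e] r V'_def)
  then show ?case
  proof (simp only:, intro hs_Sq hs_Sto, goal_cases)
  case 6
  have cc: "(\<forall>i<L. (arr s' k)[p + m := V' mod W] ! i = (if p <= i & i < p + Suc m then V div W ^ (i - p) mod W else arr s k ! i))"
   using c pm r by (auto simp: nth_list_update V'_def less_Suc_eq)
  show ?case using s e1 r md V'd cc by (intro hs_Asg) auto
  qed (use s e1 r pm pB l1 V'W md mW in \<open>auto simp: W_def[symmetric]\<close>)
 qed
 qed
qed
note st = this[OF order_refl]
show ?thesis by (rule hs_mono[OF st]) (auto simp: V_def p_def L_def)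
qed

end

section \<open>Drawing and testing the window\<close>

context building
begin

definition bk :: "nat \<Rightarrow> nat" where "bk t = X div R ^ t mod R"

definition clean :: "nat \<Rightarrow> nat \<Rightarrow> bool" where
"clean M j \<longleftrightarrow> (\<forall>t<F. \<not> (j * M <= bk t & bk t < j * M + R mod M))"

lemma Fle: "t < F ==> t * (3 * K) + 3 * K <= N"
proof -
assume "t < F"
then have "(t + 1) * (3 * K) <= F * (3 * K)" by (intro mult_le_mono1) simp
also have "\<dots> <= N" by (simp add: F)
finally show ?thesis by simp
qed

lemma NW: "N <= W"
proof -
have "n * b <= W * w" using b nW by (intro mult_le_mono) auto
then have "N * w < (W + 1) * w" using num_words_bounds(2)[of w "n * b"] w6 by (simp add: N)
then have "N < W + 1" by (rule mult_less_cancel2[THEN iffD1, THEN conjunct2])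
then show ?thesis by simp
qed

lemma XW: "X < W ^ N"
unfolding X by (rule val_less) (rule A0(2))

lemma R_pow_W: "R ^ t = W ^ (t * (3 * K))"
by (simp add: R mult.commute flip: power_mult)

lemma bk: "t < F ==> val W (3 * K) (%i. A0 ! (t * (3 * K) + i)) = bk t"
proof -
assume t: "t < F"
have "bk t = val W N (%a. A0 ! a) div W ^ (t * (3 * K)) mod W ^ (3 * K)"
 unfolding bk_def R_pow_W by (simp only: R X)
also have "\<dots> = val W (3 * K) (%i. A0 ! (t * (3 * K) + i))"
 using Fle[OF t] A0(2) by (subst val_div_mod(1)) (auto intro!: val_div_mod(2))
finally show ?thesis by simp
qed

lemma raw_block:
assumes "env s" "length (arr s 0) = N" "\<forall>a<N. arr s 0 ! a < W"
 "\<forall>a<t * (3 * K) + 3 * K. arr s 0 ! a = A0 ! a" "reg s 41 = t" "t < F"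
shows "safe s (block_ex K (Var 41))" "eval s (block_ex K (Var 41)) = bk t"
proof -
have l: "t * (3 * K) + 3 * K <= N" by (rule Fle[OF assms(6)])
have "val W (3 * K) (%i. arr s 0 ! (t * (3 * K) + i)) = val W (3 * K) (%i. A0 ! (t * (3 * K) + i))"
 by (rule val_cong) (use assms(4) in auto)
then show "eval s (block_ex K (Var 41)) = bk t"
 using bk[OF assms(6)] by (simp add: block_ex_def cells[OF assms(1)] assms(5))
show "safe s (block_ex K (Var 41))" unfolding block_ex_def
proof (rule safe_cells[OF assms(1)])
 have "t * (3 * K) < W" using l NW K1 by linarith
 then have "t * (3 * K) < B ^ nd" by (rule lim_W)
 then show "safe s (Times (Var 41) (Num (3 * K)))" using assms K_less[of 3] by (simp add: W_def)
next
 fix i assume i: "i < 3 * K"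
 have "A0 ! (t * (3 * K) + i) < W" using A0(2) i l by simp
 then show "arr s 0 ! (eval s (Times (Var 41) (Num (3 * K))) + i) < W" using assms(4,5) i by simp
qed (use l NW assms K1 in auto)
qed

lemma bk_less: "bk t < R" using W_pos unfolding bk_def by (simp add: R)

lemma R_less: "R < W ^ (5 * K)"
unfolding R by (rule wpow_less) (use K1 in simp)

lemma less_R_lim: "x < R ==> x < B ^ nd"
by (rule lim[of _ "5 * K"]) (use R_less in auto)

lemma K4_lim: "x <= W ^ (3 * K) + W ^ (3 * K) ==> x < B ^ nd"
proof -
assume "x <= W ^ (3 * K) + W ^ (3 * K)"
also have "\<dots> <= W * W ^ (3 * K)" using mult_le_mono1[OF W_ge2, of "W ^ (3 * K)"] by linarith
also have "\<dots> < W ^ (12 * K)" using wpow_less[of "Suc (3 * K)" "12 * K"] K1 by simp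
finally show ?thesis by (rule lim) simp
qed

definition win :: "nat \<Rightarrow> nat \<Rightarrow> nat \<Rightarrow> config \<Rightarrow> bool" where
"win M J e s \<longleftrightarrow> base s & modulus s M & reg s vJ = J & reg s vE = e"

lemma win_set_reg [simp]: "36 <= x ==> win M J e (set_reg x v s) = win M J e s"
by (simp add: win_def)

lemma win_frame:
assumes "win M J e s" "!!x. x < 36 ==> reg s' x = reg s x" "arr s' 0 = arr s 0" "arr s' 1 = arr s 1"
shows "win M J e s'"
proof -
have "base s'" by (rule base_frame[of s]) (use assms in \<open>auto simp: win_def\<close>)
then show ?thesis using assms by (simp add: win_def modulus_def)
qed

lemma hs_window:
assumes s: "chosen M \<omega> s"
shows "hs (window_hl K) s (%s'. win M (word_num w K 0 \<omega> * M) (R mod M) s' & word_num w K 0 \<omega> < W ^ K &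
 reg s' 75 = 0 & reg s' 41 = 0)"
proof -
define j where "j = word_num w K 0 \<omega>"
let ?I = "%k s'. base s' & modulus s' M & reg s' 72 < W ^ k & word_num w (K - k) (reg s' 72) (rnd s') = j"
have M: "0 < M" "M <= W ^ (2 * K)" and b: "base s" "modulus s M" "rnd s = \<omega>"
 using s by (auto simp: chosen_def modulus_def)
have modrnd: "modulus (s\<lparr>rnd := x\<rparr>) M' = modulus s M'" for s :: config and x M' by (simp add: modulus_def)
have 1: "hs (hrep K random_step) (set_reg 72 0 s) (?I K)"
proof (rule hs_hrep[where I = ?I])
 show "hfree random_step" by (simp add: random_step_def)
 fix k s' assume k: "k < K" and I: "?I k s'"
 obtain m where m: "K - k = Suc m" "K - Suc k = m" using k by (cases "K - k") auto
 define v where "v = reg s' 72"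
 define x where "x = shd (rnd s') mod W"
 have "v + 1 <= W ^ k" using I by (simp add: v_def)
 then have "(v + 1) * W <= W ^ k * W" by (rule mult_le_mono1)
 then have "v * W + W <= W ^ Suc k" by (simp add: algebra_simps)
 moreover have "x < W" using W_pos by (simp add: x_def)
 ultimately have vx: "v * W + x < W ^ Suc k" by linarith
 then have "v * W + x < B ^ nd" by (rule lim) (use k in simp)
 moreover from this have "v * W < B ^ nd" by simp
 ultimately show "hs random_step s' (?I (Suc k))" unfolding random_step_def
 using I vx m by (intro hs_Sq hs_Rnd hs_Asg)
  (auto simp: modrnd v_def[symmetric] x_def[symmetric] W_def[symmetric] base_def env_def)
qed (use b M in \<open>auto simp: j_def\<close>)
have jl: "?I K s' ==> reg s' 72 = j & j < W ^ K" for s' by auto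
show ?thesis unfolding window_hl_def
proof (rule hs_Asg_Sq, simp, simp, rule hs_Sq, simp only: eval.simps, rule hs_mono[OF 1])
 fix s2 assume I: "?I K s2"
 then have r2: "reg s2 72 = j" "reg s2 vM = M" "reg s2 vR = R" "j < W ^ K" by (auto simp: modulus_def base_def)
 have "j * M <= j * W ^ (2 * K)" using M by simp
 also have "\<dots> <= W ^ K * W ^ (2 * K)" using r2 by (intro mult_le_mono1) simp
 also have "\<dots> = W ^ (3 * K)" by (simp flip: power_add)
 finally have jM: "j * M < B ^ nd" by (intro K4_lim) simp
 define s3 where "s3 = set_reg 74 R (set_reg vJ (j * M) s2)"
 have s3: "env s3" "modulus s3 M" "reg s3 74 = R" "base s3" "reg s3 vJ = j * M"
 using I by (auto simp: s3_def base_def env_def modulus_def)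
 show "hs (seqs [Asg vJ (Times (Var 72) (Var vM)), Asg 74 (Var vR), reduce K 74, Asg vE (Var 74),
  Asg 75 (Num 0), Asg 41 (Num 0)]) s2
 (%s'. win M (word_num w K 0 \<omega> * M) (R mod M) s' & word_num w K 0 \<omega> < W ^ K & reg s' 75 = 0 & reg s' 41 = 0)"
 unfolding seqs.simps
 proof (rule hs_Asg_Sq, simp, (use r2 jM in simp), rule hs_Asg_Sq, simp, simp, goal_cases)
 case 1
 have e3: "set_reg 74 (eval (set_reg vJ (eval s2 (Times (Var 72) (Var vM))) s2) (Var vR))
  (set_reg vJ (eval s2 (Times (Var 72) (Var vM))) s2) = s3"
  by (simp add: s3_def r2)
 show ?case unfolding e3
 proof (rule hs_Sq, rule hs_reduce[OF s3(1,2)], goal_cases)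
  case (5 q)
  show ?case
  by (intro hs_Asg_Sq hs_Nop) (use s3 r2 W01 in \<open>auto simp: win_def modulus_def j_def[symmetric]\<close>)
 qed (use s3 R_less in auto)
 qed
qed
qed

lemma hb_check:
assumes s: "win M J e s" "reg s 75 = 0" "reg s 41 = 0" and Je: "J + e <= R"
shows "hb ((F + 1) * (steps (cmp nd (check_step K)) + cost_test (Var 41) (Var vF)) + 1) (Whl (Var 41) (Var vF) (check_step K)) s
 (%s'. win M J e s' & (0 < reg s' 75 \<longleftrightarrow> (\<exists>t<F. J <= bk t & bk t < J + e)))"
proof (rule hb_loop[where J = "%k s'. win M J e s' & reg s' 41 + k = F &
 (0 < reg s' 75 \<longleftrightarrow> (\<exists>t<reg s' 41. J <= bk t & bk t < J + e))"])
fix k s' assume I: "win M J e s' & reg s' 41 + k = F &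
 (0 < reg s' 75 \<longleftrightarrow> (\<exists>t<reg s' 41. J <= bk t & bk t < J + e))"
define t where "t = reg s' 41"
define bad where "bad t \<longleftrightarrow> (\<exists>u<t. J <= bk u & bk u < J + e)" for t
have r: "reg s' vF = F" "reg s' vJ = J" "reg s' vE = e" "env s'" "arr s' 0 = A0"
 using I by (auto simp: win_def base_def)
have "hs (check_step K) s' (%s'. win M J e s' & reg s' 41 + (k - 1) = F & (0 < reg s' 75 \<longleftrightarrow> bad (reg s' 41)))" if tF: "t < F"
proof -
 have "length (arr s' 0) = N" "\<forall>a<N. arr s' 0 ! a < W" "\<forall>a<t * (3 * K) + 3 * K. arr s' 0 ! a = A0 ! a"
 using r A0 by auto
 note rb = raw_block[OF r(4) this t_def[symmetric] tF]
 have "t + 1 <= W * 8" using tF NW div_le_dividend[of N "3 * K", folded F] by linarith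
 then have tl: "t + 1 < B ^ nd" by (rule small_lim)
 have Jel: "J + e < B ^ nd" using Je by (intro K4_lim) (simp add: R)
 have bs: "bad (Suc t) \<longleftrightarrow> bad t \<or> (J <= bk t & bk t < J + e)" by (auto simp: bad_def less_Suc_eq)
 define s1 where "s1 = set_reg 43 (bk t) s'"
 have s1: "win M J e s1" "reg s1 41 = t" "reg s1 43 = bk t" "reg s1 vJ = J" "reg s1 vE = e" "reg s1 75 = reg s' 75"
 using I r by (auto simp: s1_def t_def)
 have "hs (Iff (Var 43) (Var vJ) Nop (Iff (Var 43) (Plus (Var vJ) (Var vE)) (Asg 75 (Num 1)) Nop)) s1
 (%s'. win M J e s' & reg s' 41 = t & (0 < reg s' 75 \<longleftrightarrow> bad (Suc t)))"
 proof (rule hs_Iff, goal_cases)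
 case 5
 then show ?case using s1 bs I by (intro hs_Nop) (auto simp: bad_def[symmetric] t_def[symmetric])
 next
 case 6
 then show ?case using s1 bs I Jel W01
  by (intro hs_Iff hs_Asg hs_Nop) (auto simp: bad_def[symmetric] t_def[symmetric])
 qed auto
 note i = this
 show ?thesis unfolding check_step_def
 apply (rule hs_Asg_Sq, simp, rule rb, simp only: rb(2) s1_def[symmetric])
 apply (rule hs_Sq, rule hs_mono[OF i], rule hs_Asg, simp)
 using tl W01 I tF by (auto simp: t_def)
qed
moreover have "0 < reg s' 75 \<longleftrightarrow> (\<exists>t<F. J <= bk t & bk t < J + e)" if "\<not> t < F"
proof -
 have "reg s' 41 = F" using I that by (simp add: t_def)
 with I show ?thesis by simp
qed
ultimately show "safe s' (Var 41) & safe s' (Var vF) &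
 (eval s' (Var 41) < eval s' (Var vF) --> 0 < k & hb (steps (cmp nd (check_step K))) (check_step K) s'
  (%s'. win M J e s' & reg s' 41 + (k - 1) = F & (0 < reg s' 75 \<longleftrightarrow> (\<exists>t<reg s' 41. J <= bk t & bk t < J + e)))) &
 (\<not> eval s' (Var 41) < eval s' (Var vF) --> win M J e s' & (0 < reg s' 75 \<longleftrightarrow> (\<exists>t<F. J <= bk t & bk t < J + e)))"
 using I by (simp add: t_def[symmetric] bad_def r hb_hs)
qed (use s in auto)

definition settled :: "nat \<Rightarrow> nat \<Rightarrow> nat \<Rightarrow> nat \<Rightarrow> bool" where
"settled M J e j \<longleftrightarrow> 0 < M & M <= W ^ (2 * K) & e = R mod M & J = j * M & J + e <= R & clean M j"

text \<open>The split of a block into \<open>K\<close> words for the factor and \<open>2 * K\<close>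
  for the modulus is used here: \<open>(j + 1) * M <= W ^ K * W ^ (2 * K)\<close>.\<close>

lemma JeR: "0 < M ==> M <= W ^ (2 * K) ==> j < W ^ K ==> j * M + R mod M <= R"
proof -
assume "0 < M" "M <= W ^ (2 * K)" "j < W ^ K"
then have "j * M + R mod M <= (j + 1) * M" by (simp add: less_imp_le)
also have "\<dots> <= W ^ K * W ^ (2 * K)" using \<open>j < W ^ K\<close> \<open>M <= W ^ (2 * K)\<close> by (intro mult_le_mono) auto
also have "\<dots> = R" by (simp add: R flip: power_add)
finally show ?thesis .
qed

lemma hs_fallback:
assumes s: "win M (j * M) (R mod M) s" "j < W ^ K" "0 < reg s 75 \<longleftrightarrow> \<not> clean M j"
shows "hs (fallback K) s (%s'. \<exists>M' J e j'. win M' J e s' & settled M' J e j' & (clean M j --> M' = M) &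
 reg s' vRem = 0 & reg s' 76 = N)"
proof -
have e: "env s" using s by (simp add: win_def base_def)
have M: "0 < M" "M <= W ^ (2 * K)" using s by (auto simp: win_def modulus_def)
have W1: "1 <= W ^ (2 * K)" using W_pos by simp
let ?P = "%s'. \<exists>M' J e j'. win M' J e s' & settled M' J e j' & (clean M j --> M' = M)"
have "hs (Iff (Num 0) (Var 75) (seqs [Asg vM (Num 1), Asg vU (wpow (5 * K)), Asg vJ (Num 0), Asg vE (Num 0)]) Nop) s ?P"
proof (rule hs_Iff, goal_cases)
 case 5
 then have nc: "\<not> clean M j" using s by simp
 have e1: "env (set_reg vM v s)" for v using e by (simp add: env_def)
 have c1: "settled 1 0 0 0" using W1 by (auto simp: settled_def clean_def)
 show ?case unfolding seqs.simps
 apply (rule hs_Asg_Sq, simp, use W01 in simp)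
 apply (rule hs_Asg_Sq, simp, rule safe_wpow[OF e1], use K1 in simp)
 apply (intro hs_Asg_Sq hs_Nop)
  apply (use W01 in simp_all)
 using s(1) W1 c1 nc
 by (intro exI[of _ 1] exI[of _ 0]) (auto simp: win_def modulus_def wpow[OF e1] base_def env_def)
next
 case 6
 then have "clean M j" using s by simp
 then have "settled M (j * M) (R mod M) j" using M JeR[OF M s(2)] by (simp add: settled_def)
 then show ?case using s by (intro hs_Nop) blast
qed (use W01 in auto)
then show ?thesis unfolding fallback_def
proof (intro hs_Sq, elim hs_mono, goal_cases)
 case (1 s2)
 then obtain M' J e j' where 2: "win M' J e s2" "settled M' J e j'" "clean M j --> M' = M" by blast
 have "win M' J e (set_reg vRem v s2)" for v using 2(1) by (simp add: win_def modulus_def)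
 with 2 show ?case using W01
 by (intro hs_Asg_Sq hs_Asg) (auto simp: win_def base_def)
qed
qed

end

section \<open>Encoding of the blocks and the table of powers\<close>

locale built = building +
fixes M J e jw :: nat
assumes settled: "settled M J e jw"

sublocale built \<subseteq> encoding w K nd h M J e jw X N F R
by unfold_locales (use settled[unfolded settled_def] R NW XW F in auto)

context built
begin

lemma bl_bk: "bl t = bk t" by (simp add: bl_def bk_def)

lemma not_window: "t < F ==> \<not> (J <= bl t & bl t < J + e)"
using settled by (auto simp: settled_def clean_def bl_bk)

lemma N_less: "N < F * (3 * K) + 3 * K"
proof -
have "N < 3 * K + N div (3 * K) * (3 * K)" by (rule dividend_less_div_times) (use K1 in simp)
then show ?thesis by (simp add: F)
qed

definition tl_inv :: "nat \<Rightarrow> config \<Rightarrow> bool" where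
"tl_inv k s \<longleftrightarrow> win M J e s & reg s 76 = F * (3 * K) + k & reg s 76 <= N &
 reg s vRem = val W (N - reg s 76) (%i. A0 ! (reg s 76 + i))"

text \<open>Fewer than \<open>3 * K\<close> words follow the full blocks, so this loop costs a
  constant. It runs from the last word down, as Horner's rule for a little-endian number
  requires.\<close>

lemma hb_tail:
assumes s: "win M J e s" "reg s vRem = 0" "reg s 76 = N"
shows "hb ((3 * K + 1) * (steps (cmp nd tail_step) + cost_test (Times (Var vF) (Num (3 * K))) (Var 76)) + 1)
 (Whl (Times (Var vF) (Num (3 * K))) (Var 76) tail_step) s (%s'. win M J e s' & reg s' vRem = bl F)"
proof -
have FN: "F * (3 * K) <= N" by (simp add: F)
have FB: "F * (3 * K) < B ^ nd" using FN NW by (intro small_lim) simp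
have K3: "3 * K < 2 ^ w" using K_less[of 3] by (simp add: W_def)
have "hb ((N - F * (3 * K) + 1) * (steps (cmp nd tail_step) + cost_test (Times (Var vF) (Num (3 * K))) (Var 76)) + 1)
 (Whl (Times (Var vF) (Num (3 * K))) (Var 76) tail_step) s (%s'. win M J e s' & reg s' vRem = bl F)"
proof (rule hb_loop[where J = tl_inv])
 fix k s' assume I: "tl_inv k s'"
 have r: "reg s' vF = F" "env s'" "reg s' vW = W" "arr s' 0 = A0" using I by (auto simp: tl_inv_def win_def base_def env_def)
 have "hs tail_step s' (tl_inv (k - 1))" if k: "0 < k"
 proof -
 define p where "p = reg s' 76 - 1"
 have p: "reg s' 76 = Suc p" "p < N" "p = F * (3 * K) + (k - 1)" "N - p = Suc (N - Suc p)"
  using I k by (auto simp: tl_inv_def p_def)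
 have pW: "p < W" using p NW by simp
 define v where "v = reg s' vRem"
 have vv: "v = val W (N - Suc p) (%i. A0 ! (Suc p + i))" using I p by (simp add: tl_inv_def v_def)
 have new: "val W (N - p) (%i. A0 ! (p + i)) = v * W + A0 ! p"
  unfolding p(4) val_Suc_left vv by (simp add: mult.commute)
 have "val W (N - p) (%i. A0 ! (p + i)) < W ^ (N - p)"
  by (rule val_less) (use A0 in auto)
 then have l: "v * W + A0 ! p < W ^ (N - p)" by (simp add: new)
 have "N - p <= 12 * K" using N_less p by linarith
 from lim[OF l this] have l2: "v * W + A0 ! p < B ^ nd" .
 have wf: "win M J e (set_reg vRem u (set_reg 76 q s'))" for u q using I by (simp add: tl_inv_def win_def modulus_def)
 show ?thesis unfolding tail_step_def
  by (rule hs_Asg_Sq, simp, (use W01 p in simp), rule hs_Asg, simp)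
  (use r p pW A0 l2 new wf in \<open>auto simp: v_def tl_inv_def W_def[symmetric]\<close>)
 qed
 moreover have "reg s' vRem = bl F" if "k = 0"
 proof -
 have "reg s' vRem = val W (N - F * (3 * K)) (%i. A0 ! (F * (3 * K) + i))" using I that by (simp add: tl_inv_def)
 also have "\<dots> = X div W ^ (F * (3 * K))" unfolding X
  by (rule val_div_mod(1)[symmetric]) (use A0 FN in auto)
 also have "\<dots> = bl F + R * (X div R ^ Suc F)" unfolding R_pow_W[symmetric] by (rule X_step)
 also have "X div R ^ Suc F = 0" by (rule X_div) simp
 finally show ?thesis by simp
 qed
 ultimately show "safe s' (Times (Var vF) (Num (3 * K))) & safe s' (Var 76) &
 (eval s' (Times (Var vF) (Num (3 * K))) < eval s' (Var 76) --> 0 < k & hb (steps (cmp nd tail_step)) tail_step s' (tl_inv (k - 1))) &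
 (\<not> eval s' (Times (Var vF) (Num (3 * K))) < eval s' (Var 76) --> win M J e s' & reg s' vRem = bl F)"
 using I r FB K3 by (auto simp: tl_inv_def intro: hb_hs)
qed (use s FN in \<open>auto simp: tl_inv_def\<close>)
then show ?thesis by (rule hb_mono) (use N_less in auto)
qed

definition part_enc :: "nat \<Rightarrow> config \<Rightarrow> bool" where
"part_enc k s \<longleftrightarrow> env s & modulus s M & reg s vn = n & reg s vb = b & reg s vR = R & reg s vJ = J & reg s vE = e & reg s vRem = bl F &
 reg s vY = ys F & reg s 41 = k & k <= F & reg s 44 = ys k & arr s 1 = E0 &
 length (arr s 0) = N & (\<forall>a<N. arr s 0 ! a < W) & (\<forall>a<k * (3 * K). arr s 0 ! a = A0 ! a) &
 (\<forall>t<F. k <= t --> val W (3 * K) (%i. arr s 0 ! (t * (3 * K) + i)) = enc M J e (bl t) (ys t))"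

lemma hs_tail_final:
assumes s: "win M J e s" "reg s vRem = bl F"
shows "hs (tail_final K) s (part_enc F)"
proof -
have r: "env s" "modulus s M" using s by (auto simp: win_def base_def)
define s1 where "s1 = set_reg 77 (bl F) s"
have s1: "env s1" "modulus s1 M" "reg s1 77 < W ^ (5 * K)"
 using r bl_less[of F] R_less by (auto simp: s1_def)
have yF: "ys F = bl F mod M" by (subst ys_step) (simp add: ys_zero)
show ?thesis unfolding tail_final_def seqs.simps
proof (rule hs_Asg_Sq, simp, simp, rule hs_Sq, simp only: eval.simps s(2) s1_def[symmetric], rule hs_reduce[OF s1], goal_cases)
 case (4 q)
 show ?case
 by (intro hs_Asg_Sq hs_Nop)
  (use s A0 in \<open>auto simp: s1_def part_enc_def win_def base_def env_def modulus_def yF\<close>)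
qed auto
qed

lemma encode_step:
assumes I: "part_enc (Suc t) s"
shows "hs (encode_step K) s (part_enc t)"
proof -
have tF: "t < F" and r: "env s" "modulus s M" "reg s vR = R" "reg s vJ = J" "reg s vE = e" "reg s 41 = Suc t" "reg s 44 = ys (Suc t)"
 "length (arr s 0) = N" "\<forall>a<N. arr s 0 ! a < W" "\<forall>a<t * (3 * K) + 3 * K. arr s 0 ! a = A0 ! a"
 using I by (auto simp: part_enc_def algebra_simps)
define s1 where "s1 = set_reg 41 t s"
have s1: "env s1" "length (arr s1 0) = N" "\<forall>a<N. arr s1 0 ! a < W" "\<forall>a<t * (3 * K) + 3 * K. arr s1 0 ! a = A0 ! a" "reg s1 41 = t"
 using r by (auto simp: s1_def)
note rb = raw_block[OF s1 tF, folded bl_bk]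
define V where "V = bl t + R * ys (Suc t)"
have V: "V < W ^ (5 * K)" unfolding V_def by (rule RM_less[OF bl_less ys_less])
then have VB: "V < B ^ nd" by (rule lim) simp
have RV: "R * ys (Suc t) < B ^ nd" using VB by (simp add: V_def)
have Vy: "V mod M = ys t" by (simp add: V_def ys_step[symmetric])
define x' where "x' = (if bl t < J then bl t else bl t - e)"
define z where "z = x' - x' mod M + ys t"
have z: "z = enc M J e (bl t) (ys t)" by (simp add: z_def x'_def enc_def Let_def)
have zR: "z < R" unfolding z by (rule enc(1)[OF bl_less not_window[OF tF] ys_less])
have zB: "z < B ^ nd" using zR by (rule less_R_lim)
have x'l: "x' < W ^ (5 * K)" using bl_less[of t] R_less by (auto simp: x'_def)
have xm: "x' mod M <= x'" by simp
have ebl: "\<not> bl t < J ==> e <= bl t" using not_window[OF tF] by linarith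
have l: "t * (3 * K) + 3 * K <= N" by (rule Fle[OF tF])
have tB: "t * (3 * K) < B ^ nd" using l NW by (intro small_lim) linarith
have K3: "3 * K < 2 ^ w" using K_less[of 3] by (simp add: W_def)
define s3 where "s3 = set_reg 45 V (set_reg 43 (bl t) s1)"
have s3: "env s3" "modulus s3 M" "reg s3 45 < W ^ (5 * K)" using r V by (auto simp: s3_def s1_def)
have K12: "R < W ^ (12 * K)" unfolding R by (rule wpow_less) (use K1 in simp)
show ?thesis unfolding encode_step_def seqs.simps
proof (rule hs_Asg_Sq, simp, (use r W01 in simp), goal_cases)
 case 1
 have e1: "set_reg 41 (eval s (Minus (Var 41) (Num 1))) s = s1" by (simp add: s1_def r)
 show ?case unfolding e1
 proof (rule hs_Asg_Sq, simp, rule rb, unfold rb, rule hs_Asg_Sq, simp, goal_cases)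
 case 1 show ?case using r RV VB by (simp add: s1_def V_def)
 next
 case 2
 have e3: "set_reg 45 (eval (set_reg 43 (bl t) s1) (Plus (Var 43) (Times (Var vR) (Var 44)))) (set_reg 43 (bl t) s1) = s3"
  using r by (simp add: s3_def s1_def V_def)
 show ?case unfolding e3
 proof (rule hs_Sq, rule hs_reduce[OF s3], goal_cases)
  case (4 q)
  define s4 where "s4 = set_reg 45 (reg s3 45 mod M) (set_reg 40 q s3)"
  have r4: "reg s4 41 = t" "reg s4 43 = bl t" "reg s4 45 = ys t" "reg s4 vJ = J" "reg s4 vE = e" "env s4" "modulus s4 M"
  "!!x. x < 36 ==> reg s4 x = reg s x" "arr s4 = arr s"
  using r Vy by (auto simp: s4_def s3_def s1_def)
  let ?c = "Iff (Var 43) (Var vJ) (Asg 46 (Var 43)) (Asg 46 (Minus (Var 43) (Var vE)))"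
  have 5: "hs ?c s4 (%s5. reg s5 46 = x')"
  by (rule hs_Iff; (rule hs_Asg)?) (use r4 ebl in \<open>auto simp: x'_def\<close>)
  show ?case unfolding s4_def[symmetric]
  proof (rule hs_Sq, rule hs_call[OF 5], goal_cases)
  case (1 s5)
  define s6 where "s6 = set_reg 47 x' s5"
  have r6: "reg s6 41 = t" "reg s6 45 = ys t" "reg s6 46 = x'" "reg s6 47 < W ^ (5 * K)"
   "!!x. x < 36 ==> reg s6 x = reg s x" "arr s6 = arr s" "env s6" "modulus s6 M"
   using 1 r4 x'l by (auto simp: s6_def env_def modulus_def)
  have e6: "set_reg 47 (eval s5 (Var 46)) s5 = s6" using 1 by (simp add: s6_def)
  show ?case
  proof (rule hs_Asg_Sq, simp, simp, unfold e6, rule hs_Sq, rule hs_reduce[OF r6(7,8,4)], goal_cases)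
   case (4 q')
   define s7 where "s7 = set_reg 47 (reg s6 47 mod M) (set_reg 40 q' s6)"
   have r7: "reg s7 41 = t" "reg s7 45 = ys t" "reg s7 46 = x'" "reg s7 47 = x' mod M"
   "!!x. x < 36 ==> reg s7 x = reg s x" "arr s7 = arr s"
   using r6 by (auto simp: s7_def s6_def)
   define s8 where "s8 = set_reg 56 (t * (3 * K)) (set_reg 44 (ys t) (set_reg 43 z s7))"
   have r8: "reg s8 41 = t" "reg s8 44 = ys t" "reg s8 43 = z" "reg s8 56 = t * (3 * K)"
   "!!x. x < 36 ==> reg s8 x = reg s x" "arr s8 = arr s"
   using r7 by (auto simp: s8_def)
   have e8: "env s8" using r(1) r8(5) by (simp add: env_def)
   have sv: "hs (save 0 56 43 (3 * K)) s8 (%s'. (\<forall>i<length (arr s8 0). arr s' 0 ! i =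
   (if reg s8 56 <= i & i < reg s8 56 + 3 * K then reg s8 43 div W ^ (i - reg s8 56) mod W else arr s8 0 ! i)))"
   by (rule hs_save[OF e8]) (use r8 r l NW zR K12 in auto)
   show ?case unfolding s7_def[symmetric]
   proof (rule hs_Asg_Sq, simp, goal_cases)
   case 1 show ?case using r7 zB xm by (simp add: z_def)
   next
   case 2
   have e7: "set_reg 56 (t * (3 * K)) (set_reg 44 (ys t) (set_reg 43 (x' + ys t - x' mod M) s7)) = s8"
    by (simp add: s8_def z_def)
   show ?case
    apply (rule hs_Asg_Sq, simp, simp, rule hs_Asg_Sq, simp)
    using r7 tB K3 apply simp
    apply (simp add: r7 e7)
   proof (rule hs_Sq, rule hs_call[OF sv], rule hs_Nop, goal_cases)
    case (1 s9)
    have r9: "!!x. x < 36 ==> reg s9 x = reg s x" "reg s9 41 = t" "reg s9 44 = ys t"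
    "arr s9 1 = arr s 1" "length (arr s9 0) = N"
    using 1 r8 r by (auto simp: save_frame)
    have c9: "\<forall>i<N. arr s9 0 ! i = (if t * (3 * K) <= i & i < t * (3 * K) + 3 * K
    then z div W ^ (i - t * (3 * K)) mod W else arr s 0 ! i)"
    using 1(1) r8 r by simp
    have lt: "\<forall>a<N. arr s9 0 ! a < W" using c9 r W_pos by auto
    have low: "\<forall>a<t * (3 * K). arr s9 0 ! a = A0 ! a" using c9 r l by auto
    have bl_t: "val W (3 * K) (%i. arr s9 0 ! (t * (3 * K) + i)) = z"
    proof -
    have "val W (3 * K) (%i. arr s9 0 ! (t * (3 * K) + i)) = val W (3 * K) (%i. z div W ^ i mod W)"
     by (rule val_cong) (use c9 l in auto)
    also have "\<dots> = z" using zR by (simp add: val_digits R)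
    finally show ?thesis .
    qed
    have hi: "val W (3 * K) (%i. arr s9 0 ! (u * (3 * K) + i)) = enc M J e (bl u) (ys u)" if u: "u < F" "t < u" for u
    proof -
    have "(t + 1) * (3 * K) <= u * (3 * K)" using u by (intro mult_le_mono1) simp
    then have "val W (3 * K) (%i. arr s9 0 ! (u * (3 * K) + i)) = val W (3 * K) (%i. arr s 0 ! (u * (3 * K) + i))"
     using c9 Fle[OF u(1)] by (intro val_cong) auto
    then show ?thesis using I u by (simp add: part_enc_def)
    qed
    have "\<forall>u<F. t <= u --> val W (3 * K) (%i. arr s9 0 ! (u * (3 * K) + i)) = enc M J e (bl u) (ys u)"
    using bl_t hi z by (auto simp: le_less)
    then show ?case using I r9 lt low tF by (auto simp: part_enc_def env_def modulus_def)
   qed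
   qed
  qed auto
  qed
 qed auto
 qed
qed
qed

lemma hb_encode:
assumes s: "part_enc F s"
shows "hb ((F + 1) * (steps (cmp nd (encode_step K)) + cost_test (Num 0) (Var 41)) + 1) (Whl (Num 0) (Var 41) (encode_step K)) s (part_enc 0)"
proof (rule hb_loop[where J = part_enc])
fix k s' assume I: "part_enc k s'"
have "hs (encode_step K) s' (part_enc (k - 1))" if "0 < k"
 using encode_step[of "k - 1" s'] I that by simp
then show "safe s' (Num 0) & safe s' (Var 41) &
 (eval s' (Num 0) < eval s' (Var 41) --> 0 < k & hb (steps (cmp nd (encode_step K))) (encode_step K) s' (part_enc (k - 1))) &
 (\<not> eval s' (Num 0) < eval s' (Var 41) --> part_enc 0 s')"
 using I by (auto simp: part_enc_def intro: hb_hs)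
qed (rule s)

definition vals :: "nat \<Rightarrow> nat" where
"vals k = (if k = 0 then M else if k = 1 then W ^ (5 * K) div M else if k = 2 then J else if k = 3 then e
 else if k = 4 then bl F else if k = 5 then ys F else 2 ^ (b * 2 ^ (k - 6)) mod M)"

definition slots_ok :: "nat \<Rightarrow> config \<Rightarrow> bool" where
"slots_ok k s \<longleftrightarrow> env s & modulus s M & reg s vn = n & reg s vb = b & reg s vJ = J & reg s vE = e & reg s vRem = bl F &
 reg s vY = ys F & stru (arr s 0) & length (arr s 1) = sw K * (7 + l) & (\<forall>a<length (arr s 1). arr s 1 ! a < W) &
 (\<forall>i<k. slot (arr s 1) i = vals i)"

lemma E_W: "sw K * (7 + l) <= W"
proof -
have "sw K * (7 + l) <= (6 * K) * (8 * w)" using K1 lw w6 by (intro mult_le_mono) (auto simp: sw_def)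
also have "\<dots> <= 1000 * K * w * B" using B_pos by (cases B) auto
finally show ?thesis using big' by linarith
qed

lemma vals_less: "vals k < W ^ sw K"
proof -
have 5: "W ^ (5 * K) < W ^ sw K" by (rule wpow_less) (simp add: sw_def)
have "M <= W ^ (5 * K)" using MW wpow_less[of "2 * K" "5 * K"] K1 by simp
moreover have "J <= R" "e <= R" "bl F < R" using JR bl_less by auto
moreover have "ys F < M" "2 ^ x mod M < M" for x using ys_less M by auto
moreover have "W ^ (5 * K) div M <= W ^ (5 * K)" by simp
ultimately show ?thesis using 5 R_less unfolding vals_def by (smt (verit) le_less_trans less_trans less_imp_le order.strict_trans2)
qed

lemma slots_save:
assumes s: "slots_ok k s" "reg s 43 = vals k" "reg s 56 = k * sw K" "k < 7 + l"
shows "hs (save 1 56 43 (sw K)) s (slots_ok (Suc k))"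
proof -
have r: "env s" "length (arr s 1) = sw K * (7 + l)" using s by (auto simp: slots_ok_def)
have "(k + 1) * sw K <= (7 + l) * sw K" using s(4) by (intro mult_le_mono1) simp
then have kl: "k * sw K + sw K <= sw K * (7 + l)" by (simp add: algebra_simps)
have vl: "vals k < W ^ (12 * K)"
 by (rule less_le_trans[OF vals_less power_increasing]) (use K1 W_pos in \<open>auto simp: sw_def\<close>)
have "hs (save 1 56 43 (sw K)) s (%s'. (\<forall>i<length (arr s 1). arr s' 1 ! i =
 (if reg s 56 <= i & i < reg s 56 + sw K then reg s 43 div W ^ (i - reg s 56) mod W else arr s 1 ! i)))"
 by (rule hs_save[OF r(1)]) (use s r kl vl E_W in auto)
then show ?thesis
proof (rule hs_call, goal_cases)
 case (1 s')
 have r': "!!x. x < 36 ==> reg s' x = reg s x" "arr s' 0 = arr s 0" "length (arr s' 1) = sw K * (7 + l)"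
 using 1 r by (auto simp: save_frame)
 have c: "\<forall>i<sw K * (7 + l). arr s' 1 ! i = (if k * sw K <= i & i < k * sw K + sw K then vals k div W ^ (i - k * sw K) mod W else arr s 1 ! i)"
 using 1(1) s r by simp
 have lt: "\<forall>a<length (arr s' 1). arr s' 1 ! a < W" using c r' r s W_pos by (auto simp: slots_ok_def)
 have new: "slot (arr s' 1) k = vals k"
 proof -
 have "slot (arr s' 1) k = val W (sw K) (%i. vals k div W ^ i mod W)"
  unfolding slot_def by (rule val_cong) (use c kl in auto)
 then show ?thesis using vals_less[of k] by (simp add: val_digits)
 qed
 have old: "slot (arr s' 1) i = vals i" if i: "i < k" for i
 proof -
 have "(i + 1) * sw K <= k * sw K" using i by (intro mult_le_mono1) simp
 then have "slot (arr s' 1) i = slot (arr s 1) i"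
  unfolding slot_def by (intro val_cong) (use c kl in auto)
 then show ?thesis using s i by (simp add: slots_ok_def)
 qed
 show ?case using s(1) r' lt new old by (auto simp: slots_ok_def env_def modulus_def less_Suc_eq)
qed
qed

lemma slots_set_reg [simp]: "36 <= x ==> slots_ok k (set_reg x v s) = slots_ok k s"
by (simp add: slots_ok_def)

lemma hs_put_slot:
assumes s: "slots_ok k s" "reg s x = vals k" "k < 6" "x < 36"
shows "hs (put_slot K k x) s (slots_ok (Suc k))"
proof -
have k: "k < 2 ^ w" using num_less[of k] s(3) by (simp add: W_def)
have sK: "sw K < 2 ^ w" using K_less[of 6] K1 by (simp add: sw_def W_def)
have "k * sw K <= sw K * (7 + l)" using s(3) by simp
then have kB: "k * sw K < B ^ nd" using E_W by (intro small_lim) linarith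
have "hs (save 1 56 43 (sw K)) (set_reg 56 (k * sw K) (set_reg 43 (vals k) s)) (slots_ok (Suc k))"
 by (rule slots_save) (use s in auto)
then show ?thesis unfolding put_slot_def using s k sK kB
 by (intro hs_Asg_Sq) auto
qed

definition tab :: "nat \<Rightarrow> config \<Rightarrow> bool" where
"tab k s \<longleftrightarrow> k <= Suc l & slots_ok (6 + (Suc l - k)) s & reg s 60 = Suc l - k & reg s 61 = 2 ^ (Suc l - k) &
 reg s 48 = 2 ^ (b * 2 ^ (Suc l - k)) mod M"

lemma hs_table_init:
assumes s: "part_enc 0 s"
shows "hs (table_init K) s (tab (Suc l))"
proof -
have 0: "slots_ok 0 s"
 using s not_window E0 E0_less by (auto simp: part_enc_def slots_ok_def stru_def)
have mo: "slots_ok k s ==> reg s vM = M" "slots_ok k s ==> reg s vU = W ^ (5 * K) div M" for k s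
 by (auto simp: slots_ok_def modulus_def)
have bw: "b div 2 < w" "b - b div 2 < w" using b w6 by auto
have b2: "2 ^ (b div 2) * 2 ^ (b - b div 2) = (2::nat) ^ b" by (simp flip: power_add)
have bW: "(2::nat) ^ b <= W" unfolding W_def using b by (intro power_increasing) auto
have bB: "(2::nat) ^ b < B ^ nd" using bW by (intro small_lim) simp
have b5: "(2::nat) ^ b < W ^ (5 * K)" using bW wpow_less[of 1 "5 * K"] K1 by simp
have d2: "2 * B <= 2 ^ w" by (rule small_div) (use K1 in simp)
show ?thesis unfolding table_init_def seqs.simps
 apply (rule hs_Sq, rule hs_mono[OF hs_put_slot[OF 0]], use mo[OF 0] in \<open>simp add: vals_def\<close>, simp, simp)
 apply (rule hs_Sq, rule hs_mono[OF hs_put_slot], simp, use mo in \<open>simp add: vals_def\<close>, simp, simp)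
 apply (rule hs_Sq, rule hs_mono[OF hs_put_slot], simp add: eval_nat_numeral, use mo in \<open>simp add: vals_def slots_ok_def\<close>, simp, simp)
 apply (rule hs_Sq, rule hs_mono[OF hs_put_slot], simp add: eval_nat_numeral, use mo in \<open>simp add: vals_def slots_ok_def\<close>, simp, simp)
 apply (rule hs_Sq, rule hs_mono[OF hs_put_slot], simp add: eval_nat_numeral, use mo in \<open>simp add: vals_def slots_ok_def\<close>, simp, simp)
 apply (rule hs_Sq, rule hs_mono[OF hs_put_slot], simp add: eval_nat_numeral, use mo in \<open>simp add: vals_def slots_ok_def\<close>, simp, simp)
proof goal_cases
 case (1 _ _ _ _ _ s6)
 then have s6: "slots_ok 6 s6" by (simp add: eval_nat_numeral)
 then have r6: "reg s6 vb = b" "env s6" "modulus s6 M" by (auto simp: slots_ok_def)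
 define s7 where "s7 = set_reg 48 (2 ^ b) s6"
 have s7: "env s7" "modulus s7 M" "reg s7 48 < W ^ (5 * K)" using r6 b5 by (auto simp: s7_def)
 have e7: "eval s6 (Times (Pow (Quo (Var vb) (Num 2))) (Pow (Minus (Var vb) (Quo (Var vb) (Num 2))))) = 2 ^ b"
 by (simp add: r6 b2)
 show ?case
 proof (rule hs_Asg_Sq, simp, (use r6 bw b2 bB d2 W01 in simp), unfold e7 s7_def[symmetric], rule hs_Sq,
  rule hs_reduce[OF s7], goal_cases)
 case (4 q)
 show ?case
  by (intro hs_Asg_Sq hs_Nop) (use s6 W01 in \<open>auto simp: s7_def tab_def\<close>)
 qed auto
qed
qed

text \<open>Squaring doubles the number of characters by which the factor shifts; every entry thus
  costs one reduction.\<close>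

lemma table_step:
assumes I: "tab (Suc k) s"
shows "hs (table_step K) s (tab k)"
proof -
define i where "i = l - k"
have i: "Suc l - Suc k = i" "Suc l - k = Suc i" "i <= l" using I by (auto simp: tab_def i_def)
then have r: "slots_ok (6 + i) s" "reg s 60 = i" "reg s 61 = 2 ^ i" "reg s 48 = 2 ^ (b * 2 ^ i) mod M" "k <= l"
 using I by (auto simp: tab_def)
define v where "v = 2 ^ (b * 2 ^ i) mod M"
have vv: "v = vals (6 + i)" by (simp add: v_def vals_def)
have sK: "sw K < 2 ^ w" using K_less[of 6] K1 by (simp add: sw_def W_def)
have "sw K * (6 + i) <= sw K * (7 + l)" using i by (intro mult_le_mono2) simp
then have "sw K * (6 + i) <= W * 8" using E_W by linarith
then have kB: "(6 + i) * sw K < B ^ nd" by (intro small_lim) (simp only: mult.commute)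
have iB: "6 + i < B ^ nd" "i + 1 < B ^ nd" using i lw w_less num_less[of 6]
 by (auto intro!: small_lim)
have "2 ^ i <= (2::nat) ^ l" using i by (intro power_increasing) auto
then have "2 ^ i <= W" using l nW by linarith
then have pB: "2 * 2 ^ i < B ^ nd" by (intro small_lim) simp
have vM: "v < M" using M by (simp add: v_def)
have "v * v < W ^ (2 * K) * W ^ (2 * K)" using MW'[OF vM] by (intro mult_strict_mono') auto
then have v4: "v * v < W ^ (4 * K)" by (simp flip: power_add)
then have v5: "v * v < W ^ (5 * K)" using wpow_less[of "4 * K" "5 * K"] K1 by simp
have v4B: "v * v < B ^ nd" using v5 by (rule lim) simp
have sq: "v * v mod M = 2 ^ (b * 2 ^ Suc i) mod M"
 unfolding v_def mod_mult_eq by (simp add: mult_2 algebra_simps flip: power_add)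
have W6: "(6::nat) < 2 ^ w" using num_less[of 6] by (simp add: W_def)
define s2 where "s2 = set_reg 56 ((6 + i) * sw K) (set_reg 43 v s)"
have s2: "slots_ok (6 + i) s2" "reg s2 43 = vals (6 + i)" "reg s2 56 = (6 + i) * sw K" "6 + i < 7 + l"
 "reg s2 48 = v" "reg s2 60 = i" "reg s2 61 = 2 ^ i"
 using r i vv by (auto simp: s2_def v_def)
have e2: "set_reg 56 (eval (set_reg 43 (eval s (Var 48)) s) (Times (Plus (Num 6) (Var 60)) (Num (sw K)))) (set_reg 43 (eval s (Var 48)) s) = s2"
 by (simp add: s2_def r v_def)
show ?thesis unfolding table_step_def seqs.simps
proof (rule hs_Asg_Sq, simp, simp, rule hs_Asg_Sq, simp, (use r iB kB sK W6 in simp), unfold e2, rule hs_Sq,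
 rule hs_call[OF slots_save[OF s2(1-4)]], goal_cases)
 case (1 s3)
 have r3: "reg s3 48 = v" "reg s3 60 = i" "reg s3 61 = 2 ^ i" using 1 s2 by (auto simp: save_frame)
 define s4 where "s4 = set_reg 48 (v * v) s3"
 have s4: "env s4" "modulus s4 M" "reg s4 48 < W ^ (5 * K)" using 1(1) v5 by (auto simp: s4_def slots_ok_def)
 have e4: "set_reg 48 (eval s3 (Times (Var 48) (Var 48))) s3 = s4" by (simp add: s4_def r3)
 show ?case
 proof (rule hs_Asg_Sq, simp, (use r3 v4B in simp), unfold e4, rule hs_Sq, rule hs_reduce[OF s4], goal_cases)
 case (4 q)
 show ?case
  by (intro hs_Asg_Sq hs_Nop)
  (use 1(1) r3 i r W01 iB pB sq in \<open>auto simp: s4_def tab_def\<close>)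
 qed auto
qed
qed

lemma hb_table:
assumes s: "tab (Suc l) s"
shows "hb ((l + 2) * (steps (cmp nd (table_step K)) + cost_test (Var 61) (Plus (Var vn) (Num 1))) + 1)
 (Whl (Var 61) (Plus (Var vn) (Num 1)) (table_step K)) s (slots_ok (7 + l))"
proof -
have "hb ((Suc l + 1) * (steps (cmp nd (table_step K)) + cost_test (Var 61) (Plus (Var vn) (Num 1))) + 1)
 (Whl (Var 61) (Plus (Var vn) (Num 1)) (table_step K)) s (slots_ok (7 + l))"
proof (rule hb_loop[where J = tab])
 fix k s' assume I: "tab k s'"
 have nv: "reg s' vn = n" "reg s' 61 = 2 ^ (Suc l - k)" "k <= Suc l" using I by (auto simp: tab_def slots_ok_def)
 have nB: "n + 1 < B ^ nd" using nW W_ge2 by (intro small_lim) simp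
 have test: "2 ^ (Suc l - k) < n + 1 \<longleftrightarrow> 0 < k"
 proof
 assume "0 < k"
 then have "(2::nat) ^ (Suc l - k) <= 2 ^ l" by (intro power_increasing) auto
 then show "2 ^ (Suc l - k) < n + 1" using l by linarith
 next
 assume "2 ^ (Suc l - k) < n + 1"
 then have "k ~= 0" using l(2) by (intro notI) simp
 then show "0 < k" by simp
 qed
 have "hs (table_step K) s' (tab (k - 1))" if "0 < k"
 using table_step[of "k - 1" s'] I that by simp
 moreover have "slots_ok (7 + l) s'" if "k = 0" using I that by (simp add: tab_def)
 ultimately show "safe s' (Var 61) & safe s' (Plus (Var vn) (Num 1)) &
 (eval s' (Var 61) < eval s' (Plus (Var vn) (Num 1)) --> 0 < k & hb (steps (cmp nd (table_step K))) (table_step K) s' (tab (k - 1))) &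
 (\<not> eval s' (Var 61) < eval s' (Plus (Var vn) (Num 1)) --> slots_ok (7 + l) s')"
 using nv nB test W01 by (auto intro: hb_hs)
qed (rule s)
then show ?thesis by simp
qed

lemma queryI:
assumes "slots_ok (7 + l) s"
shows "query w K nd h M J e jw X N F R b n (arr s 0) (arr s 1)"
proof unfold_locales
have s: "slot (arr s 1) i = vals i" if "i < 7 + l" for i using assms that by (simp add: slots_ok_def)
show "slot (arr s 1) 0 = M" "slot (arr s 1) 1 = W ^ (5 * K) div M" "slot (arr s 1) 2 = J" "slot (arr s 1) 3 = e"
 "slot (arr s 1) 4 = bl F" "slot (arr s 1) 5 = ys F"
 by (simp_all only: s) (simp_all add: s vals_def)
fix k assume "2 ^ k <= n"
then have "(2::nat) ^ k < 2 ^ Suc l" using l by simp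
then have k: "k < Suc l" by (rule power_less_imp_less_exp[rotated]) simp
then show "slot (arr s 1) (6 + k) = 2 ^ (b * 2 ^ k) mod M"
 by (subst s) (auto simp: vals_def)
have "(7 + k) * sw K <= (7 + l) * sw K" using k by (intro mult_le_mono1) simp
then show "(7 + k) * sw K <= length (arr s 1)" using assms by (simp add: slots_ok_def mult.commute)
qed (use assms[unfolded slots_ok_def] b n1 nW N Xn E_W in auto)

end

context building
begin

definition T_build :: nat where
"T_build = steps (cmp nd (prepare K)) + (T_choose + (steps (cmp nd (window_hl K)) +
 (((F + 1) * (steps (cmp nd (check_step K)) + cost_test (Var 41) (Var vF)) + 1) + (steps (cmp nd (fallback K)) +
 (((3 * K + 1) * (steps (cmp nd tail_step) + cost_test (Times (Var vF) (Num (3 * K))) (Var 76)) + 1) +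
 (steps (cmp nd (tail_final K)) + (((F + 1) * (steps (cmp nd (encode_step K)) + cost_test (Num 0) (Var 41)) + 1) +
 (steps (cmp nd (table_init K)) + ((l + 2) * (steps (cmp nd (table_step K)) + cost_test (Var 61) (Plus (Var vn) (Num 1))) + 1)))))))))"

text \<open>On every tape the arrays satisfy the interface of the queries for some modulus; that it
  is the drawn one is promised only for a clean window.\<close>

definition result_ok :: "nat stream \<Rightarrow> nat list \<Rightarrow> nat list \<Rightarrow> bool" where
"result_ok \<omega> A' E \<longleftrightarrow> (\<exists>M J e jw. query w K nd h M J e jw X N F R b n A' E &
 (clean (modulus_of w K l \<omega>) (word_num w K 0 (sdrop (modulus_words w K l) \<omega>)) --> M = modulus_of w K l \<omega>))"

lemma hb_build:
assumes s: "reg s 0 = n mod W" "reg s 1 = n div W" "reg s vb = b" "reg s vw = w" "arr s 0 = A0" "arr s 1 = E0"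
shows "hb T_build (build_hl K) s (%s'. result_ok (rnd s) (arr s' 0) (arr s' 1))"
unfolding build_hl_def T_build_def
proof (rule hb_Sq[where P = "%s'. base s' & rnd s' = rnd s"], goal_cases)
case 1
show ?case unfolding base_def
 by (rule hb_hs, rule hs_call[OF hs_prepare[OF s(1-4) b nW]]) (use s in \<open>auto simp: R N F\<close>)
next
case (2 s1)
define M0 where "M0 = modulus_of w K l (rnd s)"
define \<omega>' where "\<omega>' = sdrop (modulus_words w K l) (rnd s)"
define j0 where "j0 = word_num w K 0 \<omega>'"
have bs1: "base s1" using 2 by simp
have ch: "hb T_choose (choose_modulus K) s1 (chosen M0 \<omega>')"
 using hb_choose_modulus[OF bs1] 2 by (simp add: M0_def \<omega>'_def)
show ?case
proof (rule hb_Sq[OF ch], rule hb_Sq[OF hb_hs[OF hs_window]], assumption, elim conjE)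
 fix s2 s3 assume c2: "chosen M0 \<omega>' s2" and s3: "win M0 (word_num w K 0 \<omega>' * M0) (R mod M0) s3" "word_num w K 0 \<omega>' < W ^ K"
 "reg s3 75 = 0" "reg s3 41 = 0"
 have M0: "0 < M0" "M0 <= W ^ (2 * K)" using c2 by (auto simp: chosen_def modulus_def)
 have w3: "win M0 (j0 * M0) (R mod M0) s3" "j0 < W ^ K" using s3 by (auto simp: j0_def)
 note ck = hb_check[OF w3(1) s3(3,4) JeR[OF M0 w3(2)]]
 show "hb (((F + 1) * (steps (cmp nd (check_step K)) + cost_test (Var 41) (Var vF)) + 1) + (steps (cmp nd (fallback K)) +
 (((3 * K + 1) * (steps (cmp nd tail_step) + cost_test (Times (Var vF) (Num (3 * K))) (Var 76)) + 1) +
 (steps (cmp nd (tail_final K)) + (((F + 1) * (steps (cmp nd (encode_step K)) + cost_test (Num 0) (Var 41)) + 1) +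
 (steps (cmp nd (table_init K)) + ((l + 2) * (steps (cmp nd (table_step K)) + cost_test (Var 61) (Plus (Var vn) (Num 1))) + 1)))))))
 (Sq (Whl (Var 41) (Var vF) (check_step K))
 (Sq (fallback K) (Sq (Whl (Times (Var vF) (Num (3 * K))) (Var 76) tail_step)
 (Sq (tail_final K) (Sq (Whl (Num 0) (Var 41) (encode_step K))
 (Sq (table_init K) (Whl (Var 61) (Plus (Var vn) (Num 1)) (table_step K)))))))) s3
 (%s'. result_ok (rnd s) (arr s' 0) (arr s' 1))"
 proof (rule hb_Sq[OF ck], goal_cases)
 case (1 s4)
 then have w4: "win M0 (j0 * M0) (R mod M0) s4" "0 < reg s4 75 \<longleftrightarrow> \<not> clean M0 j0"
  by (auto simp: clean_def)
 show ?case
 proof (rule hb_Sq[OF hb_hs[OF hs_fallback[OF w4(1) w3(2) w4(2)]]], elim exE conjE, goal_cases)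
  case (1 s5 M J e jw)
  interpret built w K nd h b n l N F R X A0 E0 M J e jw
  by unfold_locales (rule 1)
  show ?case
  apply (rule hb_Sq[OF hb_tail], use 1 in simp, use 1 in simp, use 1 in simp)
  apply (rule hb_Sq[OF hb_hs[OF hs_tail_final]], simp, simp)
  apply (rule hb_Sq[OF hb_encode], assumption)
  apply (rule hb_Sq[OF hb_hs[OF hs_table_init]], assumption)
  apply (rule hb_mono[OF hb_table], assumption, simp)
  unfolding result_ok_def M0_def[symmetric] \<omega>'_def[symmetric] j0_def[symmetric]
  using queryI 1(3) by blast
 qed
 qed
qed
qed

end

section \<open>Prime density and divisor counts\<close>

text \<open>The numbers \<open>1 / ((n + 1) * (n choose k))\<close> form Leibniz's harmonic
  triangle: the entry at \<open>(n, k + 1)\<close> is the one at \<open>(n - 1, k)\<close> minus the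
  one at \<open>(n, k)\<close>. A common multiple clears the denominators in the first column and
  hence everywhere.\<close>

lemma Leibniz_triangle:
fixes L :: nat
assumes "k <= n" "\<forall>i\<in>{1..Suc n}. i dvd L"
shows "real L / (real (Suc n) * real (n choose k)) \<in> \<int>"
using assms
proof (induction k arbitrary: n)
case 0
then have "Suc n dvd L" by simp
then obtain m where "L = Suc n * m" by (elim dvdE)
then have "real L / (real (Suc n) * real (n choose 0)) = real m" by (simp del: mult_Suc mult_Suc_right)
then show ?case by simp
next
case (Suc k)
then obtain m where m: "n = Suc m" "k <= m" by (cases n) auto
have 1: "real L / (real (Suc m) * real (m choose k)) \<in> \<int>" by (rule Suc.IH) (use m Suc.prems in auto)
have 2: "real L / (real (Suc n) * real (n choose k)) \<in> \<int>" by (rule Suc.IH) (use m Suc.prems in auto)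
define d where "d = real (Suc m) * real (m choose k)"
have d: "0 < d" using m by (simp add: d_def)
have "(Suc m choose Suc k) * Suc k = Suc m * (m choose k)" by (simp only: Suc_times_binomial_eq)
then have "real (Suc m choose Suc k) * real (Suc k) = d" unfolding d_def by (simp only: of_nat_mult[symmetric])
then have x: "real (n choose Suc k) * (real k + 1) = d" unfolding m(1) by (simp only: of_nat_Suc add.commute)
have "(Suc m - k) * (Suc m choose k) = Suc m * (m choose k)" using binomial_absorb_comp[of "Suc m" k] by simp
then have "real (Suc m - k) * real (Suc m choose k) = d" unfolding d_def by (simp only: of_nat_mult[symmetric])
then have y: "real (n choose k) * (real m + 1 - real k) = d"
 using m by (simp add: of_nat_diff algebra_simps)
have x': "real (n choose Suc k) = d / (real k + 1)" using x by (simp add: field_simps)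
have y': "real (n choose k) = d / (real m + 1 - real k)" using y m by (simp add: field_simps)
have k: "0 < real k + 1" "0 < real m + 1 - real k" using m by auto
have "real L / (real (Suc n) * real (n choose Suc k)) = real L / d - real L / (real (Suc n) * real (n choose k))"
proof -
 have "l / ((a + b) * (d / a)) = l / d - l / ((a + b) * (d / b))" if "0 < a" "0 < b" for a b l :: real
 using that d by (simp add: divide_simps) (simp add: algebra_simps)
 note split = this[OF k]
 have n2: "real (Suc n) = (real k + 1) + (real m + 1 - real k)" using m by simp
 show ?thesis unfolding x' y' n2 by (rule split)
qed
then show ?case using Ints_diff[OF 1[folded d_def] 2] by simp
qed

text \<open>A positive integer is at least 1, so \<open>Suc n * (n choose k) <= L\<close> for each
  \<open>k\<close>; summing over \<open>k\<close> gives
  \<open>(n + 1) * 2 ^ n <= (n + 1) * L\<close>.\<close>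

lemma common_multiple_lower:
assumes "\<forall>i\<in>{1..Suc n}. i dvd L" "0 < L"
shows "2 ^ n <= L"
proof -
have "Suc n * (n choose k) <= L" if k: "k <= n" for k
proof -
 let ?x = "real L / (real (Suc n) * real (n choose k))"
 have p: "0 < real (Suc n) * real (n choose k)" using k by simp
 then have "0 < ?x" using assms(2) by simp
 moreover obtain z where "?x = of_int z" using Leibniz_triangle[OF k assms(1)] by (elim Ints_cases)
 ultimately have "1 <= ?x" by simp
 then have "real (Suc n) * real (n choose k) <= real L" using p by (simp add: le_divide_eq)
 then show ?thesis by (simp only: of_nat_mult[symmetric] of_nat_le_iff)
qed
then have "(\<Sum>k\<le>n. Suc n * (n choose k)) <= (\<Sum>k\<le>n. L)" by (intro sum_mono) simp
then have "Suc n * 2 ^ n <= Suc n * L" unfolding sum_distrib_left[symmetric] choose_row_sum by simp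
then show ?thesis by (simp only: Suc_mult_le_cancel1)
qed

text \<open>The least common multiple of \<open>1, ..., n + 1\<close> has one factor per prime, a
  prime power not exceeding \<open>n + 1\<close>.\<close>

lemma primes_upto_lower: "2 ^ n <= Suc n ^ card {p. prime p & p <= Suc n}"
proof -
define P where "P = {p. prime p & p <= Suc n}"
define e where "e p = (GREATEST k. p ^ k <= Suc n)" for p :: nat
have P: "finite P" "!!p. p \<in> P ==> 2 <= p" by (auto simp: P_def prime_ge_2_nat)
have b: "k <= Suc n" if "2 <= p" "p ^ k <= Suc n" for p k :: nat
proof -
 have "k < 2 ^ k" by (rule less_exp)
 also have "(2::nat) ^ k <= p ^ k" using that by (intro power_mono) auto
 finally show ?thesis using that by simp
qed
have e: "p ^ e p <= Suc n" "p ^ k <= Suc n ==> k <= e p" if "2 <= p" for p k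
proof -
 show "p ^ e p <= Suc n" unfolding e_def
 by (rule GreatestI_nat[where P = "%k. p ^ k <= Suc n" and k = 0 and b = "Suc n"]) (simp, rule b[OF that])
 show "p ^ k <= Suc n ==> k <= e p" unfolding e_def
 by (rule Greatest_le_nat[where P = "%k. p ^ k <= Suc n" and b = "Suc n"]) (assumption, rule b[OF that])
qed
define L where "L = (\<Prod>p\<in>P. p ^ e p)"
have "i dvd L" if i: "i \<in> {1..Suc n}" for i
proof -
 have "i = (\<Prod>p\<in>prime_factors i. p ^ multiplicity p i)" using i by (intro prime_factorization_nat) auto
 also have "\<dots> dvd L" unfolding L_def
 proof (intro prod_dvd_prod_subset2 P subsetI)
 fix p assume p: "p \<in> prime_factors i"
 then have "p dvd i" "prime p" by auto
 moreover from this have "p <= i" using i by (auto dest: dvd_imp_le)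
 ultimately show "p \<in> P" using i by (auto simp: P_def)
 have "p ^ multiplicity p i <= i" using i by (intro dvd_imp_le multiplicity_dvd) auto
 then have "p ^ multiplicity p i <= Suc n" using i by simp
 then show "p ^ multiplicity p i dvd p ^ e p"
  using \<open>prime p\<close> by (intro le_imp_power_dvd e) (auto simp: prime_ge_2_nat)
 qed
 finally show ?thesis .
qed
moreover have "0 < L" unfolding L_def using P(2) by (intro prod_pos) fastforce
ultimately have "2 ^ n <= L" by (intro common_multiple_lower) auto
also have "L <= (\<Prod>p\<in>P. Suc n)" unfolding L_def using e(1) P(2) by (intro prod_mono) auto
finally show ?thesis by (simp add: P_def)
qed

text \<open>A bound of Chebyshev type, stated for the range \<open>4 ^ a\<close> of the candidates:
  at least one in \<open>4 * a\<close> numbers is prime.\<close>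

lemma prime_density:
assumes "1 <= a"
shows "4 ^ a <= 4 * a * card {p::nat. prime p & p < 4 ^ a}"
proof -
\<comment> \<open>With this \<open>m\<close> the primes up to \<open>Suc m\<close> are those below
  \<open>4 ^ a\<close>, and \<open>m\<close> is still at least half of \<open>4 ^ a\<close>.\<close>
define m :: nat where "m = 4 ^ a - 2"
have "(4::nat) ^ 1 <= 4 ^ a" using assms by (intro power_increasing) auto
then have m: "Suc m < 4 ^ a" "4 ^ a <= 2 * m" "Suc m = 4 ^ a - 1" by (auto simp: m_def)
have S: "{p::nat. prime p & p <= Suc m} = {p. prime p & p < 4 ^ a}" using m by auto
define c where "c = card {p::nat. prime p & p < 4 ^ a}"
have "2 ^ m <= Suc m ^ c" using primes_upto_lower[of m] by (simp only: S c_def)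
also have "\<dots> <= (4 ^ a) ^ c" using m by (intro power_mono) auto
also have "\<dots> = 2 ^ (2 * a * c)" by (simp add: power_mult)
finally have "m <= 2 * a * c" by (rule power_le_imp_le_exp[rotated]) simp
with m show ?thesis by (simp add: c_def)
qed

text \<open>Every prime factor contributes at least a factor 2 to \<open>D\<close>.\<close>

lemma card_prime_factors_less:
fixes D :: nat
assumes "0 < D" "D < 2 ^ Z"
shows "card (prime_factors D) <= Z"
proof -
have "2 ^ card (prime_factors D) = (\<Prod>p\<in>prime_factors D. 2::nat)" by simp
also have "\<dots> <= (\<Prod>p\<in>prime_factors D. p ^ multiplicity p D)"
proof (intro prod_mono conjI)
 fix p assume p: "p \<in> prime_factors D"
 then have "prime p" "0 < multiplicity p D" using assms by (auto simp: prime_factors_multiplicity)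
 then have "p ^ 1 <= p ^ multiplicity p D" by (intro power_increasing) (auto simp: prime_gt_0_nat Suc_leI)
 then show "2 <= p ^ multiplicity p D" using prime_ge_2_nat[OF \<open>prime p\<close>] by simp
qed auto
also have "\<dots> = D" using assms(1) by (intro prime_factorization_nat[symmetric]) simp
finally have "(2::nat) ^ card (prime_factors D) <= 2 ^ Z" using assms(2) by linarith
then show ?thesis by (rule power_le_imp_le_exp[rotated]) simp
qed

text \<open>Rankin's bound. The \<open>i\<close>-th smallest prime of \<open>Q\<close> is at least \<open>i + 1\<close>, so admitting it costs at most
a factor \<open>1 / (1 - 3 / (2 * (i + 1))) <= ((i + 1) / i)\<^sup>2\<close>.\<close>

lemma smooth_count:
fixes \<beta> :: real
assumes "finite Q" "\<forall>p\<in>Q. prime p" "0 <= \<beta>" "\<beta> <= 1" "real (card Q + 1) powr \<beta> <= 3 / 2"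
shows "real (card {q::nat. 0 < q & q <= y & prime_factors q \<subseteq> Q}) <= real (card Q + 1) ^ 2 * real y powr (1 - \<beta>)"
using assms(1,2,5)
proof (induction Q arbitrary: y rule: finite_linorder_max_induct)
case empty
show ?case
proof (cases "y = 0")
 case False
 have "card {q::nat. 0 < q & q <= y & prime_factors q \<subseteq> {}} <= card {1::nat}"
 by (intro card_mono) (auto simp: prime_factorization_empty_iff)
 moreover have "1 <= real y powr (1 - \<beta>)" using False assms by (intro ge_one_powr_ge_zero) auto
 ultimately show ?thesis by simp
qed auto
next
case (insert p Q)
define j where "j = card Q + 1"
have pQ: "p \<notin> Q" "prime p" using insert by auto
have cj: "card (insert p Q) = j" using insert pQ by (simp add: j_def)
have "Q \<subseteq> {2..<p}" using insert by (auto simp: prime_ge_2_nat)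
then have "card Q <= p - 2" using card_mono[of "{2..<p}" Q] by simp
then have p: "j + 1 <= p" "2 <= p" using prime_ge_2_nat[OF pQ(2)] by (auto simp: j_def)
have j32: "real (j + 1) powr \<beta> <= 3 / 2" using insert.prems(2) cj by simp
have "real (card Q + 1) powr \<beta> <= real (j + 1) powr \<beta>" using assms by (intro powr_mono2) (auto simp: j_def)
then have IH: "real (card {q::nat. 0 < q & q <= y & prime_factors q \<subseteq> Q}) <= real j ^ 2 * real y powr (1 - \<beta>)" for y
 using insert.IH[of y] insert.prems j32 by (simp add: j_def)
define S where "S y = {q::nat. 0 < q & q <= y & prime_factors q \<subseteq> insert p Q}" for y
have fS: "finite (S y)" for y by (rule finite_subset[of _ "{..y}"]) (auto simp: S_def)
have "real (card (S y)) <= real (j + 1) ^ 2 * real y powr (1 - \<beta>)"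
proof (induction y rule: less_induct)
 case (less y)
 show ?case
 proof (cases "y = 0")
 case True
 then have "S y = {}" by (auto simp: S_def)
 then show ?thesis by simp
 next
 case False
 let ?T = "{q::nat. 0 < q & q <= y & prime_factors q \<subseteq> Q}"
 \<comment> \<open>A number counted in \<open>S y\<close> is either free of \<open>p\<close> or
   \<open>p\<close> times a number counted in \<open>S (y div p)\<close>.\<close>
 have "S y \<subseteq> ?T \<union> (%q. p * q) ` S (y div p)"
 proof
  fix q assume q: "q \<in> S y"
  show "q \<in> ?T \<union> (%q. p * q) ` S (y div p)"
  proof (cases "p dvd q")
  case True
  then obtain r where r: "q = p * r" by (elim dvdE)
  then have "0 < r" "r <= y div p" using q p by (auto simp: S_def less_eq_div_iff_mult_less_eq mult.commute)
  moreover have "prime_factors r \<subseteq> prime_factors q" using q r by (intro dvd_prime_factors) (auto simp: S_def)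
  ultimately show ?thesis using q r by (auto simp: S_def)
  next
  case False
  then have "p \<notin> prime_factors q" by auto
  then show ?thesis using q by (auto simp: S_def)
  qed
 qed
 moreover have "finite ?T" by (rule finite_subset[of _ "{..y}"]) auto
 ultimately have "card (S y) <= card (?T \<union> (%q. p * q) ` S (y div p))"
  using fS by (intro card_mono) auto
 also have "\<dots> <= card ?T + card ((%q. p * q) ` S (y div p))" by (rule card_Un_le)
 also have "\<dots> <= card ?T + card (S (y div p))" using card_image_le[OF fS] by simp
 finally have "real (card (S y)) <= real (card ?T) + real (card (S (y div p)))" by linarith
 also have "\<dots> <= real j ^ 2 * real y powr (1 - \<beta>) + real (j + 1) ^ 2 * real (y div p) powr (1 - \<beta>)"
  using IH[of y] less[of "y div p"] False p by (intro add_mono) auto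
 also have "real (y div p) powr (1 - \<beta>) <= (real y / real (j + 1)) powr (1 - \<beta>)"
 proof (rule powr_mono2)
  have "real (y div p * p) <= real y" by (intro of_nat_mono) simp
  then have "real (y div p) <= real y / real p" using p by (simp add: le_divide_eq)
  also have "\<dots> <= real y / real (j + 1)" using p by (intro divide_left_mono) auto
  finally show "real (y div p) <= real y / real (j + 1)" .
 qed (use assms in auto)
 also have "\<dots> = real y powr (1 - \<beta>) * (real (j + 1) powr \<beta> / real (j + 1))"
  by (simp add: powr_divide powr_diff)
 also have "\<dots> <= real y powr (1 - \<beta>) * (3 / 2 / real (j + 1))"
  using j32 by (intro mult_left_mono divide_right_mono) auto
 also have "real j ^ 2 * real y powr (1 - \<beta>) + real (j + 1) ^ 2 * (real y powr (1 - \<beta>) * (3 / 2 / real (j + 1))) =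
  (real j ^ 2 + 3 / 2 * real (j + 1)) * real y powr (1 - \<beta>)"
  by (simp add: power2_eq_square field_simps)
 \<comment> \<open>\<open>j ^ 2 + 3 / 2 * (j + 1) <= (j + 1) ^ 2\<close> because \<open>j\<close> is
   at least 1.\<close>
 also have "\<dots> <= real (j + 1) ^ 2 * real y powr (1 - \<beta>)"
  by (intro mult_right_mono) (auto simp: power2_eq_square algebra_simps j_def)
 finally show ?thesis by simp
 qed
qed
then show ?case by (simp only: cj S_def)
qed

text \<open>Divisors of \<open>D\<close> are built from the at most \<open>Z\<close> primes of
  \<open>D\<close>, so they are among the numbers counted in \<open>smooth_count\<close>.\<close>

lemma divisor_count:
fixes D :: nat and \<beta> :: real
assumes "0 < D" "D < 2 ^ Z" "0 <= \<beta>" "\<beta> <= 1" "(real Z + 1) powr \<beta> <= 3 / 2"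
shows "real (card {q. 0 < q & q <= y & q dvd D}) <= (real Z + 1) ^ 2 * real y powr (1 - \<beta>)"
proof -
define Q where "Q = prime_factors D"
have Z: "card Q <= Z" using card_prime_factors_less[OF assms(1,2)] by (simp add: Q_def)
have "real (card Q + 1) powr \<beta> <= (real Z + 1) powr \<beta>" using Z assms by (intro powr_mono2) auto
then have b: "real (card Q + 1) powr \<beta> <= 3 / 2" using assms by simp
have "card {q. 0 < q & q <= y & q dvd D} <= card {q. 0 < q & q <= y & prime_factors q \<subseteq> Q}"
proof (rule card_mono)
 show "finite {q. 0 < q & q <= y & prime_factors q \<subseteq> Q}" by (rule finite_subset[of _ "{..y}"]) auto
 show "{q. 0 < q & q <= y & q dvd D} \<subseteq> {q. 0 < q & q <= y & prime_factors q \<subseteq> Q}"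
 using assms(1) dvd_prime_factors[of D] unfolding Q_def by blast
qed
then have "real (card {q. 0 < q & q <= y & q dvd D}) <= real (card {q. 0 < q & q <= y & prime_factors q \<subseteq> Q})" by simp
also have "\<dots> <= real (card Q + 1) ^ 2 * real y powr (1 - \<beta>)"
 by (rule smooth_count) (use assms b in \<open>auto simp: Q_def\<close>)
also have "\<dots> <= (real Z + 1) ^ 2 * real y powr (1 - \<beta>)"
 using Z by (intro mult_right_mono power_mono) auto
finally show ?thesis .
qed

section \<open>Probabilities on the random tape\<close>

interpretation tape: prob_space "tapes w" for w
unfolding tapes_def by (rule prob_space.prob_space_stream_space) (rule prob_space_measure_pmf)

lemma space_tapes [simp]: "space (tapes w) = UNIV"
by (simp add: tapes_def space_stream_space)

definition pr :: "nat \<Rightarrow> (nat stream \<Rightarrow> bool) \<Rightarrow> real" where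
"pr w \<Phi> = measure (tapes w) {\<omega>. \<Phi> \<omega>}"

text \<open>Dependence on a finite part of the tape yields measurability (\<open>dep_sets\<close>),
  independence from later words (\<open>pr_indep\<close>) and conditioning on the first words
  (\<open>pr_prefix\<close>).\<close>

definition dep :: "nat \<Rightarrow> (nat stream \<Rightarrow> 'a) \<Rightarrow> bool" where
"dep m f \<longleftrightarrow> (\<forall>\<omega> \<omega>'. stake m \<omega> = stake m \<omega>' --> f \<omega> = f \<omega>')"

lemma depD: "dep m f ==> stake m \<omega> = stake m \<omega>' ==> f \<omega> = f \<omega>'"
unfolding dep_def by blast

lemma stake_add_eq: "stake (m + k) \<omega> = stake (m + k) \<omega>' \<longleftrightarrow>
 stake m \<omega> = stake m \<omega>' & stake k (sdrop m \<omega>) = stake k (sdrop m \<omega>')"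
by (simp flip: stake_add)

lemma dep_mono: "dep m f ==> m <= k ==> dep k f"
unfolding dep_def by (metis le_add_diff_inverse stake_add_eq)

lemma dep_sdrop: "dep m f ==> dep (k + m) (%\<omega>. f (sdrop k \<omega>))"
unfolding dep_def stake_add_eq by (intro allI impI) (elim allE impE, erule conjunct2, assumption)

lemma dep_comp: "dep m f ==> dep m (%\<omega>. g (f \<omega>))"
unfolding dep_def by metis

lemma dep_comp2: "dep m f ==> dep m g ==> dep m (%\<omega>. h (f \<omega>) (g \<omega>))"
unfolding dep_def by metis

lemma dep_Stream: "dep (Suc m) f ==> dep m (%\<omega>. f (x ## \<omega>))"
unfolding dep_def by simp

lemma dep_ball: "(!!i. i \<in> I ==> dep m (\<Phi> i)) ==> dep m (%\<omega>. \<forall>i\<in>I. \<Phi> i \<omega>)"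
and dep_bex: "(!!i. i \<in> I ==> dep m (\<Phi> i)) ==> dep m (%\<omega>. \<exists>i\<in>I. \<Phi> i \<omega>)"
unfolding dep_def by (metis, metis)

lemma dep_sets: "dep m \<Phi> ==> {\<omega>. \<Phi> \<omega>} \<in> sets (tapes w)"
proof -
assume d: "dep m \<Phi>"
have s: "sets (tapes w) = sets (stream_space (count_space UNIV))"
 unfolding tapes_def by (rule sets_stream_space_cong) simp
have "stake m \<in> measurable (tapes w) (count_space UNIV)"
 unfolding measurable_cong_sets[OF s refl] by (rule measurable_stake)
then have "stake m -` {xs. \<exists>\<omega>. stake m \<omega> = xs & \<Phi> \<omega>} \<inter> space (tapes w) \<in> sets (tapes w)"
 by (rule measurable_sets) simp
moreover have "(\<exists>\<omega>'. stake m \<omega>' = stake m \<omega> & \<Phi> \<omega>') \<longleftrightarrow> \<Phi> \<omega>" for \<omega>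
 using d unfolding dep_def by metis
ultimately show ?thesis by (simp add: vimage_def)
qed

lemma pr_const: "pr w (%_. b) = (if b then 1 else 0)"
using tape.prob_space[of w] by (simp add: pr_def)

lemma pr_nonneg: "0 <= pr w \<Phi>" and pr_le_1: "pr w \<Phi> <= 1"
by (simp_all add: pr_def)

lemma pr_mono: "dep m \<Psi> ==> (!!\<omega>. \<Phi> \<omega> ==> \<Psi> \<omega>) ==> pr w \<Phi> <= pr w \<Psi>"
unfolding pr_def by (intro tape.finite_measure_mono dep_sets) auto

lemma pr_disj: "dep m \<Phi> ==> dep k \<Psi> ==> pr w (%\<omega>. \<Phi> \<omega> \<or> \<Psi> \<omega>) <= pr w \<Phi> + pr w \<Psi>"
unfolding pr_def Collect_disj_eq by (intro measure_Un_le dep_sets)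

lemma pr_bex: "finite I ==> (!!i. i \<in> I ==> dep m (\<Phi> i)) ==> pr w (%\<omega>. \<exists>i\<in>I. \<Phi> i \<omega>) <= (\<Sum>i\<in>I. pr w (\<Phi> i))"
proof -
assume "finite I" "!!i. i \<in> I ==> dep m (\<Phi> i)"
then have "measure (tapes w) (\<Union>i\<in>I. {\<omega>. \<Phi> i \<omega>}) <= (\<Sum>i\<in>I. measure (tapes w) {\<omega>. \<Phi> i \<omega>})"
 by (intro tape.finite_measure_subadditive_finite) (auto intro: dep_sets)
moreover have "(\<Union>i\<in>I. {\<omega>. \<Phi> i \<omega>}) = {\<omega>. \<exists>i\<in>I. \<Phi> i \<omega>}" by auto
ultimately show ?thesis by (simp add: pr_def)
qed

text \<open>Conditioning on the first word; the later inductions on the number of tape words unfold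
  this equation.\<close>

lemma pr_peel:
assumes "dep m \<Phi>"
shows "pr w \<Phi> = (\<Sum>x<2 ^ w. pr w (%\<omega>. \<Phi> (x ## \<omega>))) / 2 ^ w"
proof -
have ne: "{..<2 ^ w :: nat} ~= {}" by (auto simp: lessThan_empty_iff)
have "ennreal (pr w \<Phi>) = emeasure (tapes w) {\<omega>. \<Phi> \<omega>}" by (simp add: pr_def tape.emeasure_eq_measure)
also have "\<dots> = (\<integral>\<^sup>+x. emeasure (tapes w) {\<omega>. \<Phi> (x ## \<omega>)} \<partial>measure_pmf (pmf_of_set {..<2 ^ w}))"
 using prob_space.emeasure_stream_space[OF prob_space_measure_pmf dep_sets[OF assms, of w, unfolded tapes_def]]
 by (simp add: tapes_def space_stream_space)
also have "\<dots> = (\<Sum>x<2 ^ w. emeasure (tapes w) {\<omega>. \<Phi> (x ## \<omega>)}) / 2 ^ w"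
 using ne by (subst nn_integral_pmf_of_set) auto
also have "\<dots> = (\<Sum>x<2 ^ w. ennreal (pr w (%\<omega>. \<Phi> (x ## \<omega>)))) / ennreal (2 ^ w)"
 by (simp add: pr_def tape.emeasure_eq_measure ennreal_power flip: ennreal_numeral)
also have "\<dots> = ennreal ((\<Sum>x<2 ^ w. pr w (%\<omega>. \<Phi> (x ## \<omega>))) / 2 ^ w)"
 by (simp add: sum_ennreal pr_nonneg divide_ennreal sum_nonneg)
finally show ?thesis by (subst (asm) ennreal_inj) (auto simp: pr_nonneg intro!: divide_nonneg_nonneg sum_nonneg)
qed

lemma pr_indep:
assumes "dep m \<Phi>" "dep k \<Psi>"
shows "pr w (%\<omega>. \<Phi> \<omega> & \<Psi> (sdrop m \<omega>)) = pr w \<Phi> * pr w \<Psi>"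
using assms(1)
proof (induction m arbitrary: \<Phi>)
case 0
then have "\<Phi> = (%_. \<Phi> undefined)" by (auto simp: dep_def)
then obtain b where "\<Phi> = (%_. b)" by metis
then show ?case by (cases b) (auto simp: pr_const)
next
case (Suc m)
have "dep (Suc m + k) (%\<omega>. \<Phi> \<omega> & \<Psi> (sdrop (Suc m) \<omega>))"
 by (rule dep_comp2[where h = "(&)", OF dep_mono[OF Suc.prems] dep_sdrop[OF assms(2)]]) simp
from pr_peel[OF this] have "pr w (%\<omega>. \<Phi> \<omega> & \<Psi> (sdrop (Suc m) \<omega>)) =
 (\<Sum>x<2 ^ w. pr w (%\<omega>. \<Phi> (x ## \<omega>) & \<Psi> (sdrop m \<omega>))) / 2 ^ w" by simp
also have "\<dots> = (\<Sum>x<2 ^ w. pr w (%\<omega>. \<Phi> (x ## \<omega>)) * pr w \<Psi>) / 2 ^ w"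
 by (simp add: Suc.IH[OF dep_Stream[OF Suc.prems]])
also have "\<dots> = pr w \<Phi> * pr w \<Psi>" by (simp add: pr_peel[OF Suc.prems] sum_distrib_right)
finally show ?case .
qed

lemma pr_sdrop: "dep k \<Psi> ==> pr w (%\<omega>. \<Psi> (sdrop m \<omega>)) = pr w \<Psi>"
proof -
have "dep m (%_. True)" by (simp add: dep_def)
then show "dep k \<Psi> ==> pr w (%\<omega>. \<Psi> (sdrop m \<omega>)) = pr w \<Psi>"
 by (drule_tac pr_indep) (assumption, simp add: pr_const)
qed

lemma pr_iid: "dep m \<Phi> ==> pr w (%\<omega>. \<forall>i<k. \<Phi> (sdrop (m * i) \<omega>)) = pr w \<Phi> ^ k"
and dep_iid: "dep m \<Phi> ==> dep (m * k) (%\<omega>. \<forall>i<k. \<Phi> (sdrop (m * i) \<omega>))"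
proof -
assume d: "dep m \<Phi>"
have dp: "dep (m * k) (%\<omega>. \<forall>i<k. \<Phi> (sdrop (m * i) \<omega>))" for k
proof -
 have "dep (m * k) (%\<omega>. \<Phi> (sdrop (m * i) \<omega>))" if "i < k" for i
 proof (rule dep_mono[OF dep_sdrop[OF d]])
 have "m * (i + 1) <= m * k" using that by (intro mult_le_mono2) simp
 then show "m * i + m <= m * k" by simp
 qed
 then show ?thesis using dep_ball[of "{..<k}" "m * k" "%i \<omega>. \<Phi> (sdrop (m * i) \<omega>)"] by (simp add: Ball_def)
qed
show "dep (m * k) (%\<omega>. \<forall>i<k. \<Phi> (sdrop (m * i) \<omega>))" by (rule dp)
show "pr w (%\<omega>. \<forall>i<k. \<Phi> (sdrop (m * i) \<omega>)) = pr w \<Phi> ^ k"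
proof (induction k)
 case (Suc k)
 have "(%\<omega>. \<forall>i<Suc k. \<Phi> (sdrop (m * i) \<omega>)) = (%\<omega>. \<Phi> \<omega> & (\<forall>i<k. \<Phi> (sdrop (m * i) (sdrop m \<omega>))))"
 by (auto simp: All_less_Suc2 add.commute)
 then show ?case using pr_indep[OF d dp, of w k] Suc by simp
qed (simp add: pr_const)
qed

lemma pr_prefix:
assumes "dep k \<Phi>" "!!xs. length xs = m ==> pr w (%\<omega>. \<Phi> (xs @- \<omega>)) <= \<epsilon>"
shows "pr w \<Phi> <= \<epsilon>"
using assms
proof (induction m arbitrary: \<Phi> k)
case (Suc m)
have "pr w (%\<omega>. \<Phi> (x ## \<omega>)) <= \<epsilon>" for x
proof (rule Suc.IH)
 show "dep k (%\<omega>. \<Phi> (x ## \<omega>))" by (rule dep_Stream, rule dep_mono[OF Suc.prems(1)]) simp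
 show "pr w (%\<omega>. \<Phi> (x ## (xs @- \<omega>))) <= \<epsilon>" if "length xs = m" for xs
 using Suc.prems(2)[of "x # xs"] that by simp
qed
then have "(\<Sum>x<2 ^ w. pr w (%\<omega>. \<Phi> (x ## \<omega>))) <= (\<Sum>x<(2::nat) ^ w. \<epsilon>)" by (intro sum_mono)
then show ?case unfolding pr_peel[OF Suc.prems(1)] by (simp add: divide_le_eq mult.commute)
qed auto

lemma dep_shd: "dep (Suc 0) shd"
by (simp add: dep_def)

lemma pr_shd: "pr w (%\<omega>. P (shd \<omega>)) = card {x. x < 2 ^ w & P x} / 2 ^ w"
proof -
have "pr w (%\<omega>. P (shd \<omega>)) = (\<Sum>x<2 ^ w. if P x then 1 else 0) / 2 ^ w"
 using pr_peel[OF dep_comp[OF dep_shd, of P], of w] by (simp add: pr_const)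
also have "(\<Sum>x<(2::nat) ^ w. if P x then 1 else 0) = real (card ({x. x < 2 ^ w & P x}))"
 by (subst sum.inter_filter[symmetric]) (auto intro: arg_cong[of _ _ card])
finally show ?thesis by simp
qed

text \<open>\<open>2 ^ a\<close> divides \<open>2 ^ w\<close>, so a residue has at most
  \<open>2 ^ (w - a)\<close> preimages among the words.\<close>

lemma pr_residue: "a <= w ==> pr w (%\<omega>. shd \<omega> mod 2 ^ w mod 2 ^ a = u) <= 1 / 2 ^ a"
proof -
assume a: "a <= w"
have "{x::nat. x < 2 ^ w & x mod 2 ^ w mod 2 ^ a = u} \<subseteq> (%y. y * 2 ^ a + u) ` {..<2 ^ (w - a)}"
proof
 fix x :: nat assume x: "x \<in> {x. x < 2 ^ w & x mod 2 ^ w mod 2 ^ a = u}"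
 then have u: "x mod 2 ^ a = u" by auto
 have "x = x div 2 ^ a * 2 ^ a + u" using div_mult_mod_eq[of x "2 ^ a"] by (simp only: u)
 moreover have "x div 2 ^ a < 2 ^ (w - a)"
 using x a by (intro less_mult_imp_div_less) (simp flip: power_add)
 ultimately show "x \<in> (%y. y * 2 ^ a + u) ` {..<2 ^ (w - a)}" by blast
qed
then have "card {x::nat. x < 2 ^ w & x mod 2 ^ w mod 2 ^ a = u} <= card {..<(2::nat) ^ (w - a)}"
 by (intro surj_card_le) auto
then have "real (card {x::nat. x < 2 ^ w & x mod 2 ^ w mod 2 ^ a = u}) <= 2 ^ (w - a)"
 by (metis card_lessThan of_nat_le_iff of_nat_numeral of_nat_power)
also have "(2::real) ^ (w - a) = 2 ^ w / 2 ^ a" using a by (simp add: power_diff)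
finally show ?thesis unfolding pr_shd[of w "%x. x mod 2 ^ w mod 2 ^ a = u"] by (simp add: divide_simps)
qed

section \<open>Divisibility by the sampled modulus\<close>

lemma dep_sample: "dep 2 (sample w A)"
unfolding dep_def sample_def by (simp add: numeral_2_eq_2)

text \<open>The two halves of a sample are independent residues, so a single value has probability
  at most \<open>4 ^ (- a)\<close>; the rest is a union bound.\<close>

lemma pr_sample:
assumes "a <= w"
shows "pr w (%\<omega>. sample w (2 ^ a) \<omega> \<in> S) <= real (card (S \<inter> {..<4 ^ a})) / 4 ^ a"
proof -
let ?A = "(2::nat) ^ a"
have sq: "?A * ?A = 4 ^ a" by (simp flip: power_mult_distrib)
have "pr w (%\<omega>. sample w ?A \<omega> = v) <= 1 / 4 ^ a" for v
proof -
 let ?P = "%u \<omega>. shd \<omega> mod 2 ^ w mod ?A = u"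
 have d: "dep (Suc 0) (?P u)" for u by (rule dep_comp[OF dep_shd])
 have dm: "sample w ?A \<omega> mod ?A = shd \<omega> mod 2 ^ w mod ?A" "sample w ?A \<omega> div ?A = shd (stl \<omega>) mod 2 ^ w mod ?A" for \<omega>
 by (simp_all add: sample_def)
 have d2: "dep (Suc 0 + Suc 0) (%\<omega>. ?P (v mod ?A) \<omega> & ?P (v div ?A) (sdrop (Suc 0) \<omega>))"
 by (rule dep_comp2[where h = "(&)", OF dep_mono[OF d] dep_sdrop[OF d]]) simp
 have "pr w (%\<omega>. sample w ?A \<omega> = v) <= pr w (%\<omega>. ?P (v mod ?A) \<omega> & ?P (v div ?A) (sdrop (Suc 0) \<omega>))"
 by (rule pr_mono[OF d2]) (use dm in auto)
 also have "\<dots> = pr w (?P (v mod ?A)) * pr w (?P (v div ?A))" by (rule pr_indep[OF d d])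
 also have "\<dots> <= 1 / 2 ^ a * (1 / 2 ^ a)" by (intro mult_mono pr_residue assms pr_nonneg) auto
 also have "\<dots> = 1 / 4 ^ a" by (simp flip: power_mult_distrib)
 finally show ?thesis .
qed
note v = this
let ?I = "S \<inter> {..<4 ^ a}"
have d: "dep 2 (%\<omega>. sample w ?A \<omega> = v)" for v by (rule dep_comp[OF dep_sample])
have "pr w (%\<omega>. sample w ?A \<omega> \<in> S) <= pr w (%\<omega>. \<exists>v\<in>?I. sample w ?A \<omega> = v)"
 by (rule pr_mono[OF dep_bex[OF d]]) (use sample_less[of ?A w] sq in auto)
also have "\<dots> <= (\<Sum>v\<in>?I. pr w (%\<omega>. sample w ?A \<omega> = v))" by (rule pr_bex[OF _ d]) simp
also have "\<dots> <= (\<Sum>v\<in>?I. 1 / 4 ^ a)" by (intro sum_mono v)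
finally show ?thesis by simp
qed

lemma slot_prime_cases: "slot_prime w A r q \<omega> = q & (\<forall>i<r. \<not> prime (sample w A (sdrop (2 * i) \<omega>))) \<or>
 (\<exists>i<r. prime (sample w A (sdrop (2 * i) \<omega>)) & slot_prime w A r q \<omega> = sample w A (sdrop (2 * i) \<omega>))"
proof (induction r arbitrary: q \<omega>)
case (Suc r)
show ?case
 using Suc[of "if prime (sample w A \<omega>) then sample w A \<omega> else q" "sdrop 2 \<omega>"]
 by (auto simp: All_less_Suc2 Ex_less_Suc2 add.commute split: if_splits)
qed simp

lemma dep_slot_prime: "dep (2 * r) (slot_prime w A r q)"
proof (induction r arbitrary: q)
case (Suc r)
show ?case unfolding dep_def
proof (intro allI impI)
 fix \<omega> \<omega>' :: "nat stream" assume "stake (2 * Suc r) \<omega> = stake (2 * Suc r) \<omega>'"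
 then have "stake 2 \<omega> = stake 2 \<omega>'" "stake (2 * r) (sdrop 2 \<omega>) = stake (2 * r) (sdrop 2 \<omega>')"
 by (simp_all only: mult_Suc_right stake_add_eq)
 note eq = depD[OF dep_sample this(1)] depD[OF Suc this(2)]
 show "slot_prime w A (Suc r) q \<omega> = slot_prime w A (Suc r) q \<omega>'" by (simp add: eq)
qed
qed (simp add: dep_def)

text \<open>Either no candidate is prime and the slot keeps 1, or some candidate is a prime factor
  of \<open>D\<close>. The second event is bounded by a union over all candidates, so the
  distribution of the prime that is kept never has to be determined.\<close>

lemma pr_slot_prime:
assumes "a <= w" "1 <= a" "0 < D" "D < 2 ^ Z"
shows "pr w (%\<omega>. slot_prime w (2 ^ a) r 1 \<omega> dvd D) <= (1 - 1 / (4 * real a)) ^ r + real r * (real Z / 4 ^ a)"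
proof -
let ?s = "sample w (2 ^ a)"
let ?np = "%\<omega>. \<forall>i<r. \<not> prime (?s (sdrop (2 * i) \<omega>))"
let ?d = "%\<omega>. prime (?s \<omega>) & ?s \<omega> dvd D"
have dnp: "dep 2 (%\<omega>. \<not> prime (?s \<omega>))" and dd: "dep 2 ?d" by (rule dep_comp[OF dep_sample])+
have dI: "dep (2 * r) (%\<omega>. ?d (sdrop (2 * i) \<omega>))" if "i \<in> {..<r}" for i
 by (rule dep_mono[OF dep_sdrop[OF dd]]) (use that in auto)
have "pr w (%\<omega>. slot_prime w (2 ^ a) r 1 \<omega> dvd D) <= pr w (%\<omega>. ?np \<omega> \<or> (\<exists>i\<in>{..<r}. ?d (sdrop (2 * i) \<omega>)))"
proof (rule pr_mono)
 show "dep (2 * r) (%\<omega>. ?np \<omega> \<or> (\<exists>i\<in>{..<r}. ?d (sdrop (2 * i) \<omega>)))"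
 by (rule dep_comp2[where h = "(\<or>)", OF dep_iid[OF dnp] dep_bex[OF dI]])
 fix \<omega> assume "slot_prime w (2 ^ a) r 1 \<omega> dvd D"
 then show "?np \<omega> \<or> (\<exists>i\<in>{..<r}. ?d (sdrop (2 * i) \<omega>))"
 using slot_prime_cases[where q = 1 and \<omega> = \<omega> and w = w and A = "2 ^ a" and r = r] by auto
qed
also have "\<dots> <= pr w ?np + pr w (%\<omega>. \<exists>i\<in>{..<r}. ?d (sdrop (2 * i) \<omega>))"
 by (rule pr_disj[OF dep_iid[OF dnp] dep_bex[OF dI]])
also have "\<dots> <= (1 - 1 / (4 * real a)) ^ r + real r * (real Z / 4 ^ a)"
proof (rule add_mono)
have np: "pr w ?np = pr w (%\<omega>. \<not> prime (?s \<omega>)) ^ r" by (rule pr_iid[OF dnp])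
have "pr w (%\<omega>. \<not> prime (?s \<omega>)) <= 1 - 1 / (4 * real a)"
proof -
 have "pr w (%\<omega>. ?s \<omega> \<in> {x. \<not> prime x}) <= real (card ({x::nat. \<not> prime x} \<inter> {..<4 ^ a})) / 4 ^ a"
 by (rule pr_sample[OF assms(1)])
 moreover have "card ({x::nat. \<not> prime x} \<inter> {..<4 ^ a}) + card {p::nat. prime p & p < 4 ^ a} = 4 ^ a"
 proof -
 have "({x::nat. \<not> prime x} \<inter> {..<4 ^ a}) \<union> {p. prime p & p < 4 ^ a} = {..<4 ^ a}" by auto
 moreover have "card (({x::nat. \<not> prime x} \<inter> {..<4 ^ a}) \<union> {p. prime p & p < 4 ^ a}) =
  card ({x::nat. \<not> prime x} \<inter> {..<4 ^ a}) + card {p::nat. prime p & p < 4 ^ a}"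
  by (intro card_Un_disjoint) auto
 ultimately show ?thesis by simp
 qed
 then have "real (card ({x::nat. \<not> prime x} \<inter> {..<4 ^ a})) + real (card {p::nat. prime p & p < 4 ^ a}) = 4 ^ a"
 by (simp flip: of_nat_add)
 moreover have "(4::real) ^ a <= 4 * real a * real (card {p::nat. prime p & p < 4 ^ a})"
 using prime_density[OF assms(2)] by (metis (mono_tags) of_nat_le_iff of_nat_mult of_nat_numeral of_nat_power)
 moreover have "P <= 1 - 1 / (4 * real a)" if "P <= x / q" "x + c = q" "q <= 4 * real a * c" "0 < q" for P x c q :: real
 proof -
 have "P <= 1 - c / q" using that by (simp add: field_simps)
 moreover have "1 / (4 * real a) <= c / q" using that assms(2) by (simp add: field_simps)
 ultimately show ?thesis by simp
 qed
 ultimately show ?thesis by simp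
qed
then show "pr w ?np <= (1 - 1 / (4 * real a)) ^ r" unfolding np by (intro power_mono pr_nonneg)
have "pr w (%\<omega>. \<exists>i\<in>{..<r}. ?d (sdrop (2 * i) \<omega>)) <= (\<Sum>i<r. pr w (%\<omega>. ?d (sdrop (2 * i) \<omega>)))"
 by (rule pr_bex[OF _ dI]) simp
also have "\<dots> = real r * pr w ?d" using pr_sdrop[OF dd] by simp
also have "pr w ?d <= real Z / 4 ^ a"
proof -
 have "pr w (%\<omega>. ?s \<omega> \<in> prime_factors D) <= real (card (prime_factors D \<inter> {..<4 ^ a})) / 4 ^ a"
 by (rule pr_sample[OF assms(1)])
 also have "card (prime_factors D \<inter> {..<4 ^ a}) <= card (prime_factors D)" by (intro card_mono) auto
 also have "\<dots> <= Z" by (rule card_prime_factors_less[OF assms(3,4)])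
 finally show ?thesis using assms(3) by (simp add: in_prime_factors_iff divide_right_mono conj_commute)
qed
finally show "pr w (%\<omega>. \<exists>i\<in>{..<r}. ?d (sdrop (2 * i) \<omega>)) <= real r * (real Z / 4 ^ a)" by (simp add: mult_left_mono)
qed
finally show ?thesis .
qed

lemma prime_product_dvd: "prime_product w A r k M \<omega> dvd D ==>
 M dvd D & (\<forall>i<k. slot_prime w A r 1 (sdrop (2 * r * i) \<omega>) dvd D)"
proof (induction k arbitrary: M \<omega>)
case (Suc k)
from Suc.IH[of "M * slot_prime w A r 1 \<omega>" "sdrop (2 * r) \<omega>"] Suc.prems
have "M * slot_prime w A r 1 \<omega> dvd D" "\<forall>i<k. slot_prime w A r 1 (sdrop (2 * r * i) (sdrop (2 * r) \<omega>)) dvd D" by auto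
then show ?case by (auto simp: All_less_Suc2 add.commute dest: dvd_mult_left dvd_mult_right)
qed simp

lemma dep_prime_product: "dep (2 * r * k) (prime_product w A r k M)"
proof (induction k arbitrary: M)
case (Suc k)
show ?case unfolding dep_def
proof (intro allI impI)
 fix \<omega> \<omega>' :: "nat stream" assume "stake (2 * r * Suc k) \<omega> = stake (2 * r * Suc k) \<omega>'"
 then have "stake (2 * r) \<omega> = stake (2 * r) \<omega>'" "stake (2 * r * k) (sdrop (2 * r) \<omega>) = stake (2 * r * k) (sdrop (2 * r) \<omega>')"
 by (simp_all only: mult_Suc_right stake_add_eq)
 note eq = depD[OF dep_slot_prime this(1)] depD[OF Suc this(2)]
 show "prime_product w A r (Suc k) M \<omega> = prime_product w A r (Suc k) M \<omega>'" by (simp add: eq)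
qed
qed (simp add: dep_def)

lemma dep_modulus_of: "dep (modulus_words w K l) (modulus_of w K l)"
proof (cases "w < l ^ 4")
case True
then show ?thesis using dep_prime_product[of "l ^ 3" K] by (simp add: modulus_words_def modulus_of_def[abs_def])
next
case False
then show ?thesis using dep_comp[OF dep_shd, of "%x. max 1 (x mod 2 ^ w mod 2 ^ (w div 3))"]
 by (simp add: modulus_words_def modulus_of_def[abs_def])
qed

lemma modulus_of_pos: "0 < modulus_of w K l \<omega>"
proof -
have "0 < prime_product w (2 ^ a) r k M \<omega>" if "0 < M" for a r k M \<omega> using that
 by (induction k arbitrary: M \<omega>) (use slot_prime_bound[of "2 ^ a" 1 w r] in \<open>auto simp: Suc_le_eq\<close>)
then show ?thesis by (simp add: modulus_of_def max_def)
qed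

lemma dep_word_num: "dep k (word_num w k v)"
proof (induction k arbitrary: v)
case (Suc k)
show ?case unfolding dep_def
proof (intro allI impI)
 fix \<omega> \<omega>' :: "nat stream" assume "stake (Suc k) \<omega> = stake (Suc k) \<omega>'"
 then have "shd \<omega> = shd \<omega>'" "stake k (stl \<omega>) = stake k (stl \<omega>')" by simp_all
 note eq = this(1) depD[OF Suc this(2)]
 show "word_num w (Suc k) v \<omega> = word_num w (Suc k) v \<omega>'" by (simp add: eq)
qed
qed (simp add: dep_def)

lemma word_num_div: "word_num w k u \<omega> div 2 ^ (w * k) = u"
proof (induction k arbitrary: u \<omega>)
case (Suc k)
have "word_num w (Suc k) u \<omega> div 2 ^ (w * Suc k) = word_num w (Suc k) u \<omega> div 2 ^ (w * k) div 2 ^ w"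
 by (simp add: power_add div_mult2_eq[symmetric] mult.commute)
then show ?case using Suc by simp
qed simp

text \<open>By \<open>word_num_div\<close> the final value reveals the number accumulated after any
  word. So at most one value of the first word, \<open>?V - u * 2 ^ w\<close>, can lead to
  \<open>v\<close>.\<close>

lemma pr_word_num: "pr w (%\<omega>. word_num w k u \<omega> = v) <= 1 / 2 ^ (w * k)"
proof (induction k arbitrary: u)
case 0
show ?case by (simp add: pr_le_1)
next
case (Suc k)
let ?V = "v div 2 ^ (w * k)"
have "pr w (%\<omega>. word_num w (Suc k) u \<omega> = v) = (\<Sum>x<2 ^ w. pr w (%\<omega>. word_num w k (u * 2 ^ w + x) \<omega> = v)) / 2 ^ w"
 using pr_peel[OF dep_comp[OF dep_word_num[of "Suc k" w u], where g = "%y. y = v"], of w] by simp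
also have "(\<Sum>x<2 ^ w. pr w (%\<omega>. word_num w k (u * 2 ^ w + x) \<omega> = v)) <=
 (\<Sum>x<2 ^ w. if x = ?V - u * 2 ^ w then 1 / 2 ^ (w * k) else 0)"
proof (intro sum_mono)
 fix x
 show "pr w (%\<omega>. word_num w k (u * 2 ^ w + x) \<omega> = v) <= (if x = ?V - u * 2 ^ w then 1 / 2 ^ (w * k) else 0)"
 proof (cases "x = ?V - u * 2 ^ w")
 case False
 then have "\<not> word_num w k (u * 2 ^ w + x) \<omega> = v" for \<omega>
  using word_num_div[of w k "u * 2 ^ w + x" \<omega>] by auto
 then show ?thesis using pr_const[of w False] False by simp
 qed (use Suc in simp)
qed
also have "\<dots> <= 1 / 2 ^ (w * k)" by (subst sum.delta) auto
finally show ?case by (simp add: divide_right_mono power_add mult.commute)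
qed

context building
begin

text \<open>The words that determine the modulus are fixed first. For a fixed \<open>M\<close> the
  window is shorter than \<open>M\<close>, so it contains block \<open>t\<close> only if the random
  factor equals \<open>bk t div M\<close>; a union over the \<open>F\<close> blocks remains.\<close>

lemma pr_not_clean:
assumes "dep m f" "!!\<omega>. 0 < f \<omega>"
shows "pr w (%\<omega>. \<not> clean (f \<omega>) (word_num w K 0 (sdrop m \<omega>))) <= real F / 2 ^ (w * K)"
proof (rule pr_prefix)
show "dep (m + K) (%\<omega>. \<not> clean (f \<omega>) (word_num w K 0 (sdrop m \<omega>)))"
 by (rule dep_comp2[where h = "%a b. \<not> clean a b", OF dep_mono[OF assms(1)] dep_sdrop[OF dep_word_num]]) simp
fix xs :: "nat list" assume xs: "length xs = m"
define M where "M = f (xs @- sconst 0)"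
have fM: "f (xs @- \<omega>) = M" for \<omega> using assms(1) xs by (auto simp: dep_def M_def stake_shift)
have sd: "sdrop m (xs @- \<omega>) = \<omega>" for \<omega> :: "nat stream" using xs by (simp add: sdrop_shift)
have M: "0 < M" using assms(2) by (simp add: M_def)
let ?P = "%t \<omega>. word_num w K 0 \<omega> = bk t div M"
have d: "dep K (?P t)" for t by (rule dep_comp[OF dep_word_num])
have "pr w (%\<omega>. \<not> clean M (word_num w K 0 \<omega>)) <= pr w (%\<omega>. \<exists>t\<in>{..<F}. ?P t \<omega>)"
proof (rule pr_mono[OF dep_bex[OF d]])
 fix \<omega> assume "\<not> clean M (word_num w K 0 \<omega>)"
 then obtain t where t: "t < F" "word_num w K 0 \<omega> * M <= bk t" "bk t < word_num w K 0 \<omega> * M + R mod M"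
 by (auto simp: clean_def)
 have "R mod M < M" using M by simp
 then have "bk t div M = word_num w K 0 \<omega>" using t by (intro div_nat_eqI) (auto simp: algebra_simps)
 then show "\<exists>t\<in>{..<F}. ?P t \<omega>" using t(1) by (intro bexI[of _ t]) simp_all
qed
also have "\<dots> <= (\<Sum>t<F. pr w (?P t))" by (rule pr_bex[OF _ d]) simp
also have "\<dots> <= (\<Sum>t<F. 1 / 2 ^ (w * K))" by (intro sum_mono pr_word_num)
finally show "pr w (%\<omega>. \<not> clean (f (xs @- \<omega>)) (word_num w K 0 (sdrop m (xs @- \<omega>)))) <= real F / 2 ^ (w * K)"
 by (simp add: fM sd)
qed

end

section \<open>Failure probability\<close>

text \<open>The residue 0 stands for the modulus 1, hence the extra 1 beside the number of
  divisors.\<close>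

lemma pr_word_modulus:
fixes \<beta> :: real
assumes D: "0 < D" "D < 2 ^ Z" and h: "h <= w" and \<beta>: "0 <= \<beta>" "\<beta> <= 1" "(real Z + 1) powr \<beta> <= 3 / 2"
shows "pr w (%\<omega>. max 1 (shd \<omega> mod 2 ^ w mod 2 ^ h) dvd D) <= (1 + (real Z + 1) ^ 2 * (2 ^ h) powr (1 - \<beta>)) / 2 ^ h"
proof -
define S where "S = {q. 0 < q & q <= 2 ^ h & q dvd D}"
define I where "I = {u. u < 2 ^ h & max 1 u dvd D}"
have fS: "finite S" by (rule finite_subset[of _ "{..2 ^ h}"]) (auto simp: S_def)
have IS: "I \<subseteq> insert 0 S" by (auto simp: I_def S_def max_def split: if_splits)
then have fI: "finite I" using fS finite_subset by blast
have "card I <= card (insert 0 S)" using IS fS by (intro card_mono) auto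
also have "\<dots> <= Suc (card S)" by (rule card_insert_le_m1) auto
finally have cI: "real (card I) <= 1 + real (card S)" by simp
have cS: "real (card S) <= (real Z + 1) ^ 2 * (2 ^ h) powr (1 - \<beta>)"
 using divisor_count[OF D \<beta>, of "2 ^ h"] by (simp add: S_def)
let ?P = "%u \<omega>. shd \<omega> mod 2 ^ w mod 2 ^ h = u"
have d: "dep (Suc 0) (?P u)" for u by (rule dep_comp[OF dep_shd])
have "pr w (%\<omega>. max 1 (shd \<omega> mod 2 ^ w mod 2 ^ h) dvd D) <= pr w (%\<omega>. \<exists>u\<in>I. ?P u \<omega>)"
 by (rule pr_mono[OF dep_bex[OF d]]) (auto simp: I_def)
also have "\<dots> <= (\<Sum>u\<in>I. pr w (?P u))" by (rule pr_bex[OF fI d])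
also have "\<dots> <= (\<Sum>u\<in>I. 1 / 2 ^ h)" by (intro sum_mono pr_residue h)
also have "\<dots> = real (card I) / 2 ^ h" by simp
also have "\<dots> <= (1 + (real Z + 1) ^ 2 * (2 ^ h) powr (1 - \<beta>)) / 2 ^ h"
 using cI cS by (intro divide_right_mono) auto
finally show ?thesis .
qed

text \<open>\<open>Z + 1 <= 2 powr z\<close>, so \<open>\<beta> = 1 / (2 * z)\<close> gives
  \<open>(Z + 1) powr \<beta> <= sqrt 2 <= 3 / 2\<close>, as Rankin's bound demands. The saving
  \<open>h * \<beta>\<close> in the exponent must cover \<open>1 + 2 * z + C * (l + 1)\<close>. It
  does, because \<open>l ^ 4 <= w\<close> bounds \<open>z\<close> by \<open>w powr (1 / 4)\<close>
  up to a logarithm, whereas \<open>h\<close> is about \<open>w / 3\<close>. The bound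
  \<open>y\<close> on \<open>z\<close> depends on \<open>w\<close> only.\<close>

lemma pr_word_modulus_small:
fixes C y :: real
assumes C: "0 < C" and l: "l ~= 0" "l ^ 4 <= w" and D: "0 < D" "D < 2 ^ (2 ^ (l + 1) * w)"
 and y: "y = real w powr (1 / 4) + 2 + log 2 (real w)" "2 * y * (1 + (2 + C) * y) <= real w / 3 - 1"
shows "pr w (%\<omega>. max 1 (shd \<omega> mod 2 ^ w mod 2 ^ (w div 3)) dvd D) <= 2 powr (- C * (real l + 1))"
proof -
define h where "h = w div 3"
define Z where "Z = 2 ^ (l + 1) * w"
define z where "z = real l + 2 + log 2 (real w)"
define \<beta> where "\<beta> = 1 / (2 * z)"
have "1 <= l ^ 4" using l by simp
then have w1: "1 <= w" using l by linarith
then have lg: "0 <= log 2 (real w)" by simp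
then have z: "2 <= z" "real l + 1 <= z" by (auto simp: z_def)
have "real l = (real l ^ 4) powr (1 / 4)" using l by (simp add: powr_powr flip: powr_numeral)
also have "\<dots> <= real w powr (1 / 4)" using l by (intro powr_mono2) (auto simp flip: of_nat_power)
finally have zy: "z <= y" by (simp add: z_def y)
have hw: "real w / 3 - 1 <= real h" unfolding h_def by linarith
have pz: "2 powr z = 2 ^ (l + 2) * real w"
 unfolding z_def powr_add using w1 by (simp add: powr_realpow power_add)
have "1 <= Z" using w1 by (simp add: Z_def)
then have "real Z + 1 <= 2 * real Z" by simp
also have "\<dots> = 2 powr z" by (simp add: pz Z_def)
finally have Zz: "real Z + 1 <= 2 powr z" .
have \<beta>: "0 <= \<beta>" "\<beta> <= 1" using z by (auto simp: \<beta>_def)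
have "(real Z + 1) powr \<beta> <= (2 powr z) powr \<beta>" using Zz \<beta> by (intro powr_mono2) auto
also have "\<dots> = 2 powr (1 / 2)" using z by (simp add: powr_powr \<beta>_def)
also have "\<dots> = sqrt 2" by (simp add: powr_half_sqrt)
also have "\<dots> <= 3 / 2" by (rule real_le_lsqrt) (auto simp: power2_eq_square)
finally have Zb: "(real Z + 1) powr \<beta> <= 3 / 2" .
have "(real Z + 1) ^ 2 <= (2 powr z) ^ 2" using Zz by (intro power_mono) auto
also have "\<dots> = 2 powr (2 * z)" by (simp add: power2_eq_square flip: powr_add)
finally have Z2: "(real Z + 1) ^ 2 <= 2 powr (2 * z)" .
have ph: "(2::real) ^ h = 2 powr real h" by (simp add: powr_realpow)
have hb: "1 + 2 * z + C * (real l + 1) <= real h * \<beta>"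
proof -
 have "2 * z * (1 + (2 + C) * z) <= 2 * y * (1 + (2 + C) * y)" using z zy C by (intro mult_mono add_mono) auto
 also have "\<dots> <= real h" using y(2) hw by simp
 finally have "1 + (2 + C) * z <= real h / (2 * z)" using z by (simp add: pos_le_divide_eq mult.commute)
 moreover have "C * (real l + 1) <= C * z" using z C by (intro mult_left_mono) auto
 ultimately show ?thesis by (simp add: \<beta>_def algebra_simps)
qed
have "pr w (%\<omega>. max 1 (shd \<omega> mod 2 ^ w mod 2 ^ h) dvd D) <= (1 + (real Z + 1) ^ 2 * (2 ^ h) powr (1 - \<beta>)) / 2 ^ h"
 by (rule pr_word_modulus[OF D[folded Z_def] _ \<beta> Zb]) (simp add: h_def)
also have "\<dots> <= (1 + 2 powr (2 * z) * (2 powr (real h * (1 - \<beta>)))) / 2 powr real h"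
 unfolding ph powr_powr using Z2 by (intro divide_right_mono add_mono mult_right_mono) auto
also have "\<dots> = 2 powr (- real h) + 2 powr (2 * z - real h * \<beta>)"
 by (simp add: add_divide_distrib powr_minus_divide algebra_simps flip: powr_add powr_diff)
also have "2 powr (- real h) <= 2 powr (2 * z - real h * \<beta>)"
proof (intro powr_mono)
 have "real h * \<beta> <= real h * 1" using \<beta> by (intro mult_left_mono) auto
 then show "- real h <= 2 * z - real h * \<beta>" using z by simp
qed simp
also have "2 powr (2 * z - real h * \<beta>) + 2 powr (2 * z - real h * \<beta>) = 2 powr (1 + (2 * z - real h * \<beta>))"
 by (subst powr_add) simp
also have "\<dots> <= 2 powr (- C * (real l + 1))" using hb by (intro powr_mono) auto
finally show ?thesis by (simp add: h_def)
qed

text \<open>Candidates have at least \<open>5 / 4 * l - 7 / 4\<close> bits, while the number of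
  prime factors of \<open>D\<close> has about \<open>l\<close> bits; the gap \<open>l / 4\<close>
  beats any power of \<open>l\<close>. Missing all primes in \<open>l ^ 3\<close> attempts is far
  less likely, as about one candidate in \<open>5 / 2 * l\<close> is prime.\<close>

lemma slot_bound_le:
assumes l: "2 <= l" and a: "a = 5 * l div 8"
shows "(1 - 1 / (4 * real a)) ^ (l ^ 3) + real (l ^ 3) * (real (2 ^ (l + 1) * l ^ 4) / 4 ^ a) <=
 exp (- (2 / 5) * real l ^ 2) + real l ^ 7 * 2 powr (11 / 4 - real l / 4)"
proof (rule add_mono)
have a1: "1 <= a" and a8: "8 * a <= 5 * l" "5 * l <= 8 * a + 7" using l unfolding a by auto
then have ar: "4 * real a <= 5 / 2 * real l" "5 / 4 * real l - 7 / 4 <= 2 * real a" "1 <= real a" by auto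
have le1: "1 / (4 * real a) <= 1" using ar by (simp add: divide_simps)
have "(1 - 1 / (4 * real a)) ^ (l ^ 3) <= exp (- (1 / (4 * real a))) ^ (l ^ 3)"
 using exp_ge_add_one_self[of "- (1 / (4 * real a))"] le1 by (intro power_mono) auto
also have "\<dots> = exp (- (real l ^ 3 / (4 * real a)))" by (simp flip: exp_of_nat_mult)
also have "\<dots> <= exp (- (2 / 5) * real l ^ 2)"
proof -
 have "2 / 5 * real l ^ 2 * (4 * real a) <= 2 / 5 * real l ^ 2 * (5 / 2 * real l)"
 using ar by (intro mult_left_mono) auto
 also have "\<dots> = real l ^ 3" by (simp add: power2_eq_square power3_eq_cube)
 finally have "2 / 5 * real l ^ 2 <= real l ^ 3 / (4 * real a)" using ar by (simp add: pos_le_divide_eq)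
 then show ?thesis by simp
qed
finally show "(1 - 1 / (4 * real a)) ^ (l ^ 3) <= exp (- (2 / 5) * real l ^ 2)" .
have "(2::real) powr (5 / 4 * real l - 7 / 4) <= 2 powr (2 * real a)" using ar by (intro powr_mono) auto
also have "\<dots> = 2 powr real (2 * a)" by simp
also have "\<dots> = 4 ^ a" by (subst powr_realpow) (auto simp: power_mult)
finally have p4: "2 powr (5 / 4 * real l - 7 / 4) <= (4::real) ^ a" .
have "real (l ^ 3) * (real (2 ^ (l + 1) * l ^ 4) / 4 ^ a) = real l ^ 7 * 2 powr (real l + 1) / 4 ^ a"
 by (simp add: powr_add powr_realpow flip: power_add)
also have "\<dots> <= real l ^ 7 * 2 powr (real l + 1) / 2 powr (5 / 4 * real l - 7 / 4)"
 using p4 by (intro divide_left_mono) auto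
also have "\<dots> = real l ^ 7 * 2 powr (11 / 4 - real l / 4)"
proof -
 have e: "real l + 1 - (5 / 4 * real l - 7 / 4) = 11 / 4 - real l / 4" by simp
 show ?thesis unfolding times_divide_eq_right[symmetric] powr_diff[symmetric] e ..
qed
finally show "real (l ^ 3) * (real (2 ^ (l + 1) * l ^ 4) / 4 ^ a) <= real l ^ 7 * 2 powr (11 / 4 - real l / 4)" .
qed

text \<open>The slots use disjoint parts of the tape, so the single bound
  \<open>2 powr (- (l + 1) / 8)\<close> is raised to the power \<open>K\<close>; here
  \<open>8 * C <= K\<close> is used.\<close>

lemma pr_prime_product:
assumes lw: "l <= w" and l2: "2 <= l" and w: "w < l ^ 4" and D: "0 < D" "D < 2 ^ (2 ^ (l + 1) * w)"
 and as: "exp (- (2 / 5) * real l ^ 2) + real l ^ 7 * 2 powr (11 / 4 - real l / 4) <= 2 powr (- (real l + 1) / 8)"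
 and K: "8 * C <= real K"
shows "pr w (%\<omega>. prime_product w (2 ^ (5 * l div 8)) (l ^ 3) K 1 \<omega> dvd D) <= 2 powr (- C * (real l + 1))"
proof -
define a where "a = 5 * l div 8"
let ?\<Phi> = "%\<omega>. slot_prime w (2 ^ a) (l ^ 3) 1 \<omega> dvd D"
have d: "dep (2 * l ^ 3) ?\<Phi>" by (rule dep_comp[OF dep_slot_prime])
have D': "D < 2 ^ (2 ^ (l + 1) * l ^ 4)" using D(2) w by (meson less_imp_le less_le_trans mult_le_mono2 one_le_numeral power_increasing)
have "pr w ?\<Phi> <= (1 - 1 / (4 * real a)) ^ (l ^ 3) + real (l ^ 3) * (real (2 ^ (l + 1) * l ^ 4) / 4 ^ a)"
 by (rule pr_slot_prime[OF _ _ D(1) D']) (use lw l2 in \<open>auto simp: a_def\<close>)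
also have "\<dots> <= exp (- (2 / 5) * real l ^ 2) + real l ^ 7 * 2 powr (11 / 4 - real l / 4)"
 by (rule slot_bound_le[OF l2 a_def])
also note as
finally have 1: "pr w ?\<Phi> <= 2 powr (- (real l + 1) / 8)" .
have "pr w (%\<omega>. prime_product w (2 ^ a) (l ^ 3) K 1 \<omega> dvd D) <= pr w (%\<omega>. \<forall>i<K. ?\<Phi> (sdrop (2 * l ^ 3 * i) \<omega>))"
 by (rule pr_mono[OF dep_iid[OF d]]) (use prime_product_dvd in blast)
also have "\<dots> = pr w ?\<Phi> ^ K" by (rule pr_iid[OF d])
also have "\<dots> <= (2 powr (- (real l + 1) / 8)) ^ K" using 1 by (intro power_mono pr_nonneg)
also have "\<dots> = 2 powr (- (real l + 1) / 8 * real K)" by (simp add: powr_powr flip: powr_realpow)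
also have "\<dots> <= 2 powr (- C * (real l + 1))"
proof (intro powr_mono)
 have "(real l + 1) * (8 * C) <= (real l + 1) * real K" using K by (intro mult_left_mono) auto
 then show "- (real l + 1) / 8 * real K <= - C * (real l + 1)" by (simp add: field_simps)
qed simp
finally show ?thesis by (simp add: a_def)
qed

text \<open>One threshold for \<open>w\<close> serves all \<open>l\<close>: if
  \<open>w < l ^ 4\<close>, a large \<open>w\<close> makes \<open>l\<close> large as well, and
  otherwise the condition on \<open>y\<close> involves \<open>w\<close> alone.\<close>

lemma pr_modulus_of:
fixes C :: real
assumes C: "0 < C" and K: "8 * C <= real K"
shows "eventually (%w. \<forall>l D. 1 <= l --> l <= w --> 0 < D --> D < 2 ^ (2 ^ (l + 1) * w) -->
 pr w (%\<omega>. modulus_of w K l \<omega> dvd D) <= 2 powr (- C * (real l + 1))) sequentially"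
proof -
define y where "y w = real w powr (1 / 4) + 2 + log 2 (real w)" for w :: nat
have "(%w. y w * y w / real w) \<longlonglongrightarrow> 0" unfolding y_def log_def by real_asymp
moreover have "0 < 1 / (24 * (3 + C))" using C by simp
ultimately have "eventually (%w. y w * y w / real w < 1 / (24 * (3 + C))) sequentially" by (rule order_tendstoD(2))
then have ev1: "eventually (%w. 2 * y w * (1 + (2 + C) * y w) <= real w / 3 - 1) sequentially"
 using eventually_ge_at_top[of 4]
proof eventually_elim
 case (elim w)
 have y2: "1 <= y w" using elim by (simp add: y_def)
 have "2 * y w * (1 + (2 + C) * y w) <= 2 * y w * (y w + (2 + C) * y w)" using y2 by (intro mult_left_mono) auto
 also have "\<dots> = 2 * (3 + C) * (y w * y w)" by (simp add: algebra_simps)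
 also have "\<dots> <= 2 * (3 + C) * (real w / (24 * (3 + C)))"
 using elim C by (intro mult_left_mono) (auto simp: field_simps)
 also have "\<dots> = real w / 12" using C by (simp add: field_simps)
 also have "\<dots> <= real w / 3 - 1" using elim by simp
 finally show ?case .
qed
have "eventually (%l::nat. exp (- (2 / 5) * real l ^ 2) + real l ^ 7 * 2 powr (11 / 4 - real l / 4) <= 2 powr (- (real l + 1) / 8)) sequentially"
 by real_asymp
then obtain l1 where l1: "!!l. l1 <= l ==>
 exp (- (2 / 5) * real l ^ 2) + real l ^ 7 * 2 powr (11 / 4 - real l / 4) <= 2 powr (- (real l + 1) / 8)"
 by (auto simp: eventually_sequentially)
show ?thesis using ev1 eventually_ge_at_top[of "(l1 + 2) ^ 4"]
proof eventually_elim
 case (elim w)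
 show ?case
 proof (intro allI impI)
 fix l D :: nat assume lD: "1 <= l" "l <= w" "0 < D" "D < 2 ^ (2 ^ (l + 1) * w)"
 show "pr w (%\<omega>. modulus_of w K l \<omega> dvd D) <= 2 powr (- C * (real l + 1))"
 proof (cases "w < l ^ 4")
  case True
  then have "(l1 + 2) ^ 4 < l ^ 4" using elim by linarith
  \<comment> \<open>Comparing fourth powers; this also gives \<open>2 <= l\<close>, which the bound
    for a slot requires.\<close>
  then have ll: "l1 + 2 < l" by (rule power_less_imp_less_base) simp
  have "pr w (%\<omega>. prime_product w (2 ^ (5 * l div 8)) (l ^ 3) K 1 \<omega> dvd D) <= 2 powr (- C * (real l + 1))"
  by (rule pr_prime_product[OF lD(2) _ True lD(3,4) l1 K]) (use ll in auto)
  then show ?thesis using True by (simp add: modulus_of_def)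
 next
  case False
  have "pr w (%\<omega>. max 1 (shd \<omega> mod 2 ^ w mod 2 ^ (w div 3)) dvd D) <= 2 powr (- C * (real l + 1))"
  by (rule pr_word_modulus_small[OF C _ _ lD(3,4) y_def elim(1)]) (use False lD in auto)
  then show ?thesis using False by (simp add: modulus_of_def)
 qed
 qed
qed
qed

context building
begin

lemma N_le: "N <= n"
proof -
have "n * b <= n * w" using b by (rule mult_le_mono2)
moreover have "N * w < n * b + w" unfolding N by (rule num_words_bounds(2)) (use w6 in simp)
ultimately have "N * w < (n + 1) * w" unfolding add_mult_distrib mult_1 by linarith
then have "N < n + 1" by (rule mult_less_cancel2[THEN iffD1, THEN conjunct2])
then show ?thesis by simp
qed

text \<open>At most \<open>n ^ 3\<close> differences, each dangerous with probability at most
  \<open>n powr (- c - 4)\<close>, and a hit window, of probability at most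
  \<open>n powr (1 - K)\<close>, contribute \<open>n powr (- c - 1)\<close> each; the factor 2 is
  absorbed by \<open>2 <= n\<close>.\<close>

lemma pr_failure:
fixes c :: real
assumes c: "0 < c" and n2: "2 <= n" and K: "c + 2 <= real K"
 and small: "!!l D. 1 <= l ==> l <= w ==> 0 < D ==> D < 2 ^ (2 ^ (l + 1) * w) ==>
 pr w (%\<omega>. modulus_of w K l \<omega> dvd D) <= 2 powr (- (c + 4) * (real l + 1))"
 and S: "finite S" "card S <= n ^ 3" "!!D. D \<in> S ==> 0 < D & D < 2 ^ (b * n)"
shows "pr w (%\<omega>. (\<exists>D\<in>S. modulus_of w K l \<omega> dvd D) \<or>
 \<not> clean (modulus_of w K l \<omega>) (word_num w K 0 (sdrop (modulus_words w K l) \<omega>))) <= real n powr (- c)"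
proof -
have l1: "1 <= l"
proof (rule ccontr)
 assume "\<not> 1 <= l"
 then have "l = 0" by simp
 then show False using l(2) n2 by simp
qed
have "b * n <= w * 2 ^ (l + 1)" using b l by (intro mult_le_mono) auto
then have Z: "(2::nat) ^ (b * n) <= 2 ^ (2 ^ (l + 1) * w)" by (intro power_increasing) (auto simp: mult.commute)
have "real n <= real (2 ^ Suc l)" using l by (intro of_nat_mono) simp
then have nl: "real n <= 2 powr (real l + 1)" by (simp add: powr_add powr_realpow)
let ?\<Phi> = "%D \<omega>. modulus_of w K l \<omega> dvd D"
have d: "dep (modulus_words w K l) (?\<Phi> D)" for D by (rule dep_comp[OF dep_modulus_of])
have p: "pr w (?\<Phi> D) <= real n powr (- (c + 4))" if "D \<in> S" for D
proof -
 have D: "0 < D" "D < 2 ^ (b * n)" using S(3)[OF that] by auto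
 have "pr w (?\<Phi> D) <= 2 powr (- (c + 4) * (real l + 1))"
 by (rule small[OF l1 lw D(1) less_le_trans[OF D(2) Z]])
 also have "\<dots> = (2 powr (real l + 1)) powr (- (c + 4))" by (simp add: powr_powr mult.commute)
 also have "\<dots> <= real n powr (- (c + 4))" using nl n2 c by (intro powr_mono2') auto
 finally show ?thesis .
qed
have "pr w (%\<omega>. \<exists>D\<in>S. ?\<Phi> D \<omega>) <= (\<Sum>D\<in>S. pr w (?\<Phi> D))" by (rule pr_bex[OF S(1) d])
also have "\<dots> <= (\<Sum>D\<in>S. real n powr (- (c + 4)))" by (intro sum_mono p)
also have "\<dots> <= real n ^ 3 * real n powr (- (c + 4))"
 using S(2) by (simp add: mult_right_mono flip: of_nat_power)
also have "\<dots> = real n powr 3 * real n powr (- (c + 4))" using n2 by simp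
also have "\<dots> = real n powr (3 + - (c + 4))" by (rule powr_add[symmetric])
also have "3 + - (c + 4) = - c - 1" by simp
finally have 1: "pr w (%\<omega>. \<exists>D\<in>S. ?\<Phi> D \<omega>) <= real n powr (- c - 1)" .
let ?\<Psi> = "%\<omega>. \<not> clean (modulus_of w K l \<omega>) (word_num w K 0 (sdrop (modulus_words w K l) \<omega>))"
have "pr w ?\<Psi> <= real F / 2 ^ (w * K)" by (rule pr_not_clean[OF dep_modulus_of modulus_of_pos])
also have "\<dots> <= real n / real n ^ K"
proof (rule frac_le)
 show "real F <= real n" using N_le div_le_dividend[of N "3 * K", folded F] by linarith
 have "n ^ K <= W ^ K" using nW by (intro power_mono) auto
 then have "real (n ^ K) <= real (2 ^ (w * K))" by (simp only: of_nat_le_iff W_def power_mult)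
 then show "real n ^ K <= 2 ^ (w * K)" by simp
qed (use n2 in auto)
also have "\<dots> = real n powr (1 - real K)" using n2 by (simp add: powr_diff powr_realpow)
also have "\<dots> <= real n powr (- c - 1)" using n2 K by (intro powr_mono) auto
finally have 2: "pr w ?\<Psi> <= real n powr (- c - 1)" .
have d\<Psi>: "dep (modulus_words w K l + K) ?\<Psi>"
 by (rule dep_comp2[where h = "%a b. \<not> clean a b", OF dep_mono[OF dep_modulus_of] dep_sdrop[OF dep_word_num]]) simp
have "pr w (%\<omega>. (\<exists>D\<in>S. ?\<Phi> D \<omega>) \<or> ?\<Psi> \<omega>) <= pr w (%\<omega>. \<exists>D\<in>S. ?\<Phi> D \<omega>) + pr w ?\<Psi>"
 by (rule pr_disj[OF dep_bex[OF d] d\<Psi>])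
also have "\<dots> <= 2 * real n powr (- c - 1)" using 1 2 by simp
also have "\<dots> <= real n * real n powr (- c - 1)" using n2 by (intro mult_right_mono) auto
also have "\<dots> = real n powr (- c)" using n2 by (simp add: powr_diff)
finally show ?thesis .
qed

end

section \<open>Small word sizes\<close>

text \<open>Registers 20 and 21 are the scratch registers of the decision trees below; descending to
  a leaf changes nothing else.\<close>

definition eqv :: "config \<Rightarrow> config \<Rightarrow> bool" where
"eqv s s' \<longleftrightarrow> (\<forall>x. x \<notin> {20, 21} --> reg s' x = reg s x) & arr s' = arr s & rnd s' = rnd s"

lemma eqv_refl [simp]: "eqv s s"
by (simp add: eqv_def)

lemma eqv_trans: "eqv s s' ==> eqv s' s'' ==> eqv s s''"
by (simp add: eqv_def)

lemma eqv_set_reg [simp]: "x \<in> {20, 21} ==> eqv s (set_reg x v s)"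
by (auto simp: eqv_def set_reg_def)

lemma eqv_reg: "eqv s s' ==> x \<notin> {20, 21} ==> reg s' x = reg s x" and eqv_arr: "eqv s s' ==> arr s' = arr s"
by (simp_all add: eqv_def)

definition halts :: "nat \<Rightarrow> prog \<Rightarrow> config \<Rightarrow> (config \<Rightarrow> bool) \<Rightarrow> bool" where
"halts w p s Q \<longleftrightarrow> (\<exists>t s'. exec w p s t s' & Q s')"

lemma halts_Seq: "halts w p s P ==> (!!s'. P s' ==> halts w q s' Q) ==> halts w (Seq p q) s Q"
unfolding halts_def by (blast intro: exec.Seq)

lemma halts_If: "halts w (if test_val b s then p else q) s Q ==> halts w (If b p q) s Q"
unfolding halts_def by (cases "test_val b s") (auto intro: exec.IfTrue exec.IfFalse)

lemma halts_Const: "k < 2 ^ w ==> Q (set_reg r k s) ==> halts w (Const r k) s Q"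
unfolding halts_def using exec.Const[of w r k s] by auto

lemma halts_Load: "reg s a < length (arr s k) ==> Q (set_reg r (arr s k ! reg s a) s) ==> halts w (Load r k a) s Q"
unfolding halts_def using exec.Load[of s a k w r] by blast

lemma halts_Store: "reg s a < length (arr s k) ==> Q (s\<lparr>arr := (arr s)(k := (arr s k)[reg s a := reg s r])\<rparr>) ==>
 halts w (Store k a r) s Q"
unfolding halts_def using exec.Store[of s a k w r] by blast

section \<open>Decision trees over the arguments and the words of the text\<close>

primrec branch :: "nat \<Rightarrow> register \<Rightarrow> (nat \<Rightarrow> prog) \<Rightarrow> prog" where
"branch 0 r f = Skip"
| "branch (Suc v) r f = Seq (Const 20 v) (If (Eq 20 r) (f v) (branch v r f))"

lemma no_loop_branch: "(!!v. no_loop (f v)) ==> no_loop (branch V r f)"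
by (induction V) auto

lemma halts_branch:
assumes "r ~= 20" "reg s r < V" "V <= 2 ^ w" "!!s'. eqv s s' ==> reg s' r = reg s r ==> halts w (f (reg s r)) s' Q"
shows "halts w (branch V r f) s Q"
using assms
proof (induction V arbitrary: s)
case (Suc v)
let ?s = "set_reg 20 v s"
have r: "reg ?s r = reg s r" "reg ?s 20 = v" using Suc.prems(1) by (auto simp: set_reg_def)
have "halts w (if test_val (Eq 20 r) ?s then f v else branch v r f) ?s Q"
proof (cases "reg s r = v")
 case True
 then show ?thesis using Suc.prems(4)[of ?s] r by simp
next
 case False
 have "halts w (branch v r f) ?s Q"
 proof (rule Suc.IH)
 fix s' assume "eqv ?s s'" "reg s' r = reg ?s r"
 then show "halts w (f (reg ?s r)) s' Q" using Suc.prems(4)[of s'] r eqv_trans[of s ?s s'] by simp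
 qed (use Suc.prems False r in auto)
 then show ?thesis using False r by auto
qed
then show ?case unfolding branch.simps
 by (intro halts_Seq[where P = "%s'. s' = ?s"] halts_Const) (use Suc.prems in \<open>auto intro: halts_If\<close>)
qed simp

primrec tree :: "nat \<Rightarrow> register list \<Rightarrow> (nat list \<Rightarrow> prog) \<Rightarrow> prog" where
"tree V [] f = f []"
| "tree V (r # rs) f = branch V r (%v. tree V rs (%vs. f (v # vs)))"

lemma no_loop_tree: "(!!vs. no_loop (f vs)) ==> no_loop (tree V rs f)"
by (induction rs arbitrary: f) (auto intro: no_loop_branch)

lemma halts_tree:
assumes "!!r. r \<in> set rs ==> r \<notin> {20, 21} & reg s r < V" "V <= 2 ^ w"
 "!!s'. eqv s s' ==> halts w (f (map (reg s) rs)) s' Q"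
shows "halts w (tree V rs f) s Q"
using assms
proof (induction rs arbitrary: f s)
case (Cons r rs)
show ?case unfolding tree.simps
proof (rule halts_branch)
 fix s' assume s': "eqv s s'"
 have m: "map (reg s') rs = map (reg s) rs" using Cons.prems(1) eqv_reg[OF s'] by auto
 show "halts w (tree V rs (%vs. f (reg s r # vs))) s' Q"
 proof (rule Cons.IH)
 fix s'' assume "eqv s' s''"
 then have "eqv s s''" by (rule eqv_trans[OF s'])
 then show "halts w (f (reg s r # map (reg s') rs)) s'' Q" unfolding m using Cons.prems(3) by simp
 qed (use Cons.prems eqv_reg[OF s'] in auto)
qed (use Cons.prems in auto)
qed simp

primrec cell_tree :: "nat \<Rightarrow> nat list \<Rightarrow> (nat list \<Rightarrow> prog) \<Rightarrow> prog" where
"cell_tree V [] f = f []"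
| "cell_tree V (a # as) f = Seq (Const 20 a) (Seq (Load 21 0 20) (branch V 21 (%v. cell_tree V as (%vs. f (v # vs)))))"

lemma no_loop_cell_tree: "(!!vs. no_loop (f vs)) ==> no_loop (cell_tree V as f)"
by (induction as arbitrary: f) (auto intro: no_loop_branch)

lemma halts_cell_tree:
assumes "!!a. a \<in> set as ==> a < length (arr s 0) & a < 2 ^ w & arr s 0 ! a < V" "V <= 2 ^ w"
 "!!s'. eqv s s' ==> halts w (f (map (%a. arr s 0 ! a) as)) s' Q"
shows "halts w (cell_tree V as f) s Q"
using assms
proof (induction as arbitrary: f s)
case (Cons a as)
let ?s1 = "set_reg 20 a s"
let ?s2 = "set_reg 21 (arr s 0 ! a) ?s1"
have e1: "eqv s ?s1" by simp
have e2: "eqv s ?s2" using eqv_trans[OF e1] by simp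
have r: "reg ?s1 20 = a" "reg ?s2 21 = arr s 0 ! a" "arr ?s1 = arr s" by (auto simp: set_reg_def)
have "halts w (branch V 21 (%v. cell_tree V as (%vs. f (v # vs)))) ?s2 Q"
proof (rule halts_branch)
 fix s' assume s': "eqv ?s2 s'"
 then have e: "eqv s s'" using eqv_trans[OF e2] by blast
 show "halts w (cell_tree V as (%vs. f (reg ?s2 21 # vs))) s' Q"
 proof (rule Cons.IH)
 fix s'' assume "eqv s' s''"
 then show "halts w (f (reg ?s2 21 # map (%a. arr s' 0 ! a) as)) s'' Q"
  using Cons.prems(3)[OF eqv_trans[OF e]] r eqv_arr[OF e] by simp
 qed (use Cons.prems eqv_arr[OF e] in auto)
qed (use Cons.prems r in auto)
then show ?case unfolding cell_tree.simps
 by (intro halts_Seq[where P = "%s'. s' = ?s1"] halts_Seq[where P = "%s'. s' = ?s2"] halts_Const halts_Load)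
 (use Cons.prems r in auto)
qed simp

primrec write_list :: "nat \<Rightarrow> nat list \<Rightarrow> prog" where
"write_list k [] = Skip"
| "write_list k (y # ys) = Seq (Const 20 k) (Seq (Const 21 y) (Seq (Store 2 20 21) (write_list (Suc k) ys)))"

lemma no_loop_write_list: "no_loop (write_list k ys)"
by (induction ys arbitrary: k) auto

lemma halts_write_list:
assumes "k + length ys = length (arr s 2)" "length (arr s 2) <= 2 ^ w" "!!y. y \<in> set ys ==> y < 2 ^ w"
shows "halts w (write_list k ys) s (%s'. arr s' = (arr s)(2 := take k (arr s 2) @ ys))"
using assms
proof (induction ys arbitrary: k s)
case Nil
then show ?case unfolding halts_def by (auto intro!: exI exec.Skip)
next
case (Cons y ys)
let ?s1 = "set_reg 20 k s"
let ?s2 = "set_reg 21 y ?s1"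
let ?s3 = "?s2\<lparr>arr := (arr ?s2)(2 := (arr ?s2 2)[reg ?s2 20 := reg ?s2 21])\<rparr>"
have r: "reg ?s2 20 = k" "reg ?s2 21 = y" "arr ?s2 = arr s" by (auto simp: set_reg_def)
have a3: "arr ?s3 = (arr s)(2 := (arr s 2)[k := y])" using r by simp
have k: "k < length (arr s 2)" using Cons.prems by simp
have "halts w (write_list (Suc k) ys) ?s3 (%s'. arr s' = (arr ?s3)(2 := take (Suc k) (arr ?s3 2) @ ys))"
 by (rule Cons.IH) (use Cons.prems a3 in auto)
moreover have "(arr ?s3)(2 := take (Suc k) (arr ?s3 2) @ ys) = (arr s)(2 := take k (arr s 2) @ y # ys)"
 unfolding a3 using k by (auto simp: take_Suc_conv_app_nth fun_eq_iff)
ultimately have "halts w (write_list (Suc k) ys) ?s3 (%s'. arr s' = (arr s)(2 := take k (arr s 2) @ y # ys))" by simp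
note last = this
have 3: "halts w (Store 2 20 21) ?s2 (%s'. s' = ?s3)" by (rule halts_Store) (use r k in auto)
have 2: "halts w (Const 21 y) ?s1 (%s'. s' = ?s2)" by (rule halts_Const) (use Cons.prems in auto)
have 1: "halts w (Const 20 k) s (%s'. s' = ?s1)" by (rule halts_Const) (use Cons.prems k in auto)
show ?case unfolding write_list.simps
 by (rule halts_Seq[OF 1], simp only:, rule halts_Seq[OF 2], simp only:, rule halts_Seq[OF 3], simp only:, rule last)
qed

text \<open>A program may be any finite object, so its leaves may be chosen by a non-computable
  definition. That the choice returns the text is \<open>unpack_pack\<close>.\<close>

definition unpack :: "nat \<Rightarrow> nat \<Rightarrow> nat \<Rightarrow> nat list \<Rightarrow> nat list" where
"unpack w n b A = (SOME T. length T = n & (\<forall>x\<in>set T. x < 2 ^ b) & pack w b T = A)"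

lemma unpack_pack:
assumes "1 <= w" "\<forall>x\<in>set T. x < 2 ^ b"
shows "unpack w (length T) b (pack w b T) = T"
proof -
define T' where "T' = unpack w (length T) b (pack w b T)"
have "length T' = length T & (\<forall>x\<in>set T'. x < 2 ^ b) & pack w b T' = pack w b T"
 unfolding T'_def unpack_def by (rule someI[of _ T]) (use assms in auto)
then have T': "length T' = length T" "\<forall>x\<in>set T'. x < 2 ^ b" "pack w b T' = pack w b T" by auto
then have "tnum b T' = tnum b T" using tnum_pack[OF assms(1)] assms(2) by metis
then show ?thesis unfolding T'_def[symmetric] using T' assms by (intro tnum_inj[of T' T b]) auto
qed

text \<open>The list pattern matches the registers named in \<open>table_prog\<close>. The number of
  text words to be inspected is fixed only at this level of the tree, where \<open>n\<close> and
  \<open>b\<close> are known.\<close>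

fun decode :: "nat \<Rightarrow> (nat \<Rightarrow> nat \<Rightarrow> nat \<Rightarrow> nat \<Rightarrow> nat list \<Rightarrow> prog) \<Rightarrow> nat list \<Rightarrow> prog" where
"decode w f [n0, n1, b, i0, i1, m0, m1] = (let n = n0 + 2 ^ w * n1 in
 cell_tree (2 ^ w) [0..<num_words w (n * b)]
 (%A. f n b (i0 + 2 ^ w * i1) (m0 + 2 ^ w * m1) A))"
| "decode w f _ = Skip"

definition table_prog :: "nat \<Rightarrow> (nat \<Rightarrow> nat \<Rightarrow> nat \<Rightarrow> nat \<Rightarrow> nat list \<Rightarrow> prog) \<Rightarrow> prog" where
"table_prog w f = tree (2 ^ w) [0, 1, 4, 8, 9, 10, 11] (decode w f)"

lemma no_loop_table_prog: "(!!n b i m A. no_loop (f n b i m A)) ==> no_loop (table_prog w f)"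
proof -
assume f: "!!n b i m A. no_loop (f n b i m A)"
have "(!!n b i m A. no_loop (f n b i m A)) ==> no_loop (decode w f vs)" for vs
 by (induction w f vs rule: decode.induct) (auto simp: Let_def intro!: no_loop_cell_tree)
from this[OF f] show ?thesis unfolding table_prog_def by (rule no_loop_tree)
qed

lemma halts_table_prog:
assumes w: "1 <= w" and A: "arr s 0 = A" "length A = num_words w (n * b)" "!!x. x \<in> set A ==> x < 2 ^ w" "length A <= 2 ^ w"
 and r: "reg s 0 = n mod 2 ^ w" "reg s 1 = n div 2 ^ w" "reg s 4 = b" "b < 2 ^ w" "reg s 8 = i mod 2 ^ w" "reg s 9 = i div 2 ^ w"
 "reg s 10 = m mod 2 ^ w" "reg s 11 = m div 2 ^ w"
 and le: "n <= 2 ^ w" "i <= 2 ^ w" "m <= 2 ^ w"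
 and f: "!!s'. eqv s s' ==> halts w (f n b i m A) s' Q"
shows "halts w (table_prog w f) s Q"
unfolding table_prog_def
proof (rule halts_tree)
have w2: "(2::nat) ^ 1 <= 2 ^ w" using w by (intro power_increasing) auto
have d: "x div 2 ^ w < 2 ^ w" if "x <= 2 ^ w" for x :: nat
 using div_le_mono[OF that, of "2 ^ w"] w2 by simp
show "r \<in> set [0, 1, 4, 8, 9, 10, 11] ==> r \<notin> {20, 21} & reg s r < 2 ^ w" for r
 using r d le by auto
fix s' assume s': "eqv s s'"
have mA: "map (%a. arr s' 0 ! a) [0..<num_words w (n * b)] = A"
 using A eqv_arr[OF s'] map_nth[of A] by simp
have "halts w (cell_tree (2 ^ w) [0..<num_words w (n * b)] (%A. f n b i m A)) s' Q"
proof (rule halts_cell_tree)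
 fix s'' assume "eqv s' s''"
 then show "halts w (f n b i m (map (%a. arr s' 0 ! a) [0..<num_words w (n * b)])) s'' Q"
 unfolding mA using f eqv_trans[OF s'] by blast
qed (use A eqv_arr[OF s'] in auto)
then show "halts w (decode w f (map (reg s) [0, 1, 4, 8, 9, 10, 11])) s' Q"
 using r by (simp add: Let_def)
qed simp

primrec cases_w :: "nat \<Rightarrow> nat \<Rightarrow> (nat \<Rightarrow> prog) \<Rightarrow> prog \<Rightarrow> prog" where
"cases_w a 0 f p = p"
| "cases_w a (Suc d) f p = Seq (Const 20 a) (If (Eq 20 6) (f a) (cases_w (Suc a) d f p))"

text \<open>The word size is tested in increasing order, so that each constant compared with it fits into a word.\<close>

lemma exec_cases_w:
assumes "reg s 6 = w" "a <= w"
 "!!s'. eqv s s' ==> \<exists>t s''. exec w (if w < a + d then f w else p) s' t s'' & Q t s''"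
shows "\<exists>t u s'. exec w (cases_w a d f p) s t s' & t <= u + 2 * d & Q u s'"
using assms
proof (induction d arbitrary: a s)
case 0
have "\<not> w < a + 0" using 0(2) by simp
then obtain t s'' where e: "exec w p s t s''" "Q t s''" using 0(3)[OF eqv_refl] by (simp only: if_False) blast
then have "exec w (cases_w a 0 f p) s t s'' & t <= t + 2 * 0 & Q t s''" by simp
then show ?case by blast
next
case (Suc d)
let ?s = "set_reg 20 a s"
have aw: "a mod 2 ^ w = a" by (rule mod_less[OF le_less_trans[OF Suc.prems(2) less_exp]])
have c: "exec w (Const 20 a) s 1 ?s" using exec.Const[of w 20 a s] aw by simp
have r: "reg ?s 6 = w" "reg ?s 20 = a" "eqv s ?s" using Suc.prems by (auto simp: set_reg_def eqv_def)
show ?case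
proof (cases "a = w")
 case True
 then have "w < a + Suc d" by simp
 then obtain t s'' where e: "exec w (f w) ?s t s''" "Q t s''" using Suc.prems(3)[OF r(3)] by (simp only: if_True) blast
 have "exec w (cases_w a (Suc d) f p) s (1 + Suc t) s''"
 unfolding cases_w.simps using True r e(1) by (intro exec.Seq[OF c] exec.IfTrue) auto
 moreover have "1 + Suc t <= t + 2 * Suc d" by simp
 ultimately show ?thesis using e(2) by blast
next
 case False
 have "\<exists>t u s'. exec w (cases_w (Suc a) d f p) ?s t s' & t <= u + 2 * d & Q u s'"
 proof (rule Suc.IH)
 fix s' assume "eqv ?s s'"
 then show "\<exists>t s''. exec w (if w < Suc a + d then f w else p) s' t s'' & Q t s''"
  using Suc.prems(3)[OF eqv_trans[OF r(3)]] by simp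
 qed (use r Suc.prems False in auto)
 then obtain t u s' where e: "exec w (cases_w (Suc a) d f p) ?s t s'" "t <= u + 2 * d" "Q u s'" by blast
 have "exec w (cases_w a (Suc d) f p) s (1 + Suc t) s'"
 unfolding cases_w.simps using False r e(1) by (intro exec.Seq[OF c] exec.IfFalse) auto
 moreover have "1 + Suc t <= u + 2 * Suc d" using e(2) by simp
 ultimately show ?thesis using e(3) by blast
qed
qed

section \<open>The three programs\<close>

definition lce_out :: "nat \<Rightarrow> prog" where
"lce_out nd = Seq (Seq (to_word nd 80) (copy_reg 0 rT)) (Seq (to_word nd 81) (copy_reg 1 rT))"

definition extract_table :: "nat \<Rightarrow> prog" where
"extract_table w = table_prog w (%n b i m A. write_list 0 (pack w b (take m (drop i (unpack w n b A)))))"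

definition lce_table :: "nat \<Rightarrow> prog" where
"lce_table w = table_prog w (%n b i j A. Seq (Const 0 (lce (unpack w n b A) i j mod 2 ^ w))
 (Const 1 (lce (unpack w n b A) i j div 2 ^ w)))"

text \<open>For word sizes up to \<open>w0\<close> nothing is built: the tables work on the packed
  text itself and need no additional memory.\<close>

definition build_prog :: "nat \<Rightarrow> nat \<Rightarrow> prog" where
"build_prog K w0 = cases_w 1 w0 (%_. Skip) (Seq (prologue (48 * K)) (cmp (48 * K) (build_hl K)))"

definition extract_prog :: "nat \<Rightarrow> nat \<Rightarrow> prog" where
"extract_prog K w0 = cases_w 1 w0 extract_table (Seq (prologue (48 * K)) (cmp (48 * K) (extract_hl K)))"

definition lce_prog :: "nat \<Rightarrow> nat \<Rightarrow> prog" where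
"lce_prog K w0 = cases_w 1 w0 lce_table
 (Seq (Seq (prologue (48 * K)) (cmp (48 * K) (lce_hl K))) (lce_out (48 * K)))"

definition lg :: "nat \<Rightarrow> nat" where
"lg n = (SOME l. 2 ^ l <= n & n < 2 ^ Suc l)"

lemma lg: "1 <= n ==> 2 ^ lg n <= n & n < 2 ^ Suc (lg n)"
unfolding lg_def by (rule someI_ex) (rule lg_exists)

definition extra_words :: "nat \<Rightarrow> nat \<Rightarrow> nat \<Rightarrow> nat \<Rightarrow> nat" where
"extra_words K w0 w n = (if w <= w0 then 0 else sw K * (7 + lg n))"

definition ct :: "nat \<Rightarrow> ex \<Rightarrow> ex \<Rightarrow> nat" where
"ct K a b = steps (cmp_test (48 * K) a b) + 2"

definition st :: "nat \<Rightarrow> hl \<Rightarrow> nat" where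
"st K c = steps (cmp (48 * K) c)"

text \<open>One constant for both regimes, hence the sum over the tables of all word sizes up to
  \<open>w0\<close>.\<close>

definition extract_cost :: "nat \<Rightarrow> nat \<Rightarrow> nat" where
"extract_cost K w0 = steps (prologue (48 * K)) + st K (extract_init K) +
 (st K (extract_step K) + ct K (Num 0) (Var 53)) + 1 + 2 * w0 + (\<Sum>v\<le>w0. steps (extract_table v))"

definition lce_cost :: "nat \<Rightarrow> nat \<Rightarrow> nat" where
"lce_cost K w0 = steps (prologue (48 * K)) + st K (lce_init K) + 2 * (st K (up_step K) + ct K (Num 0) (Var 72)) +
 (st K (down_step K) + ct K (Num 0) (Var 61)) + 2 + st K lce_final + steps (lce_out (48 * K)) + 2 * w0 +
 (\<Sum>v\<le>w0. steps (lce_table v))"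

text \<open>304 is \<open>4 * 76\<close>, with 76 from \<open>trial_work_le\<close> and a factor 2
  for each of the two loop counts that are increased by 1; \<open>105 * K\<close> is
  \<open>5 * K\<close> times the 21 of \<open>fourth_le_pow\<close>.\<close>

definition prime_cost :: "nat \<Rightarrow> nat" where
"prime_cost K = st K (seqs [Asg 62 (Quo (Times (Num 5) (Var 60)) (Num 8)), Asg 63 (Pow (Var 62)), Asg vM (Num 1)]) + 1 +
 K * (st K (Sq (Asg 64 (Num 1)) (Asg 65 (Times (Times (Var 60) (Var 60)) (Var 60)))) +
 304 * (st K candidate + (st K trial_step + ct K (Var 69) (Plus (Var 63) (Num 1))) + 1 + st K accept + ct K (Num 0) (Var 65)) +
 1 + st K (Asg vM (Times (Var vM) (Var 64)))) +
 (st K (recip_init K) + (105 * K + 1) * (st K recip_step + ct K (Num 0) (Var 71)) + 1)"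

definition choose_cost :: "nat \<Rightarrow> nat" where
"choose_cost K = st K (Sq (Asg 60 (Num 0)) (Asg 61 (Num 1))) +
 2 * (st K lg_step + ct K (Times (Num 2) (Var 61)) (Plus (Var vn) (Num 1))) + 1 +
 ct K (Var vw) (Times (Times (Var 60) (Var 60)) (Times (Var 60) (Var 60))) + st K (word_modulus K) + prime_cost K"

definition build_cost :: "nat \<Rightarrow> nat" where
"build_cost K = st K (prepare K) + choose_cost K + st K (window_hl K) +
 2 * (st K (check_step K) + ct K (Var 41) (Var vF)) + st K (fallback K) +
 (3 * K + 1) * (st K tail_step + ct K (Times (Var vF) (Num (3 * K))) (Var 76)) + st K (tail_final K) +
 2 * (st K (encode_step K) + ct K (Num 0) (Var 41)) + st K (table_init K) +
 3 * (st K (table_step K) + ct K (Var 61) (Plus (Var vn) (Num 1))) + 4"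

section \<open>Estimates for a construction time linear in \<open>n\<close>\<close>

lemma cube_le_pow: "m ^ 3 <= 4 * 2 ^ m" for m :: nat
proof (cases "m < 4")
case True
then have "m = 0 \<or> m = 1 \<or> m = 2 \<or> m = 3" by auto
then show ?thesis by auto
next
case False
then have "4 <= m" by simp
then show ?thesis
proof (induction m rule: nat_induct_at_least)
 case (Suc m)
 have a: "4 * m <= m * m" using Suc.hyps by (intro mult_le_mono1)
 have "4 * (m * m) <= m * (m * m)" using Suc.hyps by (intro mult_le_mono1)
 moreover have "Suc m ^ 3 = m * (m * m) + 3 * (m * m) + 3 * m + 1" by (simp add: power3_eq_cube algebra_simps)
 ultimately have "Suc m ^ 3 <= 2 * (m * (m * m))" using a Suc.hyps by linarith
 also have "\<dots> = 2 * m ^ 3" by (simp add: power3_eq_cube)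
 finally show ?case using Suc.IH by simp
qed simp
qed

lemma fourth_le_pow: "m ^ 4 <= 21 * 2 ^ m" for m :: nat
proof (cases "m < 6")
case True
then have "m = 0 \<or> m = 1 \<or> m = 2 \<or> m = 3 \<or> m = 4 \<or> m = 5" by auto
then show ?thesis by auto
next
case False
then have "6 <= m" by simp
then show ?thesis
proof (induction m rule: nat_induct_at_least)
 case (Suc m)
 have a: "6 * m <= m * m" using Suc.hyps by (intro mult_le_mono1)
 have b: "6 * (m * m) <= m * (m * m)" using Suc.hyps by (intro mult_le_mono1)
 have "6 * (m * (m * m)) <= m * (m * (m * m))" using Suc.hyps by (intro mult_le_mono1)
 moreover have "Suc m ^ 4 = m * (m * (m * m)) + 4 * (m * (m * m)) + 6 * (m * m) + 4 * m + 1"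
 by (simp add: power4_eq_xxxx algebra_simps)
 ultimately have "Suc m ^ 4 <= 2 * (m * (m * (m * m)))" using a b Suc.hyps by linarith
 also have "\<dots> = 2 * m ^ 4" by (simp add: power4_eq_xxxx)
 finally show ?case using Suc.IH by simp
qed simp
qed

text \<open>The gap \<open>m = l - a\<close> is at least \<open>3 / 8 * l\<close>, so a cubic factor
  in \<open>l\<close> is one in \<open>m\<close> and is absorbed by \<open>2 ^ m\<close>; 76 is
  \<open>4 * 512 / 27\<close> rounded up.\<close>

lemma trial_work_le: "l ^ 3 * 2 ^ (5 * l div 8) <= 76 * (2::nat) ^ l"
proof -
define a where "a = 5 * l div 8"
define m where "m = l - a"
have al: "a <= l" by (simp add: a_def)
then have "3 * l <= 8 * m" unfolding m_def a_def by linarith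
then have "(3 * l) ^ 3 <= (8 * m) ^ 3" by (rule power_mono) simp
then have "27 * l ^ 3 <= 512 * m ^ 3" by (simp add: power_mult_distrib)
then have "l ^ 3 <= 76 * 2 ^ m" using cube_le_pow[of m] by linarith
then have "l ^ 3 * 2 ^ a <= 76 * 2 ^ m * 2 ^ a" by (rule mult_le_mono1)
also have "\<dots> = 76 * 2 ^ l" using al by (simp add: m_def flip: power_add)
finally show ?thesis by (simp add: a_def)
qed

lemma lin_le: "x <= n * y ==> x * c <= n * (y * (c::nat))"
using mult_le_mono1[of x "n * y" c] by (simp add: mult.assoc)

context building
begin

lemma ct_eq: "nd = 48 * K ==> cost_test x y = ct K x y"
unfolding cost_test_def ct_def by simp

lemma st_eq: "nd = 48 * K ==> steps (cmp nd c) = st K c"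
by (simp add: st_def)

lemma triv_le: "x <= n * x"
using n1 by simp

lemma l_le: "l <= n"
using less_exp[of l] l(1) by linarith

lemma F_le: "F <= n"
using N_le div_le_dividend[of N "3 * K", folded F] by linarith

lemma T_prime_le:
assumes "w < l ^ 4"
shows "T_prime <= n * prime_cost K"
proof -
note eqs = ct_eq[OF nd] st_eq[OF nd]
have l0: "1 <= l ^ 3" "1 <= A" using assms by (cases l) (auto simp: A_def)
have A: "l ^ 3 * A <= n * 76" using trial_work_le[of l] l(1) by (simp add: A_def)
define r0 r1 r2 q1 where "r0 = st K candidate" and "r1 = st K trial_step + ct K (Var 69) (Plus (Var 63) (Num 1))"
 and "r2 = st K accept" and "q1 = ct K (Num 0) (Var 65)"
have T: "T_try = r0 + ((A + 1) * r1 + 1 + r2)" unfolding T_try_def eqs r0_def r1_def r2_def ..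
have g: "x <= (A + 1) * x" for x by simp
have "T_try + q1 <= (A + 1) * (r0 + r1 + 1 + r2 + q1)"
 unfolding T distrib_left[of "A + 1"] using g[of r0] g[of 1] g[of r2] g[of q1] by linarith
then have "(l ^ 3 + 1) * (T_try + q1) <= (l ^ 3 + 1) * ((A + 1) * (r0 + r1 + 1 + r2 + q1))" by (rule mult_le_mono2)
also have "\<dots> = (l ^ 3 + 1) * (A + 1) * (r0 + r1 + 1 + r2 + q1)" by (simp only: mult.assoc)
also have "\<dots> <= n * (304 * (r0 + r1 + 1 + r2 + q1))"
proof (rule lin_le)
 have "(l ^ 3 + 1) * (A + 1) <= (2 * l ^ 3) * (2 * A)" by (intro mult_le_mono) (use l0 in auto)
 also have "(2 * l ^ 3) * (2 * A) = 4 * (l ^ 3 * A)" by simp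
 finally show "(l ^ 3 + 1) * (A + 1) <= n * 304" using A by linarith
qed
finally have tries: "(l ^ 3 + 1) * (T_try + q1) <= n * (304 * (r0 + r1 + 1 + r2 + q1))" .
define q0 q2 where "q0 = st K (Sq (Asg 64 (Num 1)) (Asg 65 (Times (Times (Var 60) (Var 60)) (Var 60))))"
 and "q2 = st K (Asg vM (Times (Var vM) (Var 64)))"
define sl where "sl = q0 + 304 * (r0 + r1 + 1 + r2 + q1) + 1 + q2"
have "T_slot = q0 + ((l ^ 3 + 1) * (T_try + q1) + 1 + q2)" unfolding T_slot_def eqs q0_def q1_def q2_def ..
then have slot1: "T_slot <= n * sl"
 unfolding sl_def distrib_left[of n] using tries triv_le[of q0] triv_le[of q2] triv_le[of 1] by linarith
have slot: "K * T_slot <= n * (K * sl)" using mult_le_mono2[OF slot1, of K] by (simp only: ac_simps)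
define u0 u1 where "u0 = st K (recip_init K)" and "u1 = st K recip_step + ct K (Num 0) (Var 71)"
have "w <= 21 * 2 ^ l" using assms fourth_le_pow[of l] by linarith
then have "w <= n * 21" using l(1) by linarith
then have "5 * K * w <= 5 * K * (n * 21)" by (rule mult_le_mono2)
also have "\<dots> = n * (105 * K)" by (simp add: algebra_simps)
finally have "5 * K * w + 1 <= n * (105 * K + 1)" using n1 unfolding distrib_left[of n] by linarith
from lin_le[OF this, of u1] have "(5 * K * w + 1) * u1 <= n * ((105 * K + 1) * u1)" .
moreover have "T_recip = u0 + ((5 * K * w + 1) * u1 + 1)" unfolding T_recip_def eqs u0_def u1_def ..
ultimately have rec: "T_recip <= n * (u0 + (105 * K + 1) * u1 + 1)"
 unfolding distrib_left[of n] using triv_le[of u0] triv_le[of 1] by linarith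
define p0 where "p0 = st K (seqs [Asg 62 (Quo (Times (Num 5) (Var 60)) (Num 8)), Asg 63 (Pow (Var 62)), Asg vM (Num 1)])"
have "T_prime = p0 + (1 + K * T_slot + T_recip)" unfolding T_prime_def eqs p0_def ..
then have "T_prime <= n * (p0 + 1 + K * sl + (u0 + (105 * K + 1) * u1 + 1))"
 unfolding distrib_left[of n p0] distrib_left[of n "p0 + 1"] distrib_left[of n "p0 + 1 + K * sl"]
 using slot rec triv_le[of p0] triv_le[of 1] by linarith
then show ?thesis
 by (simp only: prime_cost_def p0_def sl_def u0_def u1_def q0_def q1_def q2_def r0_def r1_def r2_def)
qed

lemma T_choose_le: "T_choose <= n * choose_cost K"
proof -
note eqs = ct_eq[OF nd] st_eq[OF nd]
define a0 a1 a2 a3 where "a0 = st K (Sq (Asg 60 (Num 0)) (Asg 61 (Num 1)))"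
 and "a1 = st K lg_step + ct K (Times (Num 2) (Var 61)) (Plus (Var vn) (Num 1))"
 and "a2 = ct K (Var vw) (Times (Times (Var 60) (Var 60)) (Times (Var 60) (Var 60)))" and "a3 = st K (word_modulus K)"
define tp where "tp = (if w < l ^ 4 then T_prime else 0)"
have tp: "tp <= n * prime_cost K" using T_prime_le by (simp add: tp_def)
have "l + 1 <= n * 2" using l_le n1 by linarith
from lin_le[OF this, of a1] have 1: "(l + 1) * a1 <= n * (2 * a1)" .
have "T_choose = a0 + ((l + 1) * a1 + 1) + (a2 + (a3 + tp))"
 unfolding T_choose_def T_lg_def eqs a0_def a1_def a2_def a3_def tp_def ..
then have "T_choose <= n * (a0 + 2 * a1 + 1 + a2 + a3 + prime_cost K)"
 unfolding distrib_left[of n] using 1 tp triv_le[of a0] triv_le[of 1] triv_le[of a2] triv_le[of a3] by linarith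
then show ?thesis by (simp only: choose_cost_def a0_def a1_def a2_def a3_def)
qed

lemma T_build_le: "T_build <= n * build_cost K"
proof -
note eqs = ct_eq[OF nd] st_eq[OF nd]
define s0 s1 s2 s3 s4 c1 c2 c3 c4 where "s0 = st K (prepare K)" and "s1 = st K (window_hl K)" and "s2 = st K (fallback K)"
 and "s3 = st K (tail_final K)" and "s4 = st K (table_init K)" and "c1 = st K (check_step K) + ct K (Var 41) (Var vF)"
 and "c2 = st K tail_step + ct K (Times (Var vF) (Num (3 * K))) (Var 76)"
 and "c3 = st K (encode_step K) + ct K (Num 0) (Var 41)"
 and "c4 = st K (table_step K) + ct K (Var 61) (Plus (Var vn) (Num 1))"
have "F + 1 <= n * 2" "l + 2 <= n * 3" using l_le F_le n1 by linarith+
note 1 = lin_le[OF this(1), of c1] lin_le[OF this(1), of c3] lin_le[OF this(2), of c4]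
have "T_build = s0 + (T_choose + (s1 + (((F + 1) * c1 + 1) + (s2 + (((3 * K + 1) * c2 + 1) +
 (s3 + (((F + 1) * c3 + 1) + (s4 + ((l + 2) * c4 + 1)))))))))"
 unfolding T_build_def eqs s0_def s1_def s2_def s3_def s4_def c1_def c2_def c3_def c4_def ..
then have "T_build <= n * (s0 + choose_cost K + s1 + 2 * c1 + s2 + (3 * K + 1) * c2 + s3 + 2 * c3 + s4 + 3 * c4 + 4)"
 unfolding distrib_left[of n s0] distrib_left[of n "s0 + choose_cost K"] distrib_left[of n "s0 + choose_cost K + s1"]
 distrib_left[of n "s0 + choose_cost K + s1 + 2 * c1"] distrib_left[of n "s0 + choose_cost K + s1 + 2 * c1 + s2"]
 distrib_left[of n "s0 + choose_cost K + s1 + 2 * c1 + s2 + (3 * K + 1) * c2"]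
 distrib_left[of n "s0 + choose_cost K + s1 + 2 * c1 + s2 + (3 * K + 1) * c2 + s3"]
 distrib_left[of n "s0 + choose_cost K + s1 + 2 * c1 + s2 + (3 * K + 1) * c2 + s3 + 2 * c3"]
 distrib_left[of n "s0 + choose_cost K + s1 + 2 * c1 + s2 + (3 * K + 1) * c2 + s3 + 2 * c3 + s4"]
 distrib_left[of n "s0 + choose_cost K + s1 + 2 * c1 + s2 + (3 * K + 1) * c2 + s3 + 2 * c3 + s4 + 3 * c4"]
 using 1 T_choose_le triv_le[of s0] triv_le[of s1] triv_le[of s2] triv_le[of s3] triv_le[of s4] triv_le[of 4]
 triv_le[of "(3 * K + 1) * c2"] by linarith
then show ?thesis
 by (simp only: build_cost_def s0_def s1_def s2_def s3_def s4_def c1_def c2_def c3_def c4_def)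
qed

end

lemma args_less: "1 <= w ==> (!!v. v \<in> set xs ==> v <= 2 ^ w) ==> args w xs r < 2 ^ w"
proof -
assume w: "1 <= w" and xs: "!!v. v \<in> set xs ==> v <= 2 ^ w"
have w2: "(2::nat) ^ 1 <= 2 ^ w" using w by (intro power_increasing) auto
have "v div 2 ^ w < 2 ^ w" if "v <= 2 ^ w" for v :: nat
 using div_le_mono[OF that, of "2 ^ w"] w2 by simp
then show ?thesis using xs by (auto simp: args_def)
qed

lemma args_beyond: "2 * length xs <= r ==> args w xs r = 0"
by (auto simp: args_def)

lemma num_words_le: "1 <= w ==> b <= w ==> num_words w (n * b) <= n"
proof -
assume w: "1 <= w" "b <= w"
have "n * b <= n * w" using w(2) by (rule mult_le_mono2)
moreover have "num_words w (n * b) * w < n * b + w" by (rule num_words_bounds(2)[OF w(1)])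
ultimately have "num_words w (n * b) * w < (n + 1) * w" unfolding add_mult_distrib mult_1 by linarith
then have "num_words w (n * b) < n + 1" by (rule mult_less_cancel2[THEN iffD1, THEN conjunct2])
then show ?thesis by simp
qed

section \<open>Inputs of the theorem, and the table programs on them\<close>

locale text_input =
fixes w \<sigma> n :: nat and T :: "nat list"
assumes n1: "1 <= n" and w1: "1 <= w" and nw: "log 2 (real n) <= real w" and bw: "char_bits \<sigma> <= w"
 and len: "length T = n" and chars: "set T \<subseteq> {..<\<sigma>}"
begin

lemma n_le: "n <= 2 ^ w"
proof -
have "real n = 2 powr (log 2 (real n))" using n1 by simp
also have "\<dots> <= 2 powr real w" using nw by (intro powr_mono) auto
also have "\<dots> = real (2 ^ w)" by (simp add: powr_realpow)
finally show ?thesis by (simp only: of_nat_le_iff)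
qed

lemma sigma1: "1 <= \<sigma>"
proof -
have "T ! 0 \<in> set T" using n1 len by (intro nth_mem) simp
then show ?thesis using chars by auto
qed

lemma sigma_le: "\<sigma> <= 2 ^ char_bits \<sigma>"
proof -
have "real \<sigma> = 2 powr (log 2 (real \<sigma>))" using sigma1 by simp
also have "\<dots> <= 2 powr real (char_bits \<sigma>)" unfolding char_bits_def by (intro powr_mono real_nat_ceiling_ge) simp
also have "\<dots> = real (2 ^ char_bits \<sigma>)" by (simp add: powr_realpow)
finally show ?thesis by (simp only: of_nat_le_iff)
qed

lemma char_less: "x \<in> set T ==> x < 2 ^ char_bits \<sigma>"
using chars sigma_le by fastforce

text \<open>Rounding up at most doubles the logarithm, which is 0 for \<open>\<sigma> = 1\<close>
  and at least 1 otherwise.\<close>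

lemma char_bits_le: "real (char_bits \<sigma>) <= 2 * log 2 (real \<sigma>)"
proof (cases "\<sigma> = 1")
case True
then show ?thesis by (simp add: char_bits_def)
next
case False
then have "1 <= log 2 (real \<sigma>)" using sigma1 by (simp add: le_log_iff)
moreover have "real (char_bits \<sigma>) = of_int \<lceil>log 2 (real \<sigma>)\<rceil>" using calculation by (simp add: char_bits_def)
moreover have "of_int \<lceil>log 2 (real \<sigma>)\<rceil> <= log 2 (real \<sigma>) + 1" by (rule of_int_ceiling_le_add_one)
ultimately show ?thesis by linarith
qed

lemma wW: "w < 2 ^ w" and bW: "char_bits \<sigma> < 2 ^ w" and sW: "\<sigma> <= 2 ^ w"
proof -
show "w < 2 ^ w" by (rule less_exp)
then show "char_bits \<sigma> < 2 ^ w" using bw by linarith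
have "(2::nat) ^ char_bits \<sigma> <= 2 ^ w" using bw by (intro power_increasing) auto
then show "\<sigma> <= 2 ^ w" using sigma_le by linarith
qed

lemma query_regs:
assumes "i <= 2 ^ w" "j <= 2 ^ w" and s: "s = query_config w (Defs.params w \<sigma> n @ [i, j]) A E k"
shows "reg s 0 = n mod 2 ^ w" "reg s 1 = n div 2 ^ w" "reg s 4 = char_bits \<sigma>" "reg s 6 = w"
 "reg s 8 = i mod 2 ^ w" "reg s 9 = i div 2 ^ w" "reg s 10 = j mod 2 ^ w" "reg s 11 = j div 2 ^ w"
 "!!x. reg s x < 2 ^ w" "!!x. 32 <= x ==> reg s x = 0"
 "arr s 0 = A" "arr s 1 = E" "arr s 2 = replicate k 0"
proof -
have r: "reg s = args w [n, \<sigma>, char_bits \<sigma>, w, i, j]" by (simp add: s query_config_def Defs.params_def)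
show "reg s 0 = n mod 2 ^ w" "reg s 1 = n div 2 ^ w" "reg s 4 = char_bits \<sigma>" "reg s 6 = w"
 "reg s 8 = i mod 2 ^ w" "reg s 9 = i div 2 ^ w" "reg s 10 = j mod 2 ^ w" "reg s 11 = j div 2 ^ w"
 using wW bW by (simp_all add: r args_def)
show "reg s x < 2 ^ w" for x unfolding r
 by (rule args_less[OF w1]) (use n_le sW wW bW assms in auto)
show "32 <= x ==> reg s x = 0" for x unfolding r by (rule args_beyond) simp
qed (simp_all add: s query_config_def)

lemma build_regs:
assumes s: "s = build_config w \<sigma> T e \<omega>"
shows "reg s 0 = n mod 2 ^ w" "reg s 1 = n div 2 ^ w" "reg s 4 = char_bits \<sigma>" "reg s 6 = w"
 "!!x. reg s x < 2 ^ w" "!!x. 32 <= x ==> reg s x = 0"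
 "arr s 0 = pack w (char_bits \<sigma>) T" "arr s 1 = replicate e 0" "rnd s = \<omega>"
proof -
have r: "reg s = args w [n, \<sigma>, char_bits \<sigma>, w]" by (simp add: s build_config_def Defs.params_def len)
show "reg s 0 = n mod 2 ^ w" "reg s 1 = n div 2 ^ w" "reg s 4 = char_bits \<sigma>" "reg s 6 = w"
 using wW bW by (simp_all add: r args_def)
show "reg s x < 2 ^ w" for x unfolding r
 by (rule args_less[OF w1]) (use n_le sW wW bW in auto)
show "32 <= x ==> reg s x = 0" for x unfolding r by (rule args_beyond) simp
qed (simp_all add: s build_config_def)

lemma small_table:
assumes ij: "i <= n" "j <= n"
 and s: "s = query_config w (Defs.params w \<sigma> n @ [i, j]) (pack w (char_bits \<sigma>) T) E k"
 and ww: "w <= w0" and nl: "!!n b i m A. no_loop (f w n b i m A)"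
 and leaf: "!!s'. eqv s s' ==> halts w (f w n (char_bits \<sigma>) i j (pack w (char_bits \<sigma>) T)) s' Q"
shows "\<exists>t s'. exec w (cases_w 1 w0 (%w. table_prog w (f w)) p) s t s' &
 t <= (\<Sum>v\<le>w0. steps (table_prog v (f v))) + 2 * w0 & Q s'"
proof -
have ij': "i <= 2 ^ w" "j <= 2 ^ w" using ij n_le by auto
note r = query_regs[OF ij' s]
let ?f = "%w. table_prog w (f w)"
have "\<exists>t u s'. exec w (cases_w 1 w0 ?f p) s t s' & t <= u + 2 * w0 & (u <= steps (?f w) & Q s')"
proof (rule exec_cases_w[OF r(4) w1])
 fix s' assume e: "eqv s s'"
 have "length (pack w (char_bits \<sigma>) T) <= n" using num_words_le[OF w1 bw, of n] by (simp add: len)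
 then have le: "length (pack w (char_bits \<sigma>) T) <= 2 ^ w" using n_le by simp
 have "halts w (?f w) s' Q"
 proof (rule halts_table_prog[OF w1, where n = n and b = "char_bits \<sigma>" and i = i and m = j and A = "pack w (char_bits \<sigma>) T"])
 show "eqv s' s'' ==> halts w (f w n (char_bits \<sigma>) i j (pack w (char_bits \<sigma>) T)) s'' Q" for s''
  using leaf eqv_trans[OF e] by blast
 qed (use r eqv_reg[OF e] eqv_arr[OF e] le n_le ij' bW len in \<open>auto dest: pack_less\<close>)
 then obtain t s'' where "exec w (?f w) s' t s''" "Q s''" by (auto simp: halts_def)
 moreover from this have "t <= steps (?f w)" by (intro exec_le_steps no_loop_table_prog nl)
 ultimately show "\<exists>t s''. exec w (if w < 1 + w0 then ?f w else p) s' t s'' & t <= steps (?f w) & Q s''"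
 using ww by auto
qed
moreover have "steps (?f w) <= (\<Sum>v\<le>w0. steps (?f v))" using ww by (intro member_le_sum) auto
ultimately show ?thesis by (meson add_le_mono1 le_trans)
qed

lemma small_extract:
assumes im: "i + m <= n" and ww: "w <= w0"
 and s: "arr s 0 = pack w (char_bits \<sigma>) T" "arr s 1 = []"
shows "\<exists>t. t <= extract_cost K w0 & extract_answer w \<sigma> n (extract_prog K w0) s i m t (take m (drop i T))"
proof -
define b where "b = char_bits \<sigma>"
define A where "A = pack w b T"
define out where "out = pack w b (take m (drop i T))"
define q where "q = query_config w (Defs.params w \<sigma> n @ [i, m]) A [] (num_words w (m * b))"
have im': "i <= n" "m <= n" using im by auto
have mw: "num_words w (m * b) <= 2 ^ w" using num_words_le[OF w1 bw, of m] im' n_le by (simp add: b_def)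
have lo: "length out = num_words w (m * b)" using im len by (simp add: out_def)
have r: "arr q 0 = A" "arr q 1 = []" "arr q 2 = replicate (num_words w (m * b)) 0" by (simp_all add: q_def query_config_def)
have un: "unpack w n b A = T" using unpack_pack[OF w1, of T b] char_less len by (simp add: b_def A_def)
let ?f = "%w n b i m A. write_list 0 (pack w b (take m (drop i (unpack w n b A))))"
have "\<exists>t s'. exec w (cases_w 1 w0 (%w. table_prog w (?f w)) (Seq (prologue (48 * K)) (cmp (48 * K) (extract_hl K)))) q t s' &
 t <= (\<Sum>v\<le>w0. steps (table_prog v (?f v))) + 2 * w0 & arr s' = (arr q)(2 := out)"
proof (rule small_table[OF im' q_def[unfolded A_def b_def] ww])
 show "no_loop (?f w n b i m A)" for n b i m A by (rule no_loop_write_list)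
 fix s' assume e: "eqv q s'"
 have "halts w (write_list 0 out) s' (%s''. arr s'' = (arr s')(2 := take 0 (arr s' 2) @ out))"
 by (rule halts_write_list) (use eqv_arr[OF e] r lo mw in \<open>auto simp: out_def dest: pack_less\<close>)
 then show "halts w (?f w n (char_bits \<sigma>) i m (pack w (char_bits \<sigma>) T)) s' (%s'. arr s' = (arr q)(2 := out))"
 using eqv_arr[OF e] un by (simp add: b_def A_def out_def)
qed
then obtain t s' where e: "exec w (extract_prog K w0) q t s'" "t <= (\<Sum>v\<le>w0. steps (extract_table v)) + 2 * w0"
 "arr s' = (arr q)(2 := out)" by (auto simp: extract_prog_def extract_table_def[abs_def])
have "t <= extract_cost K w0" using e(2) by (simp add: extract_cost_def)
moreover have "extract_answer w \<sigma> n (extract_prog K w0) s i m t (take m (drop i T))"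
 unfolding extract_answer_def s b_def[symmetric] A_def[symmetric] q_def[symmetric]
 using e r by (intro exI[of _ s']) (simp add: out_def)
ultimately show ?thesis by blast
qed

lemma small_lce:
assumes ij: "i < n" "j < n" and ww: "w <= w0"
 and s: "arr s 0 = pack w (char_bits \<sigma>) T" "arr s 1 = []"
shows "\<exists>t. t <= lce_cost K w0 & lce_answer w \<sigma> n (lce_prog K w0) s i j t (lce T i j)"
proof -
define b where "b = char_bits \<sigma>"
define A where "A = pack w b T"
define l where "l = lce T i j"
define q where "q = query_config w (Defs.params w \<sigma> n @ [i, j]) A [] 0"
have ij': "i <= n" "j <= n" using ij by auto
have r: "arr q 0 = A" "arr q 1 = []" by (simp_all add: q_def query_config_def)
have un: "unpack w n b A = T" using unpack_pack[OF w1, of T b] char_less len by (simp add: b_def A_def)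
have "l <= n" using lce_bound[of i T j] ij' len by (simp add: l_def)
then have "l div 2 ^ w <= 1" using n_le div_le_mono[of l "2 ^ w" "2 ^ w"] by simp
moreover have "(2::nat) ^ 1 <= 2 ^ w" using w1 by (intro power_increasing) auto
ultimately have lw: "l div 2 ^ w < 2 ^ w" "l mod 2 ^ w < 2 ^ w" by simp_all
let ?f = "%w n b i j A. Seq (Const 0 (lce (unpack w n b A) i j mod 2 ^ w)) (Const 1 (lce (unpack w n b A) i j div 2 ^ w))"
have "\<exists>t s'. exec w (cases_w 1 w0 (%w. table_prog w (?f w)) (Seq (Seq (prologue (48 * K)) (cmp (48 * K) (lce_hl K))) (lce_out (48 * K)))) q t s' &
 t <= (\<Sum>v\<le>w0. steps (table_prog v (?f v))) + 2 * w0 & (arr s' = arr q & result w s' = l)"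
proof (rule small_table[OF ij' q_def[unfolded A_def b_def] ww])
 fix s' assume e: "eqv q s'"
 have "halts w (Const 0 (l mod 2 ^ w)) s' (%s''. s'' = set_reg 0 (l mod 2 ^ w) s')"
 by (rule halts_Const) (use lw in auto)
 then have "halts w (Seq (Const 0 (l mod 2 ^ w)) (Const 1 (l div 2 ^ w))) s' (%s'. arr s' = arr q & result w s' = l)"
 by (rule halts_Seq, intro halts_Const) (use lw eqv_arr[OF e] in \<open>auto simp: set_reg_def result_def\<close>)
 then show "halts w (?f w n (char_bits \<sigma>) i j (pack w (char_bits \<sigma>) T)) s' (%s'. arr s' = arr q & result w s' = l)"
 using un by (simp add: b_def A_def l_def)
qed simp
then obtain t s' where e: "exec w (lce_prog K w0) q t s'" "t <= (\<Sum>v\<le>w0. steps (lce_table v)) + 2 * w0"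
 "arr s' = arr q" "result w s' = l" by (auto simp: lce_prog_def lce_table_def[abs_def])
have "t <= lce_cost K w0" using e(2) by (simp add: lce_cost_def)
moreover have "lce_answer w \<sigma> n (lce_prog K w0) s i j t (lce T i j)"
 unfolding lce_answer_def s b_def[symmetric] A_def[symmetric] q_def[symmetric]
 using e r by (intro exI[of _ s']) (simp add: l_def)
ultimately show ?thesis by blast
qed

end

context machine
begin

lemma run_hl:
assumes "!!x. x < 12 ==> reg s x < 2 ^ w" "reg s 6 = w" "!!x. 32 <= x ==> reg s x = 0" "h = w div 3" "3 <= w"
 and c: "ht c Q (start_vars s)"
shows "\<exists>t r s' u. exec w (Seq (prologue nd) (cmp nd c)) s t r & rep s' r & t <= steps (prologue nd) + u & Q u s'"
proof -
from prologue[OF assms(1-5)] obtain t r where 1: "exec w (prologue nd) s t r" "t <= steps (prologue nd)" "rep (start_vars s) r"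
 by blast
from c 1(3) obtain u r' s' where 2: "exec w (cmp nd c) r u r'" "rep s' r'" "Q u s'" unfolding ht_def by blast
from exec.Seq[OF 1(1) 2(1)] 1(2) 2 show ?thesis by (meson add_le_mono1)
qed

lemma lce_out:
assumes r: "rep s r" "reg s 80 < 2 ^ w" "reg s 81 < 2 ^ w"
shows "\<exists>t r'. exec w (lce_out nd) r t r' & t <= steps (lce_out nd) & arr r' = arr s &
 reg r' 0 = reg s 80 & reg r' 1 = reg s 81"
proof -
let ?f = "reg r"
have v: "ready ?f" "dg ?f 80" "bv ?f 80 = reg s 80" "dg ?f 81" "bv ?f 81 = reg s 81" "arr r = arr s"
 using r(1) by (auto simp: rep_def vars_ok_def)
have t1: "sl w (to_word nd 80) ?f = ?f(rT := reg s 80)" using to_word[OF v(1,2)] v(3) r(2) by simp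
define f2 where "f2 = ?f(rT := reg s 80, 0 := reg s 80)"
have s2: "sl w (Seq (to_word nd 80) (copy_reg 0 rT)) ?f = f2" by (simp add: t1 copy_reg_def f2_def)
have f2: "ready f2" "dg f2 81" "bv f2 81 = reg s 81"
 using v by (auto simp: f2_def ready_def dg_def bv_def)
have t2: "sl w (to_word nd 81) f2 = f2(rT := reg s 81)" using to_word[OF f2(1,2)] f2(3) r(3) by simp
have sl: "sl w (lce_out nd) ?f = f2(rT := reg s 81, 1 := reg s 81)"
 unfolding lce_out_def sl.simps(7)[of w "Seq (to_word nd 80) (copy_reg 0 rT)"] s2 by (simp add: t2 copy_reg_def)
have st: "straight (lce_out nd)" "no_loop (lce_out nd)" by (simp_all add: lce_out_def)
from exec_sl[OF st(1)] obtain t where e: "exec w (lce_out nd) r t (r\<lparr>reg := sl w (lce_out nd) ?f\<rparr>)" by blast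
then show ?thesis using exec_le_steps[OF e st(2)] v(6)
 by (intro exI[of _ t] exI[of _ "r\<lparr>reg := sl w (lce_out nd) ?f\<rparr>"]) (auto simp: sl f2_def)
qed

end

section \<open>The data structure\<close>

definition build_total :: "nat \<Rightarrow> nat \<Rightarrow> nat" where
"build_total K w0 = build_cost K + steps (prologue (48 * K)) + 2 * w0 + 1"

context text_input
begin

text \<open>What is demanded on every tape. The LCE value \<open>l\<close> may be wrong here, but
  the time is tied to it; the exponent \<open>k\<close> postpones real logarithms to
  \<open>works_imp\<close>.\<close>

definition answers :: "nat \<Rightarrow> nat \<Rightarrow> config \<Rightarrow> bool" where
"answers K w0 s \<longleftrightarrow>
 (\<forall>i m. i + m <= n --> (\<exists>t. t <= extract_cost K w0 * (num_words w (m * char_bits \<sigma>) + 1) &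
  extract_answer w \<sigma> n (extract_prog K w0) s i m t (take m (drop i T)))) &
 (\<forall>i<n. \<forall>j<n. \<exists>t l k. t <= lce_cost K w0 * (k + 1) & 2 ^ k <= l + 1 &
  lce_answer w \<sigma> n (lce_prog K w0) s i j t l)"

definition exact :: "nat \<Rightarrow> nat \<Rightarrow> config \<Rightarrow> bool" where
"exact K w0 s \<longleftrightarrow> (\<forall>i<n. \<forall>j<n. \<exists>t. lce_answer w \<sigma> n (lce_prog K w0) s i j t (lce T i j))"

text \<open>\<open>bad\<close> may be larger than the true failure event; its finite dependence on
  the tape makes it measurable.\<close>

definition works :: "nat \<Rightarrow> nat \<Rightarrow> real \<Rightarrow> bool" where
"works K w0 c \<longleftrightarrow> (\<exists>bad m. dep m bad & pr w bad <= real n powr (- c) &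
 (\<forall>\<omega>. \<exists>t s. exec w (build_prog K w0) (build_config w \<sigma> T (extra_words K w0 w n) \<omega>) t s &
  t <= n * build_total K w0 & answers K w0 s & (\<not> bad \<omega> --> exact K w0 s)))"

lemma small_works:
assumes ww: "w <= w0"
shows "works K w0 c"
unfolding works_def
proof (rule exI[of _ "%_. False"], rule exI[of _ "0 :: nat"], intro conjI allI)
show "dep 0 (%_. False)" by (simp add: dep_def)
show "pr w (%_. False) <= real n powr (- c)" by (simp add: pr_const)
fix \<omega>
have ex: "extra_words K w0 w n = 0" using ww by (simp add: extra_words_def)
define s where "s = build_config w \<sigma> T 0 \<omega>"
note r = build_regs[OF s_def]
have "\<exists>t u s'. exec w (cases_w 1 w0 (%_. Skip) (Seq (prologue (48 * K)) (cmp (48 * K) (build_hl K)))) s t s' &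
 t <= u + 2 * w0 & (u = 1 & arr s' = arr s)"
proof (rule exec_cases_w[OF r(4) w1])
 fix s1 assume "eqv s s1"
 then show "\<exists>t s''. exec w (if w < 1 + w0 then Skip else Seq (prologue (48 * K)) (cmp (48 * K) (build_hl K))) s1 t s'' &
  (t = 1 & arr s'' = arr s)"
 using ww exec.Skip[of w s1] eqv_arr by (intro exI[of _ 1] exI[of _ s1]) auto
qed
then obtain t s' where e: "exec w (build_prog K w0) s t s'" "t <= 1 + 2 * w0" "arr s' = arr s"
 unfolding build_prog_def by auto
have a: "arr s' 0 = pack w (char_bits \<sigma>) T" "arr s' 1 = []" using e(3) r by simp_all
have "1 * build_total K w0 <= n * build_total K w0" using n1 by (rule mult_le_mono1)
then have "t <= n * build_total K w0" using e(2) by (simp add: build_total_def)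
moreover have "exact K w0 s'" unfolding exact_def using small_lce[OF _ _ ww a] by blast
moreover have "answers K w0 s'" unfolding answers_def
proof (intro conjI allI impI)
 fix i m assume "i + m <= n"
 from small_extract[OF this ww a] obtain t where t: "t <= extract_cost K w0"
 "extract_answer w \<sigma> n (extract_prog K w0) s' i m t (take m (drop i T))" by blast
 have "extract_cost K w0 <= extract_cost K w0 * (num_words w (m * char_bits \<sigma>) + 1)" by simp
 then have "t <= extract_cost K w0 * (num_words w (m * char_bits \<sigma>) + 1)" using t(1) by linarith
 with t(2) show "\<exists>t. t <= extract_cost K w0 * (num_words w (m * char_bits \<sigma>) + 1) &
  extract_answer w \<sigma> n (extract_prog K w0) s' i m t (take m (drop i T))" by blast
next
 fix i j assume "i < n" "j < n"
 from small_lce[OF this ww a] obtain t where "t <= lce_cost K w0" "lce_answer w \<sigma> n (lce_prog K w0) s' i j t (lce T i j)" by blast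
 then show "\<exists>t l k. t <= lce_cost K w0 * (k + 1) & 2 ^ k <= l + 1 & lce_answer w \<sigma> n (lce_prog K w0) s' i j t l"
 by (intro exI[of _ t] exI[of _ "lce T i j"] exI[of _ 0]) simp
qed
ultimately show "\<exists>t s. exec w (build_prog K w0) (build_config w \<sigma> T (extra_words K w0 w n) \<omega>) t s &
  t <= n * build_total K w0 & answers K w0 s & (\<not> False --> exact K w0 s)"
 using e(1) by (intro exI[of _ t] exI[of _ s']) (simp add: ex s_def)
qed

end

section \<open>Large word sizes: construction and queries put together\<close>

locale main_input = text_input w \<sigma> n T + word_sizes w K nd h for w \<sigma> n :: nat and T :: "nat list" and K nd h :: nat

sublocale main_input \<subseteq> building w K nd h "char_bits \<sigma>" n "lg n" "num_words w (n * char_bits \<sigma>)"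
"num_words w (n * char_bits \<sigma>) div (3 * K)" "W ^ (3 * K)" "tnum (char_bits \<sigma>) T" "pack w (char_bits \<sigma>) T"
"replicate (sw K * (7 + lg n)) 0"
proof unfold_locales
show "char_bits \<sigma> <= w" by (rule bw)
show "1 <= n" by (rule n1)
show "n <= W" using n_le by (simp add: W_def)
show "2 ^ lg n <= n" "n < 2 ^ Suc (lg n)" using lg[OF n1] by auto
show len': "length (pack w (char_bits \<sigma>) T) = num_words w (n * char_bits \<sigma>)" by (simp add: len)
show "a < num_words w (n * char_bits \<sigma>) ==> pack w (char_bits \<sigma>) T ! a < W" for a
 unfolding W_def len'[symmetric] by (rule pack_less, rule nth_mem)
show "tnum (char_bits \<sigma>) T = val W (num_words w (n * char_bits \<sigma>)) (%a. pack w (char_bits \<sigma>) T ! a)"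
proof -
 have "tnum w (pack w (char_bits \<sigma>) T) = tnum (char_bits \<sigma>) T" by (rule tnum_pack[OF w1]) (rule char_less)
 then show ?thesis unfolding tnum_def[of w] len' W_def by (rule sym)
qed
show "tnum (char_bits \<sigma>) T < 2 ^ (char_bits \<sigma> * n)"
 by (rule tnum_less[of T "char_bits \<sigma>", unfolded len]) (rule char_less)
show "a < length (replicate (sw K * (7 + lg n)) 0) ==> replicate (sw K * (7 + lg n)) 0 ! a < W" for a
 using W_pos by simp
qed simp_all

context main_input
begin

abbreviation "cb \<equiv> char_bits \<sigma>"
abbreviation "qry M J e jw A' E \<equiv> query w K nd h M J e jw (tnum cb T) (num_words w (n * cb))
(num_words w (n * cb) div (3 * K)) (W ^ (3 * K)) cb n A' E"

definition pt :: "nat \<Rightarrow> nat \<Rightarrow> nat" where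
"pt a d = tnum cb T div 2 ^ (cb * a) mod 2 ^ (cb * d)"

definition separates :: "nat \<Rightarrow> bool" where
"separates M \<longleftrightarrow> (\<forall>a a' k. a + 2 ^ k <= n --> a' + 2 ^ k <= n -->
 pt a (2 ^ k) mod M = pt a' (2 ^ k) mod M --> pt a (2 ^ k) = pt a' (2 ^ k))"

lemma h3: "h = w div 3" "3 <= w"
using h w6 by auto

lemma build_main:
assumes ww: "w0 < w"
shows "\<exists>t s'. exec w (build_prog K w0) (build_config w \<sigma> T (sw K * (7 + lg n)) \<omega>) t s' &
 t <= n * build_total K w0 & result_ok \<omega> (arr s' 0) (arr s' 1)"
proof -
define s where "s = build_config w \<sigma> T (sw K * (7 + lg n)) \<omega>"
note r = build_regs[OF s_def]
have "\<exists>t u s'. exec w (cases_w 1 w0 (%_. Skip) (Seq (prologue nd) (cmp nd (build_hl K)))) s t s' &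
 t <= u + 2 * w0 & (u <= steps (prologue nd) + T_build & result_ok \<omega> (arr s' 0) (arr s' 1))"
proof (rule exec_cases_w[OF r(4) w1])
 fix s1 assume e: "eqv s s1"
 have r1: "reg s1 x = reg s x" if "x < 12 \<or> 32 <= x" for x using eqv_reg[OF e, of x] that by auto
 have rn: "rnd s1 = \<omega>" using e r(9) by (simp add: eqv_def)
 have "hb T_build (build_hl K) (start_vars s1) (%s'. result_ok (rnd (start_vars s1)) (arr s' 0) (arr s' 1))"
 by (rule hb_build) (use r r1 eqv_arr[OF e] in \<open>simp_all add: W_def\<close>)
 then have ht1: "ht (build_hl K) (%t s'. t <= T_build & result_ok \<omega> (arr s' 0) (arr s' 1)) (start_vars s1)"
 by (simp add: hb_def rn)
 have p1: "!!x. x < 12 ==> reg s1 x < 2 ^ w" "reg s1 6 = w" "!!x. 32 <= x ==> reg s1 x = 0" using r r1 by auto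
 from run_hl[OF p1 h3 ht1] obtain t r2 s2 u where
 x: "exec w (Seq (prologue nd) (cmp nd (build_hl K))) s1 t r2" "rep s2 r2" "t <= steps (prologue nd) + u"
  "u <= T_build" "result_ok \<omega> (arr s2 0) (arr s2 1)" by blast
 then show "\<exists>t s''. exec w (if w < 1 + w0 then Skip else Seq (prologue nd) (cmp nd (build_hl K))) s1 t s'' &
  (t <= steps (prologue nd) + T_build & result_ok \<omega> (arr s'' 0) (arr s'' 1))"
 using ww by (intro exI[of _ t] exI[of _ r2]) (auto simp: rep_def)
qed
then obtain t u s' where e: "exec w (build_prog K w0) s t s'" "t <= u + 2 * w0" "u <= steps (prologue nd) + T_build"
 "result_ok \<omega> (arr s' 0) (arr s' 1)" unfolding build_prog_def nd[symmetric] by blast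
have "t <= steps (prologue nd) + n * build_cost K + 2 * w0" using e(2,3) T_build_le by linarith
also have "\<dots> <= n * (build_cost K + steps (prologue nd) + 2 * w0 + 1)"
 unfolding distrib_left[of n "build_cost K"] distrib_left[of n "build_cost K + steps (prologue nd)"]
 distrib_left[of n "build_cost K + steps (prologue nd) + 2 * w0"]
 using triv_le[of "steps (prologue nd)"] triv_le[of "2 * w0"] by linarith
finally have "t <= n * build_total K w0" by (simp only: build_total_def nd)
then show ?thesis using e(1,4) unfolding s_def by blast
qed

lemma extract_main:
assumes ww: "w0 < w" and qr: "qry M J e jw A' E" and im: "i + m <= n" and s: "arr s 0 = A'" "arr s 1 = E"
shows "\<exists>t. t <= extract_cost K w0 * (num_words w (m * cb) + 1) &
 extract_answer w \<sigma> n (extract_prog K w0) s i m t (take m (drop i T))"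
proof -
interpret q: extraction w K nd h M J e jw "tnum cb T" "num_words w (n * cb)" "num_words w (n * cb) div (3 * K)"
 "W ^ (3 * K)" cb n A' E i m
 by (intro extraction.intro qr extraction_axioms.intro im)
define k where "k = num_words w (m * cb)"
define s0 where "s0 = query_config w (Defs.params w \<sigma> n @ [i, m]) A' E k"
have ij: "i <= 2 ^ w" "m <= 2 ^ w" using im n_le by auto
note r = query_regs[OF ij s0_def]
define out where "out = pack w cb (take m (drop i T))"
have Dt: "q.D = tnum cb (take m (drop i T))"
 unfolding q.D_def by (rule tnum_take_drop) (use char_less im len in auto)
have lm: "length (take m (drop i T)) = m" using im len by simp
have out: "map (%a. q.D div W ^ a mod W) [0..<k] = out" unfolding out_def pack_eq Dt lm k_def W_def ..
define c where "c = st K (extract_init K) + (k + 1) * (st K (extract_step K) + ct K (Num 0) (Var 53)) + 1"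
have "\<exists>t u s'. exec w (cases_w 1 w0 extract_table (Seq (prologue nd) (cmp nd (extract_hl K)))) s0 t s' &
 t <= u + 2 * w0 & (u <= steps (prologue nd) + c & arr s' 0 = A' & arr s' 1 = E & arr s' 2 = out)"
proof (rule exec_cases_w[OF r(4) w1])
 fix s1 assume e: "eqv s0 s1"
 have r1: "reg s1 x = reg s0 x" if "x < 12 \<or> 32 <= x" for x using eqv_reg[OF e, of x] that by auto
 have st1: "q.start (start_vars s1)" unfolding q.start_def using r r1 eqv_arr[OF e] by (simp add: W_def)
 have "\<exists>c. c = steps (cmp nd (extract_init K)) + (k + 1) * (steps (cmp nd (extract_step K)) + cost_test (Num 0) (Var 53)) + 1
 & ht (extract_hl K) (%t s'. t <= c & arr s' 0 = A' & arr s' 1 = E &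
  arr s' 2 = map (%a. q.D div W ^ a mod W) [0..<k]) (start_vars s1)"
 unfolding k_def by (rule q.ht_extract[OF st1]) (use r r1 eqv_arr[OF e] in \<open>simp_all add: W_def k_def\<close>)
 then have ht1: "ht (extract_hl K) (%t s'. t <= c & arr s' 0 = A' & arr s' 1 = E & arr s' 2 = out) (start_vars s1)"
 by (simp add: c_def out ct_eq[OF nd] st_eq[OF nd])
 have p1: "!!x. x < 12 ==> reg s1 x < 2 ^ w" "reg s1 6 = w" "!!x. 32 <= x ==> reg s1 x = 0" using r r1 by auto
 from run_hl[OF p1 h3 ht1] obtain t r2 s2 u where
 x: "exec w (Seq (prologue nd) (cmp nd (extract_hl K))) s1 t r2" "rep s2 r2" "t <= steps (prologue nd) + u"
  "u <= c" "arr s2 0 = A'" "arr s2 1 = E" "arr s2 2 = out" by blast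
 then show "\<exists>t s''. exec w (if w < 1 + w0 then extract_table w else Seq (prologue nd) (cmp nd (extract_hl K))) s1 t s'' &
  (t <= steps (prologue nd) + c & arr s'' 0 = A' & arr s'' 1 = E & arr s'' 2 = out)"
 using ww by (intro exI[of _ t] exI[of _ r2]) (auto simp: rep_def)
qed
then obtain t u s' where x: "exec w (extract_prog K w0) s0 t s'" "t <= u + 2 * w0" "u <= steps (prologue nd) + c"
 "arr s' 0 = A'" "arr s' 1 = E" "arr s' 2 = out" unfolding extract_prog_def nd[symmetric] by blast
have "t <= extract_cost K w0 * (k + 1)"
proof -
 have g: "y <= y * (k + 1)" for y by simp
 define p i0 v g0 where "p = steps (prologue nd)" and "i0 = st K (extract_init K)"
 and "v = st K (extract_step K) + ct K (Num 0) (Var 53)" and "g0 = (\<Sum>v\<le>w0. steps (extract_table v))"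
 have "t <= p + (i0 + v * (k + 1) + 1) + 2 * w0" using x(2,3) by (simp only: c_def p_def i0_def v_def mult.commute[of "k + 1"])
 also have "\<dots> <= (p + i0 + v + 1 + 2 * w0 + g0) * (k + 1)"
 unfolding distrib_right[of _ _ "k + 1"] using g[of p] g[of i0] g[of 1] g[of "2 * w0"] by linarith
 finally show ?thesis by (simp only: extract_cost_def p_def i0_def v_def g0_def nd)
qed
moreover have "extract_answer w \<sigma> n (extract_prog K w0) s i m t (take m (drop i T))"
 unfolding extract_answer_def s k_def[symmetric] s0_def[symmetric] out_def[symmetric] using x by blast
ultimately show ?thesis by (auto simp: k_def)
qed

lemma lce_main:
assumes ww: "w0 < w" and qr: "qry M J e jw A' E" and ij: "i < n" "j < n" and s: "arr s 0 = A'" "arr s 1 = E"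
shows "\<exists>t l k. t <= lce_cost K w0 * (k + 1) & 2 ^ k <= l + 1 & lce_answer w \<sigma> n (lce_prog K w0) s i j t l &
 (separates M --> l = lce T i j)"
proof -
interpret q: lce_query w K nd h M J e jw "tnum cb T" "num_words w (n * cb)" "num_words w (n * cb) div (3 * K)"
 "W ^ (3 * K)" cb n A' E i j T
 by (intro lce_query.intro qr lce_query_axioms.intro ij len refl char_less)
define s0 where "s0 = query_config w (Defs.params w \<sigma> n @ [i, j]) A' E 0"
have ij': "i <= 2 ^ w" "j <= 2 ^ w" "i < 2 ^ w" "j < 2 ^ w" using ij n_le by auto
note r = query_regs[OF ij'(1,2) s0_def]
have good: "separates M ==> q.good"
 unfolding separates_def q.good_def q.part_def pt_def by blast
define cu cd where "cu = st K (up_step K) + ct K (Num 0) (Var 72)" and "cd = st K (down_step K) + ct K (Num 0) (Var 61)"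
define c where "c k = st K (lce_init K) + ((k + 2) * cu + 1) + ((k + 1) * cd + 1) + st K lce_final" for k
define oc where "oc = steps (lce_out nd)"
define Q where "Q t s' \<longleftrightarrow> (\<exists>k l. t <= steps (prologue nd) + c k + oc & 2 ^ k <= l + 1 &
 (separates M --> l = lce T i j) & arr s' 0 = A' & arr s' 1 = E & result w s' = l)" for t and s' :: config
have "\<exists>t u s'. exec w (cases_w 1 w0 lce_table (Seq (Seq (prologue nd) (cmp nd (lce_hl K))) (lce_out nd))) s0 t s' &
 t <= u + 2 * w0 & Q u s'"
proof (rule exec_cases_w[OF r(4) w1])
 fix s1 assume e: "eqv s0 s1"
 have r1: "reg s1 x = reg s0 x" if "x < 12 \<or> 32 <= x" for x using eqv_reg[OF e, of x] that by auto
 have st1: "q.start (start_vars s1)" unfolding q.start_def using r r1 eqv_arr[OF e] by (simp add: W_def)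
 have ht1: "ht (lce_hl K) (%t s'. \<exists>k l. t <= steps (cmp nd (lce_init K)) + ((k + 2) * q.c_up + 1) +
 ((k + 1) * q.c_down + 1) + steps (cmp nd lce_final) & 2 ^ k <= l + 1 & (q.good --> l = lce T i j) &
 arr s' 0 = A' & arr s' 1 = E & reg s' 80 + W * reg s' 81 = l & reg s' 80 < W & reg s' 81 < W) (start_vars s1)"
 by (rule q.ht_lce[OF st1]) (use r r1 ij' in simp_all)
 have p1: "!!x. x < 12 ==> reg s1 x < 2 ^ w" "reg s1 6 = w" "!!x. 32 <= x ==> reg s1 x = 0" using r r1 by auto
 from run_hl[OF p1 h3 ht1] obtain t r2 s2 u k l where
 x: "exec w (Seq (prologue nd) (cmp nd (lce_hl K))) s1 t r2" "rep s2 r2" "t <= steps (prologue nd) + u"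
  "u <= steps (cmp nd (lce_init K)) + ((k + 2) * q.c_up + 1) + ((k + 1) * q.c_down + 1) + steps (cmp nd lce_final)"
  "2 ^ k <= l + 1" "q.good --> l = lce T i j" "arr s2 0 = A'" "arr s2 1 = E"
  "reg s2 80 + W * reg s2 81 = l" "reg s2 80 < W" "reg s2 81 < W" by blast
 have uc: "u <= c k" using x(4) by (simp only: c_def cu_def cd_def q.c_up_def q.c_down_def ct_eq[OF nd] st_eq[OF nd])
 from lce_out[OF x(2)] x(10,11) obtain t' r3 where
 y: "exec w (lce_out nd) r2 t' r3" "t' <= oc" "arr r3 = arr s2" "reg r3 0 = reg s2 80" "reg r3 1 = reg s2 81"
 unfolding W_def oc_def by blast
 have "Q (t + t') r3" unfolding Q_def
 by (rule exI[of _ k], rule exI[of _ l]) (use x y uc good in \<open>auto simp: result_def W_def\<close>)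
 then show "\<exists>t s''. exec w (if w < 1 + w0 then lce_table w else Seq (Seq (prologue nd) (cmp nd (lce_hl K))) (lce_out nd)) s1 t s'' & Q t s''"
 using ww exec.Seq[OF x(1) y(1)] by (intro exI[of _ "t + t'"] exI[of _ r3]) auto
qed
then obtain t u s' where z: "exec w (lce_prog K w0) s0 t s'" "t <= u + 2 * w0" "Q u s'"
 unfolding lce_prog_def nd[symmetric] by blast
from z(3) obtain k l where kl: "u <= steps (prologue nd) + c k + oc" "2 ^ k <= l + 1" "separates M --> l = lce T i j"
 "arr s' 0 = A'" "arr s' 1 = E" "result w s' = l" unfolding Q_def by blast
have "t <= lce_cost K w0 * (k + 1)"
proof -
 have g: "y <= y * (k + 1)" for y by simp
 define p i0 f g0 where "p = steps (prologue nd)" and "i0 = st K (lce_init K)" and "f = st K lce_final"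
 and "g0 = (\<Sum>v\<le>w0. steps (lce_table v))"
 have "(k + 2) * cu <= 2 * (k + 1) * cu" by (intro mult_le_mono1) simp
 then have 1: "(k + 2) * cu <= 2 * cu * (k + 1)" by (simp only: ac_simps)
 have 2: "(k + 1) * cd = cd * (k + 1)" by (rule mult.commute)
 have "t <= p + (i0 + ((k + 2) * cu + 1) + (cd * (k + 1) + 1) + f) + oc + 2 * w0"
 using z(2) kl(1) unfolding c_def p_def i0_def f_def 2 by linarith
 also have "\<dots> <= (p + i0 + 2 * cu + cd + 2 + f + oc + 2 * w0 + g0) * (k + 1)"
 unfolding distrib_right[of _ _ "k + 1"]
 using 1 g[of p] g[of i0] g[of 2] g[of f] g[of oc] g[of "2 * w0"] by linarith
 finally show ?thesis by (simp only: lce_cost_def p_def i0_def f_def g0_def cu_def cd_def oc_def nd)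
qed
moreover have "lce_answer w \<sigma> n (lce_prog K w0) s i j t l"
 unfolding lce_answer_def s s0_def[symmetric] using z(1) kl by blast
ultimately show ?thesis using kl(2,3) by blast
qed

lemma pt_le: "pt a d <= tnum cb T"
unfolding pt_def by (meson div_le_dividend le_trans mod_less_eq_dividend)

text \<open>The modulus separates all relevant substrings unless it divides one of the differences
  in \<open>S\<close>. There are at most \<open>n * n * (lg n + 1) <= n ^ 3\<close> of them, as only
  lengths \<open>2 ^ k\<close> are ever compared.\<close>

lemma main_works:
fixes c :: real
assumes ww: "w0 < w" and c: "0 < c" and K: "c + 2 <= real K"
 and small: "!!l D. 1 <= l ==> l <= w ==> 0 < D ==> D < 2 ^ (2 ^ (l + 1) * w) ==>
 pr w (%\<omega>. modulus_of w K l \<omega> dvd D) <= 2 powr (- (c + 4) * (real l + 1))"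
shows "works K w0 c"
proof -
define f where "f = (%(a, a', k). pt a (2 ^ k) - pt a' (2 ^ k))"
define I where "I = {..<n} \<times> {..<n} \<times> {..lg n}"
\<comment> \<open>Subtraction on \<open>nat\<close> truncates, so only positive values are kept;
  nothing is missed because \<open>I\<close> contains both orders of a pair of positions.\<close>
define S where "S = {D \<in> f ` I. 0 < D}"
have fI: "finite I" by (simp add: I_def)
have fS: "finite S" using fI by (simp add: S_def)
have "card S <= card (f ` I)" using fI by (intro card_mono) (auto simp: S_def)
also have "\<dots> <= card I" using fI by (rule card_image_le)
also have "card I = n * (n * (lg n + 1))" by (simp add: I_def card_cartesian_product)
also have "\<dots> <= n * (n * n)"
proof (intro mult_le_mono order_refl)
 show "lg n + 1 <= n" using less_exp[of "lg n"] lg[OF n1] by linarith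
qed
finally have cS: "card S <= n ^ 3" by (simp add: power3_eq_cube)
have SD: "0 < D & D < 2 ^ (cb * n)" if "D \<in> S" for D
proof -
 from that obtain a a' k where D: "D = pt a (2 ^ k) - pt a' (2 ^ k)" "0 < D" by (auto simp: S_def f_def)
 have "D <= pt a (2 ^ k)" unfolding D(1) by (rule diff_le_self)
 then show ?thesis using D(2) pt_le[of a "2 ^ k"] Xn by linarith
qed
define bad where "bad \<omega> \<longleftrightarrow> (\<exists>D\<in>S. modulus_of w K (lg n) \<omega> dvd D) \<or>
 \<not> clean (modulus_of w K (lg n) \<omega>) (word_num w K 0 (sdrop (modulus_words w K (lg n)) \<omega>))" for \<omega>
have dbad: "dep (modulus_words w K (lg n) + K) bad" unfolding bad_def[abs_def]
 by (rule dep_comp2[where h = "%M j. (\<exists>D\<in>S. M dvd D) \<or> \<not> clean M j",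
  OF dep_mono[OF dep_modulus_of] dep_sdrop[OF dep_word_num]]) simp
have pbad: "pr w bad <= real n powr (- c)"
proof (cases "2 <= n")
 case True
 show ?thesis unfolding bad_def[abs_def] by (rule pr_failure[OF c True K small fS cS SD])
next
 case False
 \<comment> \<open>For a single character the allowed failure probability is 1.\<close>
 then have "n = 1" using n1 by simp
 then show ?thesis using pr_le_1[of w bad] by simp
qed
have ex: "extra_words K w0 w n = sw K * (7 + lg n)" using ww by (simp add: extra_words_def)
have "\<exists>t s. exec w (build_prog K w0) (build_config w \<sigma> T (extra_words K w0 w n) \<omega>) t s &
 t <= n * build_total K w0 & answers K w0 s & (\<not> bad \<omega> --> exact K w0 s)" for \<omega>
proof -
 from build_main[OF ww, of \<omega>] obtain t s where
 e: "exec w (build_prog K w0) (build_config w \<sigma> T (sw K * (7 + lg n)) \<omega>) t s" "t <= n * build_total K w0"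
  "result_ok \<omega> (arr s 0) (arr s 1)" by blast
 from e(3) obtain M J e' jw where q: "qry M J e' jw (arr s 0) (arr s 1)"
 and M: "clean (modulus_of w K (lg n) \<omega>) (word_num w K 0 (sdrop (modulus_words w K (lg n)) \<omega>)) --> M = modulus_of w K (lg n) \<omega>"
 unfolding result_ok_def by blast
 note lce1 = lce_main[OF ww q _ _ refl refl]
 have "answers K w0 s" unfolding answers_def
 using extract_main[OF ww q _ refl refl] lce1 by blast
 moreover have "exact K w0 s" if nb: "\<not> bad \<omega>"
 proof -
 have Mm: "M = modulus_of w K (lg n) \<omega>" using nb M unfolding bad_def by blast
 have Mm': "\<not> M dvd D" if "D \<in> S" for D using nb that unfolding bad_def Mm by blast
 have fv: "f (x, y, z) = pt x (2 ^ z) - pt y (2 ^ z)" for x y z by (simp add: f_def)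
 have fS': "f x \<in> S" if "x \<in> I" "0 < f x" for x using that unfolding S_def by blast
 have "separates M" unfolding separates_def
 proof (intro allI impI)
  fix a a' k assume a: "a + 2 ^ k <= n" "a' + 2 ^ k <= n" and eq: "pt a (2 ^ k) mod M = pt a' (2 ^ k) mod M"
  have "0 < (2::nat) ^ k" by simp
  then have an: "a < n" "a' < n" using a by linarith+
  have "(2::nat) ^ k < 2 ^ Suc (lg n)" using a(1) lg[OF n1] by linarith
  then have "k < Suc (lg n)" by (rule power_less_imp_less_exp[rotated]) simp
  then have I2: "(a, a', k) \<in> I" "(a', a, k) \<in> I" using an by (auto simp: I_def)
  show "pt a (2 ^ k) = pt a' (2 ^ k)"
  proof (rule ccontr)
  assume ne: "pt a (2 ^ k) ~= pt a' (2 ^ k)"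
  show False
  proof (cases "pt a (2 ^ k) <= pt a' (2 ^ k)")
   case True
   then have "0 < f (a', a, k)" "M dvd f (a', a, k)"
   using ne eq[unfolded nat_mod_eq_dvd_diff] by (simp_all add: fv)
   then show False using Mm'[OF fS'[OF I2(2)]] by blast
  next
   case False
   then have "0 < f (a, a', k)" "M dvd f (a, a', k)"
   using ne eq[unfolded nat_mod_eq_dvd_diff] by (simp_all add: fv)
   then show False using Mm'[OF fS'[OF I2(1)]] by blast
  qed
  qed
 qed
 then show ?thesis unfolding exact_def using lce1 by blast
 qed
 ultimately show ?thesis using e(1,2) unfolding ex by blast
qed
then show ?thesis unfolding works_def using dbad pbad by blast
qed

end

text \<open>\<open>2 ^ (w - w div 3)\<close> outgrows any linear function of
  \<open>w\<close>.\<close>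

lemma eventually_params:
"eventually (%w. 6 <= w & 1000 * K * w * 2 ^ (w div 3) <= 2 ^ w) sequentially" for K :: nat
proof -
have "(%w::nat. real w * 2 powr (real w / 3) / 2 powr real w) \<longlonglongrightarrow> 0" by real_asymp
then have "eventually (%w::nat. real w * 2 powr (real w / 3) / 2 powr real w < 1 / (1000 * (real K + 1))) sequentially"
 by (rule order_tendstoD(2)) simp
then show ?thesis using eventually_ge_at_top[of 6]
proof eventually_elim
 case (elim w)
 have "real w * 2 powr (real w / 3) * (1000 * (real K + 1)) <= 2 powr real w"
 using elim(1) by (simp add: field_simps)
 moreover have "(2::real) ^ (w div 3) <= 2 powr (real w / 3)"
 by (subst powr_realpow[symmetric]) (auto intro!: powr_mono)
 then have "1000 * real K * real w * 2 ^ (w div 3) <= 1000 * (real K + 1) * real w * 2 powr (real w / 3)"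
 by (intro mult_mono) auto
 ultimately have "1000 * real K * real w * 2 ^ (w div 3) <= 2 powr real w" by (simp add: ac_simps)
 then have "real (1000 * K * w * 2 ^ (w div 3)) <= real (2 ^ w)" by (simp add: powr_realpow)
 then show ?case using elim(2) by (simp only: of_nat_le_iff simp_thms)
qed
qed

context text_input
begin

lemma lg_le: "real (lg n) <= log 2 (real n)"
proof -
have "real (2 ^ lg n) <= real n" using lg[OF n1] by (simp only: of_nat_le_iff)
then show ?thesis using n1 by (simp add: le_log_iff powr_realpow)
qed

lemma k_out_le: "real (num_words w (m * char_bits \<sigma>)) <= 1 + 2 * (real m * log 2 (real \<sigma>) / real w)"
proof -
have "num_words w (m * char_bits \<sigma>) * w <= m * char_bits \<sigma> + w"
 using num_words_bounds(2)[OF w1, of "m * char_bits \<sigma>"] by simp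
then have "real (num_words w (m * char_bits \<sigma>)) * real w <= real m * real (char_bits \<sigma>) + real w"
 by (simp flip: of_nat_mult of_nat_add)
also have "\<dots> <= real m * (2 * log 2 (real \<sigma>)) + real w"
 using char_bits_le by (intro add_mono mult_left_mono) auto
finally show ?thesis using w1 by (simp add: field_simps)
qed

lemma works_imp:
fixes c :: real
assumes wk: "works K w0 c"
defines "C \<equiv> real (build_total K w0 + 2 * extract_cost K w0 + lce_cost K w0 + 7 * sw K + 1)"
defines "start \<equiv> build_config w \<sigma> T (extra_words K w0 w n)"
shows "(\<integral>\<^sup>+ \<omega>. run_time w (build_prog K w0) (start \<omega>) \<partial>tapes w) <= ennreal (C * real n)" (is ?time)
 and "real w * real (num_words w (n * char_bits \<sigma>) + extra_words K w0 w n)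
  <= real (n * char_bits \<sigma>) + C * (real w * (1 + log 2 (real n)))" (is ?space)
 and "\<forall>\<omega> t s. exec w (build_prog K w0) (start \<omega>) t s -->
  (\<forall>i m. i + m <= n -->
   (\<exists>t'. real t' <= C * (1 + real m * log 2 (real \<sigma>) / real w) &
    extract_answer w \<sigma> n (extract_prog K w0) s i m t' (take m (drop i T)))) &
  (\<forall>i<n. \<forall>j<n.
   \<exists>t' l. real t' <= C * (1 + log 2 (1 + real l)) &
    lce_answer w \<sigma> n (lce_prog K w0) s i j t' l)" (is ?queries)
 and "1 - real n powr (- c) <= \<P>(\<omega> in tapes w. \<exists>t s. exec w (build_prog K w0) (start \<omega>) t s &
   (\<forall>i<n. \<forall>j<n. \<exists>t'. lce_answer w \<sigma> n (lce_prog K w0) s i j t' (lce T i j)))" (is ?prob)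
proof -
from wk obtain bad m where bad: "dep m bad" "pr w bad <= real n powr (- c)"
 and run: "!!\<omega>. \<exists>t s. exec w (build_prog K w0) (start \<omega>) t s &
  t <= n * build_total K w0 & answers K w0 s & (\<not> bad \<omega> --> exact K w0 s)"
 unfolding works_def start_def by blast
have log_n: "0 <= log 2 (real n)" using n1 by simp
have C: "real (build_total K w0) <= C" "2 * real (extract_cost K w0) <= C" "real (lce_cost K w0) <= C" "7 * real (sw K) + 1 <= C"
 by (simp_all add: C_def)
have "run_time w (build_prog K w0) (start \<omega>) <= ennreal (C * real n)" for \<omega>
proof -
 from run[of \<omega>] obtain t s where t: "exec w (build_prog K w0) (start \<omega>) t s" "t <= n * build_total K w0" by blast
 have "run_time w (build_prog K w0) (start \<omega>) <= of_nat t"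
 unfolding run_time_def using t(1) by (intro Inf_lower) blast
 also have "\<dots> = ennreal (real t)" by (simp add: ennreal_of_nat_eq_real_of_nat)
 also have "\<dots> <= ennreal (C * real n)"
 proof (rule ennreal_leI)
 have "real t <= real (n * build_total K w0)" using t(2) by (simp only: of_nat_le_iff)
 also have "\<dots> = real (build_total K w0) * real n" by simp
 also have "\<dots> <= C * real n" using C(1) by (intro mult_right_mono) auto
 finally show "real t <= C * real n" .
 qed
 finally show ?thesis .
qed
then have "(\<integral>\<^sup>+ \<omega>. run_time w (build_prog K w0) (start \<omega>) \<partial>tapes w) <= (\<integral>\<^sup>+ \<omega>. ennreal (C * real n) \<partial>tapes w)"
 by (intro nn_integral_mono)
also have "\<dots> = ennreal (C * real n)" using tape.emeasure_space_1[of w] by simp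
finally show ?time .
show ?space
proof -
 have "num_words w (n * char_bits \<sigma>) * w <= n * char_bits \<sigma> + w"
 using num_words_bounds(2)[OF w1, of "n * char_bits \<sigma>"] by simp
 then have 1: "real w * real (num_words w (n * char_bits \<sigma>)) <= real (n * char_bits \<sigma>) + real w"
 by (simp add: mult.commute flip: of_nat_mult of_nat_add)
 have "extra_words K w0 w n <= sw K * (7 + lg n)" by (simp add: extra_words_def)
 then have "real (extra_words K w0 w n) <= real (sw K * (7 + lg n))" by (simp only: of_nat_le_iff)
 also have "\<dots> = real (sw K) * (7 + real (lg n))" by simp
 also have "\<dots> <= real (sw K) * (7 * (1 + log 2 (real n)))" using lg_le log_n by (intro mult_left_mono) auto
 finally have "real w * real (extra_words K w0 w n) <= real w * (real (sw K) * (7 * (1 + log 2 (real n))))"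
 by (intro mult_left_mono) auto
 moreover have "real w <= real w * (1 + log 2 (real n))" using log_n by (simp add: mult_left_mono algebra_simps)
 ultimately have "real w * real (num_words w (n * char_bits \<sigma>) + extra_words K w0 w n)
  <= real (n * char_bits \<sigma>) + (7 * real (sw K) + 1) * (real w * (1 + log 2 (real n)))"
 using 1 by (simp add: algebra_simps)
 also have "\<dots> <= real (n * char_bits \<sigma>) + C * (real w * (1 + log 2 (real n)))"
 using C(4) log_n by (intro add_left_mono mult_right_mono) auto
 finally show ?thesis .
qed
show ?queries
proof (intro allI impI)
 fix \<omega> t s assume e: "exec w (build_prog K w0) (start \<omega>) t s"
 from run[of \<omega>] obtain t0 s0 where "exec w (build_prog K w0) (start \<omega>) t0 s0" "answers K w0 s0" by blast
 then have ans: "answers K w0 s" using exec_deterministic[OF e] by blast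
 show "(\<forall>i m. i + m <= n -->
   (\<exists>t'. real t' <= C * (1 + real m * log 2 (real \<sigma>) / real w) &
    extract_answer w \<sigma> n (extract_prog K w0) s i m t' (take m (drop i T)))) &
  (\<forall>i<n. \<forall>j<n. \<exists>t' l. real t' <= C * (1 + log 2 (1 + real l)) &
    lce_answer w \<sigma> n (lce_prog K w0) s i j t' l)"
 proof (intro conjI allI impI)
 fix i m assume im: "i + m <= n"
 let ?x = "real m * log 2 (real \<sigma>) / real w"
 have x0: "0 <= ?x" using sigma1 by simp
 from ans im obtain t' where t': "t' <= extract_cost K w0 * (num_words w (m * char_bits \<sigma>) + 1)"
  "extract_answer w \<sigma> n (extract_prog K w0) s i m t' (take m (drop i T))" unfolding answers_def by blast
 have "real t' <= real (extract_cost K w0 * (num_words w (m * char_bits \<sigma>) + 1))" using t'(1) by (simp only: of_nat_le_iff)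
 also have "\<dots> = real (extract_cost K w0) * (real (num_words w (m * char_bits \<sigma>)) + 1)"
  by (simp only: of_nat_mult of_nat_add of_nat_1)
 also have "\<dots> <= real (extract_cost K w0) * (2 * (1 + ?x))"
 proof (rule mult_left_mono)
  have "u + 1 <= 2 * (1 + y)" if "u <= 1 + 2 * y" for u y :: real using that by simp
  from this[OF k_out_le] show "real (num_words w (m * char_bits \<sigma>)) + 1 <= 2 * (1 + ?x)" .
 qed simp
 also have "\<dots> = 2 * real (extract_cost K w0) * (1 + ?x)" by (simp only: ac_simps)
 also have "\<dots> <= C * (1 + ?x)" using C(2) x0 by (intro mult_right_mono) auto
 finally show "\<exists>t'. real t' <= C * (1 + ?x) & extract_answer w \<sigma> n (extract_prog K w0) s i m t' (take m (drop i T))"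
  using t'(2) by blast
 next
 fix i j assume "i < n" "j < n"
 with ans obtain t' l k where t': "t' <= lce_cost K w0 * (k + 1)" "2 ^ k <= l + 1"
  "lce_answer w \<sigma> n (lce_prog K w0) s i j t' l" unfolding answers_def by blast
 have "real (2 ^ k) <= real (l + 1)" using t'(2) by (simp only: of_nat_le_iff)
 then have k: "real k <= log 2 (1 + real l)" by (simp add: le_log_iff powr_realpow add.commute)
 have "real t' <= real (lce_cost K w0 * (k + 1))" using t'(1) by (simp only: of_nat_le_iff)
 also have "\<dots> = real (lce_cost K w0) * (real k + 1)" by (simp only: of_nat_mult of_nat_add of_nat_1)
 also have "\<dots> <= C * (1 + log 2 (1 + real l))"
 proof (rule mult_mono)
  show "0 <= C" by (simp add: C_def)
  show "real k + 1 <= 1 + log 2 (1 + real l)" using k by simp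
 qed (use C(3) in simp_all)
 finally show "\<exists>t' l. real t' <= C * (1 + log 2 (1 + real l)) & lce_answer w \<sigma> n (lce_prog K w0) s i j t' l"
  using t'(3) by blast
 qed
qed
show ?prob
proof -
 \<comment> \<open>\<open>measurable_exec\<close> accepts predicates of the final arrays only.
   \<open>exact\<close> depends on nothing else, so the other components may be filled
   arbitrarily.\<close>
 define Q where "Q a \<longleftrightarrow> exact K w0 \<lparr>reg = %_. 0, arr = a, rnd = sconst 0\<rparr>" for a
 have Q: "Q (arr s) \<longleftrightarrow> exact K w0 s" for s by (simp add: Q_def exact_def lce_answer_def)
 define s0 where "s0 = start (sconst 0)"
 have s0: "start \<omega> = s0\<lparr>rnd := \<omega>\<rparr>" for \<omega> by (simp add: s0_def start_def build_config_def)
 define E where "E = {\<omega>. \<exists>t s. exec w (build_prog K w0) (start \<omega>) t s & exact K w0 s}"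
 have "E = (\<Union>t. {\<omega>. \<exists>s. exec w (build_prog K w0) (s0\<lparr>rnd := \<omega>\<rparr>) t s & Q (arr s)})" by (auto simp: E_def Q s0)
 also have "\<dots> \<in> sets (tapes w)"
 proof -
 have m: "{\<omega>. \<exists>s. exec w (build_prog K w0) (s0\<lparr>rnd := \<omega>\<rparr>) t s & Q (arr s)} \<in> sets (tapes w)" for t
  by (rule measurable_exec[of w "build_prog K w0" s0 t Q])
 show ?thesis by (rule sets.countable_UN) (use m in blast)
 qed
 finally have mE: "E \<in> sets (tapes w)" .
 have "1 - real n powr (- c) <= 1 - measure (tapes w) {\<omega>. bad \<omega>}" using bad(2) by (simp add: pr_def)
 also have "\<dots> = measure (tapes w) (space (tapes w) - {\<omega>. bad \<omega>})"
 by (rule tape.prob_compl[symmetric]) (rule dep_sets[OF bad(1)])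
 also have "\<dots> <= measure (tapes w) E"
 proof (rule tape.finite_measure_mono[OF _ mE])
 show "space (tapes w) - {\<omega>. bad \<omega>} \<subseteq> E"
 proof
  fix \<omega> assume "\<omega> \<in> space (tapes w) - {\<omega>. bad \<omega>}"
  then have "\<not> bad \<omega>" by simp
  with run[of \<omega>] show "\<omega> \<in> E" unfolding E_def by blast
 qed
 qed
 finally show ?thesis by (simp add: E_def exact_def)
qed
qed

end

theorem theorem2:
  fixes c :: real
  assumes "c > 0"
  shows "\<exists>(build :: prog) (extract_prog :: prog) (lce_prog :: prog)
            (extra :: nat \<Rightarrow> nat \<Rightarrow> nat \<Rightarrow> nat) (C :: real).
    \<forall>(n :: nat) (\<sigma> :: nat) (w :: nat) (T :: nat list).
      1 \<le> n \<longrightarrow> 1 \<le> w \<longrightarrow> log 2 (real n) \<le> real w \<longrightarrow> char_bits \<sigma> \<le> w \<longrightarrow>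
      length T = n \<longrightarrow> set T \<subseteq> {..<\<sigma>} \<longrightarrow>
      (let b = char_bits \<sigma>;
           start = build_config w \<sigma> T (extra w \<sigma> n)
       in
        (\<integral>\<^sup>+ \<omega>. run_time w build (start \<omega>) \<partial>tapes w) \<le> ennreal (C * real n) \<and>
        real w * real (num_words w (n * b) + extra w \<sigma> n)
          \<le> real (n * b) + C * (real w * (1 + log 2 (real n))) \<and>
        (\<forall>\<omega> t s. exec w build (start \<omega>) t s \<longrightarrow>
          (\<forall>i m. i + m \<le> n \<longrightarrow>
            (\<exists>t'. real t' \<le> C * (1 + real m * log 2 (real \<sigma>) / real w) \<and>
                  extract_answer w \<sigma> n extract_prog s i m t' (take m (drop i T)))) \<and>
          (\<forall>i<n. \<forall>j<n.
            \<exists>t' l. real t' \<le> C * (1 + log 2 (1 + real l)) \<and>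
                   lce_answer w \<sigma> n lce_prog s i j t' l)) \<and>
        \<P>(\<omega> in tapes w. \<exists>t s. exec w build (start \<omega>) t s \<and>
            (\<forall>i<n. \<forall>j<n. \<exists>t'. lce_answer w \<sigma> n lce_prog s i j t' (lce T i j)))
          \<ge> 1 - real n powr (- c))"
proof -
\<comment> \<open>\<open>pr_modulus_of\<close> is applied with \<open>c + 4\<close> and asks for a
  factor 8; the weaker demand \<open>c + 2 <= K\<close> of the window follows.\<close>
define K where "K = nat \<lceil>8 * (c + 4)\<rceil>"
have K: "8 * (c + 4) <= real K" unfolding K_def by (rule real_nat_ceiling_ge)
have K1: "1 <= K" using K assms by (cases K) auto
have "eventually (%w. (6 <= w & 1000 * K * w * 2 ^ (w div 3) <= 2 ^ w) &
 (\<forall>l D. 1 <= l --> l <= w --> 0 < D --> D < 2 ^ (2 ^ (l + 1) * w) -->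
  pr w (%\<omega>. modulus_of w K l \<omega> dvd D) <= 2 powr (- (c + 4) * (real l + 1)))) sequentially"
 by (intro eventually_conj eventually_params pr_modulus_of K) (use assms in simp)
then obtain w0 where w0: "!!w. w0 <= w ==> 6 <= w & 1000 * K * w * 2 ^ (w div 3) <= 2 ^ w"
 "!!w l D. w0 <= w ==> 1 <= l ==> l <= w ==> 0 < D ==> D < 2 ^ (2 ^ (l + 1) * w) ==>
  pr w (%\<omega>. modulus_of w K l \<omega> dvd D) <= 2 powr (- (c + 4) * (real l + 1))"
 unfolding eventually_sequentially by blast
have wk: "text_input.works w \<sigma> n T K w0 c" if "text_input w \<sigma> n T" for w \<sigma> n T
proof (cases "w <= w0")
 case True
 then show ?thesis using text_input.small_works[OF that] by blast
next
 case False
 interpret text_input w \<sigma> n T by (rule that)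
 interpret main_input w \<sigma> n T K "48 * K" "w div 3"
 by unfold_locales (use w0(1)[of w] False K1 in auto)
 show ?thesis
 by (rule main_works) (use False assms K w0(2)[of w] in auto)
qed
show ?thesis
 apply (rule exI[of _ "build_prog K w0"], rule exI[of _ "extract_prog K w0"], rule exI[of _ "lce_prog K w0"])
 apply (rule exI[of _ "%w \<sigma> n. extra_words K w0 w n"])
 apply (rule exI[of _ "real (build_total K w0 + 2 * extract_cost K w0 + lce_cost K w0 + 7 * sw K + 1)"])
 unfolding Let_def
proof (intro allI impI conjI, goal_cases)
 case (1 n \<sigma> w T)
 then have "text_input w \<sigma> n T" by unfold_locales
 from text_input.works_imp(1)[OF this wk[OF this]] show ?case .
next
 case (2 n \<sigma> w T)
 then have "text_input w \<sigma> n T" by unfold_locales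
 from text_input.works_imp(2)[OF this wk[OF this]] show ?case .
next
 case (3 n \<sigma> w T \<omega> t s i m)
 then have ti: "text_input w \<sigma> n T" by unfold_locales
 from text_input.works_imp(3)[OF ti wk[OF ti]] 3 show ?case by blast
next
 case (4 n \<sigma> w T \<omega> t s i j)
 then have ti: "text_input w \<sigma> n T" by unfold_locales
 from text_input.works_imp(3)[OF ti wk[OF ti]] 4 show ?case by blast
next
 case (5 n \<sigma> w T)
 then have "text_input w \<sigma> n T" by unfold_locales
 from text_input.works_imp(4)[OF this wk[OF this]] show ?case .
qed
qed

end
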